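(* Let $n\ge 3$. For every $u_0\in\dot H^{\frac n2-1}(\mathbb{R}^n;\mathbb{R}^n)$ with $\operatorname{div}u_0=0$, there exist $T^*>0$ and $u\in\mathscr{E}_{T^*}$ which is a mild solution of the Navier-Stokes system on $(0,T^* )\times\mathbb{R}^n$ with initial condition $u_0$. Moreover, $u\in\mathscr{C}([0,T^* );\dot H^{\frac n2-1}(\mathbb{R}^n;\mathbb{R}^n))$.
   Context: The Fourier transform is $\hat f(\xi)=\mathscr{F}(f)(\xi)=(2\pi)^{-n/2}\int_{\mathbb{R}^n}f(x)e^{-i\xi\cdot x}\,dx$, extended to tempered distributions $\mathscr{S}'(\mathbb{R}^n)$. For $s\in\mathbb{R}$, $\dot H^s(\mathbb{R}^n)$ is the set of $f\in\mathscr{S}'(\mathbb{R}^n)$ with $\hat f\in L^1_{\rm loc}(\mathbb{R}^n)$ and $\xi\mapsto|\xi|^s\hat f(\xi)\in L^2(\mathbb{R}^n)$, normed by $\|f\|_{\dot H^s}=\||\xi|^s\hat f\|_{L^2}$; for vector fields it is taken componentwise. The heat semigroup is $e^{t\Delta}g=\mathscr{F}^{-1}(\xi\mapsto e^{-t|\xi|^2}\hat g(\xi))$, $t\ge0$. The Leray projection $\mathbb{P}$ is the Fourier multiplier acting on vector fields with matrix symbol $\bigl(\delta_{jk}-\frac{\xi_j\xi_k}{|\xi|^2}\bigr)_{1\le j,k\le n}$. For vector fields $u,v$, $\nabla\cdot(u\otimes v):=\sum_{j=1}^n\partial_j(u_jv)$. For $0<T\le\infty$, $$\mathscr{E}_T=\Bigl\{u\in\mathscr{C}\bigl((0,T);\dot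 H^{\frac{n-1}{2}}(\mathbb{R}^n;\mathbb{R}^n)\bigr):\ \|u\|_{\mathscr{E}_T}:=\sup_{t\in(0,T)}t^{1/4}\|u(t)\|_{\dot H^{\frac{n-1}{2}}}<\infty\Bigr\}.$$ The Navier-Stokes system is $\partial_tu-\Delta u+\nabla\pi+(u\cdot\nabla)u=0$, $\operatorname{div}u=0$ in $(0,T)\times\mathbb{R}^n$. A mild solution on $(0,T)\times\mathbb{R}^n$ with initial condition $u_0$ satisfying $\operatorname{div}u_0=0$ is a vector field $u:[0,T)\times\mathbb{R}^n\to\mathbb{R}^n$ satisfying $$u(t)=e^{t\Delta}u_0-\int_0^te^{(t-s)\Delta}\,\mathbb{P}\bigl(\nabla\cdot(u\otimes u)(s)\bigr)\,ds,\qquad 0\le t<T,$$ where the time integral is understood on the Fourier side in the space variable (i.e. the Fourier transform of the integral at $\xi$ is $\int_0^te^{-(t-s)|\xi|^2}\mathscr{F}\bigl(\mathbb{P}(\nabla\cdot(u\otimes u)(s))\bigr)(\xi)\,ds$). *)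

theory Defs
  imports "HOL-Analysis.Analysis"
begin

type_synonym 'n distribution = "(real^'n \<Rightarrow> complex) \<Rightarrow> complex"

text \<open>Distributions are functionals on all functions, but only their values on Schwartz
  functions (or on test functions) are ever used.\<close>

definition partial :: "'n::finite \<Rightarrow> (real^'n \<Rightarrow> complex) \<Rightarrow> real^'n \<Rightarrow> complex" where
  "partial j f x = frechet_derivative f (at x) (axis j 1)"

fun partials :: "'n::finite list \<Rightarrow> (real^'n \<Rightarrow> complex) \<Rightarrow> real^'n \<Rightarrow> complex" where
  "partials [] f = f"
| "partials (j # js) f = partial j (partials js f)"

definition smooth_fun :: "(real^'n::finite \<Rightarrow> complex) \<Rightarrow> bool" where
  "smooth_fun f \<longleftrightarrow> (\<forall>js x. partials js f differentiable (at x))"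

definition schwartz :: "(real^'n::finite \<Rightarrow> complex) \<Rightarrow> bool" where
  "schwartz f \<longleftrightarrow> smooth_fun f \<and>
     (\<forall>N js. bdd_above (range (\<lambda>x. (1 + norm x) ^ N * cmod (partials js f x))))"

definition test_fun :: "(real^'n::finite \<Rightarrow> complex) \<Rightarrow> bool" where
  "test_fun f \<longleftrightarrow> smooth_fun f \<and> bounded {x. f x \<noteq> 0}"

definition schwartz_seminorm :: "nat \<Rightarrow> (real^'n::finite \<Rightarrow> complex) \<Rightarrow> real" where
  "schwartz_seminorm N f =
     (\<Sum>js | length js \<le> N. SUP x. (1 + norm x) ^ N * cmod (partials js f x))"

definition tempered :: "'n::finite distribution \<Rightarrow> bool" where
  "tempered f \<longleftrightarrow>
     (\<forall>\<phi> \<psi> a b. schwartz \<phi> \<longrightarrow> schwartz \<psi> \<longrightarrow>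
        f (\<lambda>x. a * \<phi> x + b * \<psi> x) = a * f \<phi> + b * f \<psi>) \<and>
     (\<exists>C N. \<forall>\<phi>. schwartz \<phi> \<longrightarrow> cmod (f \<phi>) \<le> C * schwartz_seminorm N \<phi>)"

definition real_valued_dist :: "'n::finite distribution \<Rightarrow> bool" where
  "real_valued_dist f \<longleftrightarrow> (\<forall>\<phi>. schwartz \<phi> \<longrightarrow> (\<forall>x. \<phi> x \<in> \<real>) \<longrightarrow> f \<phi> \<in> \<real>)"

definition fourier :: "(real^'n::finite \<Rightarrow> complex) \<Rightarrow> real^'n \<Rightarrow> complex" where
  "fourier f \<xi> = of_real ((2 * pi) powr (- real CARD('n) / 2)) *
     (LINT x|lborel. f x * exp (- \<i> * of_real (\<xi> \<bullet> x)))"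

definition inv_fourier :: "(real^'n::finite \<Rightarrow> complex) \<Rightarrow> real^'n \<Rightarrow> complex" where
  "inv_fourier f x = of_real ((2 * pi) powr (- real CARD('n) / 2)) *
     (LINT \<xi>|lborel. f \<xi> * exp (\<i> * of_real (\<xi> \<bullet> x)))"

definition fourier_dist :: "'n::finite distribution \<Rightarrow> 'n distribution" where
  "fourier_dist f = (\<lambda>\<phi>. f (fourier \<phi>))"

definition inv_fourier_dist :: "'n::finite distribution \<Rightarrow> 'n distribution" where
  "inv_fourier_dist f = (\<lambda>\<phi>. f (inv_fourier \<phi>))"

definition partial_dist :: "'n::finite \<Rightarrow> 'n distribution \<Rightarrow> 'n distribution" where
  "partial_dist j f = (\<lambda>\<phi>. - f (partial j \<phi>))"

definition fun_dist :: "(real^'n::finite \<Rightarrow> complex) \<Rightarrow> 'n distribution" where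
  "fun_dist g = (\<lambda>\<phi>. LINT x|lborel. g x * \<phi> x)"

text \<open>Since the integral of a non-integrable function is 0 in the library, temperedness of
  \<open>fun_dist g\<close> alone would not say that \<open>g\<close> really acts on Schwartz functions.\<close>

definition tempered_fun :: "(real^'n::finite \<Rightarrow> complex) \<Rightarrow> bool" where
  "tempered_fun g \<longleftrightarrow>
     (\<forall>\<phi>. schwartz \<phi> \<longrightarrow> integrable lborel (\<lambda>x. g x * \<phi> x)) \<and> tempered (fun_dist g)"

definition locally_integrable :: "(real^'n::finite \<Rightarrow> complex) \<Rightarrow> bool" where
  "locally_integrable g \<longleftrightarrow> (\<forall>K. compact K \<longrightarrow> set_integrable lborel K g)"

text \<open>The distribution \<open>f\<close> is the locally integrable function \<open>g\<close>. A locally integrable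
  function need not be integrable against Schwartz functions, so the equality is one of
  distributions, on compactly supported test functions.\<close>

definition is_L1loc_fun :: "'n::finite distribution \<Rightarrow> (real^'n \<Rightarrow> complex) \<Rightarrow> bool" where
  "is_L1loc_fun f g \<longleftrightarrow> locally_integrable g \<and> (\<forall>\<phi>. test_fun \<phi> \<longrightarrow> f \<phi> = fun_dist g \<phi>)"

definition has_fourier_fun :: "'n::finite distribution \<Rightarrow> bool" where
  "has_fourier_fun f \<longleftrightarrow> tempered f \<and> (\<exists>g. is_L1loc_fun (fourier_dist f) g)"

text \<open>A representative, determined up to a null set.\<close>

definition fourier_fun :: "'n::finite distribution \<Rightarrow> real^'n \<Rightarrow> complex" where
  "fourier_fun f = (SOME g. is_L1loc_fun (fourier_dist f) g)"

definition hom_sobolev :: "real \<Rightarrow> 'n::finite distribution set" where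
  "hom_sobolev s = {f. has_fourier_fun f \<and>
     integrable lborel (\<lambda>\<xi>. (norm \<xi> powr s * cmod (fourier_fun f \<xi>))\<^sup>2)}"

definition hom_sobolev_norm :: "real \<Rightarrow> 'n::finite distribution \<Rightarrow> real" where
  "hom_sobolev_norm s f =
     sqrt (LINT \<xi>|lborel. (norm \<xi> powr s * cmod (fourier_fun f \<xi>))\<^sup>2)"

text \<open>Vector fields with values in \<open>\<real>\<^sup>n\<close> are families of \<open>n\<close> real-valued distributions.\<close>

definition hom_sobolev_field :: "real \<Rightarrow> ('n::finite \<Rightarrow> 'n distribution) set" where
  "hom_sobolev_field s = {f. \<forall>j. f j \<in> hom_sobolev s \<and> real_valued_dist (f j)}"

definition hom_sobolev_field_norm :: "real \<Rightarrow> ('n::finite \<Rightarrow> 'n distribution) \<Rightarrow> real" where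
  "hom_sobolev_field_norm s f = L2_set (\<lambda>j. hom_sobolev_norm s (f j)) UNIV"

definition continuous_into_hom_sobolev ::
    "real set \<Rightarrow> real \<Rightarrow> (real \<Rightarrow> 'n::finite \<Rightarrow> 'n distribution) \<Rightarrow> bool" where
  "continuous_into_hom_sobolev I s U \<longleftrightarrow>
     (\<forall>t\<in>I. U t \<in> hom_sobolev_field s) \<and>
     (\<forall>t\<^sub>0\<in>I. ((\<lambda>t. hom_sobolev_field_norm s (\<lambda>j \<phi>. U t j \<phi> - U t\<^sub>0 j \<phi>)) \<longlongrightarrow> 0)
        (at t\<^sub>0 within I))"

definition E_space :: "ereal \<Rightarrow> (real \<Rightarrow> 'n::finite \<Rightarrow> 'n distribution) set" where
  "E_space T = {U.
     continuous_into_hom_sobolev {t. 0 < t \<and> ereal t < T} ((real CARD('n) - 1) / 2) U \<and>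
     bdd_above ((\<lambda>t. t powr (1/4) * hom_sobolev_field_norm ((real CARD('n) - 1) / 2) (U t))
       ` {t. 0 < t \<and> ereal t < T})}"

definition divergence_free :: "('n::finite \<Rightarrow> 'n distribution) \<Rightarrow> bool" where
  "divergence_free f \<longleftrightarrow> (\<forall>\<phi>. schwartz \<phi> \<longrightarrow> (\<Sum>j\<in>UNIV. partial_dist j (f j) \<phi>) = 0)"

definition fourier_multiplier ::
    "(real^'n::finite \<Rightarrow> complex) \<Rightarrow> 'n distribution \<Rightarrow> 'n distribution" where
  "fourier_multiplier m f = inv_fourier_dist (fun_dist (\<lambda>\<xi>. m \<xi> * fourier_fun f \<xi>))"

definition heat :: "real \<Rightarrow> 'n::finite distribution \<Rightarrow> 'n distribution" where
  "heat t = fourier_multiplier (\<lambda>\<xi>. of_real (exp (- t * (norm \<xi>)\<^sup>2)))"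

definition leray :: "('n::finite \<Rightarrow> 'n distribution) \<Rightarrow> 'n \<Rightarrow> 'n distribution" where
  "leray f j = (\<lambda>\<phi>. \<Sum>k\<in>UNIV. fourier_multiplier
     (\<lambda>\<xi>. of_real ((if j = k then 1 else 0) - \<xi> $ j * \<xi> $ k / (norm \<xi>)\<^sup>2)) (f k) \<phi>)"

definition field_dist :: "(real^'n::finite \<Rightarrow> real^'n) \<Rightarrow> 'n \<Rightarrow> 'n distribution" where
  "field_dist v j = fun_dist (\<lambda>x. of_real (v x $ j))"

definition div_tensor ::
    "(real^'n::finite \<Rightarrow> real^'n) \<Rightarrow> (real^'n \<Rightarrow> real^'n) \<Rightarrow> 'n \<Rightarrow> 'n distribution" where
  "div_tensor u v k =
     (\<lambda>\<phi>. \<Sum>j\<in>UNIV. partial_dist j (fun_dist (\<lambda>x. of_real (u x $ j * v x $ k))) \<phi>)"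

definition div_tensor_defined ::
    "(real^'n::finite \<Rightarrow> real^'n) \<Rightarrow> (real^'n \<Rightarrow> real^'n) \<Rightarrow> bool" where
  "div_tensor_defined u v \<longleftrightarrow>
     (\<forall>j k. tempered_fun (\<lambda>x. of_real (u x $ j * v x $ k))) \<and>
     (\<forall>k. has_fourier_fun (div_tensor u v k))"

text \<open>\<open>D\<close> is the time integral over \<open>(0, t)\<close> of the heat flow of the projected nonlinearity,
  taken on the Fourier side. The function \<open>G j\<close> collects, for all times \<open>s\<close>, representatives
  \<open>\<xi> \<mapsto> G j (s, \<xi>)\<close> of the Fourier transforms. Each of these is determined only up to a null set
  depending on \<open>s\<close>; joint measurability makes the integral over \<open>s\<close> meaningful and, by Fubini,
  independent of the choice of \<open>G\<close> for almost every \<open>\<xi>\<close>.\<close>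

definition is_duhamel_integral ::
    "(real \<Rightarrow> real^'n::finite \<Rightarrow> real^'n) \<Rightarrow> real \<Rightarrow> ('n \<Rightarrow> 'n distribution) \<Rightarrow> bool" where
  "is_duhamel_integral u t D \<longleftrightarrow>
     (\<forall>j. tempered (D j)) \<and>
     (\<exists>G :: 'n \<Rightarrow> real \<times> (real^'n) \<Rightarrow> complex. \<forall>j.
        G j \<in> borel_measurable borel \<and>
        (\<forall>s\<in>{0<..<t}. is_L1loc_fun
           (fourier_dist (leray (div_tensor (u s) (u s)) j)) (\<lambda>\<xi>. G j (s, \<xi>))) \<and>
        (AE \<xi> in lborel. set_integrable lborel {0<..<t}
           (\<lambda>s. of_real (exp (- (t - s) * (norm \<xi>)\<^sup>2)) * G j (s, \<xi>))) \<and>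
        is_L1loc_fun (fourier_dist (D j))
          (\<lambda>\<xi>. LINT s:{0<..<t}|lborel. of_real (exp (- (t - s) * (norm \<xi>)\<^sup>2)) * G j (s, \<xi>)))"

definition mild_solution ::
    "ereal \<Rightarrow> ('n::finite \<Rightarrow> 'n distribution) \<Rightarrow> (real \<Rightarrow> real^'n \<Rightarrow> real^'n) \<Rightarrow> bool" where
  "mild_solution T u\<^sub>0 u \<longleftrightarrow>
     (\<forall>t. 0 \<le> t \<longrightarrow> ereal t < T \<longrightarrow> (\<forall>j. tempered_fun (\<lambda>x. of_real (u t x $ j)))) \<and>
     (\<forall>t. 0 < t \<longrightarrow> ereal t < T \<longrightarrow> div_tensor_defined (u t) (u t)) \<and>
     (\<forall>t. 0 \<le> t \<longrightarrow> ereal t < T \<longrightarrow> (\<exists>D. is_duhamel_integral u t D \<and>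
        (\<forall>j \<phi>. schwartz \<phi> \<longrightarrow> field_dist (u t) j \<phi> = heat t (u\<^sub>0 j) \<phi> - D j \<phi>)))"

end

theory Submission
  imports Defs "HOL-Probability.Probability"
begin

text \<open>On the Fourier side every product becomes a convolution, so the Picard iterates are dominated
  by the iterates of a scalar, nonnegative equation
  \<open>V(t, \<xi>) = exp (- t |\<xi>|\<^sup>2) \<gamma>(\<xi>) + K \<integral>\<^sub>0\<^sup>t exp (- (t - s) |\<xi>|\<^sup>2) |\<xi>| (V(s) * V(s))(\<xi>) ds\<close>,
  where \<open>\<gamma>\<close> majorizes the transform of the datum. These scalar iterates increase, and the increments
  of the Picard iterates are dominated by theirs; hence wherever the scalar limit is finite the
  Picard iterates converge, and no contraction argument or completeness of a function space is needed.

  Finiteness is an a priori bound. Cauchy-Schwarz against the Riesz kernel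
  \<open>\<integral> |\<xi> - \<eta>|\<^bsup>-q\<^esup> |\<eta>|\<^bsup>-q\<^esup> d\<eta>\<close> bounds the weighted norm \<open>\<integral> |\<xi>|\<^bsup>2q-n\<^esup> (V * V)\<^sup>2\<close> by
  \<open>(\<integral> |\<xi>|\<^bsup>q\<^esup> V\<^sup>2)\<^sup>2\<close>. With \<open>q = n - 1/2\<close> and the weight \<open>t\<^bsup>3/4\<^esup>\<close> in time the estimate closes,
  because the norm of the heat flow of the datum tends to 0 with the length of the time interval.
  One further application of the bilinear estimate reaches the weights \<open>n - 3 + 4b\<close> for
  \<open>1/4 \<le> b < 1\<close>: \<open>b = 1/4\<close> is the space of the datum, \<open>b = 1/2\<close> that of \<open>E_space\<close>, and the values on
  both sides of \<open>3/4\<close> together show that the solution has an integrable Fourier transform at positive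
  times. So it is a bounded function there and the products in the nonlinearity are honest functions.\<close>

subsection \<open>Smooth functions and test functions\<close>

text \<open>The exponent q = n - 1/2 is chosen for its reach. Convolution puts the nonlinearity into
  the weight 2q - n, and the Duhamel integral, its derivative included, gains less than 2. Closing
  the estimate at q = n - 1, the weight of \<open>E_space\<close>, would therefore stop below n,
  just where integrability of the transform fails to follow; q = n - 1/2 reaches both sides of n in
  one step, while the singularities in time stay integrable. The powers of time are dictated by
  scaling: the weight n - 2 of the datum is critical, so the squared norm of weight n - 3 + 4b has
  size t^(1/2 - 2b). At b = 1/4 this power is 0 and gives no decay at time 0; continuity there comes
  from the constant in the weight n - 1/2, which becomes arbitrarily small on short intervals. The
  dimension n \<ge> 3 is decisive at time 0, where the datum itself has to be a function: at high
  frequencies the weight n - 2 is then at least 1, and this makes the dyadic pieces of the datum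
  geometrically small in the square mean.\<close>

lemma partial_eqI: "(f has_derivative f') (at x) \<Longrightarrow> partial j f x = f' (axis j 1)"
  unfolding partial_def using frechet_derivative_at by metis

lemma partials_append: "partials (xs @ ys) f = partials xs (partials ys f)"
  by (induction xs) auto

text \<open>Smoothness quantifies over all iterated partials. A class of differentiable functions
  closed under \<open>partial\<close> handles them by one induction, so a smoothness proof only has
  to exhibit such a class.\<close>

lemma smooth_funI_closed:
  fixes F :: "(real^'n::finite \<Rightarrow> complex) set"
  assumes "\<And>f x. f \<in> F \<Longrightarrow> f differentiable (at x)"
    and "\<And>f j. f \<in> F \<Longrightarrow> partial j f \<in> F" and "f \<in> F"
  shows "smooth_fun f"
proof -
  have "partials js f \<in> F" for js
    by (induction js) (use assms in auto)
  then show ?thesis using assms(1) unfolding smooth_fun_def by blast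
qed

lemma smooth_fun_differentiable: "smooth_fun f \<Longrightarrow> f differentiable (at x)"
  unfolding smooth_fun_def using partials.simps(1) by metis

lemma smooth_fun_partials: "smooth_fun f \<Longrightarrow> smooth_fun (partials js f)"
  unfolding smooth_fun_def by (metis partials_append)

lemma smooth_fun_partial: "smooth_fun f \<Longrightarrow> smooth_fun (partial j f)"
  using smooth_fun_partials[of f "[j]"] by simp

lemma smooth_fun_continuous: "smooth_fun f \<Longrightarrow> continuous_on S f"
  by (meson continuous_at_imp_continuous_on differentiable_imp_continuous_within smooth_fun_differentiable)

lemma smooth_fun_measurable [measurable_dest]: "smooth_fun f \<Longrightarrow> f \<in> borel_measurable borel"
  by (intro borel_measurable_continuous_onI smooth_fun_continuous)

lemma partial_add:
  assumes "f differentiable (at x)" "g differentiable (at x)"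
  shows "partial j (\<lambda>x. f x + g x) x = partial j f x + partial j g x"
  using partial_eqI[OF has_derivative_add[OF assms[unfolded frechet_derivative_works]]]
  by (simp add: partial_def)

lemma partial_mult:
  assumes "f differentiable (at x)" "g differentiable (at x)"
  shows "partial j (\<lambda>x. f x * g x) x = f x * partial j g x + partial j f x * g x"
  using partial_eqI[OF has_derivative_mult[OF assms[unfolded frechet_derivative_works]]]
  by (simp add: partial_def)

text \<open>The product rule turns a product into a sum of products, so products alone do not form a
  class closed under \<open>partial\<close>; the algebra generated by the smooth functions
  does.\<close>

inductive_set smooth_algebra :: "(real^'n::finite \<Rightarrow> complex) set" where
  base: "smooth_fun f \<Longrightarrow> f \<in> smooth_algebra"
| add: "f \<in> smooth_algebra \<Longrightarrow> g \<in> smooth_algebra \<Longrightarrow> (\<lambda>x. f x + g x) \<in> smooth_algebra"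
| mult: "f \<in> smooth_algebra \<Longrightarrow> g \<in> smooth_algebra \<Longrightarrow> (\<lambda>x. f x * g x) \<in> smooth_algebra"

lemma smooth_algebra_differentiable:
  "f \<in> smooth_algebra \<Longrightarrow> f differentiable (at x)"
  by (induction rule: smooth_algebra.induct) (auto intro: smooth_fun_differentiable)

lemma smooth_algebra_partial: "f \<in> smooth_algebra \<Longrightarrow> partial j f \<in> smooth_algebra"
proof (induction rule: smooth_algebra.induct)
  case (base f)
  then show ?case by (intro smooth_algebra.base smooth_fun_partial)
next
  case (add f g)
  have "partial j (\<lambda>x. f x + g x) = (\<lambda>x. partial j f x + partial j g x)"
    using add by (intro ext partial_add smooth_algebra_differentiable)
  then show ?case using add by (auto intro: smooth_algebra.add)
next
  case (mult f g)
  have "partial j (\<lambda>x. f x * g x) = (\<lambda>x. f x * partial j g x + partial j f x * g x)"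
    using mult by (intro ext partial_mult smooth_algebra_differentiable)
  then show ?case using mult by (auto intro: smooth_algebra.add smooth_algebra.mult)
qed

lemma smooth_algebra_smooth: "f \<in> smooth_algebra \<Longrightarrow> smooth_fun f"
  using smooth_funI_closed[of smooth_algebra f] smooth_algebra_differentiable smooth_algebra_partial
  by blast

lemma smooth_fun_add: "smooth_fun f \<Longrightarrow> smooth_fun g \<Longrightarrow> smooth_fun (\<lambda>x. f x + g x)"
  by (rule smooth_algebra_smooth[OF smooth_algebra.add[OF smooth_algebra.base smooth_algebra.base]])

lemma smooth_fun_mult: "smooth_fun f \<Longrightarrow> smooth_fun g \<Longrightarrow> smooth_fun (\<lambda>x. f x * g x)"
  by (rule smooth_algebra_smooth[OF smooth_algebra.mult[OF smooth_algebra.base smooth_algebra.base]])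

lemma smooth_fun_const: "smooth_fun (\<lambda>x. c)"
proof (rule smooth_funI_closed[where F = "range (\<lambda>c x. c)"])
  fix f :: "real^'n \<Rightarrow> complex" and j
  assume "f \<in> range (\<lambda>c x. c)"
  then obtain c where f: "f = (\<lambda>x. c)" by auto
  have "partial j f = (\<lambda>x. 0)"
    unfolding f by (rule ext, rule partial_eqI) (rule has_derivative_const)
  then show "partial j f \<in> range (\<lambda>c x. c)" by auto
qed auto

lemma smooth_fun_prod:
  "finite I \<Longrightarrow> (\<And>i. i \<in> I \<Longrightarrow> smooth_fun (f i)) \<Longrightarrow> smooth_fun (\<lambda>x. \<Prod>i\<in>I. f i x)"
  by (induction I rule: finite_induct) (auto intro: smooth_fun_const smooth_fun_mult)

lemma vec_nth_has_derivative: "((\<lambda>x. x $ i) has_derivative (\<lambda>h. h $ i)) (at x within S)"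
  by (rule bounded_linear_imp_has_derivative) (rule bounded_linear_vec_nth)

lemma smooth_fun_coord: "smooth_fun (\<lambda>x::real^'n::finite. of_real (x $ i))"
proof (rule smooth_funI_closed[where F = "insert (\<lambda>x. of_real (x $ i)) (range (\<lambda>c x. c))"])
  have d: "((\<lambda>x. complex_of_real (x $ i)) has_derivative (\<lambda>h. of_real (h $ i))) (at x)" for x :: "real^'n"
    by (intro has_derivative_of_real vec_nth_has_derivative)
  fix f :: "real^'n \<Rightarrow> complex" and j x
  assume f: "f \<in> insert (\<lambda>x. of_real (x $ i)) (range (\<lambda>c x. c))"
  show "f differentiable at x" using f d by (auto simp: differentiable_def intro: has_derivative_const)
  show "partial j f \<in> insert (\<lambda>x. of_real (x $ i)) (range (\<lambda>c x. c))"
  proof (cases "f \<in> range (\<lambda>c x. c)")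
    case True
    then obtain c where f: "f = (\<lambda>x. c)" by auto
    have "partial j f = (\<lambda>x. 0)"
      unfolding f by (rule ext, rule partial_eqI) (rule has_derivative_const)
    then show ?thesis by auto
  next
    case False
    with f have f: "f = (\<lambda>x. of_real (x $ i))" by auto
    have "partial j f = (\<lambda>x. of_real (axis j 1 $ i))"
      unfolding f by (rule ext, rule partial_eqI) (rule d)
    then show ?thesis by auto
  qed
qed auto

lemma iexp_inner_has_derivative:
  "((\<lambda>x. exp (\<i> * of_real (\<xi> \<bullet> x))) has_derivative
     (\<lambda>h. \<i> * of_real (\<xi> \<bullet> h) * exp (\<i> * of_real (\<xi> \<bullet> x)))) (at x)"
proof -
  have "((\<lambda>x. \<i> * of_real (\<xi> \<bullet> x)) has_derivative (\<lambda>h. \<i> * of_real (\<xi> \<bullet> h))) (at x)"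
    by (intro has_derivative_mult_right has_derivative_of_real has_derivative_inner_right has_derivative_ident)
  from has_derivative_compose[OF this DERIV_exp[unfolded has_field_derivative_def]]
  show ?thesis by (simp add: mult_ac)
qed

lemma smooth_fun_iexp:
  fixes \<xi> :: "real^'n::finite"
  shows "smooth_fun (\<lambda>x. exp (\<i> * of_real (\<xi> \<bullet> x)))"
proof (rule smooth_funI_closed[where F = "range (\<lambda>c x. c * exp (\<i> * of_real (\<xi> \<bullet> x)))"])
  have d: "((\<lambda>x. c * exp (\<i> * of_real (\<xi> \<bullet> x))) has_derivative
     (\<lambda>h. c * (\<i> * of_real (\<xi> \<bullet> h) * exp (\<i> * of_real (\<xi> \<bullet> x))))) (at x)" for c x
    by (intro has_derivative_mult_right iexp_inner_has_derivative)
  fix f :: "real^'n \<Rightarrow> complex" and j x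
  assume f: "f \<in> range (\<lambda>c x. c * exp (\<i> * of_real (\<xi> \<bullet> x)))"
  then obtain c where c: "f = (\<lambda>x. c * exp (\<i> * of_real (\<xi> \<bullet> x)))" by auto
  show "f differentiable at x" using d unfolding c by (auto simp: differentiable_def)
  have "partial j f = (\<lambda>x. (c * \<i> * of_real (\<xi> \<bullet> axis j 1)) * exp (\<i> * of_real (\<xi> \<bullet> x)))"
    unfolding c by (rule ext, subst partial_eqI[OF d]) simp
  then show "partial j f \<in> range (\<lambda>c x. c * exp (\<i> * of_real (\<xi> \<bullet> x)))" by blast
qed (auto intro: range_eqI[where x = 1])

text \<open>The polynomial keeps the family closed under differentiation: with s = 1/t, the
  derivative of p(s) exp(-s) in t is (p - p')(s) s^2 exp(-s). The case p = 1 is the classical flat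
  function.\<close>

definition flat_fun :: "real poly \<Rightarrow> real \<Rightarrow> real" where
  "flat_fun p t = (if t > 0 then poly p (1 / t) * exp (- (1 / t)) else 0)"

lemma poly_times_exp_neg_tendsto_0:
  "((\<lambda>s. poly p s * exp (- s)) \<longlongrightarrow> (0::real)) at_top"
proof -
  \<comment> \<open>The free power of s absorbs the factor s produced by each \<open>pCons\<close>
    step.\<close>
  have "((\<lambda>s. s ^ k * (poly p s * exp (- s))) \<longlongrightarrow> (0::real)) at_top" for k
  proof (induction p arbitrary: k)
    case 0
    then show ?case by simp
  next
    case (pCons a p)
    have "((\<lambda>s. a * (s ^ k * exp (- s)) + s ^ Suc k * (poly p s * exp (- s))) \<longlongrightarrow> a * 0 + 0) at_top"
      by (intro tendsto_add tendsto_mult_left pCons)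
        (use tendsto_power_div_exp_0[of k] in \<open>simp add: exp_minus divide_inverse\<close>)
    then show ?case by (simp add: algebra_simps)
  qed
  from this[of 0] show ?thesis by simp
qed

lemma flat_fun_has_derivative:
  "(flat_fun p has_real_derivative flat_fun ((p - pderiv p) * [:0, 0, 1:]) t) (at t)"
proof -
  consider "t > 0" | "t < 0" | "t = 0" by linarith
  then show ?thesis
  proof cases
    case 1
    have "((\<lambda>t. poly p (1 / t) * exp (- (1 / t))) has_real_derivative
        flat_fun ((p - pderiv p) * [:0, 0, 1:]) t) (at t)"
      using 1 by (auto intro!: derivative_eq_intros simp: flat_fun_def field_simps power2_eq_square)
    then show ?thesis
      by (rule has_field_derivative_transform_within_open[where S = "{0<..}"]) (use 1 in \<open>auto simp: flat_fun_def\<close>)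
  next
    case 2
    have "((\<lambda>t. 0) has_real_derivative flat_fun ((p - pderiv p) * [:0, 0, 1:]) t) (at t)"
      using 2 by (auto simp: flat_fun_def)
    then show ?thesis
      by (rule has_field_derivative_transform_within_open[where S = "{..<0}"]) (use 2 in \<open>auto simp: flat_fun_def\<close>)
  next
    case 3
    \<comment> \<open>With s = 1/h the right difference quotient at 0 is s p(s) exp(-s), again a
      polynomial times exp(-s).\<close>
    have "((\<lambda>h. poly (p * [:0,1:]) (1 / h) * exp (- (1 / h))) \<longlongrightarrow> 0) (at_right (0::real))"
      using filterlim_compose[OF poly_times_exp_neg_tendsto_0[of "p * [:0,1:]"] filterlim_inverse_at_top_right]
      by (simp add: divide_inverse)
    then have "((\<lambda>h. flat_fun p h / h) \<longlongrightarrow> 0) (at_right 0)"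
      by (rule Lim_transform_eventually)
        (auto simp: flat_fun_def eventually_at_right_less elim!: eventually_mono intro!: eventually_at_rightI[of 0 1])
    moreover have "((\<lambda>h. flat_fun p h / h) \<longlongrightarrow> 0) (at_left 0)"
      by (rule tendsto_eventually) (auto simp: flat_fun_def intro!: eventually_at_leftI[of "-1"])
    ultimately have "((\<lambda>h. flat_fun p h / h) \<longlongrightarrow> 0) (at 0)"
      by (rule filterlim_split_at[rotated])
    then show ?thesis using 3 by (simp add: has_field_derivative_iff flat_fun_def)
  qed
qed

lemma smooth_fun_flat:
  fixes i :: "'n::finite"
  shows "smooth_fun (\<lambda>x. of_real (flat_fun p (c * x $ i + d)))"
\<comment> \<open>The scalar \<open>a\<close> collects the inner derivatives from the chain
  rule.\<close>
proof (rule smooth_funI_closed[where F = "range (\<lambda>(a, p) x. of_real (a * flat_fun p (c * x $ i + d)))"])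
  have d: "((\<lambda>x. complex_of_real (a * flat_fun p (c * x $ i + d))) has_derivative
     (\<lambda>h. of_real (a * (flat_fun ((p - pderiv p) * [:0, 0, 1:]) (c * x $ i + d) * (c * h $ i))))) (at x)"
    for a p and x :: "real^'n"
  proof -
    have "((\<lambda>x::real^'n. c * x $ i + d) has_derivative (\<lambda>h. c * h $ i + 0)) (at x)"
      by (intro has_derivative_add has_derivative_mult_right vec_nth_has_derivative has_derivative_const)
    then have "((\<lambda>x::real^'n. c * x $ i + d) has_derivative (\<lambda>h. c * h $ i)) (at x)" by simp
    from has_derivative_compose[OF this flat_fun_has_derivative[of p "c * x $ i + d", unfolded has_field_derivative_def]]
    show ?thesis by (intro has_derivative_of_real has_derivative_mult_right) 
  qed
  fix f :: "real^'n \<Rightarrow> complex" and j x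
  assume f: "f \<in> range (\<lambda>(a, p) x. of_real (a * flat_fun p (c * x $ i + d)))"
  then obtain a p where c: "f = (\<lambda>x. of_real (a * flat_fun p (c * x $ i + d)))" by auto
  show "f differentiable at x" using d unfolding c by (auto simp: differentiable_def)
  have "partial j f = (\<lambda>x. of_real ((a * (c * (axis j 1 :: real^'n) $ i)) *
        flat_fun ((p - pderiv p) * [:0, 0, 1:]) (c * x $ i + d)))"
    unfolding c by (rule ext, subst partial_eqI[OF d]) (simp add: mult_ac)
  then show "partial j f \<in> range (\<lambda>(a, p) x. of_real (a * flat_fun p (c * x $ i + d)))"
    by (auto intro!: image_eqI[where x = "(a * (c * (axis j 1 :: real^'n) $ i), (p - pderiv p) * [:0, 0, 1:])"])
qed (auto intro!: image_eqI[where x = "(1, p)"])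

lemma partial_eq_0_outside:
  assumes "x \<notin> closure {x. f x \<noteq> 0}"
  shows "partial j f x = 0"
proof -
  have "((\<lambda>x. 0) has_derivative (\<lambda>x. 0)) (at x)" by simp
  then have "(f has_derivative (\<lambda>x. 0)) (at x)"
    by (rule has_derivative_transform_within_open[where s = "- closure {x. f x \<noteq> 0}"])
      (use assms closure_subset[of "{x. f x \<noteq> 0}"] in \<open>auto simp: open_Compl\<close>)
  then show ?thesis by (simp add: partial_eqI)
qed

lemma test_fun_partial: "test_fun f \<Longrightarrow> test_fun (partial j f)"
  unfolding test_fun_def
  by (metis (mono_tags, lifting) bounded_closure bounded_subset mem_Collect_eq partial_eq_0_outside
      smooth_fun_partial subsetI)

lemma test_fun_partials: "test_fun f \<Longrightarrow> test_fun (partials js f)"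
  by (induction js) (auto intro: test_fun_partial)

lemma test_fun_mult: "smooth_fun f \<Longrightarrow> test_fun g \<Longrightarrow> test_fun (\<lambda>x. f x * g x)"
  unfolding test_fun_def by (auto intro: smooth_fun_mult bounded_subset)

lemma test_fun_smooth: "test_fun f \<Longrightarrow> smooth_fun f"
  by (simp add: test_fun_def)

lemma test_fun_support:
  assumes "test_fun f"
  obtains r where "r > 0" "\<And>x. norm x > r \<Longrightarrow> f x = 0"
  using assms unfolding test_fun_def bounded_pos by (metis (mono_tags, lifting) mem_Collect_eq not_le)

lemma test_fun_bound:
  assumes "test_fun f"
  obtains B where "B > 0" "\<And>x. cmod (f x) \<le> B"
proof -
  obtain r where r: "r > 0" "\<And>x. norm x > r \<Longrightarrow> f x = 0" using test_fun_support[OF assms] by blast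
  have "bounded (f ` cball 0 r)"
    by (intro compact_imp_bounded compact_continuous_image smooth_fun_continuous test_fun_smooth assms) auto
  then obtain B where B: "B > 0" "\<And>x. x \<in> cball 0 r \<Longrightarrow> cmod (f x) \<le> B"
    unfolding bounded_pos by blast
  have "cmod (f x) \<le> B" for x using B r(2)[of x] by (cases "norm x > r") auto
  then show ?thesis using B that by blast
qed

lemma integrable_bounded_compact_support:
  fixes f :: "'a::euclidean_space \<Rightarrow> 'b::{banach, second_countable_topology}"
  assumes "f \<in> borel_measurable borel" "\<And>x. norm (f x) \<le> B" "\<And>x. norm x > r \<Longrightarrow> f x = 0"
  shows "integrable lborel f"
proof (rule Bochner_Integration.integrable_bound[where f = "\<lambda>x. B * indicator (cball 0 r) x"])
  show "integrable lborel (\<lambda>x. B * indicator (cball (0::'a) r) x)"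
    by (intro integrable_mult_right integrable_real_indicator)
      (use emeasure_lborel_cball_finite[of "0::'a" r] in auto)
  show "AE x in lborel. norm (f x) \<le> norm (B * indicator (cball 0 r) x)"
  proof (rule AE_I2)
    fix x show "norm (f x) \<le> norm (B * indicator (cball 0 r) x)"
      using assms(2)[of x] assms(3)[of x] norm_ge_zero[of "f x"]
      by (cases "norm x > r") (auto simp: indicator_def)
  qed
qed (use assms in simp)

lemma test_fun_integrable:
  assumes "test_fun f"
  shows "integrable lborel f"
proof -
  obtain r where "r > 0" "\<And>x. norm x > r \<Longrightarrow> f x = 0" using test_fun_support[OF assms] by blast
  moreover obtain B where "\<And>x. cmod (f x) \<le> B" using test_fun_bound[OF assms] by blast
  ultimately show ?thesis
    by (intro integrable_bounded_compact_support[where B = B and r = r])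
     (auto intro: smooth_fun_measurable test_fun_smooth assms)
qed

text \<open>Inside the box each factor is exp(-1/(m d)), where d is the distance of the coordinate
  to a face. Growing \<open>m\<close> drives the bump to 1 there, while it stays 0 outside the
  box.\<close>

definition box_bump :: "real^'n::finite \<Rightarrow> real^'n \<Rightarrow> real \<Rightarrow> real^'n \<Rightarrow> real" where
  "box_bump a b m x =
     (\<Prod>i\<in>UNIV. flat_fun 1 (m * x $ i + - m * a $ i) * flat_fun 1 (- m * x $ i + m * b $ i))"

lemma flat_fun_1_bounds: "0 \<le> flat_fun 1 t" "flat_fun 1 t \<le> 1"
  by (auto simp: flat_fun_def)

lemma box_bump_bounds: "0 \<le> box_bump a b m x" "box_bump a b m x \<le> 1"
  unfolding box_bump_def
  by (intro prod_nonneg prod_le_1 ballI conjI mult_nonneg_nonneg mult_le_one flat_fun_1_bounds)+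

lemma box_bump_eq_0:
  assumes "m > 0" "x \<notin> box a b"
  shows "box_bump a b m x = 0"
proof -
  obtain i where i: "x $ i \<le> a $ i \<or> b $ i \<le> x $ i"
    using assms(2) by (force simp: mem_box_cart not_less)
  then have "flat_fun 1 (m * x $ i + - m * a $ i) * flat_fun 1 (- m * x $ i + m * b $ i) = 0"
    using assms(1) by (auto simp: flat_fun_def)
  then show ?thesis unfolding box_bump_def by (intro prod_zero) auto
qed

lemma box_bump_test_fun:
  assumes "m > 0"
  shows "test_fun (\<lambda>x. of_real (box_bump a b m x))"
  unfolding test_fun_def
proof
  show "smooth_fun (\<lambda>x. complex_of_real (box_bump a b m x))"
    unfolding box_bump_def of_real_prod of_real_mult
    by (intro smooth_fun_prod smooth_fun_mult smooth_fun_flat) auto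
  show "bounded {x. complex_of_real (box_bump a b m x) \<noteq> 0}"
    by (rule bounded_subset[OF bounded_box[of a b]]) (use box_bump_eq_0[OF assms] in auto)
qed

lemma box_bump_tendsto: "(\<lambda>k. box_bump a b (real (Suc k)) x) \<longlonglongrightarrow> indicator (box a b) x"
proof (cases "x \<in> box a b")
  case True
  have *: "(\<lambda>k. flat_fun 1 (real (Suc k) * c)) \<longlonglongrightarrow> 1" if "c > 0" for c
  proof -
    have "(\<lambda>k. exp (- (1 / c * inverse (real (Suc k))))) \<longlonglongrightarrow> exp (- (1 / c * 0))"
      by (intro tendsto_intros LIMSEQ_inverse_real_of_nat)
    then show ?thesis using that by (simp add: flat_fun_def divide_inverse mult_ac)
  qed
  have "(\<lambda>k. box_bump a b (real (Suc k)) x) \<longlonglongrightarrow> (\<Prod>i\<in>(UNIV :: 'a set). 1 * 1)"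
    unfolding box_bump_def
  proof (intro tendsto_prod tendsto_mult)
    fix i
    have "a $ i < x $ i" "x $ i < b $ i" using True by (auto simp: mem_box_cart)
    with *[of "x $ i - a $ i"] *[of "b $ i - x $ i"]
    show "(\<lambda>k. flat_fun 1 (real (Suc k) * x $ i + - real (Suc k) * a $ i)) \<longlonglongrightarrow> 1"
      "(\<lambda>k. flat_fun 1 (- real (Suc k) * x $ i + real (Suc k) * b $ i)) \<longlonglongrightarrow> 1"
      by (simp_all add: right_diff_distrib del: of_nat_Suc)
  qed
  then show ?thesis using True by simp
next
  case False
  then show ?thesis by (simp add: box_bump_eq_0)
qed

section \<open>Functions that vanish against all test functions\<close>

lemma mem_box_One:
  fixes x :: "'a::euclidean_space"
  assumes "norm x < r"
  shows "x \<in> box (- r *\<^sub>R One) (r *\<^sub>R One)"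
  unfolding mem_box
proof
  fix i :: 'a assume i: "i \<in> Basis"
  then have "\<bar>x \<bullet> i\<bar> < r" using Basis_le_norm[of i x] assms by linarith
  then show "(- r *\<^sub>R One) \<bullet> i < x \<bullet> i \<and> x \<bullet> i < (r *\<^sub>R One) \<bullet> i"
    using i by (auto simp: abs_less_iff)
qed

text \<open>Open boxes form an intersection-stable generator of the Borel sets, so Dynkin induction
  carries vanishing from boxes to all Borel sets. The complement step needs the integral over the
  whole space to vanish, which comes from exhausting it by boxes.\<close>

lemma integrable_AE_zero_of_boxes:
  fixes h :: "'a::euclidean_space \<Rightarrow> 'b::{banach, second_countable_topology}"
  assumes h: "integrable lborel h"
    and boxes: "\<And>a b. (LINT x|lborel. indicator (box a b) x *\<^sub>R h x) = 0"
  shows "AE x in lborel. h x = 0"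
proof (rule sigma_finite_measure.density_zero[OF sigma_finite_lborel h])
  fix A :: "'a set" assume A: "A \<in> sets lborel"
  have all: "(LINT x|lborel. h x) = 0"
  proof -
    have "(\<lambda>k::nat. LINT x|lborel. indicator (box (- real k *\<^sub>R One) (real k *\<^sub>R One)) x *\<^sub>R h x) \<longlonglongrightarrow> (LINT x|lborel. h x)"
    proof (rule integral_dominated_convergence[where w = "\<lambda>x. norm (h x)"])
      show "AE x in lborel. (\<lambda>k::nat. indicator (box (- real k *\<^sub>R One) (real k *\<^sub>R One)) x *\<^sub>R h x) \<longlonglongrightarrow> h x"
      proof (rule AE_I2, rule tendsto_eventually)
        fix x :: 'a
        have "eventually (\<lambda>k. norm x < real k) sequentially"
          using filterlim_real_sequentially unfolding filterlim_at_top_dense by (rule spec)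
        then show "\<forall>\<^sub>F k in sequentially. indicator (box (- real k *\<^sub>R One) (real k *\<^sub>R One)) x *\<^sub>R h x = h x"
        proof eventually_elim
          case (elim k)
          then show ?case using mem_box_One[OF elim] by simp
        qed
      qed
    qed (use h in \<open>auto simp: indicator_def\<close>)
    then show ?thesis by (simp add: boxes LIMSEQ_const_iff)
  qed
  have int: "integrable lborel (\<lambda>x. indicator A x *\<^sub>R h x)" if "A \<in> sets borel" for A
    using integrable_mult_indicator[OF _ h, of A] that by simp
  have sb: "sets borel = sigma_sets UNIV (range (\<lambda>(a, b). box a b :: 'a set))"
    by (subst borel_eq_box) (rule sets_measure_of, simp)
  have "Int_stable (range (\<lambda>(a, b). box a b :: 'a set))"
    by (auto simp: Int_stable_def box_Int_box)
  moreover have "range (\<lambda>(a, b). box a b :: 'a set) \<subseteq> Pow UNIV" by simp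
  moreover have "A \<in> sigma_sets UNIV (range (\<lambda>(a, b). box a b :: 'a set))"
    using A sb by simp
  ultimately have "(LINT x|lborel. indicator A x *\<^sub>R h x) = 0"
  proof (induction rule: sigma_sets_induct_disjoint)
    case (basic A)
    then show ?case using boxes by auto
  next
    case empty
    then show ?case by simp
  next
    case (compl A)
    then have A: "A \<in> sets borel" using sb by simp
    have "(LINT x|lborel. indicator (UNIV - A) x *\<^sub>R h x) = (LINT x|lborel. h x - indicator A x *\<^sub>R h x)"
      by (rule Bochner_Integration.integral_cong) (auto simp: indicator_def)
    also have "\<dots> = 0" using all compl h int[OF A] by simp
    finally show ?case .
  next
    case (union A)
    have A: "A i \<in> sets borel" for i using union(2) sb by auto
    have "(LINT x:(\<Union>i. A i)|lborel. h x) = (\<Sum>i. LINT x:(A i)|lborel. h x)"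
      using union(1) A int by (intro lebesgue_integral_countable_add) (auto simp: set_integrable_def disjoint_family_on_def)
    then show ?case using union(3) by (simp add: set_lebesgue_integral_def)
  qed
  then show "set_lebesgue_integral lborel A h = 0" by (simp add: set_lebesgue_integral_def)
qed

lemma locally_integrable_measurable:
  fixes g :: "real^'n::finite \<Rightarrow> complex"
  assumes "locally_integrable g"
  shows "g \<in> borel_measurable borel"
proof (rule borel_measurable_LIMSEQ_metric)
  show "(\<lambda>x. indicator (cball 0 (real k)) x *\<^sub>R g x) \<in> borel_measurable borel" for k
    using borel_measurable_integrable[OF assms[unfolded locally_integrable_def set_integrable_def, rule_format, OF compact_cball]]
    by simp
  fix x :: "real^'n"
  have "eventually (\<lambda>k. norm x < real k) sequentially"
    using filterlim_real_sequentially unfolding filterlim_at_top_dense by (rule spec)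
  then show "(\<lambda>k. indicator (cball 0 (real k)) x *\<^sub>R g x) \<longlonglongrightarrow> g x"
    by (intro tendsto_eventually) (auto elim!: eventually_mono)
qed

text \<open>Bumps approximate the indicator of a box, so all box integrals vanish. As
  \<open>g\<close> is only locally integrable, the criterion for integrable functions is applied to
  \<open>g\<close> cut off to a large box; the intersection of two boxes is again a box.\<close>

lemma du_bois_reymond:
  fixes g :: "real^'n::finite \<Rightarrow> complex"
  assumes g: "locally_integrable g" and 0: "\<And>\<phi>. test_fun \<phi> \<Longrightarrow> (LINT x|lborel. g x * \<phi> x) = 0"
  shows "AE x in lborel. g x = 0"
proof -
  have [measurable]: "g \<in> borel_measurable borel" by (rule locally_integrable_measurable[OF g])
  have loc: "integrable lborel (\<lambda>x. indicator (box a b) x *\<^sub>R g x)" for a b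
  proof (rule Bochner_Integration.integrable_bound)
    show "integrable lborel (\<lambda>x. indicator (cbox a b) x *\<^sub>R g x)"
      using g compact_cbox unfolding locally_integrable_def set_integrable_def by blast
  qed (use box_subset_cbox[of a b] in \<open>auto simp: indicator_def\<close>)
  have boxes: "(LINT x|lborel. indicator (box a b) x *\<^sub>R g x) = 0" for a b
  proof -
    have meas[measurable]: "(\<lambda>x. complex_of_real (box_bump a b (real (Suc k)) x)) \<in> borel_measurable borel" for k
      by (rule smooth_fun_measurable) (rule test_fun_smooth, rule box_bump_test_fun, simp)
    have "(\<lambda>k. LINT x|lborel. g x * of_real (box_bump a b (real (Suc k)) x)) \<longlonglongrightarrow>
        (LINT x|lborel. indicator (box a b) x *\<^sub>R g x)"
    proof (rule integral_dominated_convergence[where w = "\<lambda>x. norm (indicator (box a b) x *\<^sub>R g x)"])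
      show "AE x in lborel. (\<lambda>k. g x * of_real (box_bump a b (real (Suc k)) x)) \<longlonglongrightarrow> indicator (box a b) x *\<^sub>R g x"
      proof (rule AE_I2)
        fix x
        have "(\<lambda>k. g x * of_real (box_bump a b (real (Suc k)) x)) \<longlonglongrightarrow> g x * of_real (indicator (box a b) x)"
          by (intro tendsto_intros box_bump_tendsto)
        then show "(\<lambda>k. g x * of_real (box_bump a b (real (Suc k)) x)) \<longlonglongrightarrow> indicator (box a b) x *\<^sub>R g x"
          by (simp add: scaleR_conv_of_real mult.commute)
      qed
      show "AE x in lborel. norm (g x * of_real (box_bump a b (real (Suc k)) x)) \<le> norm (indicator (box a b) x *\<^sub>R g x)" for k
        using box_bump_bounds[of a b "real (Suc k)"] box_bump_eq_0[of "real (Suc k)" _ a b]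
        by (intro AE_I2) (auto simp: norm_mult indicator_def intro: mult_left_le)
      show "integrable lborel (\<lambda>x. norm (indicator (box a b) x *\<^sub>R g x))" using loc by (rule integrable_norm)
    qed (simp_all del: of_nat_Suc)
    then show ?thesis
      using 0[OF box_bump_test_fun, of "real (Suc _)" a b] by (simp add: LIMSEQ_const_iff)
  qed
  have "AE x in lborel. indicator (box (- real k *\<^sub>R One) (real k *\<^sub>R One)) x *\<^sub>R g x = 0" for k :: nat
  proof (rule integrable_AE_zero_of_boxes[OF loc])
    fix c d :: "real^'n"
    define a b where "a = (- real k *\<^sub>R One :: real^'n)" and "b = (real k *\<^sub>R One :: real^'n)"
    have "indicator (box c d) x *\<^sub>R indicator (box a b) x *\<^sub>R g x = indicator (box c d \<inter> box a b) x *\<^sub>R g x" for x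
      by (simp add: indicator_def)
    then have "(LINT x|lborel. indicator (box c d) x *\<^sub>R indicator (box a b) x *\<^sub>R g x) = 0"
      unfolding box_Int_box[of c d a b] by (simp only: boxes)
    then show "(LINT x|lborel. indicator (box c d) x *\<^sub>R indicator (box (- real k *\<^sub>R One) (real k *\<^sub>R One)) x *\<^sub>R g x) = 0"
      unfolding a_def b_def .
  qed
  then have "AE x in lborel. \<forall>k::nat. indicator (box (- real k *\<^sub>R One) (real k *\<^sub>R One)) x *\<^sub>R g x = 0"
    unfolding AE_all_countable by (rule allI)
  then show ?thesis
  proof eventually_elim
    case (elim x)
    obtain k :: nat where k: "norm x < real k" using reals_Archimedean2 by blast
    then show ?case using elim[rule_format, of k] mem_box_One[OF k] by simp
  qed
qed

subsection \<open>The Fourier transform of integrable functions\<close>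

lemma nn_integral_affine:
  fixes f :: "'a::euclidean_space \<Rightarrow> ennreal"
  assumes [measurable]: "f \<in> borel_measurable borel" and "c \<noteq> 0"
  shows "(\<integral>\<^sup>+x. f x \<partial>lborel) = ennreal (\<bar>c\<bar> ^ DIM('a)) * (\<integral>\<^sup>+x. f (t + c *\<^sub>R x) \<partial>lborel)"
  by (subst lborel_affine[OF assms(2), of t])
    (simp add: nn_integral_density nn_integral_distr nn_integral_cmult)

lemma lebesgue_integral_affine:
  fixes f :: "'a::euclidean_space \<Rightarrow> 'b::{banach, second_countable_topology}"
  assumes [measurable]: "f \<in> borel_measurable borel" and "c \<noteq> 0"
  shows "(LINT x|lborel. f x) = \<bar>c\<bar> ^ DIM('a) *\<^sub>R (LINT x|lborel. f (t + c *\<^sub>R x))"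
  by (subst lborel_affine[OF assms(2), of t])
    (simp add: integral_density integral_distr)

lemma integrable_affine:
  fixes f :: "'a::euclidean_space \<Rightarrow> 'b::{banach, second_countable_topology}"
  assumes f: "integrable lborel f" and c: "c \<noteq> 0"
  shows "integrable lborel (\<lambda>x. f (t + c *\<^sub>R x))"
proof -
  have [measurable]: "f \<in> borel_measurable borel" using borel_measurable_integrable[OF f] by simp
  have "(\<integral>\<^sup>+x. norm (f x) \<partial>lborel) < \<infinity>" using f by (simp add: integrable_iff_bounded)
  then have "(\<integral>\<^sup>+x. norm (f (t + c *\<^sub>R x)) \<partial>lborel) < \<infinity>"
    using c by (subst (asm) nn_integral_affine[of _ c t]) (auto simp: ennreal_mult_less_top)
  then show ?thesis by (simp add: integrable_iff_bounded)
qed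

lemma nn_integral_translate:
  fixes f :: "'a::euclidean_space \<Rightarrow> ennreal"
  assumes "f \<in> borel_measurable borel"
  shows "(\<integral>\<^sup>+x. f (x - t) \<partial>lborel) = (\<integral>\<^sup>+x. f x \<partial>lborel)"
proof -
  have "(\<lambda>x. f (x - t)) \<in> borel_measurable borel" using assms by measurable
  from nn_integral_affine[OF this, of 1 t] show ?thesis by simp
qed

lemma nn_integral_reflect:
  fixes f :: "'a::euclidean_space \<Rightarrow> ennreal"
  assumes "f \<in> borel_measurable borel"
  shows "(\<integral>\<^sup>+x. f (t - x) \<partial>lborel) = (\<integral>\<^sup>+x. f x \<partial>lborel)"
  using nn_integral_affine[OF assms, of "-1" t] by simp

lemma lebesgue_integral_reflect:
  fixes f :: "'a::euclidean_space \<Rightarrow> 'b::{banach, second_countable_topology}"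
  assumes "f \<in> borel_measurable borel"
  shows "(LINT x|lborel. f (t - x)) = (LINT x|lborel. f x)"
  using lebesgue_integral_affine[OF assms, of "-1" t] by simp

lemma AE_lborel_reflect:
  fixes P :: "'a::euclidean_space \<Rightarrow> bool"
  assumes [measurable]: "Measurable.pred borel P" and "AE x in lborel. P x"
  shows "AE x in lborel. P (t - x)"
proof -
  have *: "lborel = density (distr lborel borel (\<lambda>x::'a. t - x)) (\<lambda>_. 1)"
    using lborel_affine[of "-1::real" t] by simp
  have "AE x in density (distr lborel borel (\<lambda>x::'a. t - x)) (\<lambda>_. 1). P x"
    using assms(2) by (subst *[symmetric])
  then show ?thesis by (simp add: AE_density AE_distr_iff)
qed

lemma lebesgue_integral_lborel_prod:
  fixes f :: "'a::euclidean_space \<Rightarrow> real \<Rightarrow> complex"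
  assumes "\<And>b. b \<in> Basis \<Longrightarrow> integrable lborel (f b)"
  shows "(LINT x|lborel. (\<Prod>b\<in>Basis. f b (x \<bullet> b))) = (\<Prod>b\<in>Basis. LINT t|lborel. f b t)"
    "integrable lborel (\<lambda>x::'a. (\<Prod>b\<in>Basis. f b (x \<bullet> b)))"
proof -
  interpret product_sigma_finite "\<lambda>b::'a. lborel :: real measure" ..
  have [measurable]: "b \<in> Basis \<Longrightarrow> f b \<in> borel_measurable borel" for b
    using borel_measurable_integrable[OF assms, of b] by simp
  have *: "(\<lambda>x::'a. (\<Prod>b\<in>Basis. f b (x \<bullet> b))) \<in> borel_measurable borel" by measurable
  have eq: "(\<Prod>b\<in>Basis. f b ((\<Sum>b\<in>Basis. x b *\<^sub>R b) \<bullet> b)) = (\<Prod>b\<in>Basis. f b (x b))" for x :: "'a \<Rightarrow> real"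
    by (intro prod.cong) auto
  show "(LINT x|lborel. (\<Prod>b\<in>Basis. f b (x \<bullet> b))) = (\<Prod>b\<in>Basis. LINT t|lborel. f b t)"
    by (subst lborel_eq) (simp add: integral_distr * eq product_integral_prod assms)
  show "integrable lborel (\<lambda>x::'a. (\<Prod>b\<in>Basis. f b (x \<bullet> b)))"
    by (subst lborel_eq) (simp add: integrable_distr_eq * eq product_integrable_prod assms)
qed

section \<open>The normalised transform and the multiplication formula\<close>

definition ft_const :: "nat \<Rightarrow> real" where
  "ft_const n = (2 * pi) powr (- real n / 2)"

lemma ft_const_pos: "ft_const n > 0"
  by (simp add: ft_const_def)

lemma ft_const_power: "ft_const n = (1 / sqrt (2 * pi)) ^ n"
proof -
  have "(1 / sqrt (2 * pi)) ^ n = ((2 * pi) powr (- 1 / 2)) powr real n"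
    by (simp add: powr_realpow powr_half_sqrt powr_minus_divide)
  also have "\<dots> = ft_const n" by (simp add: ft_const_def powr_powr)
  finally show ?thesis by simp
qed

lemma fourier_alt:
  "fourier f \<xi> = of_real (ft_const CARD('n)) * (LINT x|lborel. f x * exp (\<i> * of_real (- \<xi> \<bullet> x)))"
  for f :: "real^'n::finite \<Rightarrow> complex"
  by (simp add: fourier_def ft_const_def)

lemma inv_fourier_alt:
  "inv_fourier f x = of_real (ft_const CARD('n)) * (LINT \<xi>|lborel. f \<xi> * exp (\<i> * of_real (\<xi> \<bullet> x)))"
  for f :: "real^'n::finite \<Rightarrow> complex"
  by (simp add: inv_fourier_def ft_const_def)

lemma fourier_eq_inv_fourier: "fourier f \<xi> = inv_fourier f (- \<xi>)"
  by (simp add: fourier_alt inv_fourier_alt inner_commute)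

lemma integrable_mult_unimodular:
  fixes g :: "'a \<Rightarrow> complex"
  assumes "integrable M g" "e \<in> borel_measurable M" "\<And>x. cmod (e x) \<le> 1"
  shows "integrable M (\<lambda>x. g x * e x)"
  by (rule Bochner_Integration.integrable_bound[OF assms(1)])
    (use assms in \<open>auto simp: norm_mult intro!: mult_left_le AE_I2\<close>)

lemma integrable_mult_iexp:
  fixes g :: "'a::euclidean_space \<Rightarrow> complex"
  shows "integrable lborel g \<Longrightarrow> integrable lborel (\<lambda>x. g x * exp (\<i> * of_real (x \<bullet> a)))"
    "integrable lborel g \<Longrightarrow> integrable lborel (\<lambda>x. g x * exp (\<i> * of_real (a \<bullet> x)))"
  by (auto intro!: integrable_mult_unimodular)

lemma inv_fourier_bound: 
  fixes g :: "real^'n::finite \<Rightarrow> complex"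
  assumes "integrable lborel g"
  shows "cmod (inv_fourier g x) \<le> ft_const CARD('n) * (LINT \<xi>|lborel. cmod (g \<xi>))"
proof -
  have "cmod (LINT \<xi>|lborel. g \<xi> * exp (\<i> * of_real (\<xi> \<bullet> x))) \<le> (LINT \<xi>|lborel. cmod (g \<xi> * exp (\<i> * of_real (\<xi> \<bullet> x))))"
    by (rule integral_norm_bound)
  also have "\<dots> = (LINT \<xi>|lborel. cmod (g \<xi>))" by (simp add: norm_mult)
  finally show ?thesis using ft_const_pos[of "CARD('n)"] by (simp add: inv_fourier_alt norm_mult)
qed

lemma inv_fourier_measurable [measurable]:
  fixes g :: "real^'n::finite \<Rightarrow> complex"
  assumes [measurable]: "g \<in> borel_measurable borel"
  shows "inv_fourier g \<in> borel_measurable borel"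
  unfolding inv_fourier_alt[abs_def]
  by (intro borel_measurable_times borel_measurable_const lborel.borel_measurable_lebesgue_integral) simp

lemma integrable_pair_mult:
  fixes f :: "'a::euclidean_space \<Rightarrow> complex" and g :: "'b::euclidean_space \<Rightarrow> complex"
  assumes f: "integrable lborel f" and g: "integrable lborel g"
  shows "integrable (lborel \<Otimes>\<^sub>M lborel) (\<lambda>(x, y). f x * g y)"
proof (rule lborel_pair.Fubini_integrable)
  have [measurable]: "f \<in> borel_measurable borel" "g \<in> borel_measurable borel"
    using borel_measurable_integrable[OF f] borel_measurable_integrable[OF g] by auto
  show "(\<lambda>(x, y). f x * g y) \<in> borel_measurable (lborel \<Otimes>\<^sub>M lborel)" by measurable
qed (use f g in \<open>auto simp: norm_mult\<close>)

text \<open>The kernel exp(i \<xi>.x) is symmetric in its two variables, so Fubini moves the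
  transform from one factor to the other. The later passages between functions and their transforms
  rest on this.\<close>

lemma inv_fourier_duality:
  fixes f g :: "real^'n::finite \<Rightarrow> complex"
  assumes f: "integrable lborel f" and g: "integrable lborel g"
  shows "(LINT x|lborel. inv_fourier f x * g x) = (LINT x|lborel. f x * inv_fourier g x)"
proof -
  have [measurable]: "f \<in> borel_measurable borel" "g \<in> borel_measurable borel"
    using borel_measurable_integrable[OF f] borel_measurable_integrable[OF g] by auto
  let ?h = "\<lambda>\<xi> x. f \<xi> * g x * exp (\<i> * of_real (\<xi> \<bullet> x))"
  have "integrable (lborel \<Otimes>\<^sub>M lborel) (\<lambda>p. (case p of (\<xi>, x) \<Rightarrow> f \<xi> * g x) * exp (\<i> * of_real (fst p \<bullet> snd p)))"
    by (intro integrable_mult_unimodular integrable_pair_mult f g) auto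
  then have "integrable (lborel \<Otimes>\<^sub>M lborel) (\<lambda>(\<xi>, x). ?h \<xi> x)" by (simp add: split_beta')
  from lborel_pair.Fubini_integral[OF this]
  have "(LINT x|lborel. LINT \<xi>|lborel. ?h \<xi> x) = (LINT \<xi>|lborel. LINT x|lborel. ?h \<xi> x)" by simp
  moreover have "(LINT x|lborel. inv_fourier f x * g x) =
      of_real (ft_const CARD('n)) * (LINT x|lborel. LINT \<xi>|lborel. ?h \<xi> x)"
  proof -
    have "inv_fourier f x * g x = of_real (ft_const CARD('n)) * (LINT \<xi>|lborel. ?h \<xi> x)" for x
      by (simp add: inv_fourier_alt mult_ac flip: integral_mult_right_zero integral_mult_left_zero)
    then show ?thesis by simp
  qed
  moreover have "(LINT x|lborel. f x * inv_fourier g x) =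
      of_real (ft_const CARD('n)) * (LINT \<xi>|lborel. LINT x|lborel. ?h \<xi> x)"
  proof -
    have "f x * inv_fourier g x = of_real (ft_const CARD('n)) * (LINT \<xi>|lborel. ?h x \<xi>)" for x
      by (simp add: inv_fourier_alt inner_commute mult_ac flip: integral_mult_right_zero integral_mult_left_zero)
    then show ?thesis by simp
  qed
  ultimately show ?thesis by simp
qed

lemma fourier_duality:
  fixes f g :: "real^'n::finite \<Rightarrow> complex"
  assumes f: "integrable lborel f" and g: "integrable lborel g"
  shows "(LINT x|lborel. fourier f x * g x) = (LINT x|lborel. f x * fourier g x)"
proof -
  have [measurable]: "f \<in> borel_measurable borel" "g \<in> borel_measurable borel"
    using borel_measurable_integrable[OF f] borel_measurable_integrable[OF g] by auto
  have g': "integrable lborel (\<lambda>x. g (- x))"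
    using integrable_affine[OF g, of "-1" 0] by simp
  have gf: "inv_fourier (\<lambda>x. g (- x)) x = fourier g x" for x
    using lebesgue_integral_reflect[of "\<lambda>\<xi>. g \<xi> * exp (\<i> * of_real (- x \<bullet> \<xi>))" 0]
    by (simp add: fourier_alt inv_fourier_alt inner_commute)
  have "(LINT x|lborel. fourier f x * g x) = (LINT x|lborel. inv_fourier f x * g (- x))"
    using lebesgue_integral_reflect[of "\<lambda>x. inv_fourier f (- x) * g x" 0]
    by (simp add: fourier_eq_inv_fourier)
  also have "\<dots> = (LINT x|lborel. f x * fourier g x)"
    using inv_fourier_duality[OF f g'] by (simp add: gf)
  finally show ?thesis .
qed

section \<open>Gaussians, inversion and Plancherel\<close>

definition gauss :: "'a::euclidean_space \<Rightarrow> real" where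
  "gauss x = exp (- (norm x)\<^sup>2 / 2)"

lemma gauss_bounds: "0 < gauss x" "gauss x \<le> 1"
  by (auto simp: gauss_def)

lemma gauss_measurable [measurable]: "gauss \<in> borel_measurable borel"
  unfolding gauss_def[abs_def] by measurable

lemma gauss_prod: "gauss (x::real^'n::finite) = (\<Prod>b\<in>Basis. exp (- (x \<bullet> b)\<^sup>2 / 2))"
proof -
  have "(norm x)\<^sup>2 = (\<Sum>b\<in>Basis. (x \<bullet> b)\<^sup>2)"
    unfolding power2_norm_eq_inner by (subst euclidean_inner) (simp add: power2_eq_square)
  then show ?thesis by (simp add: gauss_def exp_sum[symmetric] sum_negf sum_divide_distrib)
qed

text \<open>Up to the factor sqrt(2 pi) this is the characteristic function of the standard normal
  distribution, which supplies the value without contour integration.\<close>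

lemma gauss_1d:
  "integrable lborel (\<lambda>s::real. complex_of_real (exp (- s\<^sup>2 / 2)) * exp (\<i> * of_real (t * s)))"
  "(LINT s|lborel. complex_of_real (exp (- s\<^sup>2 / 2)) * exp (\<i> * of_real (t * s))) =
     of_real (sqrt (2 * pi) * exp (- t\<^sup>2 / 2))"
proof -
  have nd: "std_normal_density s = exp (- s\<^sup>2 / 2) / sqrt (2 * pi)" for s
    by (simp add: std_normal_density_def)
  have 1: "exp (- s\<^sup>2 / 2) = sqrt (2 * pi) * std_normal_density s" for s
    by (simp add: nd)
  have i: "integrable lborel (\<lambda>s::real. complex_of_real (exp (- s\<^sup>2 / 2)))"
    unfolding 1 using integrable_std_normal_moment[of 0] by (simp add: integrable_of_real)
  show "integrable lborel (\<lambda>s::real. complex_of_real (exp (- s\<^sup>2 / 2)) * exp (\<i> * of_real (t * s)))"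
    by (intro integrable_mult_unimodular[OF i]) auto
  have "exp (- t\<^sup>2 / 2) = char std_normal_distribution t"
    by (simp add: char_std_normal_distribution)
  also have "\<dots> = (LINT s|lborel. std_normal_density s *\<^sub>R exp (\<i> * of_real (t * s)))"
    unfolding char_def by (subst integral_density) (auto simp: normal_density_nonneg)
  finally have c: "(LINT s|lborel. std_normal_density s *\<^sub>R exp (\<i> * of_real (t * s))) = exp (- t\<^sup>2 / 2)" ..
  have "(LINT s|lborel. complex_of_real (exp (- s\<^sup>2 / 2)) * exp (\<i> * of_real (t * s))) =
      (LINT s|lborel. of_real (sqrt (2 * pi)) * (std_normal_density s *\<^sub>R exp (\<i> * of_real (t * s))))"
    unfolding 1 by (simp add: scaleR_conv_of_real mult_ac)
  also have "\<dots> = of_real (sqrt (2 * pi) * exp (- t\<^sup>2 / 2))"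
    by (subst integral_mult_right_zero, subst c) (simp add: exp_of_real)
  finally show "(LINT s|lborel. complex_of_real (exp (- s\<^sup>2 / 2)) * exp (\<i> * of_real (t * s))) =
     of_real (sqrt (2 * pi) * exp (- t\<^sup>2 / 2))" .
qed

lemma gauss_fourier:
  fixes a :: "real^'n::finite"
  shows "integrable lborel (\<lambda>x. complex_of_real (gauss x) * exp (\<i> * of_real (a \<bullet> x)))"
    "(LINT x|lborel. complex_of_real (gauss x) * exp (\<i> * of_real (a \<bullet> x))) =
       of_real (gauss a / ft_const CARD('n))"
proof -
  define f where "f b s = complex_of_real (exp (- s\<^sup>2 / 2)) * exp (\<i> * of_real ((a \<bullet> b) * s))" for b :: "real^'n" and s
  have eq: "complex_of_real (gauss x) * exp (\<i> * of_real (a \<bullet> x)) = (\<Prod>b\<in>Basis. f b (x \<bullet> b))" for x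
    unfolding f_def prod.distrib euclidean_inner[of a x] gauss_prod
    by (simp add: exp_sum sum_distrib_left)
  have i: "integrable lborel (f b)" for b unfolding f_def by (rule gauss_1d)
  have v: "(LINT s|lborel. f b s) = of_real (sqrt (2 * pi) * exp (- (a \<bullet> b)\<^sup>2 / 2))" for b
    unfolding f_def by (rule gauss_1d)
  show "integrable lborel (\<lambda>x. complex_of_real (gauss x) * exp (\<i> * of_real (a \<bullet> x)))"
    unfolding eq by (rule lebesgue_integral_lborel_prod) (rule i)
  have "(LINT x|lborel. complex_of_real (gauss x) * exp (\<i> * of_real (a \<bullet> x))) =
      (\<Prod>b\<in>(Basis::(real^'n) set). of_real (sqrt (2 * pi) * exp (- (a \<bullet> b)\<^sup>2 / 2)))"
    unfolding eq by (subst lebesgue_integral_lborel_prod(1)[OF i]) (simp only: v)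
  also have "\<dots> = of_real (sqrt (2 * pi) ^ CARD('n) * gauss a)"
    unfolding gauss_prod of_real_mult prod.distrib by simp
  also have "\<dots> = of_real (gauss a / ft_const CARD('n))"
    by (simp add: ft_const_power power_divide)
  finally show "(LINT x|lborel. complex_of_real (gauss x) * exp (\<i> * of_real (a \<bullet> x))) =
       of_real (gauss a / ft_const CARD('n))" .
qed

declare gauss_bounds [simp]

lemma gauss_nonneg [simp]: "0 \<le> gauss x"
  by (simp add: less_imp_le)

lemma cnj_measurable [measurable]: "f \<in> borel_measurable M \<Longrightarrow> (\<lambda>x. cnj (f x)) \<in> borel_measurable M"
  by (rule borel_measurable_continuous_on[of cnj]) (auto intro: continuous_intros)

lemma gauss_integrable: "integrable lborel (\<lambda>x::real^'n::finite. gauss x)"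
proof -
  have "integrable lborel (\<lambda>x::real^'n. complex_of_real (gauss x))"
    using gauss_fourier(1)[of 0] by simp
  then show ?thesis unfolding complex_of_real_integrable_eq .
qed

lemma gauss_integral: "(LINT x::real^'n::finite|lborel. gauss x) = 1 / ft_const CARD('n)"
proof -
  have "(LINT x::real^'n|lborel. complex_of_real (gauss x)) = of_real (1 / ft_const CARD('n))"
    using gauss_fourier(2)[of "0::real^'n"] by (simp add: gauss_def)
  then show ?thesis unfolding integral_complex_of_real of_real_eq_iff .
qed

text \<open>The Gaussian makes the character integrable, and the transform of the product is a bump
  around \<open>x\<close> of width \<delta>. This approximate identity is behind both inversion and
  Plancherel.\<close>

lemma gauss_kernel:
  fixes x y :: "real^'n::finite"
  assumes "\<delta> > 0"
  shows "integrable lborel (\<lambda>\<xi>. exp (\<i> * of_real (x \<bullet> \<xi>)) * complex_of_real (gauss (\<delta> *\<^sub>R \<xi>)))"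
    "fourier (\<lambda>\<xi>. exp (\<i> * of_real (x \<bullet> \<xi>)) * complex_of_real (gauss (\<delta> *\<^sub>R \<xi>))) y =
       of_real (gauss ((x - y) /\<^sub>R \<delta>) / \<delta> ^ CARD('n))"
proof -
  have "integrable lborel (\<lambda>\<xi>. gauss (\<delta> *\<^sub>R \<xi> :: real^'n))"
    using integrable_affine[OF gauss_integrable, of \<delta> 0] assms by simp
  then have "integrable lborel (\<lambda>\<xi>. complex_of_real (gauss (\<delta> *\<^sub>R \<xi> :: real^'n)))" by simp
  from integrable_mult_iexp(2)[OF this, of x]
  show "integrable lborel (\<lambda>\<xi>. exp (\<i> * of_real (x \<bullet> \<xi>)) * complex_of_real (gauss (\<delta> *\<^sub>R \<xi>)))"
    by (simp add: mult.commute)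
  define a where "a = (x - y) /\<^sub>R \<delta>"
  have e: "exp (\<i> * of_real (x \<bullet> \<xi>)) * complex_of_real (gauss (\<delta> *\<^sub>R \<xi>)) * exp (\<i> * of_real (- y \<bullet> \<xi>))
      = complex_of_real (gauss (\<delta> *\<^sub>R \<xi>)) * exp (\<i> * of_real (a \<bullet> (\<delta> *\<^sub>R \<xi>)))" for \<xi>
  proof -
    have "a \<bullet> (\<delta> *\<^sub>R \<xi>) = x \<bullet> \<xi> - y \<bullet> \<xi>"
      using assms by (simp add: a_def inner_diff_left)
    then show ?thesis by (simp only: of_real_diff) (simp add: exp_diff exp_minus field_simps)
  qed
  have "of_real (gauss a / ft_const CARD('n)) =
      \<bar>\<delta>\<bar> ^ DIM(real^'n) *\<^sub>R (LINT \<xi>|lborel. complex_of_real (gauss (0 + \<delta> *\<^sub>R \<xi>)) * exp (\<i> * of_real (a \<bullet> (0 + \<delta> *\<^sub>R \<xi>))))"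
    using assms by (subst gauss_fourier(2)[symmetric], subst lebesgue_integral_affine[of _ \<delta> 0]) auto
  then have "(LINT \<xi>|lborel. complex_of_real (gauss (\<delta> *\<^sub>R \<xi>)) * exp (\<i> * of_real (a \<bullet> (\<delta> *\<^sub>R \<xi>)))) =
      of_real (gauss a / ft_const CARD('n) / \<delta> ^ CARD('n))"
    using assms ft_const_pos[of "CARD('n)"]
    by (simp add: scaleR_conv_of_real eq_divide_eq mult_ac del: scaleR_right_distrib) (simp add: divide_simps mult_ac)
  then show "fourier (\<lambda>\<xi>. exp (\<i> * of_real (x \<bullet> \<xi>)) * complex_of_real (gauss (\<delta> *\<^sub>R \<xi>))) y =
       of_real (gauss ((x - y) /\<^sub>R \<delta>) / \<delta> ^ CARD('n))"
    using ft_const_pos[of "CARD('n)"] unfolding fourier_alt e a_def by simp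
qed

lemma gauss_scaled_tendsto: "(\<lambda>k. gauss (inverse (real (Suc k)) *\<^sub>R x)) \<longlonglongrightarrow> 1"
proof -
  have "(\<lambda>k. exp (- (norm (inverse (real (Suc k)) *\<^sub>R x))\<^sup>2 / 2)) \<longlonglongrightarrow> exp (- (norm (0 *\<^sub>R x))\<^sup>2 / 2)"
    by (intro tendsto_intros LIMSEQ_inverse_real_of_nat) simp
  then show ?thesis by (simp add: gauss_def)
qed

text \<open>The regularised inversion integral \<open>A k\<close> is evaluated in two ways.
  Directly, the Gaussian tends to 1 under the integrable bound given by
  \<open>fourier \<phi>\<close>; by duality, \<open>A k\<close> is an average of \<phi> around
  \<open>x\<close> at scale \<open>d k\<close>, which converges by continuity.\<close>

theorem fourier_inversion:
  fixes \<phi> :: "real^'n::finite \<Rightarrow> complex"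
  assumes i: "integrable lborel \<phi>" and c: "continuous_on UNIV \<phi>" and b: "\<And>x. cmod (\<phi> x) \<le> B"
    and f: "integrable lborel (fourier \<phi>)"
  shows "inv_fourier (fourier \<phi>) x = \<phi> x"
proof -
  have [measurable]: "\<phi> \<in> borel_measurable borel" "fourier \<phi> \<in> borel_measurable borel"
    using borel_measurable_integrable[OF i] borel_measurable_integrable[OF f] by auto
  define d where "d k = inverse (real (Suc k))" for k
  have d: "d k > 0" "d \<longlonglongrightarrow> 0" for k
    unfolding d_def by (simp, rule LIMSEQ_inverse_real_of_nat)
  define A where "A k = (LINT \<xi>|lborel. fourier \<phi> \<xi> * (exp (\<i> * of_real (x \<bullet> \<xi>)) * of_real (gauss (d k *\<^sub>R \<xi>))))" for k
  have A1: "A \<longlonglongrightarrow> (LINT \<xi>|lborel. fourier \<phi> \<xi> * (exp (\<i> * of_real (x \<bullet> \<xi>)) * of_real 1))"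
    unfolding A_def
  proof (rule integral_dominated_convergence[where w = "\<lambda>\<xi>. cmod (fourier \<phi> \<xi>)"])
    show "AE \<xi> in lborel. (\<lambda>k. fourier \<phi> \<xi> * (exp (\<i> * of_real (x \<bullet> \<xi>)) * of_real (gauss (d k *\<^sub>R \<xi>))))
      \<longlonglongrightarrow> fourier \<phi> \<xi> * (exp (\<i> * of_real (x \<bullet> \<xi>)) * of_real 1)"
      unfolding d_def by (intro AE_I2 tendsto_intros gauss_scaled_tendsto)
    show "AE \<xi> in lborel. cmod (fourier \<phi> \<xi> * (exp (\<i> * of_real (x \<bullet> \<xi>)) * of_real (gauss (d k *\<^sub>R \<xi>)))) \<le> cmod (fourier \<phi> \<xi>)" for k
      by (intro AE_I2) (auto simp: norm_mult abs_of_pos[OF gauss_bounds(1)] gauss_bounds(2) intro!: mult_left_le)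
  qed (use f in auto)
  \<comment> \<open>Duality, then the substitution y = x + \<open>d k\<close> z, whose Jacobian
    cancels the power of \<open>d k\<close> in the kernel.\<close>
  have A2: "A k = (LINT z|lborel. \<phi> (x + d k *\<^sub>R z) * of_real (gauss z))" for k
  proof -
    have "A k = (LINT y|lborel. \<phi> y * of_real (gauss ((x - y) /\<^sub>R d k) / d k ^ CARD('n)))"
      unfolding A_def fourier_duality[OF i gauss_kernel(1)[OF d(1)]] gauss_kernel(2)[OF d(1)] ..
    also have "\<dots> = \<bar>d k\<bar> ^ DIM(real^'n) *\<^sub>R (LINT z|lborel. \<phi> (x + d k *\<^sub>R z) * of_real (gauss ((x - (x + d k *\<^sub>R z)) /\<^sub>R d k) / d k ^ CARD('n)))"
      using d(1)[of k] by (subst lebesgue_integral_affine[of _ "d k" x]) auto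
    also have "\<dots> = (LINT z|lborel. \<bar>d k\<bar> ^ DIM(real^'n) *\<^sub>R (\<phi> (x + d k *\<^sub>R z) * of_real (gauss ((x - (x + d k *\<^sub>R z)) /\<^sub>R d k) / d k ^ CARD('n))))"
      by simp
    also have "\<dots> = (LINT z|lborel. \<phi> (x + d k *\<^sub>R z) * of_real (gauss z))"
    proof (rule Bochner_Integration.integral_cong[OF refl])
      fix z
      have "(x - (x + d k *\<^sub>R z)) /\<^sub>R d k = - z" using d(1)[of k] by simp
      then have "gauss ((x - (x + d k *\<^sub>R z)) /\<^sub>R d k) = gauss z" by (simp only:) (simp add: gauss_def)
      then show "\<bar>d k\<bar> ^ DIM(real^'n) *\<^sub>R (\<phi> (x + d k *\<^sub>R z) * of_real (gauss ((x - (x + d k *\<^sub>R z)) /\<^sub>R d k) / d k ^ CARD('n)))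
          = \<phi> (x + d k *\<^sub>R z) * of_real (gauss z)"
        using d(1)[of k] by (simp only:) (simp add: scaleR_conv_of_real[where 'a = complex])
    qed
    finally show ?thesis .
  qed
  have A3: "A \<longlonglongrightarrow> (LINT z|lborel. \<phi> (x + 0 *\<^sub>R z) * of_real (gauss z))"
    unfolding A2[abs_def]
  proof (rule integral_dominated_convergence[where w = "\<lambda>z. B * gauss z"])
    show "AE z in lborel. (\<lambda>k. \<phi> (x + d k *\<^sub>R z) * of_real (gauss z)) \<longlonglongrightarrow> \<phi> (x + 0 *\<^sub>R z) * of_real (gauss z)"
      by (intro AE_I2 tendsto_intros continuous_on_tendsto_compose[OF c] d) auto
    show "AE z in lborel. cmod (\<phi> (x + d k *\<^sub>R z) * of_real (gauss z)) \<le> B * gauss z" for k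
      using b by (intro AE_I2) (auto simp: norm_mult abs_of_pos[OF gauss_bounds(1)] less_imp_le[OF gauss_bounds(1)] intro!: mult_right_mono)
  qed (use gauss_integrable in auto)
  have "(LINT z::real^'n|lborel. \<phi> x * of_real (gauss z)) = \<phi> x * of_real (1 / ft_const CARD('n))"
    by (simp add: gauss_integral)
  with LIMSEQ_unique[OF A1 A3] ft_const_pos[of "CARD('n)"] show ?thesis
    by (simp add: inv_fourier_alt inner_commute)
qed

lemma ennreal_half_add: "(x::ennreal) / 2 + x / 2 = x"
proof -
  have "x / 2 + x / 2 = (x + x) / 2" by (simp add: divide_ennreal_def distrib_right)
  also have "\<dots> = x * (2 / 2)" by (simp only: mult_2_right[symmetric] ennreal_times_divide)
  also have "2 / 2 = (1::ennreal)" by (rule ennreal_divide_self) auto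
  finally show ?thesis by simp
qed

text \<open>Since \<open>g\<close> is merely integrable, the right side may be infinite. A Gaussian
  weight makes the left side finite; duality turns it into a double integral of g(\<xi>) and the
  conjugate of g(\<eta>) against a kernel in \<xi> - \<eta>, and AM-GM bounds this by the mass of
  the kernel.\<close>

theorem plancherel_inv_fourier_le:
  fixes g :: "real^'n::finite \<Rightarrow> complex"
  assumes g: "integrable lborel g"
  shows "(\<integral>\<^sup>+x. (cmod (inv_fourier g x))\<^sup>2 \<partial>lborel) \<le> (\<integral>\<^sup>+\<xi>. (cmod (g \<xi>))\<^sup>2 \<partial>lborel)"
proof -
  have [measurable]: "g \<in> borel_measurable borel" using borel_measurable_integrable[OF g] by auto
  let ?N = "\<integral>\<^sup>+\<xi>. (cmod (g \<xi>))\<^sup>2 \<partial>lborel"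
  define c where "c = ft_const CARD('n)"
  have c: "c > 0" using ft_const_pos c_def by auto
  define h where "h = inv_fourier g"
  have [measurable]: "h \<in> borel_measurable borel" unfolding h_def by measurable
  obtain B where B: "\<And>x. cmod (h x) \<le> B" using inv_fourier_bound[OF g] h_def by blast
  have gc: "integrable lborel (\<lambda>x. cnj (g x))" using g by simp
  have hc: "cnj (h x) = fourier (\<lambda>x. cnj (g x)) x" for x
  proof -
    have "cnj (LINT \<xi>|lborel. g \<xi> * exp (\<i> * of_real (\<xi> \<bullet> x))) = (LINT \<xi>|lborel. cnj (g \<xi> * exp (\<i> * of_real (\<xi> \<bullet> x))))"
      by (rule Bochner_Integration.integral_cnj[symmetric])
    then show ?thesis by (simp add: h_def inv_fourier_alt fourier_alt exp_cnj inner_commute)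
  qed
  have key: "(\<integral>\<^sup>+x. (cmod (h x))\<^sup>2 * gauss (\<delta> *\<^sub>R x) \<partial>lborel) \<le> ?N" if d: "\<delta> > 0" for \<delta>
  proof -
    define K where "K z = gauss (z /\<^sub>R \<delta>) / \<delta> ^ CARD('n)" for z :: "real^'n"
    have K0: "K z \<ge> 0" for z using d gauss_bounds(1)[of "z /\<^sub>R \<delta>"] by (simp add: K_def)
    have [measurable]: "K \<in> borel_measurable borel" unfolding K_def by measurable
    \<comment> \<open>The mass 1 / c compensates the factor \<open>c\<close> in
      \<open>inv_fourier\<close>, so the final constant is exactly 1.\<close>
    have Kint: "(\<integral>\<^sup>+z. K (t - z) \<partial>lborel) = ennreal (1 / c)" for t
    proof -
      have "(\<integral>\<^sup>+z. K (t - z) \<partial>lborel) = (\<integral>\<^sup>+z. K z \<partial>lborel)"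
        by (rule nn_integral_reflect) measurable
      also have "\<dots> = ennreal (\<bar>\<delta>\<bar> ^ DIM(real^'n)) * (\<integral>\<^sup>+z. K (0 + \<delta> *\<^sub>R z) \<partial>lborel)"
        using d by (intro nn_integral_affine) auto
      also have "\<dots> = (\<integral>\<^sup>+z. ennreal (\<bar>\<delta>\<bar> ^ DIM(real^'n)) * K (0 + \<delta> *\<^sub>R z) \<partial>lborel)"
        by (rule nn_integral_cmult[symmetric]) measurable
      also have "\<dots> = (\<integral>\<^sup>+z. gauss (z::real^'n) \<partial>lborel)"
        using d by (intro nn_integral_cong) (simp add: K_def ennreal_mult'[symmetric])
      also have "\<dots> = ennreal (1 / c)"
        using gauss_integral[where 'n = 'n]
        by (subst nn_integral_eq_integral[OF gauss_integrable]) (auto simp: less_imp_le c_def)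
      finally show ?thesis .
    qed
    let ?w = "\<lambda>x. cnj (h x) * of_real (gauss (\<delta> *\<^sub>R x))"
    have gi: "integrable lborel (\<lambda>\<xi>. complex_of_real (gauss (\<delta> *\<^sub>R \<xi> :: real^'n)))"
      using gauss_kernel(1)[OF d, of 0] by simp
    have wi: "integrable lborel ?w"
    proof (rule Bochner_Integration.integrable_bound)
      show "integrable lborel (\<lambda>x. B * gauss (\<delta> *\<^sub>R x :: real^'n))"
        using gi unfolding complex_of_real_integrable_eq by (rule integrable_mult_right)
      show "AE x in lborel. norm (?w x) \<le> norm (B * gauss (\<delta> *\<^sub>R x))"
        using B order_trans[OF norm_ge_zero B] by (intro AE_I2) (auto simp: norm_mult intro!: mult_right_mono)
    qed measurable
    have wf: "inv_fourier ?w \<xi> = of_real c * (LINT \<eta>|lborel. cnj (g \<eta>) * of_real (K (\<xi> - \<eta>)))" for \<xi>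
    proof -
      have "inv_fourier ?w \<xi> = of_real c * (LINT x|lborel. fourier (\<lambda>x. cnj (g x)) x * (exp (\<i> * of_real (\<xi> \<bullet> x)) * complex_of_real (gauss (\<delta> *\<^sub>R x))))"
        by (simp add: inv_fourier_alt hc c_def mult_ac inner_commute)
      then show ?thesis
        unfolding fourier_duality[OF gc gauss_kernel(1)[OF d]] gauss_kernel(2)[OF d] K_def by simp
    qed
    have wb: "ennreal (cmod (inv_fourier ?w \<xi>)) \<le> c * (\<integral>\<^sup>+\<eta>. cmod (g \<eta>) * K (\<xi> - \<eta>) \<partial>lborel)" for \<xi>
    proof -
      have "ennreal (cmod (LINT \<eta>|lborel. cnj (g \<eta>) * of_real (K (\<xi> - \<eta>)))) \<le> (\<integral>\<^sup>+\<eta>. cmod (cnj (g \<eta>) * of_real (K (\<xi> - \<eta>))) \<partial>lborel)"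
      proof (cases "integrable lborel (\<lambda>\<eta>. cnj (g \<eta>) * of_real (K (\<xi> - \<eta>)))")
        case True then show ?thesis by (rule integral_norm_bound_ennreal)
      qed (simp add: not_integrable_integral_eq)
      then show ?thesis using c K0 by (auto simp: wf norm_mult ennreal_mult intro!: mult_left_mono)
    qed
    have e1: "of_real ((cmod (h x))\<^sup>2 * gauss (\<delta> *\<^sub>R x)) = h x * ?w x" for x
      by (simp only: of_real_mult complex_norm_square mult.assoc)
    have "integrable lborel (\<lambda>x. h x * ?w x)"
    proof (rule Bochner_Integration.integrable_bound[OF integrable_mult_right[OF wi, of "of_real B"]])
      show "AE x in lborel. norm (h x * ?w x) \<le> norm (of_real B * ?w x)"
        using B order_trans[OF norm_ge_zero B] by (intro AE_I2) (auto simp: norm_mult mult_ac intro!: mult_right_mono)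
    qed measurable
    then have i2: "integrable lborel (\<lambda>x. (cmod (h x))\<^sup>2 * gauss (\<delta> *\<^sub>R x))"
      unfolding e1[symmetric] complex_of_real_integrable_eq .
    have "(\<integral>\<^sup>+x. (cmod (h x))\<^sup>2 * gauss (\<delta> *\<^sub>R x) \<partial>lborel) = ennreal (LINT x|lborel. (cmod (h x))\<^sup>2 * gauss (\<delta> *\<^sub>R x))"
      by (intro nn_integral_eq_integral i2) (auto simp: less_imp_le)
    also have "(LINT x|lborel. (cmod (h x))\<^sup>2 * gauss (\<delta> *\<^sub>R x)) = cmod (LINT x|lborel. h x * ?w x)"
    proof -
      have eqc: "complex_of_real (LINT x|lborel. (cmod (h x))\<^sup>2 * gauss (\<delta> *\<^sub>R x)) = (LINT x|lborel. h x * ?w x)"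
        unfolding e1[symmetric] by (rule integral_complex_of_real[symmetric])
      have "cmod (LINT x|lborel. h x * ?w x) = \<bar>LINT x|lborel. (cmod (h x))\<^sup>2 * gauss (\<delta> *\<^sub>R x)\<bar>"
        unfolding eqc[symmetric] by (rule norm_of_real)
      also have "\<dots> = (LINT x|lborel. (cmod (h x))\<^sup>2 * gauss (\<delta> *\<^sub>R x))"
        by (intro abs_of_nonneg integral_nonneg_AE) (auto simp: less_imp_le)
      finally show ?thesis ..
    qed
    also have "(LINT x|lborel. h x * ?w x) = (LINT \<xi>|lborel. g \<xi> * inv_fourier ?w \<xi>)"
      unfolding h_def by (rule inv_fourier_duality[OF g wi[unfolded h_def]])
    also have "ennreal (cmod \<dots>) \<le> (\<integral>\<^sup>+\<xi>. cmod (g \<xi> * inv_fourier ?w \<xi>) \<partial>lborel)"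
    proof (cases "integrable lborel (\<lambda>\<xi>. g \<xi> * inv_fourier ?w \<xi>)")
      case True then show ?thesis by (rule integral_norm_bound_ennreal)
    qed (simp add: not_integrable_integral_eq)
    also have "\<dots> \<le> (\<integral>\<^sup>+\<xi>. cmod (g \<xi>) * (c * (\<integral>\<^sup>+\<eta>. cmod (g \<eta>) * K (\<xi> - \<eta>) \<partial>lborel)) \<partial>lborel)"
      using wb by (intro nn_integral_mono) (auto simp: norm_mult ennreal_mult intro!: mult_left_mono)
    also have "\<dots> = c * (\<integral>\<^sup>+\<xi>. \<integral>\<^sup>+\<eta>. ennreal (cmod (g \<xi>)) * cmod (g \<eta>) * K (\<xi> - \<eta>) \<partial>lborel \<partial>lborel)"
      by (simp add: nn_integral_cmult[symmetric] mult_ac ennreal_mult K0)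
    also have "\<dots> \<le> c * (\<integral>\<^sup>+\<xi>. \<integral>\<^sup>+\<eta>. (ennreal ((cmod (g \<xi>))\<^sup>2) * K (\<xi> - \<eta>) / 2 + ennreal ((cmod (g \<eta>))\<^sup>2) * K (\<xi> - \<eta>) / 2) \<partial>lborel \<partial>lborel)"
    proof (intro mult_left_mono nn_integral_mono)
      fix \<xi> \<eta>
      have "cmod (g \<xi>) * cmod (g \<eta>) \<le> ((cmod (g \<xi>))\<^sup>2 + (cmod (g \<eta>))\<^sup>2) / 2"
        using sum_squares_bound[of "cmod (g \<xi>)" "cmod (g \<eta>)"] by simp
      from mult_right_mono[OF this K0[of "\<xi> - \<eta>"]]
      have "ennreal (cmod (g \<xi>) * cmod (g \<eta>) * K (\<xi> - \<eta>)) \<le> ennreal ((cmod (g \<xi>))\<^sup>2 * K (\<xi> - \<eta>) / 2 + (cmod (g \<eta>))\<^sup>2 * K (\<xi> - \<eta>) / 2)"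
        by (intro ennreal_leI) (simp add: field_simps)
      then show "ennreal (cmod (g \<xi>)) * cmod (g \<eta>) * K (\<xi> - \<eta>) \<le> ennreal ((cmod (g \<xi>))\<^sup>2) * K (\<xi> - \<eta>) / 2 + ennreal ((cmod (g \<eta>))\<^sup>2) * K (\<xi> - \<eta>) / 2"
        using K0 by (simp add: ennreal_mult divide_ennreal[symmetric])
    qed simp
    also have "\<dots> = c * (?N * (1 / c) / 2 + ?N * (1 / c) / 2)"
    proof -
      have a: "(\<integral>\<^sup>+\<xi>. \<integral>\<^sup>+\<eta>. ennreal ((cmod (g \<xi>))\<^sup>2) * K (\<xi> - \<eta>) / 2 \<partial>lborel \<partial>lborel) = ?N * (1 / c) / 2"
        by (simp add: nn_integral_divide nn_integral_cmult Kint nn_integral_multc)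
      have "(\<integral>\<^sup>+\<xi>. \<integral>\<^sup>+\<eta>. ennreal ((cmod (g \<eta>))\<^sup>2) * K (\<xi> - \<eta>) / 2 \<partial>lborel \<partial>lborel) = 
         (\<integral>\<^sup>+\<eta>. \<integral>\<^sup>+\<xi>. ennreal ((cmod (g \<eta>))\<^sup>2) * K (\<xi> - \<eta>) / 2 \<partial>lborel \<partial>lborel)"
        by (rule lborel_pair.Fubini'[symmetric]) measurable
      also have "\<dots> = (\<integral>\<^sup>+\<eta>. \<integral>\<^sup>+\<xi>. ennreal ((cmod (g \<eta>))\<^sup>2) * K (\<eta> - \<xi>) / 2 \<partial>lborel \<partial>lborel)"
        by (simp add: K_def gauss_def norm_minus_commute)
      also have "\<dots> = ?N * (1 / c) / 2" by (rule a)
      finally have b: "(\<integral>\<^sup>+\<xi>. \<integral>\<^sup>+\<eta>. ennreal ((cmod (g \<eta>))\<^sup>2) * K (\<xi> - \<eta>) / 2 \<partial>lborel \<partial>lborel) = ?N * (1 / c) / 2" .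
      show ?thesis by (simp add: nn_integral_add a b)
    qed
    also have "\<dots> = c * (?N * (1 / c))"
      by (simp only: ennreal_half_add)
    also have "\<dots> = ?N"
      using c by (simp add: mult.left_commute[of _ ?N] ennreal_mult[symmetric])
    finally show ?thesis .
  qed
  \<comment> \<open>Fatou removes the Gaussian weight as \<delta> tends to 0.\<close>
  have "(\<integral>\<^sup>+x. (cmod (h x))\<^sup>2 \<partial>lborel) = (\<integral>\<^sup>+x. liminf (\<lambda>k. ennreal ((cmod (h x))\<^sup>2 * gauss (inverse (real (Suc k)) *\<^sub>R x))) \<partial>lborel)"
  proof (rule nn_integral_cong)
    fix x
    have "(\<lambda>k. ennreal ((cmod (h x))\<^sup>2 * gauss (inverse (real (Suc k)) *\<^sub>R x))) \<longlonglongrightarrow> ennreal ((cmod (h x))\<^sup>2 * 1)"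
      by (intro tendsto_intros gauss_scaled_tendsto)
    from lim_imp_Liminf[OF _ this]
    show "ennreal ((cmod (h x))\<^sup>2) = liminf (\<lambda>k. ennreal ((cmod (h x))\<^sup>2 * gauss (inverse (real (Suc k)) *\<^sub>R x)))" by simp
  qed
  also have "\<dots> \<le> liminf (\<lambda>k. \<integral>\<^sup>+x. ennreal ((cmod (h x))\<^sup>2 * gauss (inverse (real (Suc k)) *\<^sub>R x)) \<partial>lborel)"
    by (rule nn_integral_liminf) measurable
  also have "\<dots> \<le> liminf (\<lambda>k::nat. ?N)"
    by (intro Liminf_mono always_eventually allI key) simp
  also have "\<dots> = ?N" by (simp add: Liminf_const)
  finally show ?thesis unfolding h_def .
qed

subsection \<open>Schwartz functions and tempered distributions\<close>

lemma cball_measurable [measurable]: "cball (x::'a::metric_space) r \<in> sets borel"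
  by (simp add: borel_closed)

text \<open>The function is majorised by the sum of the constants \<open>c k\<close> on the balls of
  radius \<open>R k\<close>. Growing radii treat the behaviour at infinity, shrinking radii a
  singularity at the origin.\<close>

lemma nn_integral_shells_finite:
  fixes f :: "'a::euclidean_space \<Rightarrow> real"
  assumes f: "\<And>x. x \<in> S \<Longrightarrow> 0 \<le> f x" and R: "\<And>k. R k \<ge> 0" and c: "\<And>k. c k \<ge> 0"
    and cover: "\<And>x. x \<in> S \<Longrightarrow> \<exists>k::nat. norm x \<le> R k \<and> f x \<le> c k"
    and s: "summable (\<lambda>k. c k * R k ^ DIM('a))"
  shows "(\<integral>\<^sup>+x. ennreal (f x) * indicator S x \<partial>lborel) < \<infinity>"
proof -
  have "(\<integral>\<^sup>+x. ennreal (f x) * indicator S x \<partial>lborel) \<le> (\<integral>\<^sup>+(x::'a). (\<Sum>k. ennreal (c k) * indicator (cball 0 (R k)) x) \<partial>lborel)"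
  proof (rule nn_integral_mono)
    fix x :: 'a
    show "ennreal (f x) * indicator S x \<le> (\<Sum>k. ennreal (c k) * indicator (cball 0 (R k)) x)"
    proof (cases "x \<in> S")
      case True
      then obtain k where k: "norm x \<le> R k" "f x \<le> c k" using cover by blast
      have "ennreal (f x) * indicator S x \<le> ennreal (c k) * indicator (cball 0 (R k)) x"
        using k True by (simp add: ennreal_leI)
      also have "\<dots> \<le> (\<Sum>k. ennreal (c k) * indicator (cball 0 (R k)) x)"
        using sum_le_suminf[of "\<lambda>k. ennreal (c k) * indicator (cball 0 (R k)) x" "{k}"]
        by (simp del: sum_mult_indicator add: sum.insert)
      finally show ?thesis .
    qed simp
  qed
  also have "\<dots> = (\<Sum>k. ennreal (c k) * emeasure lborel (cball (0::'a) (R k)))"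
  proof (subst nn_integral_suminf)
    show "(\<lambda>x. ennreal (c k) * indicator (cball (0::'a) (R k)) x) \<in> borel_measurable lborel" for k by measurable
    show "(\<Sum>k. \<integral>\<^sup>+x\<in>cball (0::'a) (R k). ennreal (c k) \<partial>lborel) = (\<Sum>k. ennreal (c k) * emeasure lborel (cball (0::'a) (R k)))"
      by (simp add: nn_integral_cmult)
  qed
  also have "\<dots> = (\<Sum>k. ennreal (unit_ball_vol (DIM('a)) * (c k * R k ^ DIM('a))))"
    using R c by (simp add: emeasure_cball ennreal_mult[symmetric] mult_ac)
  also have "\<dots> = ennreal (\<Sum>k. unit_ball_vol (DIM('a)) * (c k * R k ^ DIM('a)))"
    using R c s by (intro suminf_ennreal2 summable_mult) auto
  finally show ?thesis by (simp add: le_less_trans)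
qed

lemma nn_integral_norm_powr_large:
  fixes p :: real
  assumes "p > DIM('a::euclidean_space)"
  shows "(\<integral>\<^sup>+x. ennreal (norm (x::'a) powr (- p)) * indicator {x. norm x \<ge> 1} x \<partial>lborel) < \<infinity>"
proof (rule nn_integral_shells_finite[where R = "\<lambda>k. 2 powr (real k + 1)" and c = "\<lambda>k. 2 powr (- p * real k)"])
  let ?n = "DIM('a)"
  have eq: "2 powr (- p * real k) * (2 powr (real k + 1)) ^ ?n = 2 ^ ?n * (2 powr (?n - p)) ^ k" for k
  proof -
    have a: "(2 powr (real k + 1)) ^ ?n = 2 powr (?n * (real k + 1))"
      and b: "(2 powr (?n - p)) ^ k = 2 powr (k * (?n - p))"
      and c: "(2::real) ^ ?n = 2 powr ?n" by (simp_all add: powr_power powr_realpow)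
    show ?thesis unfolding a b c powr_add[symmetric] by (simp add: algebra_simps)
  qed
  have "2 powr (?n - p) < (1::real)" using assms powr_less_cancel_iff[of 2 "?n - p" 0] by simp
  then show "summable (\<lambda>k. 2 powr (- p * real k) * (2 powr (real k + 1)) ^ ?n)"
    unfolding eq by (intro summable_mult summable_geometric) simp
  fix x :: 'a assume "x \<in> {x. norm x \<ge> 1}"
  then have x: "norm x \<ge> 1" by simp
  define k where "k = nat \<lfloor>log 2 (norm x)\<rfloor>"
  have l: "log 2 (norm x) \<ge> 0" using x by (subst zero_le_log_cancel_iff) auto
  have k: "real k \<le> log 2 (norm x)" "log 2 (norm x) \<le> real k + 1" unfolding k_def using l by linarith+
  have n: "norm x = 2 powr (log 2 (norm x))" using x by (subst powr_log_cancel) auto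
  have "norm x \<le> 2 powr (real k + 1)" by (subst n) (use k in simp)
  moreover have "norm x powr (- p) \<le> 2 powr (- p * real k)"
  proof -
    have "norm x powr (- p) \<le> (2 powr real k) powr (- p)"
      by (rule powr_mono2') (use assms k in \<open>auto simp: less_imp_le, subst n, simp\<close>)
    then show ?thesis by (simp add: powr_powr mult.commute)
  qed
  ultimately show "\<exists>k. norm x \<le> 2 powr (real k + 1) \<and> norm x powr (- p) \<le> 2 powr (- p * real k)" by blast
qed auto

lemma nn_integral_norm_powr_small:
  fixes p :: real
  assumes "p < DIM('a::euclidean_space)" "p \<ge> 0"
  shows "(\<integral>\<^sup>+x. ennreal (norm (x::'a) powr (- p)) * indicator {x. norm x \<le> 1} x \<partial>lborel) < \<infinity>"
proof (rule nn_integral_shells_finite[where R = "\<lambda>k. 2 powr (- real k)" and c = "\<lambda>k. 2 powr (p * (real k + 1))"])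
  let ?n = "DIM('a)"
  have eq: "2 powr (p * (real k + 1)) * (2 powr (- real k)) ^ ?n = 2 powr p * (2 powr (p - ?n)) ^ k" for k
  proof -
    have a: "(2 powr (- real k)) ^ ?n = 2 powr (?n * (- real k))"
      and b: "(2 powr (p - ?n)) ^ k = 2 powr (k * (p - ?n))" by (simp_all add: powr_power)
    show ?thesis unfolding a b powr_add[symmetric] by (simp add: algebra_simps)
  qed
  have "2 powr (p - ?n) < (1::real)" using assms powr_less_cancel_iff[of 2 "p - ?n" 0] by simp
  then show "summable (\<lambda>k. 2 powr (p * (real k + 1)) * (2 powr (- real k)) ^ ?n)"
    unfolding eq by (intro summable_mult summable_geometric) simp
  fix x :: 'a assume "x \<in> {x. norm x \<le> 1}"
  then have x: "norm x \<le> 1" by simp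
  show "\<exists>k. norm x \<le> 2 powr (- real k) \<and> norm x powr (- p) \<le> 2 powr (p * (real k + 1))"
  proof (cases "x = 0")
    case True
    \<comment> \<open>\<open>0 powr (- p)\<close> is 0, so the singular point satisfies every
      bound.\<close>
    then show ?thesis by (auto intro!: exI[of _ 0])
  next
    case False
    define k where "k = nat \<lfloor>- log 2 (norm x)\<rfloor>"
    have l: "log 2 (norm x) \<le> 0" using x False by (subst log_le_zero_cancel_iff) auto
    have k: "real k \<le> - log 2 (norm x)" "- log 2 (norm x) \<le> real k + 1" unfolding k_def using l by linarith+
    have n: "norm x = 2 powr (log 2 (norm x))" using False by simp
    have "norm x \<le> 2 powr (- real k)" by (subst n) (use k in simp)
    moreover have "norm x powr (- p) \<le> 2 powr (p * (real k + 1))"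
    proof -
      have "norm x powr (- p) \<le> (2 powr (- (real k + 1))) powr (- p)"
        by (rule powr_mono2') (use assms k in \<open>auto, subst n, simp\<close>)
      then show ?thesis by (simp add: powr_powr algebra_simps)
    qed
    ultimately show ?thesis by blast
  qed
qed auto

section \<open>Schwartz seminorms and functions of slow growth\<close>

lemma one_plus_norm_pos [simp]: "0 < 1 + norm x"
  by (simp add: add_pos_nonneg)

lemma one_plus_norm_power_ge_1: "1 \<le> (1 + norm x) ^ N"
  by (simp add: one_le_power)

lemma integrable_decay:
  "integrable lborel (\<lambda>x::'a::euclidean_space. 1 / (1 + norm x) ^ (DIM('a) + 1))"
proof -
  let ?m = "DIM('a) + 1"
  have "(\<integral>\<^sup>+(x::'a). norm (1 / (1 + norm x) ^ ?m) \<partial>lborel) \<le>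
      (\<integral>\<^sup>+(x::'a). (ennreal (norm x powr (- real ?m)) * indicator {x. norm x \<ge> 1} x + indicator (cball 0 1) x) \<partial>lborel)"
  proof (rule nn_integral_mono)
    fix x :: 'a
    show "ennreal (norm (1 / (1 + norm x) ^ ?m)) \<le> ennreal (norm x powr (- real ?m)) * indicator {x. norm x \<ge> 1} x + indicator (cball 0 1) x"
    proof (cases "norm x \<ge> 1")
      case True
      then have x: "norm x > 0" by linarith
      have "1 / (1 + norm x) ^ ?m \<le> 1 / norm x ^ ?m"
        using x by (intro divide_left_mono power_mono mult_pos_pos zero_less_power) auto
      also have "\<dots> = norm x powr (- real ?m)" using x by (simp add: powr_minus_divide powr_realpow del: power_Suc of_nat_Suc of_nat_add)
      finally have "ennreal (norm (1 / (1 + norm x) ^ ?m)) \<le> ennreal (norm x powr (- real ?m))"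
        by (intro ennreal_leI) simp
      also have "\<dots> \<le> ennreal (norm x powr (- real ?m)) * indicator {x. norm x \<ge> 1} x + indicator (cball 0 1) x"
        using True by simp
      finally show ?thesis .
    next
      case False
      have "1 / (1 + norm x) ^ ?m \<le> 1" using one_plus_norm_power_ge_1[of x ?m] by (simp del: power_Suc)
      with False show ?thesis by simp
    qed
  qed
  also have "\<dots> = (\<integral>\<^sup>+(x::'a). ennreal (norm x powr (- real ?m)) * indicator {x. norm x \<ge> 1} x \<partial>lborel) + emeasure lborel (cball (0::'a) 1)"
    by (subst nn_integral_add) auto
  also have "\<dots> < \<infinity>"
    using nn_integral_norm_powr_large[of "real ?m", where 'a = 'a] emeasure_lborel_cball_finite[of "0::'a" 1] by simp
  finally show ?thesis by (simp add: integrable_iff_bounded)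
qed

lemma finite_lists_univ_length_le: "finite {js :: 'n::finite list. length js \<le> N}"
  using finite_lists_length_le[of "UNIV :: 'n set" N] by simp

lemma schwartz_seminorm_ge:
  fixes \<phi> :: "real^'n::finite \<Rightarrow> complex"
  assumes "schwartz \<phi>" "length js \<le> N"
  shows "(1 + norm x) ^ N * cmod (partials js \<phi> x) \<le> schwartz_seminorm N \<phi>"
proof -
  let ?s = "\<lambda>js. SUP x. (1 + norm x) ^ N * cmod (partials js \<phi> x)"
  have b: "bdd_above (range (\<lambda>x. (1 + norm x) ^ N * cmod (partials js \<phi> x)))" for js
    using assms unfolding schwartz_def by simp
  have u: "(1 + norm x) ^ N * cmod (partials js \<phi> x) \<le> ?s js" for js x
    by (rule cSUP_upper[OF UNIV_I b])
  have nn: "?s js \<ge> 0" for js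
    by (rule order_trans[OF _ u[of 0]]) simp
  have "?s js \<le> schwartz_seminorm N \<phi>"
    unfolding schwartz_seminorm_def
    by (rule member_le_sum) (use assms nn finite_lists_univ_length_le in auto)
  with u[of x js] show ?thesis by linarith
qed

lemma schwartz_smooth: "schwartz \<phi> \<Longrightarrow> smooth_fun \<phi>"
  by (simp add: schwartz_def)

lemma schwartz_measurable [measurable_dest]: "schwartz \<phi> \<Longrightarrow> \<phi> \<in> borel_measurable borel"
  by (intro smooth_fun_measurable schwartz_smooth)

lemma schwartz_decay:
  assumes "schwartz \<phi>" "length js \<le> N"
  shows "cmod (partials js \<phi> x) \<le> schwartz_seminorm N \<phi> / (1 + norm x) ^ N"
proof -
  have "(1 + norm x) ^ N > 0" by (simp add: add_pos_nonneg)
  then show ?thesis using schwartz_seminorm_ge[OF assms, of x] by (simp add: field_simps)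
qed

lemma schwartz_decay0:
  "schwartz \<phi> \<Longrightarrow> cmod (\<phi> x) \<le> schwartz_seminorm N \<phi> / (1 + norm x) ^ N"
  using schwartz_decay[of \<phi> "[]" N x] by simp

lemma schwartz_integrable:
  fixes \<phi> :: "real^'n::finite \<Rightarrow> complex"
  assumes s: "schwartz \<phi>"
  shows "integrable lborel \<phi>"
proof (rule Bochner_Integration.integrable_bound)
  let ?N = "DIM(real^'n) + 1"
  show "integrable lborel (\<lambda>x::real^'n. schwartz_seminorm ?N \<phi> * (1 / (1 + norm x) ^ ?N))"
    by (intro integrable_mult_right integrable_decay)
  show "AE x in lborel. cmod (\<phi> x) \<le> norm (schwartz_seminorm ?N \<phi> * (1 / (1 + norm x) ^ ?N))"
    using order_trans[OF schwartz_decay0[OF s, of _ ?N] abs_ge_self] by (intro AE_I2) simp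
qed (use schwartz_measurable[OF s] in simp)

lemma schwartz_square_integrable:
  fixes \<phi> :: "real^'n::finite \<Rightarrow> complex"
  assumes s: "schwartz \<phi>"
  shows "integrable lborel (\<lambda>x. (cmod (\<phi> x))\<^sup>2)"
proof (rule Bochner_Integration.integrable_bound)
  show "integrable lborel (\<lambda>x. schwartz_seminorm 0 \<phi> * cmod (\<phi> x))"
    using schwartz_integrable[OF s] by simp
  have "(cmod (\<phi> x))\<^sup>2 \<le> schwartz_seminorm 0 \<phi> * cmod (\<phi> x)" for x
    using schwartz_decay0[OF s, of x 0] by (simp add: power2_eq_square mult_right_mono)
  then show "AE x in lborel. norm ((cmod (\<phi> x))\<^sup>2) \<le> norm (schwartz_seminorm 0 \<phi> * cmod (\<phi> x))"
    by (intro AE_I2) (auto intro: order_trans[OF _ abs_ge_self])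
qed (use schwartz_measurable[OF s] in simp)

text \<open>A directly checkable sufficient condition for \<open>tempered_fun\<close>. It is stable
  under sums and also controls the pairing with first derivatives of Schwartz functions.\<close>

definition slow_growth :: "(real^'n::finite \<Rightarrow> complex) \<Rightarrow> bool" where
  "slow_growth g \<longleftrightarrow> g \<in> borel_measurable borel \<and>
     (\<exists>N. integrable lborel (\<lambda>x. cmod (g x) / (1 + norm x) ^ N))"

text \<open>Lists of length at most 1 treat the distribution of \<open>g\<close> and its first
  distributional derivatives by one and the same bound.\<close>

lemma slow_growth_pairing:
  fixes g :: "real^'n::finite \<Rightarrow> complex"
  assumes g: "slow_growth g"
  obtains C N where "\<And>\<phi> (js :: 'n list). schwartz \<phi> \<Longrightarrow> length js \<le> 1 \<Longrightarrow> 
      integrable lborel (\<lambda>x. g x * partials js \<phi> x) \<and>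
      cmod (LINT x|lborel. g x * partials js \<phi> x) \<le> C * schwartz_seminorm N \<phi>"
proof -
  obtain N where N: "integrable lborel (\<lambda>x. cmod (g x) / (1 + norm x) ^ N)"
    and [measurable]: "g \<in> borel_measurable borel"
    using g unfolding slow_growth_def by blast
  \<comment> \<open>One index of the seminorm bounds both the weight and the number of derivatives;
    N + 1 admits one derivative even for N = 0.\<close>
  let ?M = "N + 1"
  let ?w = "\<lambda>x. cmod (g x) / (1 + norm x) ^ N"
  show ?thesis
  proof (rule that)
    fix \<phi> :: "real^'n \<Rightarrow> complex" and js :: "'n list"
    assume s: "schwartz \<phi>" and l: "length js \<le> 1"
    have [measurable]: "partials js \<phi> \<in> borel_measurable borel"
      by (intro smooth_fun_measurable smooth_fun_partials schwartz_smooth s)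
    have b: "cmod (g x * partials js \<phi> x) \<le> ?w x * schwartz_seminorm ?M \<phi>" for x
    proof -
      have "(1 + norm x) ^ N \<le> (1 + norm x) ^ ?M" by (intro power_increasing) auto
      then have "(1 + norm x) ^ N * cmod (partials js \<phi> x) \<le> (1 + norm x) ^ ?M * cmod (partials js \<phi> x)"
        by (intro mult_right_mono) auto
      also have "\<dots> \<le> schwartz_seminorm ?M \<phi>" using schwartz_seminorm_ge[OF s, of js ?M x] l by simp
      finally have "?w x * ((1 + norm x) ^ N * cmod (partials js \<phi> x)) \<le> ?w x * schwartz_seminorm ?M \<phi>"
        by (intro mult_left_mono) auto
      moreover have "1 + norm x \<noteq> 0" using one_plus_norm_pos[of x] by linarith
      ultimately show ?thesis by (simp add: norm_mult)
    qed
    have i: "integrable lborel (\<lambda>x. g x * partials js \<phi> x)"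
      by (rule Bochner_Integration.integrable_bound[OF integrable_mult_left[OF N, of "schwartz_seminorm ?M \<phi>"]])
        (use order_trans[OF b abs_ge_self] in \<open>simp_all\<close>)
    have "cmod (LINT x|lborel. g x * partials js \<phi> x) \<le> (LINT x|lborel. cmod (g x * partials js \<phi> x))"
      by (rule integral_norm_bound)
    also have "\<dots> \<le> (LINT x|lborel. ?w x * schwartz_seminorm ?M \<phi>)"
      by (rule integral_mono[OF integrable_norm[OF i] integrable_mult_left b]) (use N in simp)
    also have "\<dots> = (LINT x|lborel. ?w x) * schwartz_seminorm ?M \<phi>" by (rule integral_mult_left_zero)
    finally show "integrable lborel (\<lambda>x. g x * partials js \<phi> x) \<and>
      cmod (LINT x|lborel. g x * partials js \<phi> x) \<le> (LINT x|lborel. ?w x) * schwartz_seminorm ?M \<phi>"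
      using i by simp
  qed
qed

lemma slow_growth_integrable:
  fixes g :: "real^'n::finite \<Rightarrow> complex"
  assumes "slow_growth g" "schwartz \<phi>"
  shows "integrable lborel (\<lambda>x. g x * \<phi> x)" "integrable lborel (\<lambda>x. g x * partial j \<phi> x)"
proof -
  obtain C N where "\<And>\<phi> (js :: 'n list). schwartz \<phi> \<Longrightarrow> length js \<le> 1 \<Longrightarrow> 
      integrable lborel (\<lambda>x. g x * partials js \<phi> x) \<and>
      cmod (LINT x|lborel. g x * partials js \<phi> x) \<le> C * schwartz_seminorm N \<phi>"
    using slow_growth_pairing[OF assms(1)] by blast
  from this[OF assms(2), of "[]"] this[OF assms(2), of "[j]"]
  show "integrable lborel (\<lambda>x. g x * \<phi> x)" "integrable lborel (\<lambda>x. g x * partial j \<phi> x)" by auto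
qed

lemma tempered_fun_dist:
  fixes g :: "real^'n::finite \<Rightarrow> complex"
  assumes "slow_growth g"
  shows "tempered (fun_dist g)"
proof -
  obtain C N where *: "\<And>\<phi> (js :: 'n list). schwartz \<phi> \<Longrightarrow> length js \<le> 1 \<Longrightarrow> 
      integrable lborel (\<lambda>x. g x * partials js \<phi> x) \<and>
      cmod (LINT x|lborel. g x * partials js \<phi> x) \<le> C * schwartz_seminorm N \<phi>"
    using slow_growth_pairing[OF assms] by blast
  show ?thesis
    unfolding tempered_def fun_dist_def
  proof (intro conjI allI impI exI)
    fix \<phi> \<psi> :: "real^'n \<Rightarrow> complex" and a b
    assume s: "schwartz \<phi>" "schwartz \<psi>"
    have "(LINT x|lborel. g x * (a * \<phi> x + b * \<psi> x)) = (LINT x|lborel. a * (g x * \<phi> x) + b * (g x * \<psi> x))"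
      by (simp add: algebra_simps)
    also have "\<dots> = a * (LINT x|lborel. g x * \<phi> x) + b * (LINT x|lborel. g x * \<psi> x)"
      using slow_growth_integrable[OF assms s(1)] slow_growth_integrable[OF assms s(2)] by simp
    finally show "(LINT x|lborel. g x * (a * \<phi> x + b * \<psi> x)) = a * (LINT x|lborel. g x * \<phi> x) + b * (LINT x|lborel. g x * \<psi> x)" .
  next
    fix \<phi> :: "real^'n \<Rightarrow> complex" assume "schwartz \<phi>"
    from *[OF this, of "[]"] show "cmod (LINT x|lborel. g x * \<phi> x) \<le> C * schwartz_seminorm N \<phi>" by simp
  qed
qed

lemma tempered_fun_slow_growth: "slow_growth g \<Longrightarrow> tempered_fun g"
  unfolding tempered_fun_def using slow_growth_integrable tempered_fun_dist by blast

lemma tempered_partial_dist: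
  fixes g :: "real^'n::finite \<Rightarrow> complex"
  assumes "slow_growth g"
  shows "tempered (partial_dist j (fun_dist g))"
proof -
  obtain C N where *: "\<And>\<phi> (js :: 'n list). schwartz \<phi> \<Longrightarrow> length js \<le> 1 \<Longrightarrow> 
      integrable lborel (\<lambda>x. g x * partials js \<phi> x) \<and>
      cmod (LINT x|lborel. g x * partials js \<phi> x) \<le> C * schwartz_seminorm N \<phi>"
    using slow_growth_pairing[OF assms] by blast
  show ?thesis
    unfolding tempered_def fun_dist_def partial_dist_def
  proof (intro conjI allI impI exI)
    fix \<phi> \<psi> :: "real^'n \<Rightarrow> complex" and a b
    assume s: "schwartz \<phi>" "schwartz \<psi>"
    have d: "\<phi> differentiable (at x)" "\<psi> differentiable (at x)" for x
      using s by (auto intro: smooth_fun_differentiable schwartz_smooth)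
    have p: "partial j (\<lambda>x. a * \<phi> x + b * \<psi> x) x = a * partial j \<phi> x + b * partial j \<psi> x" for x
      using partial_eqI[OF has_derivative_add[OF has_derivative_mult_right[OF d(1)[unfolded frechet_derivative_works]]
            has_derivative_mult_right[OF d(2)[unfolded frechet_derivative_works]]]]
      by (simp add: partial_def)
    have "(LINT x|lborel. g x * partial j (\<lambda>x. a * \<phi> x + b * \<psi> x) x) = (LINT x|lborel. a * (g x * partial j \<phi> x) + b * (g x * partial j \<psi> x))"
      by (simp add: p algebra_simps)
    also have "\<dots> = a * (LINT x|lborel. g x * partial j \<phi> x) + b * (LINT x|lborel. g x * partial j \<psi> x)"
      using slow_growth_integrable[OF assms s(1)] slow_growth_integrable[OF assms s(2)] by simp
    finally show "- (LINT x|lborel. g x * partial j (\<lambda>x. a * \<phi> x + b * \<psi> x) x) = a * (- (LINT x|lborel. g x * partial j \<phi> x)) + b * (- (LINT x|lborel. g x * partial j \<psi> x))"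
      by simp
  next
    fix \<phi> :: "real^'n \<Rightarrow> complex" assume "schwartz \<phi>"
    from *[OF this, of "[j]"] show "cmod (- (LINT x|lborel. g x * partial j \<phi> x)) \<le> C * schwartz_seminorm N \<phi>" by simp
  qed
qed

lemma schwartz_seminorm_mono:
  fixes \<phi> :: "real^'n::finite \<Rightarrow> complex"
  assumes s: "schwartz \<phi>" and "N \<le> M"
  shows "schwartz_seminorm N \<phi> \<le> schwartz_seminorm M \<phi>"
proof -
  let ?s = "\<lambda>N js. SUP x. (1 + norm x) ^ N * cmod (partials js \<phi> x)"
  have b: "bdd_above (range (\<lambda>x. (1 + norm x) ^ N * cmod (partials js \<phi> x)))" for N js
    using s unfolding schwartz_def by simp
  have nn: "?s N js \<ge> 0" for N js
    by (rule order_trans[OF _ cSUP_upper[OF UNIV_I b[of N js], of 0]]) simp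
  have "?s N js \<le> ?s M js" for js
    using assms(2) by (intro cSUP_mono b) (auto intro!: exI mult_right_mono power_increasing)
  then have "schwartz_seminorm N \<phi> \<le> (\<Sum>js | length js \<le> N. ?s M js)"
    unfolding schwartz_seminorm_def by (intro sum_mono)
  also have "\<dots> \<le> schwartz_seminorm M \<phi>"
    unfolding schwartz_seminorm_def using assms(2) nn finite_lists_univ_length_le
    by (intro sum_mono2) auto
  finally show ?thesis .
qed

lemma schwartz_seminorm_nonneg:
  assumes "schwartz \<phi>" shows "0 \<le> schwartz_seminorm N \<phi>"
  using schwartz_seminorm_ge[OF assms, of "[]" N 0] order_trans[OF norm_ge_zero] by simp

lemma tempered_add:
  assumes "tempered f" "tempered g"
  shows "tempered (\<lambda>\<phi>. f \<phi> + g \<phi>)"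
proof -
  obtain C N where f: "\<And>\<phi>. schwartz \<phi> \<Longrightarrow> cmod (f \<phi>) \<le> C * schwartz_seminorm N \<phi>"
    using assms(1) unfolding tempered_def by blast
  obtain D M where g: "\<And>\<phi>. schwartz \<phi> \<Longrightarrow> cmod (g \<phi>) \<le> D * schwartz_seminorm M \<phi>"
    using assms(2) unfolding tempered_def by blast
  \<comment> \<open>The constants in \<open>tempered\<close> carry no sign, hence the absolute
    values.\<close>
  have "cmod (f \<phi> + g \<phi>) \<le> (\<bar>C\<bar> + \<bar>D\<bar>) * schwartz_seminorm (max N M) \<phi>" if s: "schwartz \<phi>" for \<phi>
  proof -
    have "C * schwartz_seminorm N \<phi> \<le> \<bar>C\<bar> * schwartz_seminorm (max N M) \<phi>"
      using schwartz_seminorm_mono[OF s] schwartz_seminorm_nonneg[OF s] by (intro mult_mono) auto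
    moreover have "D * schwartz_seminorm M \<phi> \<le> \<bar>D\<bar> * schwartz_seminorm (max N M) \<phi>"
      using schwartz_seminorm_mono[OF s] schwartz_seminorm_nonneg[OF s] by (intro mult_mono) auto
    ultimately show ?thesis
      using f[OF s] g[OF s] norm_triangle_ineq[of "f \<phi>" "g \<phi>"] by (simp add: distrib_right)
  qed
  moreover have "f (\<lambda>x. a * \<phi> x + b * \<psi> x) + g (\<lambda>x. a * \<phi> x + b * \<psi> x) = a * (f \<phi> + g \<phi>) + b * (f \<psi> + g \<psi>)"
    if "schwartz \<phi>" "schwartz \<psi>" for \<phi> \<psi> a b
  proof -
    have "f (\<lambda>x. a * \<phi> x + b * \<psi> x) = a * f \<phi> + b * f \<psi>" "g (\<lambda>x. a * \<phi> x + b * \<psi> x) = a * g \<phi> + b * g \<psi>"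
      using assms that unfolding tempered_def by simp_all
    then show ?thesis by (simp only:) (simp add: algebra_simps)
  qed
  ultimately show ?thesis unfolding tempered_def by blast
qed

lemma tempered_sum:
  "finite I \<Longrightarrow> (\<And>i. i \<in> I \<Longrightarrow> tempered (f i)) \<Longrightarrow> tempered (\<lambda>\<phi>. \<Sum>i\<in>I. f i \<phi>)"
proof (induction I rule: finite_induct)
  case empty
  then show ?case by (auto simp: tempered_def intro!: exI[of _ 0])
next
  case (insert i I)
  then show ?case using tempered_add[of "f i" "\<lambda>\<phi>. \<Sum>i\<in>I. f i \<phi>"] by simp
qed

lemma slow_growth_bounded:
  fixes g :: "real^'n::finite \<Rightarrow> complex"
  assumes "g \<in> borel_measurable borel" "\<And>x. cmod (g x) \<le> B"
  shows "slow_growth g"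
  unfolding slow_growth_def
proof (intro conjI exI)
  let ?N = "DIM(real^'n) + 1"
  show "integrable lborel (\<lambda>x. cmod (g x) / (1 + norm x) ^ ?N)"
  proof (rule Bochner_Integration.integrable_bound)
    show "integrable lborel (\<lambda>x::real^'n. B * (1 / (1 + norm x) ^ ?N))"
      by (intro integrable_mult_right integrable_decay)
    show "AE x in lborel. norm (cmod (g x) / (1 + norm x) ^ ?N) \<le> norm (B * (1 / (1 + norm x) ^ ?N))"
      using assms(2) by (intro AE_I2) (auto simp: abs_mult intro!: divide_right_mono order_trans[OF assms(2) abs_ge_self])
  qed (use assms in measurable)
qed (use assms in auto)

lemma slow_growth_add:
  fixes f g :: "real^'n::finite \<Rightarrow> complex"
  assumes f: "slow_growth f" and g: "slow_growth g"
  shows "slow_growth (\<lambda>x. f x + g x)"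
proof -
  obtain N where N: "integrable lborel (\<lambda>x. cmod (f x) / (1 + norm x) ^ N)"
    and [measurable]: "f \<in> borel_measurable borel" using f unfolding slow_growth_def by blast
  obtain M where M: "integrable lborel (\<lambda>x. cmod (g x) / (1 + norm x) ^ M)"
    and [measurable]: "g \<in> borel_measurable borel" using g unfolding slow_growth_def by blast
  have "integrable lborel (\<lambda>x. cmod (f x + g x) / (1 + norm x) ^ (N + M))"
  proof (rule Bochner_Integration.integrable_bound[OF Bochner_Integration.integrable_add[OF N M]])
    show "AE x in lborel. norm (cmod (f x + g x) / (1 + norm x) ^ (N + M))
        \<le> norm (cmod (f x) / (1 + norm x) ^ N + cmod (g x) / (1 + norm x) ^ M)"
    proof (rule AE_I2)
      fix x :: "real^'n"
      have p: "(1 + norm x) ^ k > 0" for k by (simp add: add_pos_nonneg)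
      have "cmod (f x + g x) / (1 + norm x) ^ (N + M) \<le> cmod (f x) / (1 + norm x) ^ (N + M) + cmod (g x) / (1 + norm x) ^ (N + M)"
        unfolding add_divide_distrib[symmetric] using p by (intro divide_right_mono norm_triangle_ineq less_imp_le)
      also have "\<dots> \<le> cmod (f x) / (1 + norm x) ^ N + cmod (g x) / (1 + norm x) ^ M"
        using p by (intro add_mono divide_left_mono power_increasing mult_pos_pos) auto
      finally show "norm (cmod (f x + g x) / (1 + norm x) ^ (N + M))
        \<le> norm (cmod (f x) / (1 + norm x) ^ N + cmod (g x) / (1 + norm x) ^ M)"
        by (auto intro: order_trans[OF _ abs_ge_self])
    qed
  qed measurable
  then show ?thesis unfolding slow_growth_def by auto
qed

section \<open>Test functions: integration by parts and transforms\<close>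

lemma partial_has_vector_derivative:
  fixes f :: "real^'n::finite \<Rightarrow> complex"
  assumes "f differentiable (at (x + t *\<^sub>R axis j 1))"
  shows "((\<lambda>t. f (x + t *\<^sub>R axis j 1)) has_vector_derivative partial j f (x + t *\<^sub>R axis j 1)) (at t within S)"
proof -
  have 1: "((\<lambda>t. x + t *\<^sub>R axis j 1) has_vector_derivative axis j 1) (at t within S)"
    by (auto intro!: derivative_eq_intros)
  have "(f has_derivative frechet_derivative f (at (x + t *\<^sub>R axis j 1))) (at (x + t *\<^sub>R axis j 1) within (\<lambda>t. x + t *\<^sub>R axis j 1) ` S)"
    using assms has_derivative_at_withinI unfolding frechet_derivative_works by blast
  from vector_derivative_diff_chain_within[OF 1 this]
  show ?thesis unfolding o_def partial_def .
qed

lemma partial_mean_value: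
  fixes f :: "real^'n::finite \<Rightarrow> complex"
  assumes f: "\<And>x. f differentiable (at x)" and B: "\<And>x. cmod (partial j f x) \<le> B" and "d \<ge> 0"
  shows "cmod (f (x + d *\<^sub>R axis j 1) - f x) \<le> B * d"
proof -
  have "norm ((\<lambda>t. f (x + t *\<^sub>R axis j 1)) d - (\<lambda>t. f (x + t *\<^sub>R axis j 1)) 0) \<le> B * norm (d - 0)"
  proof (rule differentiable_bound[where S = UNIV])
    fix t :: real
    show "((\<lambda>t. f (x + t *\<^sub>R axis j 1)) has_derivative (\<lambda>h. h *\<^sub>R partial j f (x + t *\<^sub>R axis j 1))) (at t within UNIV)"
      using partial_has_vector_derivative[OF f] unfolding has_vector_derivative_def .
    show "onorm (\<lambda>h. h *\<^sub>R partial j f (x + t *\<^sub>R axis j 1)) \<le> B"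
      using B[of "x + t *\<^sub>R axis j 1"] by (intro onorm_le) (auto simp: mult.commute[of B] intro!: mult_left_mono)
  qed auto
  then show ?thesis using assms(3) by simp
qed

text \<open>Difference quotients have integral 0 by translation invariance. They converge to the
  partial derivative, and the mean value inequality supplies the dominating bound.\<close>

lemma integral_partial_test_fun:
  fixes f :: "real^'n::finite \<Rightarrow> complex"
  assumes t: "test_fun f"
  shows "(LINT x|lborel. partial j f x) = 0"
proof -
  let ?e = "axis j 1 :: real^'n"
  have df: "f differentiable (at x)" for x by (intro smooth_fun_differentiable test_fun_smooth t)
  have [measurable]: "f \<in> borel_measurable borel" "partial j f \<in> borel_measurable borel"
    by (auto intro!: smooth_fun_measurable test_fun_smooth test_fun_partial t)
  obtain r where r: "r > 0" "\<And>x. norm x > r \<Longrightarrow> f x = 0" using test_fun_support[OF t] by blast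
  obtain B where B: "B > 0" "\<And>x. cmod (partial j f x) \<le> B" using test_fun_bound[OF test_fun_partial[OF t]] by blast
  define d where "d k = inverse (real (Suc k))" for k
  have d: "d k > 0" "d k \<le> 1" for k by (auto simp: d_def inverse_le_1_iff)
  have d0: "d \<longlonglongrightarrow> 0" unfolding d_def by (rule LIMSEQ_inverse_real_of_nat)
  define q where "q k x = (f (x + d k *\<^sub>R ?e) - f x) /\<^sub>R d k" for k x
  have "(LINT x|lborel. q k x) = 0" for k
  proof -
    have "integrable lborel (\<lambda>x. f (d k *\<^sub>R ?e + 1 *\<^sub>R x))"
      by (intro integrable_affine test_fun_integrable t) simp
    then have "integrable lborel (\<lambda>x. f (x + d k *\<^sub>R ?e))" by (simp add: add.commute)
    moreover have "(LINT x|lborel. f (x + d k *\<^sub>R ?e)) = (LINT x|lborel. f x)"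
      using lebesgue_integral_affine[of f 1 "d k *\<^sub>R ?e"] by (simp add: add.commute)
    ultimately show ?thesis using test_fun_integrable[OF t] by (simp add: q_def)
  qed
  moreover have "(\<lambda>k. LINT x|lborel. q k x) \<longlonglongrightarrow> (LINT x|lborel. partial j f x)"
  \<comment> \<open>The shifts have length at most 1, so all quotients live in the ball of radius r
    + 1.\<close>
  proof (rule integral_dominated_convergence[where w = "\<lambda>x. B * indicator (cball 0 (r + 1)) x"])
    show "integrable lborel (\<lambda>x::real^'n. B * indicator (cball 0 (r + 1)) x)"
      using emeasure_lborel_cball_finite[of "0::real^'n" "r + 1"] by simp
    show "AE x in lborel. (\<lambda>k. q k x) \<longlonglongrightarrow> partial j f x"
    proof (rule AE_I2)
      fix x
      have "((\<lambda>t. f (x + t *\<^sub>R ?e)) has_vector_derivative partial j f (x + 0 *\<^sub>R ?e)) (at 0 within UNIV)"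
        by (rule partial_has_vector_derivative[OF df])
      then have l0: "((\<lambda>h. cmod (f (x + h *\<^sub>R ?e) - f x - h *\<^sub>R partial j f x) / \<bar>h\<bar>) \<longlongrightarrow> 0) (at 0)"
        unfolding has_vector_derivative_def has_derivative_at by simp
      have eq: "cmod (f (x + h *\<^sub>R ?e) - f x - h *\<^sub>R partial j f x) / \<bar>h\<bar> = cmod ((f (x + h *\<^sub>R ?e) - f x) /\<^sub>R h - partial j f x)"
        if "h \<noteq> 0" for h
      proof -
        have "f (x + h *\<^sub>R ?e) - f x - h *\<^sub>R partial j f x = h *\<^sub>R ((f (x + h *\<^sub>R ?e) - f x) /\<^sub>R h - partial j f x)"
          using that by (simp add: scaleR_right_diff_distrib)
        then show ?thesis using that by (simp only: norm_scaleR) simp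
      qed
      have "((\<lambda>h. cmod ((f (x + h *\<^sub>R ?e) - f x) /\<^sub>R h - partial j f x)) \<longlongrightarrow> 0) (at 0)"
        by (rule Lim_transform_eventually[OF l0]) (auto simp: eventually_at_filter eq)
      then have l: "((\<lambda>h. (f (x + h *\<^sub>R ?e) - f x) /\<^sub>R h) \<longlongrightarrow> partial j f x) (at 0)"
        by (simp add: tendsto_norm_zero_iff LIM_zero_iff)
      have "filterlim d (at 0) sequentially"
        unfolding filterlim_at using d0 d(1) by (auto simp: less_imp_neq[symmetric] intro!: always_eventually)
      from filterlim_compose[OF l this] show "(\<lambda>k. q k x) \<longlonglongrightarrow> partial j f x"
        unfolding q_def .
    qed
    show "AE x in lborel. norm (q k x) \<le> B * indicator (cball 0 (r + 1)) x" for k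
    proof (rule AE_I2)
      fix x
      show "norm (q k x) \<le> B * indicator (cball 0 (r + 1)) x"
      proof (cases "norm x \<le> r + 1")
        case True
        have "cmod (f (x + d k *\<^sub>R ?e) - f x) \<le> B * d k"
          using partial_mean_value[OF df B(2) less_imp_le[OF d(1)]] .
        then have "norm (q k x) \<le> B" unfolding q_def norm_scaleR using d(1)[of k] by (simp add: field_simps)
        then show ?thesis using True by simp
      next
        case False
        have "norm x \<le> norm (x + d k *\<^sub>R ?e) + norm (d k *\<^sub>R ?e)"
          using norm_triangle_ineq4[of "x + d k *\<^sub>R ?e" "d k *\<^sub>R ?e"] by simp
        then have "norm (x + d k *\<^sub>R ?e) > r" using False d[of k] by (simp add: norm_axis_1)
        then show ?thesis using False r d[of k] by (simp add: q_def)
      qed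
    qed
  qed (auto simp: q_def)
  ultimately show ?thesis by (simp add: LIMSEQ_const_iff)
qed

text \<open>Integration by parts: the derivative of exp(-i \<xi>.x) f(x) integrates to 0, and the
  product rule splits it into the two sides.\<close>

lemma fourier_partial:
  fixes f :: "real^'n::finite \<Rightarrow> complex"
  assumes t: "test_fun f"
  shows "fourier (partial j f) \<xi> = \<i> * of_real (\<xi> $ j) * fourier f \<xi>"
proof -
  define E where "E x = exp (\<i> * of_real (- \<xi> \<bullet> x))" for x
  have E: "smooth_fun E" unfolding E_def by (rule smooth_fun_iexp)
  have tE: "test_fun (\<lambda>x. E x * f x)" by (rule test_fun_mult[OF E t])
  have tE': "test_fun (\<lambda>x. E x * partial j f x)" by (rule test_fun_mult[OF E test_fun_partial[OF t]])
  have pE: "partial j E x = - \<i> * of_real (\<xi> $ j) * E x" for x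
    unfolding E_def by (subst partial_eqI[OF iexp_inner_has_derivative]) (simp add: inner_axis)
  have "partial j (\<lambda>x. E x * f x) x = E x * partial j f x + (- \<i> * of_real (\<xi> $ j)) * (E x * f x)" for x
    using partial_mult[OF smooth_fun_differentiable[OF E] smooth_fun_differentiable[OF test_fun_smooth[OF t]]]
    by (simp add: pE)
  then have "0 = (LINT x|lborel. E x * partial j f x + (- \<i> * of_real (\<xi> $ j)) * (E x * f x))"
    using integral_partial_test_fun[OF tE, of j] by simp
  also have "\<dots> = (LINT x|lborel. E x * partial j f x) + (- \<i> * of_real (\<xi> $ j)) * (LINT x|lborel. E x * f x)"
    using test_fun_integrable[OF tE] test_fun_integrable[OF tE']
    by (subst Bochner_Integration.integral_add) simp_all
  finally have "(LINT x|lborel. E x * partial j f x) = \<i> * of_real (\<xi> $ j) * (LINT x|lborel. E x * f x)"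
    by (simp add: algebra_simps)
  then show ?thesis unfolding fourier_alt E_def[symmetric] by (simp add: mult_ac)
qed

text \<open>The candidate derivative in direction h is the transform of -i (h.x) f(x). The Taylor
  bound |exp(is) - 1 - is| \<le> s^2, with |s| \<le> r |h| on the support of \<open>f\<close>, makes
  the remainder quadratic in h.\<close>

lemma fourier_has_derivative:
  fixes f :: "real^'n::finite \<Rightarrow> complex"
  assumes t: "test_fun f"
  shows "(fourier f has_derivative (\<lambda>h. \<Sum>j\<in>UNIV. (h $ j) *\<^sub>R fourier (\<lambda>x. - \<i> * of_real (x $ j) * f x) \<xi>)) (at \<xi>)"
proof -
  define c where "c = ft_const CARD('n)"
  have c: "c > 0" using ft_const_pos c_def by auto
  obtain r where r: "r > 0" "\<And>x. norm x > r \<Longrightarrow> f x = 0" using test_fun_support[OF t] by blast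
  define K where "K = c * (r\<^sup>2 * (LINT x|lborel. cmod (f x)))"
  define D where "D h = (\<Sum>j\<in>UNIV. (h $ j) *\<^sub>R fourier (\<lambda>x. - \<i> * of_real (x $ j) * f x) \<xi>)" for h :: "real^'n"
  have ti: "integrable lborel (\<lambda>x. - \<i> * of_real (x $ j) * f x)" for j
    by (intro test_fun_integrable test_fun_mult t smooth_fun_mult smooth_fun_const smooth_fun_coord)
  let ?E = "\<lambda>\<xi> x. exp (\<i> * of_real (- \<xi> \<bullet> x))"
  have Deq: "D h = of_real c * (LINT x|lborel. - \<i> * of_real (h \<bullet> x) * f x * ?E \<xi> x)" for h
  proof -
    have "D h = of_real c * (\<Sum>j\<in>UNIV. (LINT x|lborel. of_real (h $ j) * (- \<i> * of_real (x $ j) * f x * ?E \<xi> x)))"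
      unfolding D_def fourier_alt c_def integral_mult_right_zero by (simp add: scaleR_conv_of_real sum_distrib_left mult_ac)
    also have "(\<Sum>j\<in>UNIV. (LINT x|lborel. of_real (h $ j) * (- \<i> * of_real (x $ j) * f x * ?E \<xi> x)))
      = (LINT x|lborel. (\<Sum>j\<in>UNIV. of_real (h $ j) * (- \<i> * of_real (x $ j) * f x * ?E \<xi> x)))"
      by (intro Bochner_Integration.integral_sum[symmetric] integrable_mult_right integrable_mult_iexp ti)
    also have "\<dots> = (LINT x|lborel. - \<i> * of_real (h \<bullet> x) * f x * ?E \<xi> x)"
      by (intro Bochner_Integration.integral_cong refl) (simp add: inner_vec_def sum_distrib_left sum_distrib_right sum_negf mult_ac)
    finally show ?thesis .
  qed
  have fi: "integrable lborel f" by (rule test_fun_integrable[OF t])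
  have Di: "integrable lborel (\<lambda>x. - \<i> * of_real (h \<bullet> x) * f x)" for h
  proof -
    have "integrable lborel (\<lambda>x. \<Sum>j\<in>UNIV. of_real (h $ j) * (- \<i> * of_real (x $ j) * f x))"
      by (intro Bochner_Integration.integrable_sum integrable_mult_right ti)
    then show ?thesis by (simp add: inner_vec_def sum_distrib_left sum_distrib_right sum_negf mult_ac)
  qed
  note i1 = integrable_mult_iexp(2)[OF fi] and i2 = integrable_mult_iexp(2)[OF Di]
  have rem: "cmod (fourier f (\<xi> + h) - fourier f \<xi> - D h) \<le> K * (norm h)\<^sup>2" for h
  proof -
    have "fourier f (\<xi> + h) - fourier f \<xi> - D h =
       of_real c * ((LINT x|lborel. f x * ?E (\<xi> + h) x) - (LINT x|lborel. f x * ?E \<xi> x) - (LINT x|lborel. - \<i> * of_real (h \<bullet> x) * f x * ?E \<xi> x))"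
      unfolding Deq fourier_alt c_def by (simp only: right_diff_distrib)
    also have "\<dots> = of_real c * (LINT x|lborel. f x * ?E (\<xi> + h) x - f x * ?E \<xi> x - (- \<i> * of_real (h \<bullet> x) * f x * ?E \<xi> x))"
      by (simp only: Bochner_Integration.integral_diff[OF Bochner_Integration.integrable_diff[OF i1 i1] i2] Bochner_Integration.integral_diff[OF i1 i1])
    finally have e: "fourier f (\<xi> + h) - fourier f \<xi> - D h = of_real c *
      (LINT x|lborel. f x * ?E (\<xi> + h) x - f x * ?E \<xi> x - (- \<i> * of_real (h \<bullet> x) * f x * ?E \<xi> x))" .
    have "cmod (fourier f (\<xi> + h) - fourier f \<xi> - D h) \<le>
        c * (LINT x|lborel. cmod (f x * ?E (\<xi> + h) x - f x * ?E \<xi> x - (- \<i> * of_real (h \<bullet> x) * f x * ?E \<xi> x)))"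
      unfolding e norm_mult norm_of_real abs_of_pos[OF c]
      by (rule mult_left_mono[OF integral_norm_bound less_imp_le[OF c]])
    also have "\<dots> \<le> c * (LINT x|lborel. ((norm h)\<^sup>2 * r\<^sup>2) * cmod (f x))"
    proof (intro mult_left_mono integral_mono)
      show "integrable lborel (\<lambda>x. cmod (f x * ?E (\<xi> + h) x - f x * ?E \<xi> x - (- \<i> * of_real (h \<bullet> x) * f x * ?E \<xi> x)))"
        by (intro integrable_norm Bochner_Integration.integrable_diff i1 i2)
      show "integrable lborel (\<lambda>x. ((norm h)\<^sup>2 * r\<^sup>2) * cmod (f x))" using fi by simp
      fix x
      define s where "s = - h \<bullet> x"
      have "f x * ?E (\<xi> + h) x - f x * ?E \<xi> x - (- \<i> * of_real (h \<bullet> x) * f x * ?E \<xi> x) =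
         f x * ?E \<xi> x * (exp (\<i> * of_real s) - 1 - \<i> * of_real s)"
      proof -
        have "- (\<xi> + h) \<bullet> x = - \<xi> \<bullet> x + s" by (simp add: s_def inner_add_left inner_diff_left inner_minus_left)
        then have "?E (\<xi> + h) x = ?E \<xi> x * exp (\<i> * of_real s)"
          by (simp only: of_real_add distrib_left exp_add)
        then show ?thesis by (simp only:) (simp add: s_def algebra_simps)
      qed
      moreover have "cmod (exp (\<i> * of_real s) - 1 - \<i> * of_real s) \<le> s\<^sup>2"
      proof -
        have a: "(\<Sum>k\<le>1. (\<i> * complex_of_real s) ^ k / fact k) = 1 + \<i> * of_real s" by simp
        have "cmod (exp (\<i> * of_real s) - (1 + \<i> * of_real s)) \<le> \<bar>s\<bar> ^ Suc 1 / fact (Suc 1)"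
          using iexp_approx1[of s 1] unfolding a .
        also have "\<dots> \<le> s\<^sup>2" by (simp add: power2_eq_square)
        finally show ?thesis by (simp add: diff_diff_eq)
      qed
      moreover have "s\<^sup>2 * cmod (f x) \<le> (norm h)\<^sup>2 * r\<^sup>2 * cmod (f x)"
      proof (cases "norm x > r")
        case True then show ?thesis using r by simp
      next
        case False
        have "\<bar>s\<bar> \<le> norm h * r"
          using Cauchy_Schwarz_ineq2[of h x] mult_left_mono[of "norm x" r "norm h"] False by (simp add: s_def)
        then have "s\<^sup>2 \<le> (norm h * r)\<^sup>2" by (metis abs_le_square_iff abs_of_nonneg abs_ge_zero order_trans power2_abs)
        then show ?thesis by (simp add: power_mult_distrib mult_right_mono)
      qed
      ultimately show "cmod (f x * ?E (\<xi> + h) x - f x * ?E \<xi> x - (- \<i> * of_real (h \<bullet> x) * f x * ?E \<xi> x)) \<le> (norm h)\<^sup>2 * r\<^sup>2 * cmod (f x)"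
      proof -
        assume e: "f x * ?E (\<xi> + h) x - f x * ?E \<xi> x - (- \<i> * of_real (h \<bullet> x) * f x * ?E \<xi> x) =
          f x * ?E \<xi> x * (exp (\<i> * of_real s) - 1 - \<i> * of_real s)"
          and a: "cmod (exp (\<i> * of_real s) - 1 - \<i> * of_real s) \<le> s\<^sup>2"
          and b: "s\<^sup>2 * cmod (f x) \<le> (norm h)\<^sup>2 * r\<^sup>2 * cmod (f x)"
        have "cmod (f x * ?E \<xi> x * (exp (\<i> * of_real s) - 1 - \<i> * of_real s)) = cmod (f x) * cmod (exp (\<i> * of_real s) - 1 - \<i> * of_real s)"
          by (simp add: norm_mult)
        also have "\<dots> \<le> cmod (f x) * s\<^sup>2" by (rule mult_left_mono[OF a norm_ge_zero])
        finally show ?thesis unfolding e using b by (simp add: mult.commute)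
      qed
    qed (use c in simp)
    also have "\<dots> = K * (norm h)\<^sup>2" by (simp add: K_def)
    finally show ?thesis .
  qed
  have "(fourier f has_derivative D) (at \<xi>)"
  proof (rule has_derivativeI_sandwich[where e = 1 and H = "\<lambda>y. K * norm (y - \<xi>)"])
    show "bounded_linear D"
      unfolding D_def by (intro bounded_linear_sum bounded_linear_scaleR_left[THEN bounded_linear_compose] bounded_linear_vec_nth)
    show "((\<lambda>y. K * norm (y - \<xi>)) \<longlongrightarrow> 0) (at \<xi>)"
      by (auto intro!: tendsto_eq_intros)
    fix y assume "y \<noteq> \<xi>"
    then have "norm (y - \<xi>) > 0" by simp
    with rem[of "y - \<xi>"] show "norm (fourier f y - fourier f \<xi> - D (y - \<xi>)) / norm (y - \<xi>) \<le> K * norm (y - \<xi>)"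
      by (simp add: divide_le_eq power2_eq_square mult_ac)
  qed simp
  then show ?thesis unfolding D_def .
qed

lemma partial_fourier:
  fixes f :: "real^'n::finite \<Rightarrow> complex"
  assumes t: "test_fun f"
  shows "partial j (fourier f) = fourier (\<lambda>x. - \<i> * of_real (x $ j) * f x)"
proof
  fix \<xi>
  have "(axis j 1 :: real^'n) $ i = (if i = j then 1 else 0)" for i by (simp add: axis_def)
  then show "partial j (fourier f) \<xi> = fourier (\<lambda>x. - \<i> * of_real (x $ j) * f x) \<xi>"
    by (subst partial_eqI[OF fourier_has_derivative[OF t]]) (simp add: if_distrib[of "\<lambda>a. a *\<^sub>R _"] cong: if_cong)
qed

lemma test_fun_coord_mult: "test_fun f \<Longrightarrow> test_fun (\<lambda>x. - \<i> * of_real (x $ j) * f x)"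
  by (intro test_fun_mult smooth_fun_mult smooth_fun_const smooth_fun_coord)

text \<open>The transform of \<open>partial j f\<close> has an additional factor |\<xi>_j| in
  modulus. As 1 + |\<xi>| is at most 1 plus the sum of the |\<xi>_j|, each induction step gains one
  power of decay.\<close>

lemma fourier_test_fun_decay:
  fixes f :: "real^'n::finite \<Rightarrow> complex"
  assumes "test_fun f"
  shows "\<exists>B. \<forall>\<xi>. (1 + norm \<xi>) ^ N * cmod (fourier f \<xi>) \<le> B"
  using assms
proof (induction N arbitrary: f)
  case 0
  have "cmod (fourier f \<xi>) \<le> ft_const CARD('n) * (LINT \<xi>|lborel. cmod (f \<xi>))" for \<xi>
    unfolding fourier_eq_inv_fourier by (rule inv_fourier_bound[OF test_fun_integrable[OF 0]])
  then show ?case by auto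
next
  case (Suc N)
  obtain B where B: "\<And>\<xi>. (1 + norm \<xi>) ^ N * cmod (fourier f \<xi>) \<le> B" using Suc.IH[OF Suc.prems] by blast
  have "\<forall>j. \<exists>B. \<forall>\<xi>. (1 + norm \<xi>) ^ N * cmod (fourier (partial j f) \<xi>) \<le> B"
    using Suc.IH[OF test_fun_partial[OF Suc.prems]] by blast
  then obtain C where C: "\<And>j \<xi>. (1 + norm \<xi>) ^ N * cmod (fourier (partial j f) \<xi>) \<le> C j" by metis
  have "(1 + norm \<xi>) ^ Suc N * cmod (fourier f \<xi>) \<le> B + (\<Sum>j\<in>UNIV. C j)" for \<xi>
  proof -
    have "(1 + norm \<xi>) * cmod (fourier f \<xi>) \<le> (1 + (\<Sum>j\<in>UNIV. \<bar>\<xi> $ j\<bar>)) * cmod (fourier f \<xi>)"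
      using norm_le_l1_cart[of \<xi>] by (intro mult_right_mono) auto
    also have "\<dots> = cmod (fourier f \<xi>) + (\<Sum>j\<in>UNIV. cmod (fourier (partial j f) \<xi>))"
      using Suc.prems by (simp add: fourier_partial norm_mult distrib_right sum_distrib_right)
    finally have "(1 + norm \<xi>) ^ N * ((1 + norm \<xi>) * cmod (fourier f \<xi>)) \<le>
        (1 + norm \<xi>) ^ N * (cmod (fourier f \<xi>) + (\<Sum>j\<in>UNIV. cmod (fourier (partial j f) \<xi>)))"
      by (intro mult_left_mono) (auto simp: less_imp_le)
    also have "\<dots> = (1 + norm \<xi>) ^ N * cmod (fourier f \<xi>) + (\<Sum>j\<in>UNIV. (1 + norm \<xi>) ^ N * cmod (fourier (partial j f) \<xi>))"
      by (simp add: distrib_left sum_distrib_left)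
    also have "\<dots> \<le> B + (\<Sum>j\<in>UNIV. C j)" by (intro add_mono B sum_mono C)
    finally show ?thesis by (simp add: mult_ac)
  qed
  then show ?case by blast
qed

lemma partials_fourier:
  fixes f :: "real^'n::finite \<Rightarrow> complex"
  assumes "test_fun f"
  obtains g where "test_fun g" "partials js (fourier f) = fourier g"
proof -
  have "\<exists>g. test_fun g \<and> partials js (fourier f) = fourier g"
    using assms by (induction js) (auto simp: partial_fourier intro: test_fun_coord_mult)
  then show ?thesis using that by blast
qed

text \<open>The representation of \<open>fourier_dist f\<close> by a function is tested on test
  functions, so \<open>f\<close> is evaluated at their transforms; a tempered distribution is
  controlled only on Schwartz functions. This theorem connects the two classes.\<close>

theorem schwartz_fourier_test_fun:
  fixes f :: "real^'n::finite \<Rightarrow> complex"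
  assumes t: "test_fun f"
  shows "schwartz (fourier f)"
  unfolding schwartz_def smooth_fun_def
proof (intro conjI allI)
  fix js :: "'n list" and x
  obtain g where g: "test_fun g" "partials js (fourier f) = fourier g" by (rule partials_fourier[OF t])
  show "partials js (fourier f) differentiable at x"
    unfolding g differentiable_def using fourier_has_derivative[OF g(1)] by blast
next
  fix js :: "'n list" and N
  obtain g where g: "test_fun g" "partials js (fourier f) = fourier g" by (rule partials_fourier[OF t])
  show "bdd_above (range (\<lambda>x. (1 + norm x) ^ N * cmod (partials js (fourier f) x)))"
    unfolding g using fourier_test_fun_decay[OF g(1), of N] by (auto intro: bdd_aboveI2)
qed

lemma fourier_inversion_test_fun:
  assumes t: "test_fun f"
  shows "inv_fourier (fourier f) = f"
proof
  fix x
  obtain B where B: "\<And>x. cmod (f x) \<le> B" using test_fun_bound[OF t] by blast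
  show "inv_fourier (fourier f) x = f x"
    by (rule fourier_inversion[OF test_fun_integrable[OF t] smooth_fun_continuous[OF test_fun_smooth[OF t]] B
          schwartz_integrable[OF schwartz_fourier_test_fun[OF t]]])
qed

subsection \<open>Fourier transforms that are locally integrable functions\<close>

lemma locally_integrable_iff_cball:
  fixes g :: "real^'n::finite \<Rightarrow> complex"
  assumes [measurable]: "g \<in> borel_measurable borel"
    and i: "\<And>r. r > 0 \<Longrightarrow> integrable lborel (\<lambda>x. indicator (cball 0 r) x *\<^sub>R g x)"
  shows "locally_integrable g"
  unfolding locally_integrable_def set_integrable_def
proof (intro allI impI)
  fix K :: "(real^'n) set" assume K: "compact K"
  then have [measurable]: "K \<in> sets borel" by (simp add: borel_compact)
  obtain r where r: "r > 0" "\<And>x. x \<in> K \<Longrightarrow> norm x \<le> r"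
    using compact_imp_bounded[OF K] unfolding bounded_pos by blast
  show "integrable lborel (\<lambda>x. indicator K x *\<^sub>R g x)"
    by (rule Bochner_Integration.integrable_bound[OF i[OF r(1)]]) (use r(2) in \<open>auto simp: indicator_def\<close>)
qed

lemma locally_integrable_cball:
  fixes g :: "real^'n::finite \<Rightarrow> complex"
  assumes "locally_integrable g"
  shows "integrable lborel (\<lambda>x. indicator (cball 0 r) x *\<^sub>R g x)"
  using assms compact_cball unfolding locally_integrable_def set_integrable_def by blast

lemma integrable_imp_locally_integrable:
  fixes g :: "real^'n::finite \<Rightarrow> complex"
  assumes "integrable lborel g"
  shows "locally_integrable g"
proof (rule locally_integrable_iff_cball)
  show "g \<in> borel_measurable borel" using borel_measurable_integrable[OF assms] by simp
  show "integrable lborel (\<lambda>x. indicator (cball 0 r) x *\<^sub>R g x)" for r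
    by (rule integrable_mult_indicator[OF _ assms]) simp
qed

text \<open>Linear growth admits both the bounded multiplier symbols and the factor \<xi>_j of a
  derivative.\<close>

lemma locally_integrable_mult:
  fixes g m :: "real^'n::finite \<Rightarrow> complex"
  assumes g: "locally_integrable g" and [measurable]: "m \<in> borel_measurable borel"
    and b: "\<And>x. cmod (m x) \<le> C * (1 + norm x)"
  shows "locally_integrable (\<lambda>x. m x * g x)"
proof (rule locally_integrable_iff_cball)
  have [measurable]: "g \<in> borel_measurable borel" by (rule locally_integrable_measurable[OF g])
  show "(\<lambda>x. m x * g x) \<in> borel_measurable borel" by measurable
  fix r :: real assume r: "r > 0"
  have C: "C \<ge> 0" using order_trans[OF norm_ge_zero b[of 0]] by simp
  show "integrable lborel (\<lambda>x. indicator (cball 0 r) x *\<^sub>R (m x * g x))"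
  proof (rule Bochner_Integration.integrable_bound)
    show "integrable lborel (\<lambda>x. (C * (1 + r)) *\<^sub>R indicator (cball 0 r) x *\<^sub>R g x)"
      by (rule integrable_scaleR_right) (rule locally_integrable_cball[OF g])
    show "AE x in lborel. norm (indicator (cball 0 r) x *\<^sub>R (m x * g x)) \<le> norm ((C * (1 + r)) *\<^sub>R indicator (cball 0 r) x *\<^sub>R g x)"
    proof (rule AE_I2)
      fix x :: "real^'n"
      show "norm (indicator (cball 0 r) x *\<^sub>R (m x * g x)) \<le> norm ((C * (1 + r)) *\<^sub>R indicator (cball 0 r) x *\<^sub>R g x)"
      proof (cases "norm x \<le> r")
        case True
        have "cmod (m x) \<le> C * (1 + r)" using b[of x] mult_left_mono[of "1 + norm x" "1 + r" C] C True by linarith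
        then have "cmod (m x) * cmod (g x) \<le> C * (1 + r) * cmod (g x)" by (rule mult_right_mono) simp
        then show ?thesis using True C r by (simp add: norm_mult)
      qed simp
    qed
  qed measurable
qed

lemma locally_integrable_sum:
  fixes g :: "'i \<Rightarrow> real^'n::finite \<Rightarrow> complex"
  assumes "\<And>i. i \<in> I \<Longrightarrow> locally_integrable (g i)"
  shows "locally_integrable (\<lambda>x. \<Sum>i\<in>I. g i x)"
proof (rule locally_integrable_iff_cball)
  show "(\<lambda>x. \<Sum>i\<in>I. g i x) \<in> borel_measurable borel"
    by (intro borel_measurable_sum locally_integrable_measurable assms)
  show "integrable lborel (\<lambda>x. indicator (cball 0 r) x *\<^sub>R (\<Sum>i\<in>I. g i x))" for r
    unfolding scaleR_sum_right by (intro Bochner_Integration.integrable_sum locally_integrable_cball assms)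
qed

lemma locally_integrable_diff:
  fixes g h :: "real^'n::finite \<Rightarrow> complex"
  assumes "locally_integrable g" "locally_integrable h"
  shows "locally_integrable (\<lambda>x. g x - h x)"
proof (rule locally_integrable_iff_cball)
  show "(\<lambda>x. g x - h x) \<in> borel_measurable borel"
    by (intro borel_measurable_diff locally_integrable_measurable assms)
  show "integrable lborel (\<lambda>x. indicator (cball 0 r) x *\<^sub>R (g x - h x))" for r
    unfolding scaleR_diff_right by (intro Bochner_Integration.integrable_diff locally_integrable_cball assms)
qed

lemma locally_integrable_test_fun:
  fixes g :: "real^'n::finite \<Rightarrow> complex"
  assumes g: "locally_integrable g" and t: "test_fun \<phi>"
  shows "integrable lborel (\<lambda>x. g x * \<phi> x)"
proof -
  obtain r where r: "r > 0" "\<And>x. norm x > r \<Longrightarrow> \<phi> x = 0" using test_fun_support[OF t] by blast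
  obtain B where B: "B > 0" "\<And>x. cmod (\<phi> x) \<le> B" using test_fun_bound[OF t] by blast
  have [measurable]: "g \<in> borel_measurable borel" by (rule locally_integrable_measurable[OF g])
  have [measurable]: "\<phi> \<in> borel_measurable borel" by (intro smooth_fun_measurable test_fun_smooth t)
  show ?thesis
  proof (rule Bochner_Integration.integrable_bound)
    show "integrable lborel (\<lambda>x. B *\<^sub>R indicator (cball 0 r) x *\<^sub>R g x)"
      by (rule integrable_scaleR_right) (rule locally_integrable_cball[OF g])
    show "AE x in lborel. norm (g x * \<phi> x) \<le> norm (B *\<^sub>R indicator (cball 0 r) x *\<^sub>R g x)"
    proof (rule AE_I2)
      fix x show "norm (g x * \<phi> x) \<le> norm (B *\<^sub>R indicator (cball 0 r) x *\<^sub>R g x)"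
        using r(2)[of x] B by (cases "norm x \<le> r") (auto simp: norm_mult mult.commute intro!: mult_right_mono)
    qed
  qed measurable
qed

text \<open>This makes the arbitrary choice in \<open>fourier_fun\<close> harmless: norms and
  multipliers can be computed from any locally integrable representative.\<close>

lemma is_L1loc_fun_unique:
  fixes g h :: "real^'n::finite \<Rightarrow> complex"
  assumes "is_L1loc_fun f g" "is_L1loc_fun f h"
  shows "AE x in lborel. g x = h x"
proof -
  have l: "locally_integrable g" "locally_integrable h" using assms by (auto simp: is_L1loc_fun_def)
  have "AE x in lborel. g x - h x = 0"
  proof (rule du_bois_reymond)
    show "locally_integrable (\<lambda>x. g x - h x)" by (intro locally_integrable_diff l)
    fix \<phi> :: "real^'n \<Rightarrow> complex" assume t: "test_fun \<phi>"
    have "(LINT x|lborel. g x * \<phi> x) = (LINT x|lborel. h x * \<phi> x)"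
      using assms t unfolding is_L1loc_fun_def fun_dist_def by metis
    then show "(LINT x|lborel. (g x - h x) * \<phi> x) = 0"
      using locally_integrable_test_fun[OF l(1) t] locally_integrable_test_fun[OF l(2) t]
      by (simp add: left_diff_distrib)
  qed
  then show ?thesis by simp
qed

lemma is_L1loc_fun_measurable: "is_L1loc_fun f g \<Longrightarrow> g \<in> borel_measurable borel"
  by (simp add: is_L1loc_fun_def locally_integrable_measurable)

lemma fourier_fun_is_L1loc:
  "is_L1loc_fun (fourier_dist f) g \<Longrightarrow> is_L1loc_fun (fourier_dist f) (fourier_fun f)"
  using someI[of "is_L1loc_fun (fourier_dist f)" g] by (simp add: fourier_fun_def)

lemma fourier_fun_AE:
  "is_L1loc_fun (fourier_dist f) g \<Longrightarrow> AE \<xi> in lborel. fourier_fun f \<xi> = g \<xi>"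
  by (rule is_L1loc_fun_unique[OF fourier_fun_is_L1loc])

lemma hom_sobolev_norm_eq:
  assumes g: "is_L1loc_fun (fourier_dist f) g"
  shows "hom_sobolev_norm s f = sqrt (LINT \<xi>|lborel. (norm \<xi> powr s * cmod (g \<xi>))\<^sup>2)"
proof -
  have [measurable]: "g \<in> borel_measurable borel" "fourier_fun f \<in> borel_measurable borel"
    using is_L1loc_fun_measurable g fourier_fun_is_L1loc[OF g] by auto
  have "(LINT \<xi>|lborel. (norm \<xi> powr s * cmod (fourier_fun f \<xi>))\<^sup>2) = (LINT \<xi>|lborel. (norm \<xi> powr s * cmod (g \<xi>))\<^sup>2)"
    by (rule integral_cong_AE) (use fourier_fun_AE[OF g] in auto)
  then show ?thesis by (simp add: hom_sobolev_norm_def)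
qed

lemma hom_sobolevI:
  assumes "tempered f" and g: "is_L1loc_fun (fourier_dist f) g"
    and i: "integrable lborel (\<lambda>\<xi>. (norm \<xi> powr s * cmod (g \<xi>))\<^sup>2)"
  shows "f \<in> hom_sobolev s"
proof -
  have [measurable]: "g \<in> borel_measurable borel" "fourier_fun f \<in> borel_measurable borel"
    using is_L1loc_fun_measurable g fourier_fun_is_L1loc[OF g] by auto
  have "integrable lborel (\<lambda>\<xi>. (norm \<xi> powr s * cmod (fourier_fun f \<xi>))\<^sup>2)"
    by (rule integrable_cong_AE_imp[OF i]) (use fourier_fun_AE[OF g] in auto)
  then show ?thesis using assms by (auto simp: hom_sobolev_def has_fourier_fun_def)
qed

text \<open>Duality combined with inversion on test functions; it identifies the distributional
  transform of \<open>inv_fourier W\<close>.\<close>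

lemma inv_fourier_fourier_test_fun:
  fixes W :: "real^'n::finite \<Rightarrow> complex"
  assumes W: "integrable lborel W" and t: "test_fun \<phi>"
  shows "(LINT x|lborel. inv_fourier W x * fourier \<phi> x) = (LINT \<xi>|lborel. W \<xi> * \<phi> \<xi>)"
  using inv_fourier_duality[OF W schwartz_integrable[OF schwartz_fourier_test_fun[OF t]]]
  by (simp add: fourier_inversion_test_fun[OF t])

lemma inv_fourier_is_L1loc:
  fixes W :: "real^'n::finite \<Rightarrow> complex"
  assumes W: "integrable lborel W"
  shows "is_L1loc_fun (fourier_dist (fun_dist (inv_fourier W))) W"
  using inv_fourier_fourier_test_fun[OF W] integrable_imp_locally_integrable[OF W]
  by (simp add: is_L1loc_fun_def fourier_dist_def fun_dist_def)

lemma inv_fourier_slow_growth: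
  fixes W :: "real^'n::finite \<Rightarrow> complex"
  assumes W: "integrable lborel W"
  shows "slow_growth (inv_fourier W)"
proof -
  have [measurable]: "W \<in> borel_measurable borel" using borel_measurable_integrable[OF W] by simp
  show ?thesis by (rule slow_growth_bounded[OF _ inv_fourier_bound[OF W]]) measurable
qed

text \<open>Two signs combine: the minus of the distributional derivative and the factor -i \<xi>_j
  from differentiating \<open>fourier \<phi>\<close>.\<close>

lemma inv_fourier_partial_is_L1loc:
  fixes W :: "real^'n::finite \<Rightarrow> complex"
  assumes W: "integrable lborel W"
  shows "is_L1loc_fun (fourier_dist (partial_dist j (fun_dist (inv_fourier W)))) (\<lambda>\<xi>. \<i> * of_real (\<xi> $ j) * W \<xi>)"
  unfolding is_L1loc_fun_def
proof (intro conjI allI impI)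
  show "locally_integrable (\<lambda>\<xi>. \<i> * of_real (\<xi> $ j) * W \<xi>)"
  proof (rule locally_integrable_mult[where C = 1, OF integrable_imp_locally_integrable[OF W]])
    show "cmod (\<i> * complex_of_real (x $ j)) \<le> 1 * (1 + norm x)" for x :: "real^'n"
      using component_le_norm_cart[of x j] by (simp add: norm_mult)
  qed measurable
  fix \<phi> :: "real^'n \<Rightarrow> complex" assume t: "test_fun \<phi>"
  have "(LINT x|lborel. inv_fourier W x * partial j (fourier \<phi>) x) = (LINT \<xi>|lborel. W \<xi> * (- \<i> * of_real (\<xi> $ j) * \<phi> \<xi>))"
    unfolding partial_fourier[OF t] by (rule inv_fourier_fourier_test_fun[OF W test_fun_coord_mult[OF t]])
  also have "\<dots> = (LINT \<xi>|lborel. - (\<i> * of_real (\<xi> $ j) * W \<xi> * \<phi> \<xi>))" by (simp add: mult_ac)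
  finally show "fourier_dist (partial_dist j (fun_dist (inv_fourier W))) \<phi> = fun_dist (\<lambda>\<xi>. \<i> * of_real (\<xi> $ j) * W \<xi>) \<phi>"
    by (simp add: fourier_dist_def partial_dist_def fun_dist_def)
qed

lemma is_L1loc_fun_sum:
  fixes g :: "'i \<Rightarrow> real^'n::finite \<Rightarrow> complex"
  assumes "finite I" and "\<And>i. i \<in> I \<Longrightarrow> is_L1loc_fun (fourier_dist (f i)) (g i)"
  shows "is_L1loc_fun (fourier_dist (\<lambda>\<phi>. \<Sum>i\<in>I. f i \<phi>)) (\<lambda>x. \<Sum>i\<in>I. g i x)"
  unfolding is_L1loc_fun_def
proof (intro conjI allI impI)
  have l: "locally_integrable (g i)" if "i \<in> I" for i using assms(2)[OF that] by (simp add: is_L1loc_fun_def)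
  then show "locally_integrable (\<lambda>x. \<Sum>i\<in>I. g i x)" by (rule locally_integrable_sum)
  fix \<phi> :: "real^'n \<Rightarrow> complex" assume t: "test_fun \<phi>"
  have "f i (fourier \<phi>) = (LINT x|lborel. g i x * \<phi> x)" if "i \<in> I" for i
    using assms(2)[OF that] t by (simp add: is_L1loc_fun_def fourier_dist_def fun_dist_def)
  then have "(\<Sum>i\<in>I. f i (fourier \<phi>)) = (\<Sum>i\<in>I. LINT x|lborel. g i x * \<phi> x)" by simp
  also have "\<dots> = (LINT x|lborel. (\<Sum>i\<in>I. g i x * \<phi> x))"
    by (rule Bochner_Integration.integral_sum[symmetric]) (intro locally_integrable_test_fun l t)
  finally show "fourier_dist (\<lambda>\<phi>. \<Sum>i\<in>I. f i \<phi>) \<phi> = fun_dist (\<lambda>x. \<Sum>i\<in>I. g i x) \<phi>"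
    by (simp add: fourier_dist_def fun_dist_def sum_distrib_right)
qed

lemma is_L1loc_fun_diff:
  fixes g h :: "real^'n::finite \<Rightarrow> complex"
  assumes "is_L1loc_fun (fourier_dist f) g" "is_L1loc_fun (fourier_dist f') h"
  shows "is_L1loc_fun (fourier_dist (\<lambda>\<phi>. f \<phi> - f' \<phi>)) (\<lambda>x. g x - h x)"
proof -
  have l: "locally_integrable g" "locally_integrable h" using assms by (auto simp: is_L1loc_fun_def)
  show ?thesis
    using assms l locally_integrable_diff[OF l]
    by (auto simp: is_L1loc_fun_def fourier_dist_def fun_dist_def left_diff_distrib locally_integrable_test_fun)
qed

lemma is_L1loc_fun_cong_AE:
  fixes g h :: "real^'n::finite \<Rightarrow> complex"
  assumes g: "is_L1loc_fun f g" and e: "AE x in lborel. g x = h x" and [measurable]: "h \<in> borel_measurable borel"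
  shows "is_L1loc_fun f h"
proof -
  have [measurable]: "g \<in> borel_measurable borel" by (rule is_L1loc_fun_measurable[OF g])
  have l: "locally_integrable h"
  proof (rule locally_integrable_iff_cball)
    show "integrable lborel (\<lambda>x. indicator (cball 0 r) x *\<^sub>R h x)" for r
      by (rule integrable_cong_AE_imp[OF locally_integrable_cball[of g r]])
        (use g e in \<open>auto simp: is_L1loc_fun_def\<close>)
  qed simp
  have "fun_dist g \<phi> = fun_dist h \<phi>" if "test_fun \<phi>" for \<phi>
  proof -
    have [measurable]: "\<phi> \<in> borel_measurable borel" by (intro smooth_fun_measurable test_fun_smooth that)
    show ?thesis unfolding fun_dist_def by (rule integral_cong_AE) (use e in auto)
  qed
  then show ?thesis using g l by (auto simp: is_L1loc_fun_def)
qed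

lemma fourier_multiplier_is_L1loc:
  fixes m :: "real^'n::finite \<Rightarrow> complex"
  assumes g: "is_L1loc_fun (fourier_dist f) g" and [measurable]: "m \<in> borel_measurable borel"
    and b: "\<And>x. cmod (m x) \<le> C"
  shows "is_L1loc_fun (fourier_dist (fourier_multiplier m f)) (\<lambda>\<xi>. m \<xi> * g \<xi>)"
proof (rule is_L1loc_fun_cong_AE)
  have [measurable]: "g \<in> borel_measurable borel" by (rule is_L1loc_fun_measurable[OF g])
  show "AE x in lborel. m x * fourier_fun f x = m x * g x" using fourier_fun_AE[OF g] by auto
  show "(\<lambda>\<xi>. m \<xi> * g \<xi>) \<in> borel_measurable borel" by measurable
  have "locally_integrable (\<lambda>\<xi>. m \<xi> * fourier_fun f \<xi>)"
  proof (rule locally_integrable_mult[where C = C])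
    show "locally_integrable (fourier_fun f)" using fourier_fun_is_L1loc[OF g] by (simp add: is_L1loc_fun_def)
    fix x :: "real^'n"
    have "0 \<le> C" using order_trans[OF norm_ge_zero b] .
    then have "C * 1 \<le> C * (1 + norm x)" by (intro mult_left_mono) auto
    with b[of x] show "cmod (m x) \<le> C * (1 + norm x)" by simp
  qed simp
  then show "is_L1loc_fun (fourier_dist (fourier_multiplier m f)) (\<lambda>x. m x * fourier_fun f x)"
    by (simp add: is_L1loc_fun_def fourier_dist_def fourier_multiplier_def inv_fourier_dist_def fourier_inversion_test_fun)
qed

text \<open>At the origin the quotient is 0, the value of division by zero, so the bound by 2 below
  holds everywhere.\<close>

definition leray_symbol :: "'n::finite \<Rightarrow> 'n \<Rightarrow> real^'n \<Rightarrow> real" where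
  "leray_symbol j k \<xi> = (if j = k then 1 else 0) - \<xi> $ j * \<xi> $ k / (norm \<xi>)\<^sup>2"

lemma leray_symbol_bound: "\<bar>leray_symbol j k \<xi>\<bar> \<le> 2"
proof -
  have "\<bar>\<xi> $ j * \<xi> $ k\<bar> \<le> norm \<xi> * norm \<xi>"
    unfolding abs_mult by (intro mult_mono component_le_norm_cart) auto
  then have "\<bar>\<xi> $ j * \<xi> $ k\<bar> / (norm \<xi>)\<^sup>2 \<le> 1"
    by (cases "\<xi> = 0") (auto simp: divide_le_eq_1 power2_eq_square)
  then have "\<bar>\<xi> $ j * \<xi> $ k / (norm \<xi>)\<^sup>2\<bar> \<le> 1" by simp
  moreover have "\<bar>(if j = k then 1 else 0 :: real)\<bar> \<le> 1" by simp
  ultimately show ?thesis unfolding leray_symbol_def by linarith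
qed

lemma leray_symbol_measurable [measurable]: "leray_symbol j k \<in> borel_measurable borel"
  unfolding leray_symbol_def[abs_def] by measurable

lemma leray_symbol_minus [simp]: "leray_symbol j k (- \<xi>) = leray_symbol j k \<xi>"
  by (simp add: leray_symbol_def)

lemma leray_is_L1loc:
  fixes F :: "'n::finite \<Rightarrow> real^'n \<Rightarrow> complex"
  assumes "\<And>k. is_L1loc_fun (fourier_dist (f k)) (F k)"
  shows "is_L1loc_fun (fourier_dist (leray f j)) (\<lambda>\<xi>. \<Sum>k\<in>UNIV. of_real (leray_symbol j k \<xi>) * F k \<xi>)"
  unfolding leray_def leray_symbol_def[symmetric]
  by (intro is_L1loc_fun_sum fourier_multiplier_is_L1loc[where C = 2] assms)
    (auto simp: leray_symbol_bound)

section \<open>Convolutions and hermitian symmetry\<close>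

definition conv :: "(real^'n::finite \<Rightarrow> complex) \<Rightarrow> (real^'n \<Rightarrow> complex) \<Rightarrow> real^'n \<Rightarrow> complex" where
  "conv U V \<xi> = (LINT \<eta>|lborel. U (\<xi> - \<eta>) * V \<eta>)"

text \<open>With the symmetric normalisation each inverse transform carries the constant
  \<open>ft_const\<close>. A product of two has it twice, the transform of the convolution once, so
  one factor remains in front of the convolution.\<close>

lemma
  fixes U V :: "real^'n::finite \<Rightarrow> complex"
  assumes U: "integrable lborel U" and V: "integrable lborel V"
  shows conv_integrable: "integrable lborel (conv U V)"
    and inv_fourier_conv: "inv_fourier U x * inv_fourier V x = inv_fourier (\<lambda>\<xi>. of_real (ft_const CARD('n)) * conv U V \<xi>) x"
proof -
  have [measurable]: "U \<in> borel_measurable borel" "V \<in> borel_measurable borel"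
    using borel_measurable_integrable[OF U] borel_measurable_integrable[OF V] by auto
  have t: "integrable lborel (\<lambda>\<xi>. U (\<xi> - \<eta>))" for \<eta>
    using integrable_affine[OF U, of 1 "- \<eta>"] by simp
  have tn: "(LINT \<xi>|lborel. cmod (U (\<xi> - \<eta>))) = (LINT \<xi>|lborel. cmod (U \<xi>))" for \<eta>
    using lebesgue_integral_affine[of "\<lambda>\<xi>. cmod (U \<xi>)" 1 "- \<eta>"] by simp
  have i: "integrable (lborel \<Otimes>\<^sub>M lborel) (\<lambda>(\<eta>, \<xi>). U (\<xi> - \<eta>) * V \<eta>)"
  proof (rule lborel_pair.Fubini_integrable)
    show "integrable lborel (\<lambda>\<eta>. LINT \<xi>|lborel. norm (case (\<eta>, \<xi>) of (\<eta>, \<xi>) \<Rightarrow> U (\<xi> - \<eta>) * V \<eta>))"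
      using V by (simp add: norm_mult tn)
    show "AE \<eta> in lborel. integrable lborel (\<lambda>\<xi>. case (\<eta>, \<xi>) of (\<eta>, \<xi>) \<Rightarrow> U (\<xi> - \<eta>) * V \<eta>)"
      using t by simp
  qed measurable
  from lborel_pair.integrable_snd[OF i] show "integrable lborel (conv U V)" by (simp add: conv_def[abs_def])
  let ?e = "\<lambda>\<xi>. exp (\<i> * of_real (\<xi> \<bullet> x))"
  have "integrable (lborel \<Otimes>\<^sub>M lborel) (\<lambda>p. (case p of (\<eta>, \<xi>) \<Rightarrow> U (\<xi> - \<eta>) * V \<eta>) * ?e (snd p))"
    by (intro integrable_mult_unimodular i) auto
  then have i2: "integrable (lborel \<Otimes>\<^sub>M lborel) (\<lambda>(\<eta>, \<xi>). U (\<xi> - \<eta>) * V \<eta> * ?e \<xi>)" by (simp add: split_beta')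
  have "(LINT \<xi>|lborel. conv U V \<xi> * ?e \<xi>) = (LINT \<xi>|lborel. LINT \<eta>|lborel. U (\<xi> - \<eta>) * V \<eta> * ?e \<xi>)"
    unfolding conv_def by simp
  also have "\<dots> = (LINT \<eta>|lborel. LINT \<xi>|lborel. U (\<xi> - \<eta>) * V \<eta> * ?e \<xi>)"
    using lborel_pair.Fubini_integral[OF i2] by simp
  also have "\<dots> = (LINT \<eta>|lborel. (LINT \<xi>|lborel. U \<xi> * ?e \<xi>) * (V \<eta> * ?e \<eta>))"
  proof (rule Bochner_Integration.integral_cong[OF refl])
    fix \<eta> :: "real^'n"
    have "(LINT \<xi>|lborel. U (\<xi> - \<eta>) * V \<eta> * ?e \<xi>) = (LINT \<xi>|lborel. U (\<eta> + \<xi> - \<eta>) * V \<eta> * ?e (\<eta> + \<xi>))"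
      using lebesgue_integral_affine[of "\<lambda>\<xi>. U (\<xi> - \<eta>) * V \<eta> * ?e \<xi>" 1 \<eta>] by simp
    also have "\<dots> = (LINT \<xi>|lborel. (U \<xi> * ?e \<xi>) * (V \<eta> * ?e \<eta>))"
      by (simp add: inner_add_left distrib_left exp_add mult_ac)
    also have "\<dots> = (LINT \<xi>|lborel. U \<xi> * ?e \<xi>) * (V \<eta> * ?e \<eta>)" by (rule integral_mult_left_zero)
    finally show "(LINT \<xi>|lborel. U (\<xi> - \<eta>) * V \<eta> * ?e \<xi>) = (LINT \<xi>|lborel. U \<xi> * ?e \<xi>) * (V \<eta> * ?e \<eta>)" .
  qed
  also have "\<dots> = (LINT \<xi>|lborel. U \<xi> * ?e \<xi>) * (LINT \<eta>|lborel. V \<eta> * ?e \<eta>)" by (rule integral_mult_right_zero)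
  finally have c: "(LINT \<xi>|lborel. conv U V \<xi> * ?e \<xi>) = (LINT \<xi>|lborel. U \<xi> * ?e \<xi>) * (LINT \<eta>|lborel. V \<eta> * ?e \<eta>)" .
  have "(LINT \<xi>|lborel. of_real (ft_const CARD('n)) * conv U V \<xi> * ?e \<xi>) = of_real (ft_const CARD('n)) * (LINT \<xi>|lborel. conv U V \<xi> * ?e \<xi>)"
    by (simp only: mult.assoc integral_mult_right_zero)
  then show "inv_fourier U x * inv_fourier V x = inv_fourier (\<lambda>\<xi>. of_real (ft_const CARD('n)) * conv U V \<xi>) x"
    unfolding inv_fourier_alt c by simp
qed

text \<open>Conjugation and reflection of the frequency cancel. Both steps remain valid for a
  divergent integral, which has the value 0 throughout.\<close>

lemma inv_fourier_hermitian_real: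
  fixes G :: "real^'n::finite \<Rightarrow> complex"
  assumes [measurable]: "G \<in> borel_measurable borel" and h: "\<And>\<xi>. G (- \<xi>) = cnj (G \<xi>)"
  shows "of_real (Re (inv_fourier G x)) = inv_fourier G x"
proof -
  let ?f = "\<lambda>\<xi>. G \<xi> * exp (\<i> * of_real (\<xi> \<bullet> x))"
  have "cnj (LINT \<xi>|lborel. ?f \<xi>) = (LINT \<xi>|lborel. cnj (?f \<xi>))"
    by (rule Bochner_Integration.integral_cnj[symmetric])
  also have "\<dots> = (LINT \<xi>|lborel. ?f (0 - \<xi>))" by (simp add: h exp_cnj)
  also have "\<dots> = (LINT \<xi>|lborel. ?f \<xi>)" by (rule lebesgue_integral_reflect) measurable
  finally have "cnj (inv_fourier G x) = inv_fourier G x" by (simp add: inv_fourier_alt)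
  then show ?thesis by (metis Reals_cnj_iff of_real_Re)
qed

lemma smooth_fun_cnj_reflect:
  fixes f :: "real^'n::finite \<Rightarrow> complex"
  assumes "smooth_fun f"
  shows "smooth_fun (\<lambda>x. cnj (f (- x)))"
\<comment> \<open>Each derivative of the reflected function produces a factor -1, which the real
  scalar in the class records.\<close>
proof (rule smooth_funI_closed[where F = "(\<lambda>(c, f) x. of_real c * cnj (f (- x))) ` (UNIV \<times> {f. smooth_fun f})"])
  have d: "((\<lambda>x. of_real c * cnj (f (- x))) has_derivative (\<lambda>h. of_real c * cnj (frechet_derivative f (at (- x)) (- h)))) (at x)"
    if "smooth_fun f" for c :: real and f :: "real^'n \<Rightarrow> complex" and x
  proof -
    have 1: "((\<lambda>x::real^'n. - x) has_derivative (\<lambda>h. - h)) (at x)" by (auto intro!: derivative_eq_intros)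
    have 2: "(f has_derivative frechet_derivative f (at (- x))) (at (- x))"
      using smooth_fun_differentiable[OF that] by (simp add: frechet_derivative_works)
    show ?thesis
      by (intro has_derivative_mult_right has_derivative_cnj has_derivative_compose[OF 1 2])
  qed
  fix g :: "real^'n \<Rightarrow> complex" and j x
  assume "g \<in> (\<lambda>(c, f) x. of_real c * cnj (f (- x))) ` (UNIV \<times> {f. smooth_fun f})"
  then obtain c f where g: "g = (\<lambda>x. of_real c * cnj (f (- x)))" and f: "smooth_fun f" by auto
  show "g differentiable at x" unfolding g differentiable_def using d[OF f] by blast
  have "partial j g = (\<lambda>x. of_real (- c) * cnj (partial j f (- x)))"
  proof
    fix x
    have "linear (frechet_derivative f (at (- x)))"
      using linear_frechet_derivative[OF smooth_fun_differentiable[OF f]] .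
    then show "partial j g x = of_real (- c) * cnj (partial j f (- x))"
      unfolding g by (subst partial_eqI[OF d[OF f]]) (simp add: linear_neg partial_def)
  qed
  then show "partial j g \<in> (\<lambda>(c, f) x. of_real c * cnj (f (- x))) ` (UNIV \<times> {f. smooth_fun f})"
    using smooth_fun_partial[OF f, of j] by (auto intro!: image_eqI[where x = "(- c, partial j f)"])
qed (use assms in \<open>auto intro!: image_eqI[where x = "(1, f)"]\<close>)

lemma test_fun_cnj_reflect:
  assumes "test_fun f"
  shows "test_fun (\<lambda>x. cnj (f (- x)))"
proof -
  obtain r where r: "r > 0" "\<And>x. norm x > r \<Longrightarrow> f x = 0" using test_fun_support[OF assms] by blast
  have "norm x \<le> r" if "cnj (f (- x)) \<noteq> 0" for x
    using that r(2)[of "- x"] by (cases "norm x > r") auto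
  then have "bounded {x. cnj (f (- x)) \<noteq> 0}" unfolding bounded_iff by blast
  then show ?thesis using smooth_fun_cnj_reflect[OF test_fun_smooth[OF assms]] by (simp add: test_fun_def)
qed

lemma fourier_cnj_reflect:
  fixes f :: "real^'n::finite \<Rightarrow> complex"
  assumes [measurable]: "f \<in> borel_measurable borel"
  shows "fourier (\<lambda>x. cnj (f (- x))) \<xi> = cnj (fourier f \<xi>)"
proof -
  let ?f = "\<lambda>x. f x * exp (\<i> * of_real (- \<xi> \<bullet> x))"
  have "cnj (LINT x|lborel. ?f x) = (LINT x|lborel. cnj (?f x))"
    by (rule Bochner_Integration.integral_cnj[symmetric])
  also have "\<dots> = (LINT x|lborel. cnj (?f (0 - x)))"
    by (rule lebesgue_integral_reflect[symmetric]) measurable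
  finally show ?thesis by (simp add: fourier_alt exp_cnj)
qed

text \<open>Reality is known only on real-valued Schwartz functions. With \<psi>(x) the conjugate of
  \<phi>(-x), the combination a \<phi> + \<open>cnj a\<close> \<psi> has a real transform for every
  complex a, so its pairing with \<open>g\<close> is real.\<close>

lemma real_valued_dist_hermitian:
  fixes f :: "'n::finite distribution"
  assumes f: "real_valued_dist f" and g: "is_L1loc_fun (fourier_dist f) g"
  shows "AE \<xi> in lborel. cnj (g (- \<xi>)) = g \<xi>"
proof -
  have l: "locally_integrable g" using g by (simp add: is_L1loc_fun_def)
  have [measurable]: "g \<in> borel_measurable borel" by (rule is_L1loc_fun_measurable[OF g])
  have l': "locally_integrable (\<lambda>\<xi>. cnj (g (- \<xi>)))"
  proof (rule locally_integrable_iff_cball)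
    fix r :: real
    have "integrable lborel (\<lambda>x. cnj (indicator (cball 0 r) (0 + (-1) *\<^sub>R x) *\<^sub>R g (0 + (-1) *\<^sub>R x)))"
      by (intro integrable_cnj integrable_affine[OF locally_integrable_cball[OF l]]) simp
    then show "integrable lborel (\<lambda>x. indicator (cball 0 r) x *\<^sub>R cnj (g (- x)))"
      by (simp add: indicator_def)
  qed measurable
  have "AE \<xi> in lborel. cnj (g (- \<xi>)) - g \<xi> = 0"
  proof (rule du_bois_reymond)
    show "locally_integrable (\<lambda>\<xi>. cnj (g (- \<xi>)) - g \<xi>)" by (intro locally_integrable_diff l l')
    fix \<phi> :: "real^'n \<Rightarrow> complex" assume t: "test_fun \<phi>"
    have [measurable]: "\<phi> \<in> borel_measurable borel" by (intro smooth_fun_measurable test_fun_smooth t)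
    define \<psi> where "\<psi> x = cnj (\<phi> (- x))" for x
    have t': "test_fun \<psi>" unfolding \<psi>_def by (rule test_fun_cnj_reflect[OF t])
    have real: "a * (LINT x|lborel. g x * \<phi> x) + cnj a * (LINT x|lborel. g x * \<psi> x) \<in> \<real>" for a
    proof -
      let ?\<chi> = "\<lambda>x. a * \<phi> x + cnj a * \<psi> x"
      have tc: "test_fun ?\<chi>"
      proof -
        have "bounded ({x. \<phi> x \<noteq> 0} \<union> {x. \<psi> x \<noteq> 0})" using t t' by (simp add: test_fun_def)
        moreover have "{x. ?\<chi> x \<noteq> 0} \<subseteq> {x. \<phi> x \<noteq> 0} \<union> {x. \<psi> x \<noteq> 0}" by auto
        ultimately have "bounded {x. ?\<chi> x \<noteq> 0}" by (rule bounded_subset)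
        then show ?thesis
          unfolding test_fun_def
          by (rule conjI[OF smooth_fun_add[OF smooth_fun_mult[OF smooth_fun_const test_fun_smooth[OF t]] smooth_fun_mult[OF smooth_fun_const test_fun_smooth[OF t']]]])
      qed
      have "fourier ?\<chi> \<xi> \<in> \<real>" for \<xi>
      proof -
        have "fourier ?\<chi> \<xi> = fourier (\<lambda>x. a * \<phi> x) \<xi> + fourier (\<lambda>x. cnj a * \<psi> x) \<xi>"
        proof -
          have "integrable lborel (\<lambda>x. a * \<phi> x)" "integrable lborel (\<lambda>x. cnj a * \<psi> x)"
            using test_fun_integrable[OF t] test_fun_integrable[OF t'] by auto
          note i = integrable_mult_iexp(2)[OF this(1), of "- \<xi>"] integrable_mult_iexp(2)[OF this(2), of "- \<xi>"]
          show ?thesis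
            unfolding fourier_alt distrib_right Bochner_Integration.integral_add[OF i] distrib_left ..
        qed
        also have "fourier (\<lambda>x. cnj a * \<psi> x) \<xi> = cnj (fourier (\<lambda>x. a * \<phi> x) \<xi>)"
          using fourier_cnj_reflect[of "\<lambda>x. a * \<phi> x" \<xi>] by (simp add: \<psi>_def)
        finally show ?thesis by (simp add: complex_add_cnj)
      qed
      then have "f (fourier ?\<chi>) \<in> \<real>"
        using f schwartz_fourier_test_fun[OF tc] unfolding real_valued_dist_def by blast
      moreover have "f (fourier ?\<chi>) = (LINT x|lborel. g x * ?\<chi> x)"
        using g tc by (simp add: is_L1loc_fun_def fourier_dist_def fun_dist_def)
      moreover have "(LINT x|lborel. g x * ?\<chi> x) = a * (LINT x|lborel. g x * \<phi> x) + cnj a * (LINT x|lborel. g x * \<psi> x)"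
      proof -
        have "(LINT x|lborel. g x * ?\<chi> x) = (LINT x|lborel. a * (g x * \<phi> x) + cnj a * (g x * \<psi> x))"
          by (simp add: algebra_simps)
        then show ?thesis
          using locally_integrable_test_fun[OF l t] locally_integrable_test_fun[OF l t'] by simp
      qed
      ultimately show ?thesis by simp
    qed
    define A B where "A = (LINT x|lborel. g x * \<phi> x)" and "B = (LINT x|lborel. g x * \<psi> x)"
    \<comment> \<open>a = 1 gives the imaginary part and a = i the real part of
      \<open>cnj B = A\<close>.\<close>
    have "A + B \<in> \<real>" "\<i> * A - \<i> * B \<in> \<real>" using real[of 1] real[of \<i>] by (auto simp: A_def B_def)
    then have AB: "cnj B = A" by (auto simp: complex_is_Real_iff complex_eq_iff)
    have "(LINT x|lborel. cnj (g (- x)) * \<phi> x) = (LINT x|lborel. cnj (g (0 - x) * \<psi> (0 - x)))"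
      by (simp add: \<psi>_def)
    also have "\<dots> = (LINT x|lborel. cnj (g x * \<psi> x))"
      unfolding \<psi>_def by (rule lebesgue_integral_reflect) measurable
    also have "\<dots> = cnj B" unfolding B_def by (rule Bochner_Integration.integral_cnj)
    finally have "(LINT x|lborel. cnj (g (- x)) * \<phi> x) = (LINT x|lborel. g x * \<phi> x)" by (simp add: AB A_def)
    then show "(LINT x|lborel. (cnj (g (- x)) - g x) * \<phi> x) = 0"
      using locally_integrable_test_fun[OF l t] locally_integrable_test_fun[OF l' t]
      by (simp add: left_diff_distrib)
  qed
  then show ?thesis by simp
qed

subsection \<open>The initial datum as a function\<close>

lemma prod_le_sum_squares:
  fixes a b :: real
  assumes "0 \<le> a" "0 \<le> b"
  shows "a * b \<le> a\<^sup>2 + b\<^sup>2"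
  using sum_squares_bound[of a b] mult_nonneg_nonneg[OF assms] by linarith

text \<open>Half-open shells partition the frequencies of modulus at least 1, so in the dyadic
  decomposition each such frequency belongs to exactly one piece.\<close>

lemma dyadic_shell_unique:
  assumes "x \<ge> (1::real)"
  shows "\<exists>!k::nat. 2 ^ k \<le> x \<and> x < 2 ^ Suc k"
proof -
  define k where "k = nat \<lfloor>log 2 x\<rfloor>"
  have l: "log 2 x \<ge> 0" using assms by (subst zero_le_log_cancel_iff) auto
  have k: "real k \<le> log 2 x" "log 2 x < real k + 1" unfolding k_def using l by linarith+
  have x: "x = 2 powr log 2 x" using assms by (subst powr_log_cancel) auto
  have "2 powr real k \<le> 2 powr log 2 x" "2 powr log 2 x < 2 powr (real (Suc k))" using k by auto
  then have "2 ^ k \<le> x" "x < 2 ^ Suc k" unfolding powr_realpow[of 2, simplified] x[symmetric] by auto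
  moreover have "j = k" if "2 ^ j \<le> x" "x < 2 ^ Suc j" "2 ^ k \<le> x" "x < 2 ^ Suc k" for j k :: nat
  proof -
    have "(2::real) ^ j < 2 ^ Suc k" "(2::real) ^ k < 2 ^ Suc j" using that by linarith+
    then have "j < Suc k" "k < Suc j" by (auto intro: power_less_imp_less_exp[of "2::real"] simp del: power_Suc)
    then show ?thesis by simp
  qed
  ultimately show ?thesis by blast
qed

text \<open>The inverse transform of \<open>g\<close> is not given by an absolutely convergent integral. The pieces of \<open>g\<close>
  on the dyadic shells have inverse transforms in \<open>L\<^sup>2\<close> with geometrically decreasing norms.\<close>

theorem low_regularity_representation:
  fixes g :: "real^'n::finite \<Rightarrow> complex"
  assumes [measurable]: "g \<in> borel_measurable borel" and herm: "\<And>\<xi>. g (- \<xi>) = cnj (g \<xi>)"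
    and low: "integrable lborel (\<lambda>\<xi>. indicator (ball 0 1) \<xi> *\<^sub>R g \<xi>)"
    and high: "integrable lborel (\<lambda>\<xi>. indicator (- ball 0 1) \<xi> * (norm \<xi> * (cmod (g \<xi>))\<^sup>2))"
  obtains h :: "real^'n \<Rightarrow> real" where "slow_growth (\<lambda>x. of_real (h x))"
    "\<And>\<phi>. schwartz \<phi> \<Longrightarrow> integrable lborel (\<lambda>\<xi>. g \<xi> * inv_fourier \<phi> \<xi>) \<and>
       (LINT x|lborel. of_real (h x) * \<phi> x) = (LINT \<xi>|lborel. g \<xi> * inv_fourier \<phi> \<xi>)"
proof -
  define S where "S k = {\<xi>::real^'n. 2 ^ k \<le> norm \<xi> \<and> norm \<xi> < 2 ^ Suc k}" for k :: nat
  have Sm[measurable]: "S k \<in> sets borel" for k unfolding S_def by measurable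
  define G where "G k \<xi> = indicator (S k) \<xi> *\<^sub>R g \<xi>" for k \<xi>
  define G0 where "G0 \<xi> = indicator (ball 0 1) \<xi> *\<^sub>R g \<xi>" for \<xi>
  have [measurable]: "ball (0::real^'n) 1 \<in> sets borel" by simp
  have [measurable]: "G k \<in> borel_measurable borel" "G0 \<in> borel_measurable borel" for k
    using assms(1) unfolding G_def[abs_def] G0_def[abs_def] by measurable
  have Gherm: "G k (- \<xi>) = cnj (G k \<xi>)" "G0 (- \<xi>) = cnj (G0 \<xi>)" for k \<xi>
    by (auto simp: G_def G0_def S_def herm indicator_def)
  define M where "M = (LINT \<xi>|lborel. indicator (- ball 0 1) \<xi> * (norm \<xi> * (cmod (g \<xi>))\<^sup>2))"
  have M0: "M \<ge> 0" unfolding M_def by (intro integral_nonneg_AE) auto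
  \<comment> \<open>On shell k the weight |\<xi>| is at least 2^k; this is the origin of the
    geometric factor.\<close>
  have Gsq: "(cmod (G k \<xi>))\<^sup>2 \<le> (1 / 2) ^ k * (indicator (- ball 0 1) \<xi> * (norm \<xi> * (cmod (g \<xi>))\<^sup>2))" for k \<xi>
  proof (cases "\<xi> \<in> S k")
    case True
    then have n: "2 ^ k \<le> norm \<xi>" by (simp add: S_def)
    then have "norm \<xi> \<ge> 1" using one_le_power[of 2 k] by (rule order_trans[rotated]) simp
    moreover have "1 * (cmod (g \<xi>))\<^sup>2 \<le> ((1 / 2) ^ k * norm \<xi>) * (cmod (g \<xi>))\<^sup>2"
      using n by (intro mult_right_mono) (auto simp: power_divide field_simps)
    ultimately show ?thesis using True by (simp add: G_def mult_ac)
  qed (simp add: G_def)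
  have G2i: "integrable lborel (\<lambda>\<xi>. (cmod (G k \<xi>))\<^sup>2)" for k
    by (rule Bochner_Integration.integrable_bound[OF integrable_mult_right[OF high, of "(1 / 2) ^ k"]])
      (use order_trans[OF Gsq abs_ge_self] in simp_all)
  have G2: "(LINT \<xi>|lborel. (cmod (G k \<xi>))\<^sup>2) \<le> (1 / 2) ^ k * M" for k
  proof -
    have "(LINT \<xi>|lborel. (cmod (G k \<xi>))\<^sup>2) \<le> (LINT \<xi>|lborel. (1 / 2) ^ k * (indicator (- ball 0 1) \<xi> * (norm \<xi> * (cmod (g \<xi>))\<^sup>2)))"
      by (rule integral_mono[OF G2i integrable_mult_right[OF high] Gsq])
    also have "\<dots> = (1 / 2) ^ k * M" unfolding M_def by (rule integral_mult_right_zero)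
    finally show ?thesis .
  qed
  \<comment> \<open>Bounded support and |G| \<le> 1 + |G|^2 upgrade square integrability to
    integrability, so each piece has a classical inverse transform.\<close>
  have Gi: "integrable lborel (G k)" for k
  proof (rule Bochner_Integration.integrable_bound)
    show "integrable lborel (\<lambda>\<xi>::real^'n. indicator (cball 0 (2 ^ Suc k)) \<xi> + (cmod (G k \<xi>))\<^sup>2)"
      using emeasure_lborel_cball_finite[of "0::real^'n" "2 ^ Suc k"]
      by (intro Bochner_Integration.integrable_add G2i integrable_real_indicator) auto
    show "AE \<xi> in lborel. norm (G k \<xi>) \<le> norm (indicator (cball 0 (2 ^ Suc k)) \<xi> + (cmod (G k \<xi>))\<^sup>2)"
    proof (rule AE_I2)
      fix \<xi>
      have "cmod (G k \<xi>) \<le> 1 + (cmod (G k \<xi>))\<^sup>2"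
        using sum_squares_bound[of "cmod (G k \<xi>)" 1, unfolded power_one mult_1_right] norm_ge_zero[of "G k \<xi>"] by linarith
      then show "norm (G k \<xi>) \<le> norm (indicator (cball 0 (2 ^ Suc k)) \<xi> + (cmod (G k \<xi>))\<^sup>2)"
        by (cases "\<xi> \<in> S k") (auto simp: S_def G_def)
    qed
  qed measurable
  have G0i: "integrable lborel G0" using low by (simp add: G0_def[abs_def])
  define r where "r k x = Re (inv_fourier (G k) x)" for k x
  define r0 where "r0 x = Re (inv_fourier G0 x)" for x
  have r: "of_real (r k x) = inv_fourier (G k) x" and r0: "of_real (r0 x) = inv_fourier G0 x" for k x
    unfolding r_def r0_def by (rule inv_fourier_hermitian_real; simp add: Gherm)+
  have [measurable]: "r k \<in> borel_measurable borel" "r0 \<in> borel_measurable borel" for k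
    unfolding r_def[abs_def] r0_def[abs_def] by measurable
  have r2: "integrable lborel (\<lambda>x. (r k x)\<^sup>2)" "(LINT x|lborel. (r k x)\<^sup>2) \<le> (1 / 2) ^ k * M" for k
  proof -
    have e: "(r k x)\<^sup>2 = (cmod (inv_fourier (G k) x))\<^sup>2" for x
      unfolding r[symmetric] by simp
    have "(\<integral>\<^sup>+x. ennreal ((r k x)\<^sup>2) \<partial>lborel) \<le> (\<integral>\<^sup>+\<xi>. (cmod (G k \<xi>))\<^sup>2 \<partial>lborel)"
      unfolding e by (rule plancherel_inv_fourier_le[OF Gi])
    also have "\<dots> = ennreal (LINT \<xi>|lborel. (cmod (G k \<xi>))\<^sup>2)"
      by (rule nn_integral_eq_integral[OF G2i]) simp
    also have "\<dots> \<le> ennreal ((1 / 2) ^ k * M)" by (rule ennreal_leI[OF G2])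
    finally have n: "(\<integral>\<^sup>+x. ennreal ((r k x)\<^sup>2) \<partial>lborel) \<le> ennreal ((1 / 2) ^ k * M)" .
    show i: "integrable lborel (\<lambda>x. (r k x)\<^sup>2)"
      using n by (intro integrableI_bounded) (auto intro: le_less_trans)
    have "ennreal (LINT x|lborel. (r k x)\<^sup>2) \<le> ennreal ((1 / 2) ^ k * M)"
      using n by (subst (asm) nn_integral_eq_integral[OF i]) auto
    then show "(LINT x|lborel. (r k x)\<^sup>2) \<le> (1 / 2) ^ k * M"
      using M0 by (simp add: ennreal_le_iff)
  qed
  \<comment> \<open>a is the square root of 2 and b = 1/a. Weighting the k-th squared norm by a^k
    still leaves a^k (1/2)^k = b^k, which is summable.\<close>
  define a b where "a = (2::real) powr (1 / 2)" and "b = (2::real) powr (- 1 / 2)"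
  have ab: "a > 0" "b > 0" "a * b = 1" "b < 1" "a * (1 / 2) = b"
  proof -
    show "a > 0" "b > 0" by (simp_all add: a_def b_def)
    show "a * b = 1" by (simp add: a_def b_def powr_add[symmetric])
    show "b < 1" unfolding b_def using powr_less_cancel_iff[of 2 "- 1 / 2" 0] by simp
    have "a * (1/2) = 2 powr (1/2) * 2 powr (-1)" by (simp add: a_def powr_minus)
    also have "\<dots> = b" unfolding powr_add[symmetric] b_def by simp
    finally show "a * (1 / 2) = b" .
  qed
  text \<open>Weighted AM-GM with weights \<open>2\<^bsup>k/2\<^esup>\<close> makes the series of the pieces converge absolutely
    against any square integrable function.\<close>
  have sumbound: "integrable lborel (\<lambda>x. r k x * w x)" "(LINT x|lborel. \<bar>r k x * w x\<bar>) \<le> b ^ k * (M + (LINT x|lborel. (w x)\<^sup>2))"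
    if [measurable]: "w \<in> borel_measurable borel" and w: "integrable lborel (\<lambda>x. (w x)\<^sup>2)" for w :: "real^'n \<Rightarrow> real" and k
  proof -
    have pt: "\<bar>r k x * w x\<bar> \<le> a ^ k * (r k x)\<^sup>2 + b ^ k * (w x)\<^sup>2" for x
    proof -
      define u v where "u = \<bar>r k x\<bar>" and "v = \<bar>w x\<bar>"
      have "0 \<le> a ^ k * (u - b ^ k * v)\<^sup>2" using ab by simp
      also have "\<dots> = a ^ k * u\<^sup>2 - 2 * (a ^ k * b ^ k) * (u * v) + (a ^ k * b ^ k) * b ^ k * v\<^sup>2"
        by (simp add: power2_eq_square algebra_simps)
      finally have "0 \<le> a ^ k * u\<^sup>2 - 2 * (a ^ k * b ^ k) * (u * v) + (a ^ k * b ^ k) * b ^ k * v\<^sup>2" .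
      moreover have "a ^ k * b ^ k = 1" unfolding power_mult_distrib[symmetric] ab(3) by simp
      ultimately have "2 * (u * v) \<le> a ^ k * u\<^sup>2 + b ^ k * v\<^sup>2" by simp
      moreover have "0 \<le> u * v" by (simp add: u_def v_def)
      ultimately have "u * v \<le> a ^ k * u\<^sup>2 + b ^ k * v\<^sup>2" by linarith
      then show ?thesis by (simp add: u_def v_def abs_mult)
    qed
    have i: "integrable lborel (\<lambda>x. a ^ k * (r k x)\<^sup>2 + b ^ k * (w x)\<^sup>2)"
      using r2(1) w by simp
    show i': "integrable lborel (\<lambda>x. r k x * w x)"
      by (rule Bochner_Integration.integrable_bound[OF i]) (use order_trans[OF pt abs_ge_self] in simp_all)
    have "(LINT x|lborel. \<bar>r k x * w x\<bar>) \<le> (LINT x|lborel. a ^ k * (r k x)\<^sup>2 + b ^ k * (w x)\<^sup>2)"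
      using i' by (intro integral_mono i pt) simp
    also have "\<dots> = a ^ k * (LINT x|lborel. (r k x)\<^sup>2) + b ^ k * (LINT x|lborel. (w x)\<^sup>2)"
      using r2(1) w by simp
    also have "\<dots> \<le> a ^ k * ((1 / 2) ^ k * M) + b ^ k * (LINT x|lborel. (w x)\<^sup>2)"
      using ab r2(2)[of k] by (intro add_right_mono mult_left_mono) auto
    also have "a ^ k * ((1 / 2) ^ k * M) = b ^ k * M"
      unfolding mult.assoc[symmetric] power_mult_distrib[symmetric] ab ..
    finally show "(LINT x|lborel. \<bar>r k x * w x\<bar>) \<le> b ^ k * (M + (LINT x|lborel. (w x)\<^sup>2))"
      by (simp add: distrib_left)
  qed
  have series: "integrable lborel (\<lambda>x. \<Sum>k. norm (r k x * w x))"
      "AE x in lborel. summable (\<lambda>k. norm (r k x * w x))"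
      "summable (\<lambda>k. LINT x|lborel. norm (r k x * w x))"
    if [measurable]: "w \<in> borel_measurable borel" and w: "integrable lborel (\<lambda>x. (w x)\<^sup>2)" for w :: "real^'n \<Rightarrow> real"
  proof -
    let ?W = "M + (LINT x|lborel. (w x)\<^sup>2)"
    show s: "summable (\<lambda>k. LINT x|lborel. norm (r k x * w x))"
    proof (rule summable_comparison_test')
      show "summable (\<lambda>k. b ^ k * ?W)" using ab by (intro summable_mult2 summable_geometric) simp
      show "norm (LINT x|lborel. norm (r k x * w x)) \<le> b ^ k * ?W" if "0 \<le> k" for k
        using sumbound(2)[OF _ w, of k] by (simp add: abs_of_nonneg)
    qed
    have i: "integrable lborel (\<lambda>x. norm (r k x * w x))" for k using sumbound(1)[OF _ w, of k] by (intro integrable_norm) simp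
    have "(\<integral>\<^sup>+x. (\<Sum>k. ennreal (norm (r k x * w x))) \<partial>lborel) = (\<Sum>k. \<integral>\<^sup>+x. ennreal (norm (r k x * w x)) \<partial>lborel)"
      by (rule nn_integral_suminf) measurable
    also have "\<dots> = (\<Sum>k. ennreal (LINT x|lborel. norm (r k x * w x)))"
      using nn_integral_eq_integral[OF i] by simp
    also have "\<dots> = ennreal (\<Sum>k. LINT x|lborel. norm (r k x * w x))"
      by (rule suminf_ennreal2[OF _ s]) simp
    finally have "(\<integral>\<^sup>+x. (\<Sum>k. ennreal (norm (r k x * w x))) \<partial>lborel) \<noteq> \<infinity>" by simp
    then have "AE x in lborel. (\<Sum>k. ennreal (norm (r k x * w x))) \<noteq> \<infinity>"
      by (rule nn_integral_PInf_AE[rotated]) measurable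
    then show a: "AE x in lborel. summable (\<lambda>k. norm (r k x * w x))"
    proof eventually_elim
      case (elim x)
      show ?case by (rule summable_suminf_not_top) (use elim in auto)
    qed
    show "integrable lborel (\<lambda>x. \<Sum>k. norm (r k x * w x))"
      by (rule integrable_suminf) (use i s a in auto)
  qed
  define f where "f x = (\<Sum>k. r k x)" for x
  have [measurable]: "f \<in> borel_measurable borel" unfolding f_def[abs_def] by measurable
  let ?N = "DIM(real^'n) + 1"
  \<comment> \<open>A strictly positive, square integrable weight: the series tested against it
    gives convergence almost everywhere and slow growth of the sum at once.\<close>
  define w where "w x = 1 / (1 + norm x) ^ ?N" for x :: "real^'n"
  have wp: "0 < w x" "w x \<le> 1" for x
    using one_plus_norm_power_ge_1[of x ?N] unfolding w_def by (simp_all del: power_Suc)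
  have [measurable]: "w \<in> borel_measurable borel" unfolding w_def[abs_def] by measurable
  have w2: "integrable lborel (\<lambda>x. (w x)\<^sup>2)"
  proof (rule Bochner_Integration.integrable_bound)
    show "integrable lborel w" unfolding w_def[abs_def] by (rule integrable_decay)
    show "AE x in lborel. norm ((w x)\<^sup>2) \<le> norm (w x)"
    proof (rule AE_I2)
      fix x show "norm ((w x)\<^sup>2) \<le> norm (w x)"
        using wp[of x] mult_left_le[of "w x" "w x"] by (simp add: power2_eq_square)
    qed
  qed measurable
  have sAE: "AE x in lborel. summable (\<lambda>k. \<bar>r k x\<bar>)"
    using series(2)[OF _ w2, simplified]
  proof eventually_elim
    case (elim x)
    then have "summable (\<lambda>k. \<bar>r k x\<bar> * w x)" using wp(1)[of x] by (simp add: abs_mult)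
    from summable_mult2[OF this, of "1 / w x"] show "summable (\<lambda>k. \<bar>r k x\<bar>)" using wp(1)[of x] by simp
  qed
  have fs: "slow_growth (\<lambda>x. complex_of_real (f x))"
    unfolding slow_growth_def
  proof (intro conjI exI)
    show "integrable lborel (\<lambda>x. cmod (of_real (f x)) / (1 + norm x) ^ ?N)"
    proof (rule Bochner_Integration.integrable_bound[OF series(1)[OF _ w2]])
      show "AE x in lborel. norm (cmod (of_real (f x)) / (1 + norm x) ^ ?N) \<le> norm (\<Sum>k. norm (r k x * w x))"
        using sAE
      proof eventually_elim
        case (elim x)
        have "\<bar>f x\<bar> \<le> (\<Sum>k. \<bar>r k x\<bar>)" unfolding f_def by (rule summable_rabs[OF elim])
        then have "\<bar>f x\<bar> * w x \<le> (\<Sum>k. \<bar>r k x\<bar>) * w x" using wp(1)[of x] by (intro mult_right_mono) auto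
        also have "\<dots> = (\<Sum>k. \<bar>r k x\<bar> * w x)" by (rule suminf_mult2[OF elim])
        also have "\<dots> = (\<Sum>k. norm (r k x * w x))" using wp(1)[of x] by (simp add: abs_mult)
        finally have A: "\<bar>f x\<bar> * w x \<le> (\<Sum>k. norm (r k x * w x))" .
        have B: "norm (cmod (of_real (f x)) / (1 + norm x) ^ ?N) = \<bar>f x\<bar> * w x"
          by (simp add: w_def abs_mult)
        show ?case unfolding B by (rule order_trans[OF A]) (simp add: abs_ge_self)
      qed
    qed measurable
  qed measurable
  show ?thesis
  proof (rule that)
    show "slow_growth (\<lambda>x. complex_of_real (r0 x + f x))"
      unfolding of_real_add r0 by (rule slow_growth_add[OF inv_fourier_slow_growth[OF G0i] fs])
    fix \<phi> :: "real^'n \<Rightarrow> complex" assume s: "schwartz \<phi>"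
    have [measurable]: "\<phi> \<in> borel_measurable borel" by (rule schwartz_measurable[OF s])
    have \<phi>i: "integrable lborel \<phi>" by (rule schwartz_integrable[OF s])
    let ?p = "inv_fourier \<phi>"
    obtain P where P: "\<And>\<xi>. cmod (?p \<xi>) \<le> P" using inv_fourier_bound[OF \<phi>i] by blast
    have p2: "integrable lborel (\<lambda>\<xi>. (cmod (?p \<xi>))\<^sup>2)"
    proof (rule integrableI_bounded)
      have "(\<integral>\<^sup>+\<xi>. ennreal ((cmod (?p \<xi>))\<^sup>2) \<partial>lborel) \<le> (\<integral>\<^sup>+x. (cmod (\<phi> x))\<^sup>2 \<partial>lborel)"
        by (rule plancherel_inv_fourier_le[OF \<phi>i])
      also have "\<dots> < \<infinity>" using schwartz_square_integrable[OF s] by (simp add: integrable_iff_bounded)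
      finally show "(\<integral>\<^sup>+\<xi>. ennreal (norm ((cmod (?p \<xi>))\<^sup>2)) \<partial>lborel) < \<infinity>" by simp
    qed measurable
    have gp: "integrable lborel (\<lambda>\<xi>. g \<xi> * ?p \<xi>)"
    proof (rule Bochner_Integration.integrable_bound)
      show "integrable lborel (\<lambda>\<xi>. P * cmod (G0 \<xi>) + (indicator (- ball 0 1) \<xi> * (norm \<xi> * (cmod (g \<xi>))\<^sup>2) + (cmod (?p \<xi>))\<^sup>2))"
        using G0i high p2 by simp
      show "AE \<xi> in lborel. norm (g \<xi> * ?p \<xi>) \<le> norm (P * cmod (G0 \<xi>) + (indicator (- ball 0 1) \<xi> * (norm \<xi> * (cmod (g \<xi>))\<^sup>2) + (cmod (?p \<xi>))\<^sup>2))"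
      proof (rule AE_I2)
        fix \<xi>
        have P0: "0 \<le> P" using order_trans[OF norm_ge_zero P] .
        show "norm (g \<xi> * ?p \<xi>) \<le> norm (P * cmod (G0 \<xi>) + (indicator (- ball 0 1) \<xi> * (norm \<xi> * (cmod (g \<xi>))\<^sup>2) + (cmod (?p \<xi>))\<^sup>2))"
        proof (cases "norm \<xi> < 1")
          case True
          have "cmod (g \<xi>) * cmod (?p \<xi>) \<le> P * cmod (g \<xi>)"
            using mult_left_mono[OF P, of "cmod (g \<xi>)" \<xi>] by (simp add: mult.commute)
          also have "\<dots> \<le> P * cmod (g \<xi>) + (cmod (?p \<xi>))\<^sup>2" by simp
          finally show ?thesis using True P0 by (simp add: G0_def norm_mult)
        next
          case False
          have "cmod (g \<xi>) * cmod (?p \<xi>) \<le> (cmod (g \<xi>))\<^sup>2 + (cmod (?p \<xi>))\<^sup>2"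
            by (rule prod_le_sum_squares) auto
          also have "\<dots> \<le> norm \<xi> * (cmod (g \<xi>))\<^sup>2 + (cmod (?p \<xi>))\<^sup>2"
            using False mult_right_mono[of 1 "norm \<xi>" "(cmod (g \<xi>))\<^sup>2"] by simp
          finally show ?thesis using False by (simp add: G0_def norm_mult)
        qed
      qed
    qed measurable
    have dual: "(LINT x|lborel. of_real (r k x) * \<phi> x) = (LINT \<xi>|lborel. G k \<xi> * ?p \<xi>)" for k
      unfolding r by (rule inv_fourier_duality[OF Gi \<phi>i])
    have dual0: "(LINT x|lborel. of_real (r0 x) * \<phi> x) = (LINT \<xi>|lborel. G0 \<xi> * ?p \<xi>)"
      unfolding r0 by (rule inv_fourier_duality[OF G0i \<phi>i])
    have \<phi>2: "integrable lborel (\<lambda>x. (cmod (\<phi> x))\<^sup>2)" by (rule schwartz_square_integrable[OF s])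
    \<comment> \<open>The pairing is summed over the pieces on both sides. Duality identifies the
      terms, so uniqueness of sums gives the formula without an inverse transform of the whole of
      \<open>g\<close>.\<close>
    have s1: "(\<lambda>k. LINT x|lborel. of_real (r k x) * \<phi> x) sums (LINT x|lborel. of_real (f x) * \<phi> x)"
    proof -
      have i: "integrable lborel (\<lambda>x. of_real (r k x) * \<phi> x)" for k
        by (rule Bochner_Integration.integrable_bound[OF sumbound(1)[OF _ \<phi>2]]) (auto simp: norm_mult abs_mult)
      have n: "norm (of_real (r k x) * \<phi> x) = norm (r k x * cmod (\<phi> x))" for k x
        by (simp add: norm_mult abs_mult)
      have "(\<lambda>k. LINT x|lborel. of_real (r k x) * \<phi> x) sums (LINT x|lborel. (\<Sum>k. of_real (r k x) * \<phi> x))"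
        by (rule sums_integral[OF i]) (unfold n, use series(2,3)[OF _ \<phi>2] in auto)
      also have "(LINT x|lborel. (\<Sum>k. of_real (r k x) * \<phi> x)) = (LINT x|lborel. of_real (f x) * \<phi> x)"
      proof (rule integral_cong_AE)
        show "AE x in lborel. (\<Sum>k. of_real (r k x) * \<phi> x) = of_real (f x) * \<phi> x"
          using sAE
        proof eventually_elim
          case (elim x)
          have sm: "summable (\<lambda>k. r k x)" using summable_rabs_cancel[OF elim] .
          have "(\<lambda>k. of_real (r k x) * \<phi> x) sums (of_real (f x) * \<phi> x)"
            unfolding f_def by (intro sums_mult2 sums_of_real summable_sums sm)
          then show ?case by (rule sums_unique[symmetric])
        qed
      qed measurable
      finally show ?thesis .
    qed
    have s2: "(\<lambda>k. LINT \<xi>|lborel. G k \<xi> * ?p \<xi>) sums ((LINT \<xi>|lborel. g \<xi> * ?p \<xi>) - (LINT \<xi>|lborel. G0 \<xi> * ?p \<xi>))"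
    proof -
      have G0p: "integrable lborel (\<lambda>\<xi>. G0 \<xi> * ?p \<xi>)"
        by (rule Bochner_Integration.integrable_bound[OF gp]) (auto simp: G0_def norm_mult indicator_def)
      have Gp: "integrable lborel (\<lambda>\<xi>. G k \<xi> * ?p \<xi>)" for k
        by (rule Bochner_Integration.integrable_bound[OF gp]) (auto simp: G_def norm_mult indicator_def)
      have pt: "(\<lambda>k. G k \<xi>) sums (g \<xi> - G0 \<xi>)" "(\<lambda>k. norm (G k \<xi>)) sums norm (g \<xi> - G0 \<xi>)" for \<xi>
      proof -
        have "(\<lambda>k. G k \<xi>) sums (g \<xi> - G0 \<xi>) \<and> (\<lambda>k. norm (G k \<xi>)) sums norm (g \<xi> - G0 \<xi>)"
        proof (cases "norm \<xi> < 1")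
          case True
          have "\<not> 2 ^ k \<le> norm \<xi>" for k using True one_le_power[of "2::real" k] by linarith
          then have "G k \<xi> = 0" for k by (simp add: G_def S_def)
          then show ?thesis using True by (simp add: G0_def)
        next
          case False
          then have "norm \<xi> \<ge> 1" by simp
          from dyadic_shell_unique[OF this] have "\<exists>!k. \<xi> \<in> S k" by (simp add: S_def)
          then obtain k where k: "\<xi> \<in> S k" "\<And>j. \<xi> \<in> S j \<Longrightarrow> j = k" by blast
          have e: "G j \<xi> = (if j = k then g \<xi> else 0)" for j
          proof (cases "j = k")
            case False
            then have "\<xi> \<notin> S j" using k(2)[of j] by blast
            then show ?thesis using False by (simp add: G_def)
          qed (simp add: G_def k(1))
          have e': "norm (G j \<xi>) = (if j = k then norm (g \<xi>) else 0)" for j by (simp add: e)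
          have "G0 \<xi> = 0" using False by (simp add: G0_def)
          moreover have "(\<lambda>j. G j \<xi>) sums g \<xi>" unfolding e by (rule sums_single)
          moreover have "(\<lambda>j. norm (G j \<xi>)) sums norm (g \<xi>)" unfolding e' by (rule sums_single)
          ultimately show ?thesis by simp
        qed
        then show "(\<lambda>k. G k \<xi>) sums (g \<xi> - G0 \<xi>)" "(\<lambda>k. norm (G k \<xi>)) sums norm (g \<xi> - G0 \<xi>)" by auto
      qed
      have nsum: "(\<lambda>k. LINT \<xi>|lborel. norm (G k \<xi> * ?p \<xi>)) sums (LINT \<xi>|lborel. norm ((g \<xi> - G0 \<xi>) * ?p \<xi>))"
      proof -
        have psum: "(\<Sum>i<k. LINT \<xi>|lborel. norm (G i \<xi> * ?p \<xi>)) = (LINT \<xi>|lborel. (\<Sum>i<k. norm (G i \<xi> * ?p \<xi>)))" for k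
          using Gp by (subst Bochner_Integration.integral_sum) auto
        show ?thesis
          unfolding sums_def psum
        proof (rule integral_dominated_convergence[where w = "\<lambda>\<xi>. norm (g \<xi> * ?p \<xi>)"])
          have "(\<lambda>k. norm (G k \<xi> * ?p \<xi>)) sums norm ((g \<xi> - G0 \<xi>) * ?p \<xi>)" for \<xi>
            unfolding norm_mult by (rule sums_mult2[OF pt(2)])
          note sm = this
          show "AE \<xi> in lborel. (\<lambda>k. \<Sum>i<k. norm (G i \<xi> * ?p \<xi>)) \<longlonglongrightarrow> norm ((g \<xi> - G0 \<xi>) * ?p \<xi>)"
            using sm unfolding sums_def by simp
          show "AE \<xi> in lborel. norm (\<Sum>i<k. norm (G i \<xi> * ?p \<xi>)) \<le> norm (g \<xi> * ?p \<xi>)" for k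
          proof (rule AE_I2)
            fix \<xi>
            have "(\<Sum>i<k. norm (G i \<xi> * ?p \<xi>)) \<le> norm ((g \<xi> - G0 \<xi>) * ?p \<xi>)"
              using sum_le_suminf[OF sums_summable[OF sm[of \<xi>]], of "{..<k}"] sums_unique[OF sm[of \<xi>]] by simp
            also have "\<dots> \<le> norm (g \<xi> * ?p \<xi>)" by (auto simp: G0_def norm_mult indicator_def)
            finally show "norm (\<Sum>i<k. norm (G i \<xi> * ?p \<xi>)) \<le> norm (g \<xi> * ?p \<xi>)" by (simp add: sum_nonneg)
          qed
          show "integrable lborel (\<lambda>\<xi>. norm (g \<xi> * ?p \<xi>))" using gp by (rule integrable_norm)
        qed measurable
      qed
      have "(\<lambda>k. LINT \<xi>|lborel. G k \<xi> * ?p \<xi>) sums (LINT \<xi>|lborel. (\<Sum>k. G k \<xi> * ?p \<xi>))"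
      proof (rule sums_integral[OF Gp])
        show "AE \<xi> in lborel. summable (\<lambda>k. norm (G k \<xi> * ?p \<xi>))"
          unfolding norm_mult by (intro AE_I2 summable_mult2 sums_summable[OF pt(2)])
        show "summable (\<lambda>k. LINT \<xi>|lborel. norm (G k \<xi> * ?p \<xi>))" by (rule sums_summable[OF nsum])
      qed
      also have "(LINT \<xi>|lborel. (\<Sum>k. G k \<xi> * ?p \<xi>)) = (LINT \<xi>|lborel. g \<xi> * ?p \<xi> - G0 \<xi> * ?p \<xi>)"
      proof (rule Bochner_Integration.integral_cong[OF refl])
        fix \<xi>
        have "(\<lambda>k. G k \<xi> * ?p \<xi>) sums ((g \<xi> - G0 \<xi>) * ?p \<xi>)" by (rule sums_mult2[OF pt(1)])
        from sums_unique[OF this] show "(\<Sum>k. G k \<xi> * ?p \<xi>) = g \<xi> * ?p \<xi> - G0 \<xi> * ?p \<xi>"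
          by (simp add: left_diff_distrib)
      qed
      also have "\<dots> = (LINT \<xi>|lborel. g \<xi> * ?p \<xi>) - (LINT \<xi>|lborel. G0 \<xi> * ?p \<xi>)"
        by (rule Bochner_Integration.integral_diff[OF gp G0p])
      finally show ?thesis .
    qed
    have "(LINT x|lborel. of_real (f x) * \<phi> x) = (LINT \<xi>|lborel. g \<xi> * ?p \<xi>) - (LINT \<xi>|lborel. G0 \<xi> * ?p \<xi>)"
      by (rule sums_unique2[OF s1[unfolded dual] s2])
    moreover have "(LINT x|lborel. of_real (r0 x + f x) * \<phi> x) = (LINT x|lborel. of_real (r0 x) * \<phi> x) + (LINT x|lborel. of_real (f x) * \<phi> x)"
    proof -
      have "integrable lborel (\<lambda>x. of_real (r0 x) * \<phi> x)"
        unfolding r0 by (rule slow_growth_integrable(1)[OF inv_fourier_slow_growth[OF G0i] s])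
      then show ?thesis using slow_growth_integrable(1)[OF fs s] by (simp add: distrib_right)
    qed
    ultimately show "integrable lborel (\<lambda>\<xi>. g \<xi> * ?p \<xi>) \<and>
        (LINT x|lborel. of_real (r0 x + f x) * \<phi> x) = (LINT \<xi>|lborel. g \<xi> * ?p \<xi>)"
      using gp dual0 by simp
  qed
qed

subsection \<open>Weighted estimates for convolutions and the Duhamel integral\<close>

text \<open>The squared homogeneous Sobolev norm of order p/2, seen on the Fourier side. Values in
  \<open>ennreal\<close> allow estimates to be stated before finiteness is known.\<close>

definition wint :: "real \<Rightarrow> (real^'n::finite \<Rightarrow> ennreal) \<Rightarrow> ennreal" where
  "wint p V = (\<integral>\<^sup>+\<xi>. ennreal (norm \<xi> powr p) * (V \<xi>)\<^sup>2 \<partial>lborel)"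

definition nconv :: "(real^'n::finite \<Rightarrow> ennreal) \<Rightarrow> (real^'n \<Rightarrow> ennreal) \<Rightarrow> real^'n \<Rightarrow> ennreal" where
  "nconv V W \<xi> = (\<integral>\<^sup>+\<eta>. V (\<xi> - \<eta>) * W \<eta> \<partial>lborel)"

lemma powr_half_power2: "((x::real) powr (p / 2))\<^sup>2 = x powr p"
  by (simp add: power2_eq_square powr_add[symmetric])

lemma ennreal_powr_half_power2: "(ennreal (x powr (p / 2)))\<^sup>2 = ennreal (x powr p)"
  by (simp add: ennreal_power powr_half_power2)

lemma ennreal_prod_le_sum_squares: "(a::ennreal) * b \<le> a\<^sup>2 + b\<^sup>2"
proof (cases "a \<le> b")
  case True
  then have "a * b \<le> b\<^sup>2" by (simp add: power2_eq_square mult_right_mono)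
  then show ?thesis by (simp add: add_increasing)
next
  case False
  then have "a * b \<le> a\<^sup>2" by (simp add: power2_eq_square mult_left_mono)
  then show ?thesis by (simp add: add_increasing2)
qed

lemma ennreal_square_add_le: "((a::ennreal) + b)\<^sup>2 \<le> 2 * a\<^sup>2 + 2 * b\<^sup>2"
proof (cases "a = \<top> \<or> b = \<top>")
  case True
  then show ?thesis by (auto simp: power2_eq_square ennreal_mult_top ennreal_top_mult)
next
  case False
  then obtain x y where xy: "a = ennreal x" "b = ennreal y" "x \<ge> 0" "y \<ge> 0"
    by (metis ennreal_cases)
  have "(x + y)\<^sup>2 \<le> 2 * x\<^sup>2 + 2 * y\<^sup>2" using sum_squares_bound[of x y] by (simp add: power2_sum)
  then have "ennreal ((x + y)\<^sup>2) \<le> ennreal (2 * x\<^sup>2 + 2 * y\<^sup>2)" by (rule ennreal_leI)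
  then show ?thesis using xy by (simp add: ennreal_power[symmetric] ennreal_mult')
qed

text \<open>The larger of |\<eta>| and |\<xi> - \<eta>| is at least R = |\<xi>|/2, so the kernel is
  at most \<open>k R\<close> evaluated at the smaller vector. Scaling reduces \<open>k R\<close> to
  \<open>k 1\<close>, which is integrable near 0 because q < n and at infinity because 2q >
  n.\<close>

lemma riesz_kernel_bound:
  fixes q :: real
  assumes q: "real CARD('n::finite) < 2 * q" "q < CARD('n)"
  obtains C where "C \<ge> 0" "\<And>\<xi> :: real^'n. \<xi> \<noteq> 0 \<Longrightarrow>
    (\<integral>\<^sup>+\<eta>. ennreal (norm (\<xi> - \<eta>) powr (- q) * norm \<eta> powr (- q)) \<partial>lborel) \<le> ennreal (C * norm \<xi> powr (real CARD('n) - 2 * q))"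
proof -
  have q0: "q > 0" using q by linarith
  define k where "k R \<eta> = norm \<eta> powr (- q) * max R (norm \<eta>) powr (- q)" for R and \<eta> :: "real^'n"
  have [measurable]: "k R \<in> borel_measurable borel" for R unfolding k_def[abs_def] by measurable
  have "(\<integral>\<^sup>+\<eta>. ennreal (k 1 \<eta>) \<partial>lborel) \<le>
      (\<integral>\<^sup>+\<eta>. (ennreal (norm (\<eta>::real^'n) powr (- q)) * indicator {x. norm x \<le> 1} \<eta> + ennreal (norm \<eta> powr (- (2 * q))) * indicator {x. norm x \<ge> 1} \<eta>) \<partial>lborel)"
  proof (rule nn_integral_mono)
    fix \<eta> :: "real^'n"
    show "ennreal (k 1 \<eta>) \<le> ennreal (norm \<eta> powr (- q)) * indicator {x. norm x \<le> 1} \<eta> + ennreal (norm \<eta> powr (- (2 * q))) * indicator {x. norm x \<ge> 1} \<eta>"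
    proof (cases "norm \<eta> \<le> 1")
      case True
      then have "k 1 \<eta> = norm \<eta> powr (- q)" by (simp add: k_def max_absorb1)
      then show ?thesis using True by simp
    next
      case False
      then have "k 1 \<eta> = norm \<eta> powr (- (2 * q))" by (simp add: k_def max_absorb2 powr_add[symmetric])
      then show ?thesis using False by simp
    qed
  qed
  also have "\<dots> = (\<integral>\<^sup>+\<eta>. ennreal (norm (\<eta>::real^'n) powr (- q)) * indicator {x. norm x \<le> 1} \<eta> \<partial>lborel) + (\<integral>\<^sup>+\<eta>. ennreal (norm (\<eta>::real^'n) powr (- (2 * q))) * indicator {x. norm x \<ge> 1} \<eta> \<partial>lborel)"
    by (rule nn_integral_add) measurable
  also have "\<dots> < \<infinity>"
    using nn_integral_norm_powr_small[of q, where 'a = "real^'n"] nn_integral_norm_powr_large[of "2 * q", where 'a = "real^'n"] q q0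
    by simp
  finally obtain K where K: "K \<ge> 0" "(\<integral>\<^sup>+\<eta>. ennreal (k 1 \<eta>) \<partial>lborel) = ennreal K"
    by (metis ennreal_cases infinity_ennreal_def less_irrefl)
  show ?thesis
  proof (rule that)
    show "0 \<le> 2 * (1 / 2) powr (real CARD('n) - 2 * q) * K" using K by simp
    fix \<xi> :: "real^'n" assume \<xi>: "\<xi> \<noteq> 0"
    define R where "R = norm \<xi> / 2"
    have R: "R > 0" using \<xi> by (simp add: R_def)
    have kR: "(\<integral>\<^sup>+\<eta>. ennreal (k R \<eta>) \<partial>lborel) = ennreal (R powr (real CARD('n) - 2 * q) * K)"
    proof -
      have e: "k R (R *\<^sub>R \<eta>) = R powr (- (2 * q)) * k 1 \<eta>" for \<eta>
      proof -
        have "max R (R * norm \<eta>) = R * max 1 (norm \<eta>)" using R by (simp add: max_mult_distrib_left)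
        then show ?thesis using R by (simp add: k_def powr_mult powr_add[symmetric] mult_ac)
      qed
      have "(\<integral>\<^sup>+\<eta>. ennreal (k R \<eta>) \<partial>lborel) = ennreal (\<bar>R\<bar> ^ DIM(real^'n)) * (\<integral>\<^sup>+\<eta>. ennreal (k R (0 + R *\<^sub>R \<eta>)) \<partial>lborel)"
        by (rule nn_integral_affine) (use R in auto)
      also have "\<dots> = ennreal (R ^ CARD('n)) * (ennreal (R powr (- (2 * q))) * ennreal K)"
        using R by (simp add: e ennreal_mult' nn_integral_cmult K(2))
      also have "\<dots> = ennreal (R ^ CARD('n) * R powr (- (2 * q)) * K)" using R K by (simp add: ennreal_mult mult_ac)
      also have "R ^ CARD('n) * R powr (- (2 * q)) = R powr (real CARD('n) - 2 * q)"
        using R by (simp add: powr_realpow[symmetric] powr_add[symmetric])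
      finally show ?thesis .
    qed
    have le: "norm (\<xi> - \<eta>) powr (- q) * norm \<eta> powr (- q) \<le> k R \<eta> + k R (\<xi> - \<eta>)" for \<eta>
    proof -
      have *: "norm y powr (- q) * norm z powr (- q) \<le> k R y" if "norm y \<le> norm z" "norm y + norm z \<ge> norm \<xi>" for y z :: "real^'n"
      proof -
        have "max R (norm y) \<le> norm z" using that by (auto simp: R_def)
        moreover have "max R (norm y) > 0" using R by (rule less_le_trans) simp
        ultimately have "norm z powr (- q) \<le> max R (norm y) powr (- q)" using q0 by (intro powr_mono2') auto
        then show ?thesis unfolding k_def by (rule mult_left_mono) simp
      qed
      have t: "norm \<eta> + norm (\<xi> - \<eta>) \<ge> norm \<xi>" using norm_triangle_ineq[of \<eta> "\<xi> - \<eta>"] by simp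
      have k0: "k R y \<ge> 0" for y by (simp add: k_def)
      show ?thesis
      proof (cases "norm \<eta> \<le> norm (\<xi> - \<eta>)")
        case True
        from *[OF this t] k0[of "\<xi> - \<eta>"] show ?thesis by (simp add: mult.commute)
      next
        case False
        then have "norm (\<xi> - \<eta>) \<le> norm \<eta>" by simp
        from *[OF this] t k0[of \<eta>] show ?thesis by (simp add: add.commute)
      qed
    qed
    have "(\<integral>\<^sup>+\<eta>. ennreal (norm (\<xi> - \<eta>) powr (- q) * norm \<eta> powr (- q)) \<partial>lborel) \<le> (\<integral>\<^sup>+\<eta>. (ennreal (k R \<eta>) + ennreal (k R (\<xi> - \<eta>))) \<partial>lborel)"
    proof (rule nn_integral_mono)
      fix \<eta>
      have "ennreal (norm (\<xi> - \<eta>) powr (- q) * norm \<eta> powr (- q)) \<le> ennreal (k R \<eta> + k R (\<xi> - \<eta>))"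
        by (rule ennreal_leI[OF le])
      also have "\<dots> = ennreal (k R \<eta>) + ennreal (k R (\<xi> - \<eta>))" by (rule ennreal_plus) (auto simp: k_def)
      finally show "ennreal (norm (\<xi> - \<eta>) powr (- q) * norm \<eta> powr (- q)) \<le> ennreal (k R \<eta>) + ennreal (k R (\<xi> - \<eta>))" .
    qed
    also have "\<dots> = (\<integral>\<^sup>+\<eta>. ennreal (k R \<eta>) \<partial>lborel) + (\<integral>\<^sup>+\<eta>. ennreal (k R (\<xi> - \<eta>)) \<partial>lborel)"
      by (rule nn_integral_add) measurable
    also have "(\<integral>\<^sup>+\<eta>. ennreal (k R (\<xi> - \<eta>)) \<partial>lborel) = (\<integral>\<^sup>+\<eta>. ennreal (k R \<eta>) \<partial>lborel)"
      by (rule nn_integral_reflect) measurable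
    also have "(\<integral>\<^sup>+\<eta>. ennreal (k R \<eta>) \<partial>lborel) + (\<integral>\<^sup>+\<eta>. ennreal (k R \<eta>) \<partial>lborel) = ennreal (2 * (R powr (real CARD('n) - 2 * q) * K))"
      unfolding kR using K by (simp add: ennreal_plus[symmetric] del: ennreal_plus)
    also have "2 * (R powr (real CARD('n) - 2 * q) * K) = 2 * (1 / 2) powr (real CARD('n) - 2 * q) * K * norm \<xi> powr (real CARD('n) - 2 * q)"
    proof -
      have "R powr (real CARD('n) - 2 * q) = (1 / 2 * norm \<xi>) powr (real CARD('n) - 2 * q)" by (simp add: R_def)
      also have "\<dots> = (1 / 2) powr (real CARD('n) - 2 * q) * norm \<xi> powr (real CARD('n) - 2 * q)" by (rule powr_mult)
      finally show ?thesis by (simp add: mult_ac)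
    qed
    finally show "(\<integral>\<^sup>+\<eta>. ennreal (norm (\<xi> - \<eta>) powr (- q) * norm \<eta> powr (- q)) \<partial>lborel)
        \<le> ennreal (2 * (1 / 2) powr (real CARD('n) - 2 * q) * K * norm \<xi> powr (real CARD('n) - 2 * q))" .
  qed
qed

text \<open>The weights |\<xi> - \<eta>|^(q/2) and |\<eta>|^(q/2) are inserted and divided out.
  Cauchy-Schwarz then separates a Riesz kernel, whose power of |\<xi>| exactly cancels the output
  weight 2q - n; what remains is the integral of \<open>A\<close> convolved with itself, a
  square.\<close>

lemma wint_nconv_le:
  fixes q :: real
  assumes q: "real CARD('n::finite) < 2 * q" "q < CARD('n)"
  obtains C where "C \<ge> 0" "\<And>V :: real^'n \<Rightarrow> ennreal. V \<in> borel_measurable borel \<Longrightarrow>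
    wint (2 * q - CARD('n)) (nconv V V) \<le> ennreal C * (wint q V)\<^sup>2"
proof -
  obtain C where C: "C \<ge> 0" "\<And>\<xi> :: real^'n. \<xi> \<noteq> 0 \<Longrightarrow>
    (\<integral>\<^sup>+\<eta>. ennreal (norm (\<xi> - \<eta>) powr (- q) * norm \<eta> powr (- q)) \<partial>lborel) \<le> ennreal (C * norm \<xi> powr (real CARD('n) - 2 * q))"
    using riesz_kernel_bound[OF q] by blast
  show ?thesis
  proof (rule that[OF C(1)])
    fix V :: "real^'n \<Rightarrow> ennreal" assume [measurable]: "V \<in> borel_measurable borel"
    define A where "A \<eta> = ennreal (norm \<eta> powr q) * (V \<eta>)\<^sup>2" for \<eta>
    have [measurable]: "A \<in> borel_measurable borel" unfolding A_def[abs_def] by measurable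
    have pt: "ennreal (norm \<xi> powr (2 * q - CARD('n))) * (nconv V V \<xi>)\<^sup>2 \<le> ennreal C * nconv A A \<xi>" for \<xi>
    proof (cases "\<xi> = 0")
      case False
      let ?f = "\<lambda>\<eta>. (ennreal (norm (\<xi> - \<eta>) powr (q / 2)) * V (\<xi> - \<eta>)) * (ennreal (norm \<eta> powr (q / 2)) * V \<eta>)"
      let ?g = "\<lambda>\<eta>. ennreal (norm (\<xi> - \<eta>) powr (- q / 2) * norm \<eta> powr (- q / 2))"
      have "nconv V V \<xi> = (\<integral>\<^sup>+\<eta>. ?f \<eta> * ?g \<eta> \<partial>lborel)"
        unfolding nconv_def
      proof (rule nn_integral_cong_AE)
        \<comment> \<open>At \<eta> = 0 and \<eta> = \<xi> a weight vanishes and cannot be divided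
          out; these two points are null.\<close>
        show "AE \<eta> in lborel. V (\<xi> - \<eta>) * V \<eta> = ?f \<eta> * ?g \<eta>"
          using AE_lborel_singleton[of 0] AE_lborel_singleton[of \<xi>]
        proof eventually_elim
          case (elim \<eta>)
          have e: "ennreal (x powr (q / 2)) * ennreal (x powr (- q / 2)) = 1" if "x > 0" for x
            using that by (simp add: ennreal_mult[symmetric] powr_add[symmetric])
          have "?f \<eta> * ?g \<eta> = V (\<xi> - \<eta>) * V \<eta> * ((ennreal (norm (\<xi> - \<eta>) powr (q / 2)) * ennreal (norm (\<xi> - \<eta>) powr (- q / 2))) *
              (ennreal (norm \<eta> powr (q / 2)) * ennreal (norm \<eta> powr (- q / 2))))"
            by (simp only: ennreal_mult[OF powr_ge_zero powr_ge_zero] mult_ac)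
          also have "\<dots> = V (\<xi> - \<eta>) * V \<eta>" using elim by (subst e, simp, subst e, simp, simp)
          finally show ?case ..
        qed
      qed
      then have "(nconv V V \<xi>)\<^sup>2 \<le> (\<integral>\<^sup>+\<eta>. (?f \<eta>)\<^sup>2 \<partial>lborel) * (\<integral>\<^sup>+\<eta>. (?g \<eta>)\<^sup>2 \<partial>lborel)"
        by (simp only:) (rule Cauchy_Schwarz_nn_integral; measurable)
      also have "(\<integral>\<^sup>+\<eta>. (?f \<eta>)\<^sup>2 \<partial>lborel) = nconv A A \<xi>"
        unfolding nconv_def A_def power_mult_distrib ennreal_powr_half_power2 ..
      also have "(\<integral>\<^sup>+\<eta>. (?g \<eta>)\<^sup>2 \<partial>lborel) = (\<integral>\<^sup>+\<eta>. ennreal (norm (\<xi> - \<eta>) powr (- q) * norm \<eta> powr (- q)) \<partial>lborel)"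
        by (simp add: ennreal_power power_mult_distrib powr_half_power2[of _ "- q", simplified])
      also have "nconv A A \<xi> * \<dots> \<le> nconv A A \<xi> * ennreal (C * norm \<xi> powr (real CARD('n) - 2 * q))"
        by (intro mult_left_mono C(2) False) simp
      finally have "ennreal (norm \<xi> powr (2 * q - CARD('n))) * (nconv V V \<xi>)\<^sup>2 \<le>
         ennreal (norm \<xi> powr (2 * q - CARD('n))) * (nconv A A \<xi> * ennreal (C * norm \<xi> powr (real CARD('n) - 2 * q)))"
        by (intro mult_left_mono) auto
      also have "\<dots> = ennreal (norm \<xi> powr (2 * q - CARD('n)) * norm \<xi> powr (real CARD('n) - 2 * q)) * (ennreal C * nconv A A \<xi>)"
        using C(1) by (simp add: ennreal_mult mult_ac)
      also have "norm \<xi> powr (2 * q - CARD('n)) * norm \<xi> powr (real CARD('n) - 2 * q) = 1"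
        using False by (simp add: powr_add[symmetric])
      finally show ?thesis by simp
    qed simp
    have "wint (2 * q - CARD('n)) (nconv V V) \<le> (\<integral>\<^sup>+\<xi>. ennreal C * nconv A A \<xi> \<partial>lborel)"
      unfolding wint_def by (rule nn_integral_mono) (rule pt)
    also have "\<dots> = ennreal C * (\<integral>\<^sup>+\<xi>. nconv A A \<xi> \<partial>lborel)"
      unfolding nconv_def by (rule nn_integral_cmult) measurable
    also have "(\<integral>\<^sup>+\<xi>. nconv A A \<xi> \<partial>lborel) = (\<integral>\<^sup>+\<eta>. \<integral>\<^sup>+\<xi>. A (\<xi> - \<eta>) * A \<eta> \<partial>lborel \<partial>lborel)"
      unfolding nconv_def by (rule lborel_pair.Fubini') measurable
    also have "\<dots> = (\<integral>\<^sup>+\<eta>. (\<integral>\<^sup>+\<xi>. A \<xi> \<partial>lborel) * A \<eta> \<partial>lborel)"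
      by (simp add: nn_integral_multc nn_integral_translate)
    also have "\<dots> = (wint q V)\<^sup>2"
    proof -
      have "wint q V = (\<integral>\<^sup>+\<xi>. A \<xi> \<partial>lborel)" by (simp add: wint_def A_def)
      then show ?thesis by (simp add: nn_integral_cmult power2_eq_square)
    qed
    finally show "wint (2 * q - CARD('n)) (nconv V V) \<le> ennreal C * (wint q V)\<^sup>2" .
  qed
qed

section \<open>Heat smoothing and the Duhamel integral\<close>

lemma powr_le_exp:
  fixes x :: real
  assumes "x \<ge> 0" "0 \<le> b" "b \<le> 1"
  shows "x powr b \<le> exp x"
proof (cases "x \<le> 1")
  case True
  then have "x powr b \<le> 1" using assms by (simp add: powr_le1)
  also have "1 \<le> exp x" using assms by simp
  finally show ?thesis .
next
  case False
  then have "x powr b \<le> x powr 1" using assms by (intro powr_mono) auto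
  also have "x powr 1 = x" using False by simp
  also have "x \<le> exp x" using exp_ge_add_one_self[of x] by linarith
  finally show ?thesis .
qed

text \<open>This is x^b \<le> exp x at x = \<tau> r^2: heat flow of duration \<tau> trades 2b powers
  of the frequency for \<tau>^(-b).\<close>

lemma heat_kernel_weight_bound:
  fixes r \<tau> b :: real
  assumes "r > 0" "\<tau> > 0" "0 \<le> b" "b \<le> 1"
  shows "r powr (2 * b) * exp (- \<tau> * r\<^sup>2) \<le> \<tau> powr (- b)"
proof -
  have "(\<tau> * r\<^sup>2) powr b \<le> exp (\<tau> * r\<^sup>2)" using assms by (intro powr_le_exp) auto
  moreover have "(\<tau> * r\<^sup>2) powr b = \<tau> powr b * r powr (2 * b)"
    using assms by (simp add: powr_mult powr_powr[symmetric] powr_numeral)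
  ultimately have "\<tau> powr b * r powr (2 * b) \<le> exp (\<tau> * r\<^sup>2)" by simp
  then show ?thesis using assms by (simp add: powr_minus exp_minus field_simps)
qed

text \<open>The factor |\<xi>| stands for the divergence; the bounded Leray symbol goes into a
  constant in front. The free lower limit serves the increments between two positive times.\<close>

definition duhamel :: "real \<Rightarrow> real \<Rightarrow> (real \<times> (real^'n::finite) \<Rightarrow> ennreal) \<Rightarrow> real^'n \<Rightarrow> ennreal" where
  "duhamel t1 t2 F \<xi> = (\<integral>\<^sup>+s. indicator {t1<..<t2} s * (ennreal (exp (- (t2 - s) * (norm \<xi>)\<^sup>2) * norm \<xi>) * F (s, \<xi>)) \<partial>lborel)"

text \<open>(t2 - s)^(-b) is the cost of heat smoothing, and s^(-3/4) is the square root of the size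
  s^(-3/2) allowed for the squared norm of the forcing.\<close>

definition beta_int :: "real \<Rightarrow> real \<Rightarrow> real \<Rightarrow> ennreal" where
  "beta_int b t1 t2 = (\<integral>\<^sup>+s. indicator {t1<..<t2} s * ennreal ((t2 - s) powr (- b) * s powr (- 3 / 4)) \<partial>lborel)"

text \<open>Minkowski's inequality in s, carried out by a weighted Cauchy-Schwarz and Tonelli: each
  of the two factors yields the time weight once, hence the square of \<open>beta_int\<close>. The
  exponents match because (n - 3 + 4b)/2 + 1 = (n - 1)/2 + 2b.\<close>

lemma wint_duhamel_le:
  fixes F :: "real \<times> (real^'n::finite) \<Rightarrow> ennreal"
  assumes F[measurable]: "F \<in> borel_measurable borel" and t: "0 \<le> t1" and b: "1 / 4 \<le> b" "b \<le> 1"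
    and Q: "\<And>s. t1 < s \<Longrightarrow> s < t2 \<Longrightarrow> wint (real CARD('n) - 1) (\<lambda>\<xi>. F (s, \<xi>)) \<le> ennreal (Q * s powr (- 3 / 2))"
    and Q0: "Q \<ge> 0"
  shows "wint (real CARD('n) - 3 + 4 * b) (duhamel t1 t2 F) \<le> ennreal Q * (beta_int b t1 t2)\<^sup>2"
proof -
  have F2[measurable]: "F \<in> borel_measurable (borel \<Otimes>\<^sub>M borel)" using F by (simp add: borel_prod)
  define p where "p = real CARD('n) - 1"
  let ?I = "\<lambda>s. indicator {t1<..<t2} s :: ennreal"
  have pt: "ennreal (norm \<xi> powr (real CARD('n) - 3 + 4 * b)) * (duhamel t1 t2 F \<xi>)\<^sup>2 \<le>
      beta_int b t1 t2 * (\<integral>\<^sup>+s. ?I s * ennreal ((t2 - s) powr (- b) * s powr (3 / 4)) * (ennreal (norm \<xi> powr p) * (F (s, \<xi>))\<^sup>2) \<partial>lborel)" for \<xi>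
  proof (cases "\<xi> = 0")
    case False
    let ?f = "\<lambda>s. ?I s * ennreal ((t2 - s) powr (- b / 2) * s powr (- 3 / 4 / 2))"
    let ?g = "\<lambda>s. ?I s * (ennreal ((t2 - s) powr (- b / 2) * s powr (3 / 4 / 2)) * (ennreal (norm \<xi> powr (p / 2)) * F (s, \<xi>)))"
    have "ennreal (norm \<xi> powr ((real CARD('n) - 3 + 4 * b) / 2)) * duhamel t1 t2 F \<xi> =
      (\<integral>\<^sup>+s. ennreal (norm \<xi> powr ((real CARD('n) - 3 + 4 * b) / 2)) * (?I s * (ennreal (exp (- (t2 - s) * (norm \<xi>)\<^sup>2) * norm \<xi>) * F (s, \<xi>))) \<partial>lborel)"
      unfolding duhamel_def by (rule nn_integral_cmult[symmetric]) measurable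
    also have "\<dots> \<le> (\<integral>\<^sup>+s. ?f s * ?g s \<partial>lborel)"
    proof (rule nn_integral_mono)
      fix s
      show "ennreal (norm \<xi> powr ((real CARD('n) - 3 + 4 * b) / 2)) * (?I s * (ennreal (exp (- (t2 - s) * (norm \<xi>)\<^sup>2) * norm \<xi>) * F (s, \<xi>))) \<le> ?f s * ?g s"
      proof (cases "t1 < s \<and> s < t2")
        case True
        have r: "norm \<xi> > 0" using False by simp
        have "norm \<xi> powr ((real CARD('n) - 3 + 4 * b) / 2) * (exp (- (t2 - s) * (norm \<xi>)\<^sup>2) * norm \<xi>) =
            norm \<xi> powr (p / 2) * (norm \<xi> powr (2 * b) * exp (- (t2 - s) * (norm \<xi>)\<^sup>2))"
        proof -
          have "norm \<xi> powr ((real CARD('n) - 3 + 4 * b) / 2) * norm \<xi> = norm \<xi> powr ((real CARD('n) - 3 + 4 * b) / 2 + 1)"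
            using r by (simp add: powr_add)
          also have "(real CARD('n) - 3 + 4 * b) / 2 + 1 = p / 2 + 2 * b" by (simp add: p_def field_simps)
          also have "norm \<xi> powr (p / 2 + 2 * b) = norm \<xi> powr (p / 2) * norm \<xi> powr (2 * b)" by (rule powr_add)
          finally show ?thesis by (simp add: mult_ac)
        qed
        also have "\<dots> \<le> norm \<xi> powr (p / 2) * (t2 - s) powr (- b)"
          using heat_kernel_weight_bound[OF r, of "t2 - s" b] True b by (intro mult_left_mono) auto
        \<comment> \<open>The opposite powers of s are chosen so that the square of the second
          factor, multiplied by s^(-3/2), reproduces the weight of \<open>beta_int\<close>.\<close>
        also have "\<dots> = ((t2 - s) powr (- b / 2) * s powr (- 3 / 4 / 2)) * ((t2 - s) powr (- b / 2) * s powr (3 / 4 / 2) * norm \<xi> powr (p / 2))"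
        proof -
          have "s > 0" using True t by linarith
          then have "s powr (- 3 / 4 / 2) * s powr (3 / 4 / 2) = 1" by (simp add: powr_add[symmetric])
          moreover have "(t2 - s) powr (- b / 2) * (t2 - s) powr (- b / 2) = (t2 - s) powr (- b)" by (simp add: powr_add[symmetric])
          ultimately show ?thesis by (simp add: mult_ac)
        qed
        finally have "ennreal (norm \<xi> powr ((real CARD('n) - 3 + 4 * b) / 2) * (exp (- (t2 - s) * (norm \<xi>)\<^sup>2) * norm \<xi>)) \<le>
          ennreal (((t2 - s) powr (- b / 2) * s powr (- 3 / 4 / 2)) * ((t2 - s) powr (- b / 2) * s powr (3 / 4 / 2) * norm \<xi> powr (p / 2)))"
          by (rule ennreal_leI)
        from mult_right_mono[OF this, of "F (s, \<xi>)"] show ?thesis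
          using True by (simp add: ennreal_mult mult_ac)
      qed simp
    qed
    finally have 1: "ennreal (norm \<xi> powr ((real CARD('n) - 3 + 4 * b) / 2)) * duhamel t1 t2 F \<xi> \<le> (\<integral>\<^sup>+s. ?f s * ?g s \<partial>lborel)" .
    have "ennreal (norm \<xi> powr (real CARD('n) - 3 + 4 * b)) * (duhamel t1 t2 F \<xi>)\<^sup>2 = (ennreal (norm \<xi> powr ((real CARD('n) - 3 + 4 * b) / 2)) * duhamel t1 t2 F \<xi>)\<^sup>2"
      by (simp only: power_mult_distrib ennreal_powr_half_power2)
    also have "\<dots> \<le> (\<integral>\<^sup>+s. ?f s * ?g s \<partial>lborel)\<^sup>2" by (rule power_mono[OF 1]) simp
    also have "\<dots> \<le> (\<integral>\<^sup>+s. (?f s)\<^sup>2 \<partial>lborel) * (\<integral>\<^sup>+s. (?g s)\<^sup>2 \<partial>lborel)"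
      by (rule Cauchy_Schwarz_nn_integral; measurable)
    also have "(\<integral>\<^sup>+s. (?f s)\<^sup>2 \<partial>lborel) = beta_int b t1 t2"
      unfolding beta_int_def
    proof (rule nn_integral_cong)
      fix s
      show "(?f s)\<^sup>2 = ?I s * ennreal ((t2 - s) powr (- b) * s powr (- 3 / 4))"
        using powr_half_power2[of "t2 - s" "- b"] powr_half_power2[of s "- 3 / 4"]
        by (simp add: indicator_def ennreal_power power_mult_distrib)
    qed
    also have "(\<integral>\<^sup>+s. (?g s)\<^sup>2 \<partial>lborel) = (\<integral>\<^sup>+s. ?I s * ennreal ((t2 - s) powr (- b) * s powr (3 / 4)) * (ennreal (norm \<xi> powr p) * (F (s, \<xi>))\<^sup>2) \<partial>lborel)"
    proof (rule nn_integral_cong)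
      fix s
      have "(ennreal ((t2 - s) powr (- b / 2) * s powr (3 / 4 / 2)))\<^sup>2 = ennreal ((t2 - s) powr (- b) * s powr (3 / 4))"
        using powr_half_power2[of "t2 - s" "- b"] powr_half_power2[of s "3 / 4"]
        by (simp add: ennreal_power power_mult_distrib)
      then show "(?g s)\<^sup>2 = ?I s * ennreal ((t2 - s) powr (- b) * s powr (3 / 4)) * (ennreal (norm \<xi> powr p) * (F (s, \<xi>))\<^sup>2)"
        by (simp add: power_mult_distrib ennreal_powr_half_power2 indicator_def)
    qed
    finally show ?thesis .
  qed simp
  have "wint (real CARD('n) - 3 + 4 * b) (duhamel t1 t2 F) \<le>
      (\<integral>\<^sup>+\<xi>. beta_int b t1 t2 * (\<integral>\<^sup>+s. ?I s * ennreal ((t2 - s) powr (- b) * s powr (3 / 4)) * (ennreal (norm \<xi> powr p) * (F (s, \<xi>))\<^sup>2) \<partial>lborel) \<partial>lborel)"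
    unfolding wint_def by (rule nn_integral_mono) (rule pt)
  also have "\<dots> = beta_int b t1 t2 * (\<integral>\<^sup>+\<xi>. \<integral>\<^sup>+s. ?I s * ennreal ((t2 - s) powr (- b) * s powr (3 / 4)) * (ennreal (norm \<xi> powr p) * (F (s, \<xi>))\<^sup>2) \<partial>lborel \<partial>lborel)"
    by (rule nn_integral_cmult) measurable
  also have "(\<integral>\<^sup>+\<xi>. \<integral>\<^sup>+s. ?I s * ennreal ((t2 - s) powr (- b) * s powr (3 / 4)) * (ennreal (norm \<xi> powr p) * (F (s, \<xi>))\<^sup>2) \<partial>lborel \<partial>lborel)
     = (\<integral>\<^sup>+s. \<integral>\<^sup>+\<xi>. ?I s * ennreal ((t2 - s) powr (- b) * s powr (3 / 4)) * (ennreal (norm \<xi> powr p) * (F (s, \<xi>))\<^sup>2) \<partial>lborel \<partial>lborel)"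
    by (rule lborel_pair.Fubini') measurable
  also have "\<dots> = (\<integral>\<^sup>+s. ?I s * ennreal ((t2 - s) powr (- b) * s powr (3 / 4)) * wint p (\<lambda>\<xi>. F (s, \<xi>)) \<partial>lborel)"
    unfolding wint_def by (intro nn_integral_cong nn_integral_cmult) measurable
  also have "\<dots> \<le> (\<integral>\<^sup>+s. ennreal Q * (?I s * ennreal ((t2 - s) powr (- b) * s powr (- 3 / 4))) \<partial>lborel)"
  proof (rule nn_integral_mono)
    fix s
    show "?I s * ennreal ((t2 - s) powr (- b) * s powr (3 / 4)) * wint p (\<lambda>\<xi>. F (s, \<xi>)) \<le> ennreal Q * (?I s * ennreal ((t2 - s) powr (- b) * s powr (- 3 / 4)))"
    proof (cases "t1 < s \<and> s < t2")
      case True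
      have "s > 0" using True t by linarith
      then have e: "s powr (3 / 4) * s powr (- 3 / 2) = s powr (- 3 / 4)" by (simp add: powr_add[symmetric])
      have "wint p (\<lambda>\<xi>. F (s, \<xi>)) \<le> ennreal (Q * s powr (- 3 / 2))" using Q[of s] True by (simp add: p_def)
      then have "ennreal ((t2 - s) powr (- b) * s powr (3 / 4)) * wint p (\<lambda>\<xi>. F (s, \<xi>)) \<le> ennreal ((t2 - s) powr (- b) * s powr (3 / 4)) * ennreal (Q * s powr (- 3 / 2))"
        by (rule mult_left_mono) simp
      also have "\<dots> = ennreal (Q * ((t2 - s) powr (- b) * (s powr (3 / 4) * s powr (- 3 / 2))))"
        using Q0 by (simp add: ennreal_mult[symmetric] mult_ac)
      also have "\<dots> = ennreal Q * ennreal ((t2 - s) powr (- b) * s powr (- 3 / 4))"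
        unfolding e using Q0 by (rule ennreal_mult) simp
      finally show ?thesis using True by simp
    qed simp
  qed
  also have "\<dots> = ennreal Q * beta_int b t1 t2"
    unfolding beta_int_def by (rule nn_integral_cmult) measurable
  \<comment> \<open>The chain contains an estimate below the factor \<open>beta_int\<close>, so
    monotonicity of multiplication by it remains as a premise.\<close>
  finally have fin: "(\<And>x y :: ennreal. x \<le> y \<Longrightarrow> beta_int b t1 t2 * x \<le> beta_int b t1 t2 * y) \<Longrightarrow>
     wint (real CARD('n) - 3 + 4 * b) (duhamel t1 t2 F) \<le> beta_int b t1 t2 * (ennreal Q * beta_int b t1 t2)" .
  have "wint (real CARD('n) - 3 + 4 * b) (duhamel t1 t2 F) \<le> beta_int b t1 t2 * (ennreal Q * beta_int b t1 t2)"
    by (rule fin) (rule mult_left_mono, simp_all)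
  then show ?thesis by (simp only: power2_eq_square mult_ac)
qed

lemma nn_integral_powr_0:
  fixes g :: real
  assumes "g < 1" "t > 0"
  shows "(\<integral>\<^sup>+s. indicator {0<..<t} s * ennreal (s powr (- g)) \<partial>lborel) = ennreal (t powr (1 - g) / (1 - g))"
proof -
  have "((\<lambda>x. x powr (- g)) has_integral (t powr (- g + 1) / (- g + 1))) {0..t}"
    using assms by (intro has_integral_powr_from_0) auto
  then have "(\<integral>\<^sup>+s. indicator {0..t} s * ennreal (s powr (- g)) \<partial>lborel) = ennreal (t powr (- g + 1) / (- g + 1))"
    using nn_integral_has_integral_lebesgue[of "{0..t}" "\<lambda>x. x powr (- g)"]
    by (simp add: ennreal_indicator[symmetric] ennreal_mult[symmetric] mult.commute)
  moreover have "(\<integral>\<^sup>+s. indicator {0<..<t} s * ennreal (s powr (- g)) \<partial>lborel) = (\<integral>\<^sup>+s. indicator {0..t} s * ennreal (s powr (- g)) \<partial>lborel)"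
  proof (rule nn_integral_cong_AE)
    show "AE s in lborel. indicator {0<..<t} s * ennreal (s powr (- g)) = indicator {0..t} s * ennreal (s powr (- g))"
      using AE_lborel_singleton[of 0] AE_lborel_singleton[of t]
      by eventually_elim (auto simp: indicator_def)
  qed
  ultimately show ?thesis by (simp add: add.commute)
qed

text \<open>Away from time 0 the weight in s is bounded, and the bound vanishes as t2 approaches t1;
  this drives continuity at positive times.\<close>

lemma beta_int_le:
  assumes "b < 1" "0 < t1" "t1 < t2"
  shows "beta_int b t1 t2 \<le> ennreal (t1 powr (- 3 / 4) * ((t2 - t1) powr (1 - b) / (1 - b)))"
proof -
  have "beta_int b t1 t2 \<le> (\<integral>\<^sup>+s. ennreal (t1 powr (- 3 / 4)) * (indicator {t1<..<t2} s * ennreal ((t2 - s) powr (- b))) \<partial>lborel)"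
    unfolding beta_int_def
  proof (rule nn_integral_mono)
    fix s
    show "indicator {t1<..<t2} s * ennreal ((t2 - s) powr (- b) * s powr (- 3 / 4)) \<le> ennreal (t1 powr (- 3 / 4)) * (indicator {t1<..<t2} s * ennreal ((t2 - s) powr (- b)))"
    proof (cases "t1 < s \<and> s < t2")
      case True
      have "s powr (- 3 / 4) \<le> t1 powr (- 3 / 4)" using True assms by (intro powr_mono2') auto
      then have "(t2 - s) powr (- b) * s powr (- 3 / 4) \<le> t1 powr (- 3 / 4) * (t2 - s) powr (- b)"
        by (simp add: mult.commute mult_left_mono)
      then show ?thesis using True by (simp add: ennreal_mult[symmetric] ennreal_leI)
    qed simp
  qed
  also have "\<dots> = ennreal (t1 powr (- 3 / 4)) * (\<integral>\<^sup>+s. indicator {t1<..<t2} s * ennreal ((t2 - s) powr (- b)) \<partial>lborel)"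
    by (rule nn_integral_cmult) measurable
  also have "(\<integral>\<^sup>+s. indicator {t1<..<t2} s * ennreal ((t2 - s) powr (- b)) \<partial>lborel) = (\<integral>\<^sup>+s. indicator {t1<..<t2} (t2 - s) * ennreal ((t2 - (t2 - s)) powr (- b)) \<partial>lborel)"
    by (rule nn_integral_reflect[symmetric]) measurable
  also have "\<dots> = (\<integral>\<^sup>+s. indicator {0<..<t2 - t1} s * ennreal (s powr (- b)) \<partial>lborel)"
    by (intro nn_integral_cong) (auto simp: indicator_def)
  also have "\<dots> = ennreal ((t2 - t1) powr (1 - b) / (1 - b))"
    using assms by (intro nn_integral_powr_0) auto
  finally show ?thesis using assms by (simp add: ennreal_mult[symmetric])
qed

text \<open>Splitting at t/2 keeps one of the two singular factors bounded on each half. The power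
  of t is the scaling exponent 1 - b - 3/4.\<close>

lemma beta_int_0_le:
  assumes "0 \<le> b" "b < 1"
  obtains C where "C \<ge> 0" "\<And>t. t > 0 \<Longrightarrow> beta_int b 0 t \<le> ennreal (C * t powr (1 / 4 - b))"
proof (rule that)
  \<comment> \<open>4 is 1 / (1 - 3/4) from integrating s^(-3/4); the powers of 1/2 come from the
    split at t/2.\<close>
  show "0 \<le> (1 / 2) powr (- b) * 4 + (1 / 2) powr (- 3 / 4) / (1 - b)" using assms by simp
  fix t :: real assume t: "t > 0"
  have "beta_int b 0 t \<le> (\<integral>\<^sup>+s. (ennreal ((t / 2) powr (- b)) * (indicator {0<..<t} s * ennreal (s powr (- (3 / 4)))) +
      ennreal ((t / 2) powr (- 3 / 4)) * (indicator {0<..<t} s * ennreal ((t - s) powr (- b)))) \<partial>lborel)"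
    unfolding beta_int_def
  proof (rule nn_integral_mono)
    fix s
    show "indicator {0<..<t} s * ennreal ((t - s) powr (- b) * s powr (- 3 / 4)) \<le> ennreal ((t / 2) powr (- b)) * (indicator {0<..<t} s * ennreal (s powr (- (3 / 4)))) +
      ennreal ((t / 2) powr (- 3 / 4)) * (indicator {0<..<t} s * ennreal ((t - s) powr (- b)))"
    proof (cases "0 < s \<and> s < t")
      case True
      have "(t - s) powr (- b) * s powr (- 3 / 4) \<le> (t / 2) powr (- b) * s powr (- 3 / 4) + (t / 2) powr (- 3 / 4) * (t - s) powr (- b)"
      proof (cases "s \<le> t / 2")
        case s: True
        have "(t - s) powr (- b) \<le> (t / 2) powr (- b)" using s t assms by (intro powr_mono2') auto
        then have "(t - s) powr (- b) * s powr (- 3 / 4) \<le> (t / 2) powr (- b) * s powr (- 3 / 4)" by (rule mult_right_mono) simp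
        then show ?thesis by (simp add: add_increasing2)
      next
        case s: False
        have "s powr (- 3 / 4) \<le> (t / 2) powr (- 3 / 4)" using s t by (intro powr_mono2') auto
        then have "(t - s) powr (- b) * s powr (- 3 / 4) \<le> (t - s) powr (- b) * (t / 2) powr (- 3 / 4)" by (rule mult_left_mono) simp
        then show ?thesis by (simp add: add_increasing mult.commute)
      qed
      from ennreal_leI[OF this] show ?thesis using True by (simp add: ennreal_mult)
    qed simp
  qed
  also have "\<dots> = (\<integral>\<^sup>+s. ennreal ((t / 2) powr (- b)) * (indicator {0<..<t} s * ennreal (s powr (- (3 / 4)))) \<partial>lborel) +
      (\<integral>\<^sup>+s. ennreal ((t / 2) powr (- 3 / 4)) * (indicator {0<..<t} s * ennreal ((t - s) powr (- b))) \<partial>lborel)"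
    by (rule nn_integral_add) measurable
  also have "(\<integral>\<^sup>+s. ennreal ((t / 2) powr (- b)) * (indicator {0<..<t} s * ennreal (s powr (- (3 / 4)))) \<partial>lborel) =
      ennreal ((t / 2) powr (- b)) * ennreal (t powr (1 - 3 / 4) / (1 - 3 / 4))"
    using t by (subst nn_integral_cmult) (auto simp: nn_integral_powr_0)
  also have "(\<integral>\<^sup>+s. ennreal ((t / 2) powr (- 3 / 4)) * (indicator {0<..<t} s * ennreal ((t - s) powr (- b))) \<partial>lborel) =
      ennreal ((t / 2) powr (- 3 / 4)) * ennreal (t powr (1 - b) / (1 - b))"
  proof -
    have "(\<integral>\<^sup>+s. indicator {0<..<t} s * ennreal ((t - s) powr (- b)) \<partial>lborel) = (\<integral>\<^sup>+s. indicator {0<..<t} (t - s) * ennreal ((t - (t - s)) powr (- b)) \<partial>lborel)"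
      by (rule nn_integral_reflect[symmetric]) measurable
    also have "\<dots> = (\<integral>\<^sup>+s. indicator {0<..<t} s * ennreal (s powr (- b)) \<partial>lborel)"
      by (intro nn_integral_cong) (auto simp: indicator_def)
    finally show ?thesis using t assms by (subst nn_integral_cmult) (auto simp: nn_integral_powr_0)
  qed
  also have "ennreal ((t / 2) powr (- b)) * ennreal (t powr (1 - 3 / 4) / (1 - 3 / 4)) + ennreal ((t / 2) powr (- 3 / 4)) * ennreal (t powr (1 - b) / (1 - b))
     = ennreal ((t / 2) powr (- b) * (t powr (1 - 3 / 4) / (1 - 3 / 4)) + (t / 2) powr (- 3 / 4) * (t powr (1 - b) / (1 - b)))"
    using assms by (simp add: ennreal_mult[symmetric] ennreal_plus[symmetric] del: ennreal_plus)
  also have "(t / 2) powr (- b) * (t powr (1 - 3 / 4) / (1 - 3 / 4)) + (t / 2) powr (- 3 / 4) * (t powr (1 - b) / (1 - b))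
     = ((1 / 2) powr (- b) * 4 + (1 / 2) powr (- 3 / 4) / (1 - b)) * t powr (1 / 4 - b)"
  proof -
    have h: "(t / 2) powr c = (1 / 2) powr c * t powr c" for c using powr_mult[of "1 / 2" t c] t by simp
    have m: "t powr c * t powr d = t powr (c + d)" for c d by (simp add: powr_add)
    have "t powr (- b) * t powr (1 - 3 / 4) = t powr (1 / 4 - b)" "t powr (- 3 / 4) * t powr (1 - b) = t powr (1 / 4 - b)"
      unfolding m by (simp_all add: algebra_simps)
    then show ?thesis unfolding h by (simp add: distrib_right) (simp add: mult.assoc)
  qed
  finally show "beta_int b 0 t \<le> ennreal (((1 / 2) powr (- b) * 4 + (1 / 2) powr (- 3 / 4) / (1 - b)) * t powr (1 / 4 - b))" .
qed

section \<open>Sums, finiteness, and integrability from two weights\<close>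

lemma wint_mono: "(\<And>\<xi>. V \<xi> \<le> W \<xi>) \<Longrightarrow> wint p V \<le> wint p W"
  unfolding wint_def by (intro nn_integral_mono mult_left_mono power_mono) auto

lemma wint_cmult:
  assumes [measurable]: "V \<in> borel_measurable borel"
  shows "wint p (\<lambda>\<xi>. c * V \<xi>) = c\<^sup>2 * wint p V"
  unfolding wint_def by (subst nn_integral_cmult[symmetric]) (auto simp: power_mult_distrib mult_ac)

lemma wint_add_le:
  assumes [measurable]: "V \<in> borel_measurable borel" "W \<in> borel_measurable borel"
  shows "wint p (\<lambda>\<xi>. V \<xi> + W \<xi>) \<le> 2 * wint p V + 2 * wint p W"
proof -
  have "wint p (\<lambda>\<xi>. V \<xi> + W \<xi>) \<le> (\<integral>\<^sup>+\<xi>. 2 * (ennreal (norm \<xi> powr p) * (V \<xi>)\<^sup>2) + 2 * (ennreal (norm \<xi> powr p) * (W \<xi>)\<^sup>2) \<partial>lborel)"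
    unfolding wint_def
  proof (rule nn_integral_mono)
    fix \<xi>
    have "ennreal (norm \<xi> powr p) * (V \<xi> + W \<xi>)\<^sup>2 \<le> ennreal (norm \<xi> powr p) * (2 * (V \<xi>)\<^sup>2 + 2 * (W \<xi>)\<^sup>2)"
      by (rule mult_left_mono[OF ennreal_square_add_le]) simp
    then show "ennreal (norm \<xi> powr p) * (V \<xi> + W \<xi>)\<^sup>2 \<le> 2 * (ennreal (norm \<xi> powr p) * (V \<xi>)\<^sup>2) + 2 * (ennreal (norm \<xi> powr p) * (W \<xi>)\<^sup>2)"
      by (simp add: distrib_left mult_ac)
  qed
  also have "\<dots> = 2 * wint p V + 2 * wint p W"
    unfolding wint_def by (simp add: nn_integral_add nn_integral_cmult)
  finally show ?thesis .
qed

lemma wint_AE_finite: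
  fixes V :: "real^'n::finite \<Rightarrow> ennreal"
  assumes [measurable]: "V \<in> borel_measurable borel" and f: "wint p V < \<infinity>"
  shows "AE \<xi> in lborel. V \<xi> < \<infinity>"
proof -
  have "AE \<xi> in lborel. ennreal (norm \<xi> powr p) * (V \<xi>)\<^sup>2 \<noteq> \<infinity>"
    using f by (intro nn_integral_PInf_AE) (auto simp: wint_def)
  with AE_lborel_singleton[of 0] show ?thesis
  proof eventually_elim
    case (elim \<xi>)
    then have "ennreal (norm \<xi> powr p) > 0" by simp
    with elim show ?case
      by (auto simp: power2_eq_square ennreal_mult_eq_top_iff less_top[symmetric])
  qed
qed

text \<open>Away from 0, V \<le> |\<xi>|^r V^2 + |\<xi>|^(-r). The last term is integrable on the
  unit ball for r = n - 1/2 and outside it for r = n + 1/2, so a weight below n and one above n are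
  combined.\<close>

lemma nn_integral_finite_of_wint:
  fixes V :: "real^'n::finite \<Rightarrow> ennreal"
  assumes [measurable]: "V \<in> borel_measurable borel"
    and 1: "wint (real CARD('n) - 1 / 2) V < \<infinity>" and 2: "wint (real CARD('n) + 1 / 2) V < \<infinity>"
  shows "(\<integral>\<^sup>+\<xi>. V \<xi> \<partial>lborel) < \<infinity>"
proof -
  define p q where "p = real CARD('n) - 1 / 2" and "q = real CARD('n) + 1 / 2"
  have n: "real CARD('n) \<ge> 1" using zero_less_card_finite[where 'a = 'n] by linarith
  have pt: "V \<xi> \<le> ennreal (norm \<xi> powr r) * (V \<xi>)\<^sup>2 + ennreal (norm \<xi> powr (- r))" if "\<xi> \<noteq> 0" for r \<xi>
  proof -
    have "V \<xi> = (ennreal (norm \<xi> powr (r / 2)) * V \<xi>) * ennreal (norm \<xi> powr (- r / 2))"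
    proof -
      have "ennreal (norm \<xi> powr (r / 2)) * ennreal (norm \<xi> powr (- r / 2)) = 1"
        using that by (simp add: ennreal_mult[symmetric] powr_add[symmetric])
      then show ?thesis by (metis mult.commute mult.left_commute mult.right_neutral)
    qed
    also have "\<dots> \<le> (ennreal (norm \<xi> powr (r / 2)) * V \<xi>)\<^sup>2 + (ennreal (norm \<xi> powr (- r / 2)))\<^sup>2"
      by (rule ennreal_prod_le_sum_squares)
    also have "\<dots> = ennreal (norm \<xi> powr r) * (V \<xi>)\<^sup>2 + ennreal (norm \<xi> powr (- r))"
      unfolding power_mult_distrib ennreal_powr_half_power2 ..
    finally show ?thesis .
  qed
  let ?l = "\<lambda>\<xi>::real^'n. ennreal (norm \<xi> powr (- p)) * indicator {x. norm x \<le> 1} \<xi>"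
  let ?h = "\<lambda>\<xi>::real^'n. ennreal (norm \<xi> powr (- q)) * indicator {x. norm x \<ge> 1} \<xi>"
  have "(\<integral>\<^sup>+\<xi>. V \<xi> \<partial>lborel) \<le> (\<integral>\<^sup>+\<xi>. (ennreal (norm \<xi> powr p) * (V \<xi>)\<^sup>2 + ?l \<xi>) + (ennreal (norm \<xi> powr q) * (V \<xi>)\<^sup>2 + ?h \<xi>) \<partial>lborel)"
  proof (rule nn_integral_mono_AE)
    show "AE \<xi> in lborel. V \<xi> \<le> (ennreal (norm \<xi> powr p) * (V \<xi>)\<^sup>2 + ?l \<xi>) + (ennreal (norm \<xi> powr q) * (V \<xi>)\<^sup>2 + ?h \<xi>)"
      using AE_lborel_singleton[of 0]
    proof eventually_elim
      case (elim \<xi>)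
      show ?case
      proof (cases "norm \<xi> \<le> 1")
        case True
        with pt[OF elim, of p] show ?thesis by (simp add: add_increasing2)
      next
        case False
        with pt[OF elim, of q] show ?thesis by (simp add: add_increasing)
      qed
    qed
  qed
  also have "\<dots> = (wint p V + (\<integral>\<^sup>+\<xi>. ?l \<xi> \<partial>lborel)) + (wint q V + (\<integral>\<^sup>+\<xi>. ?h \<xi> \<partial>lborel))"
    unfolding wint_def by (simp add: nn_integral_add)
  also have "\<dots> < \<infinity>"
    using 1 2 nn_integral_norm_powr_small[of p, where 'a = "real^'n"] nn_integral_norm_powr_large[of q, where 'a = "real^'n"] n
    by (simp add: p_def q_def)
  finally show ?thesis .
qed

subsection \<open>The majorant equation\<close>

definition heat_maj :: "(real^'n::finite \<Rightarrow> real) \<Rightarrow> real \<times> (real^'n) \<Rightarrow> ennreal" where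
  "heat_maj \<gamma> z = ennreal (exp (- fst z * (norm (snd z))\<^sup>2) * \<gamma> (snd z))"

lemma heat_maj_square:
  assumes "\<gamma> \<xi> \<ge> 0"
  shows "(heat_maj \<gamma> (t, \<xi>))\<^sup>2 = ennreal ((exp (- t * (norm \<xi>)\<^sup>2) * \<gamma> \<xi>)\<^sup>2)"
  unfolding heat_maj_def fst_conv snd_conv by (rule ennreal_power) (simp add: assms)

text \<open>The squared heat factor gains |\<xi>|^(2 \<rho>) at the price t^(-\<rho>). The range
  \<rho> \<le> 2 is b \<le> 1 in the kernel bound, applied with b = \<rho>/2.\<close>

lemma wint_heat_maj_le:
  fixes \<gamma> :: "real^'n::finite \<Rightarrow> real"
  assumes [measurable]: "\<gamma> \<in> borel_measurable borel" and \<gamma>: "\<And>\<xi>. \<gamma> \<xi> \<ge> 0" and t: "t > 0" and r: "0 \<le> \<rho>" "\<rho> \<le> 2"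
  shows "wint (real CARD('n) - 2 + 2 * \<rho>) (\<lambda>\<xi>. heat_maj \<gamma> (t, \<xi>)) \<le> ennreal (t powr (- \<rho>)) * wint (real CARD('n) - 2) (\<lambda>\<xi>. ennreal (\<gamma> \<xi>))"
proof -
  have "wint (real CARD('n) - 2 + 2 * \<rho>) (\<lambda>\<xi>. heat_maj \<gamma> (t, \<xi>)) \<le>
     (\<integral>\<^sup>+\<xi>. ennreal (t powr (- \<rho>)) * (ennreal (norm \<xi> powr (real CARD('n) - 2)) * (ennreal (\<gamma> \<xi>))\<^sup>2) \<partial>lborel)"
    unfolding wint_def
  proof (rule nn_integral_mono)
    fix \<xi> :: "real^'n"
    show "ennreal (norm \<xi> powr (real CARD('n) - 2 + 2 * \<rho>)) * (heat_maj \<gamma> (t, \<xi>))\<^sup>2 \<le>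
        ennreal (t powr (- \<rho>)) * (ennreal (norm \<xi> powr (real CARD('n) - 2)) * (ennreal (\<gamma> \<xi>))\<^sup>2)"
    proof (cases "\<xi> = 0")
      case False
      define a where "a = norm \<xi> powr \<rho> * exp (- t * (norm \<xi>)\<^sup>2)"
      have "a \<le> t powr (- (\<rho> / 2))"
        using heat_kernel_weight_bound[of "norm \<xi>" t "\<rho> / 2"] False t r by (simp add: a_def)
      then have "a\<^sup>2 \<le> (t powr (- (\<rho> / 2)))\<^sup>2" by (rule power_mono) (simp add: a_def)
      also have "\<dots> = t powr (- \<rho>)" using powr_half_power2[of t "- \<rho>"] by simp
      finally have a: "a\<^sup>2 \<le> t powr (- \<rho>)" .
      have "norm \<xi> powr (real CARD('n) - 2 + 2 * \<rho>) * (exp (- t * (norm \<xi>)\<^sup>2) * \<gamma> \<xi>)\<^sup>2 = a\<^sup>2 * (norm \<xi> powr (real CARD('n) - 2) * (\<gamma> \<xi>)\<^sup>2)"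
      proof -
        have "norm \<xi> powr (real CARD('n) - 2 + 2 * \<rho>) = norm \<xi> powr (real CARD('n) - 2) * (norm \<xi> powr \<rho> * norm \<xi> powr \<rho>)"
          by (simp add: powr_add[symmetric])
        then show ?thesis by (simp add: a_def power2_eq_square mult_ac)
      qed
      also have "\<dots> \<le> t powr (- \<rho>) * (norm \<xi> powr (real CARD('n) - 2) * (\<gamma> \<xi>)\<^sup>2)"
        by (rule mult_right_mono[OF a]) simp
      finally have "ennreal (norm \<xi> powr (real CARD('n) - 2 + 2 * \<rho>) * (exp (- t * (norm \<xi>)\<^sup>2) * \<gamma> \<xi>)\<^sup>2) \<le>
         ennreal (t powr (- \<rho>) * (norm \<xi> powr (real CARD('n) - 2) * (\<gamma> \<xi>)\<^sup>2))" by (rule ennreal_leI)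
      then show ?thesis
        unfolding heat_maj_square[of \<gamma>, OF \<gamma>] ennreal_power[OF \<gamma>] by (simp only: ennreal_mult'[OF powr_ge_zero])
    qed simp
  qed
  also have "\<dots> = ennreal (t powr (- \<rho>)) * wint (real CARD('n) - 2) (\<lambda>\<xi>. ennreal (\<gamma> \<xi>))"
    unfolding wint_def by (rule nn_integral_cmult) measurable
  finally show ?thesis .
qed

text \<open>This trades smallness of the datum for shortness of time: after multiplication by
  t^\<rho> the integrand is dominated by that of the datum and tends to 0 at each frequency.\<close>

lemma wint_heat_maj_small:
  fixes \<gamma> :: "real^'n::finite \<Rightarrow> real"
  assumes [measurable]: "\<gamma> \<in> borel_measurable borel" and \<gamma>: "\<And>\<xi>. \<gamma> \<xi> \<ge> 0"
    and M: "wint (real CARD('n) - 2) (\<lambda>\<xi>. ennreal (\<gamma> \<xi>)) < \<infinity>" and r: "0 < \<rho>" "\<rho> \<le> 2" and e: "\<epsilon> > 0"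
  obtains T where "T > 0" "\<And>t. 0 < t \<Longrightarrow> t < T \<Longrightarrow> wint (real CARD('n) - 2 + 2 * \<rho>) (\<lambda>\<xi>. heat_maj \<gamma> (t, \<xi>)) \<le> ennreal (\<epsilon> * t powr (- \<rho>))"
proof -
  let ?p = "real CARD('n) - 2 + 2 * \<rho>"
  define f where "f t \<xi> = t powr \<rho> * (norm \<xi> powr ?p * (exp (- t * (norm \<xi>)\<^sup>2) * \<gamma> \<xi>)\<^sup>2)" for t and \<xi> :: "real^'n"
  define w where "w \<xi> = norm \<xi> powr (real CARD('n) - 2) * (\<gamma> \<xi>)\<^sup>2" for \<xi> :: "real^'n"
  have [measurable]: "f t \<in> borel_measurable borel" "w \<in> borel_measurable borel" for t
    unfolding f_def[abs_def] w_def[abs_def] by measurable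
  have wi: "integrable lborel w"
  proof (rule integrableI_bounded)
    have "(\<integral>\<^sup>+\<xi>. ennreal (norm (w \<xi>)) \<partial>lborel) = wint (real CARD('n) - 2) (\<lambda>\<xi>. ennreal (\<gamma> \<xi>))"
      unfolding wint_def w_def using \<gamma> by (intro nn_integral_cong) (simp add: ennreal_mult' ennreal_power)
    then show "(\<integral>\<^sup>+\<xi>. ennreal (norm (w \<xi>)) \<partial>lborel) < \<infinity>" using M by simp
  qed measurable
  have fw: "0 \<le> f t \<xi>" "f t \<xi> \<le> w \<xi>" if t: "t > 0" for t \<xi>
  proof -
    show "0 \<le> f t \<xi>" by (simp add: f_def)
    show "f t \<xi> \<le> w \<xi>"
    proof (cases "\<xi> = 0")
      case False
      define a where "a = norm \<xi> powr \<rho> * exp (- t * (norm \<xi>)\<^sup>2)"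
      have "a \<le> t powr (- (\<rho> / 2))"
        using heat_kernel_weight_bound[of "norm \<xi>" t "\<rho> / 2"] False t r by (simp add: a_def)
      then have "a\<^sup>2 \<le> (t powr (- (\<rho> / 2)))\<^sup>2" by (rule power_mono) (simp add: a_def)
      also have "\<dots> = t powr (- \<rho>)" using powr_half_power2[of t "- \<rho>"] by simp
      finally have "t powr \<rho> * a\<^sup>2 \<le> t powr \<rho> * t powr (- \<rho>)" by (rule mult_left_mono) simp
      also have "\<dots> = 1" using t by (simp add: powr_add[symmetric])
      finally have a: "t powr \<rho> * a\<^sup>2 \<le> 1" .
      have "f t \<xi> = t powr \<rho> * a\<^sup>2 * w \<xi>"
      proof -
        have "norm \<xi> powr ?p = norm \<xi> powr (real CARD('n) - 2) * (norm \<xi> powr \<rho> * norm \<xi> powr \<rho>)"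
          by (simp add: powr_add[symmetric])
        then show ?thesis by (simp add: f_def w_def a_def power2_eq_square mult_ac)
      qed
      also have "\<dots> \<le> 1 * w \<xi>" by (rule mult_right_mono[OF a]) (simp add: w_def)
      finally show ?thesis by simp
    qed (simp add: f_def w_def)
  qed
  \<comment> \<open>The substitution t = 1/\<tau> fits the form of dominated convergence along
    \<open>at_top\<close>.\<close>
  have "((\<lambda>\<tau>. LINT \<xi>|lborel. f (1 / \<tau>) \<xi>) \<longlongrightarrow> (LINT \<xi>::real^'n|lborel. 0)) at_top"
  proof (rule integral_dominated_convergence_at_top[where w = w])
    show "\<forall>\<^sub>F \<tau> in at_top. AE \<xi> in lborel. norm (f (1 / \<tau>) \<xi>) \<le> w \<xi>"
      using eventually_gt_at_top[of "0::real"]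
    proof eventually_elim
      case (elim \<tau>)
      then show ?case using fw[of "1 / \<tau>"] by simp
    qed
    show "AE \<xi> in lborel. ((\<lambda>\<tau>. f (1 / \<tau>) \<xi>) \<longlongrightarrow> 0) at_top"
    proof (rule AE_I2)
      fix \<xi> :: "real^'n"
      have i: "((\<lambda>\<tau>::real. 1 / \<tau>) \<longlongrightarrow> 0) at_top" by (rule tendsto_divide_0[OF tendsto_const filterlim_at_top_imp_at_infinity[OF filterlim_ident]])
      have "((\<lambda>\<tau>::real. (1 / \<tau>) powr \<rho>) \<longlongrightarrow> 0 powr \<rho>) at_top"
        using r by (intro tendsto_powr' i tendsto_const) (auto intro: eventually_mono[OF eventually_gt_at_top[of 0]])
      then have "((\<lambda>\<tau>::real. (1 / \<tau>) powr \<rho>) \<longlongrightarrow> 0) at_top" by simp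
      moreover have "((\<lambda>\<tau>. norm \<xi> powr ?p * (exp (- (1 / \<tau>) * (norm \<xi>)\<^sup>2) * \<gamma> \<xi>)\<^sup>2) \<longlongrightarrow> norm \<xi> powr ?p * (exp (- 0 * (norm \<xi>)\<^sup>2) * \<gamma> \<xi>)\<^sup>2) at_top"
        by (intro tendsto_intros i)
      ultimately have "((\<lambda>\<tau>. f (1 / \<tau>) \<xi>) \<longlongrightarrow> 0 * (norm \<xi> powr ?p * (exp (- 0 * (norm \<xi>)\<^sup>2) * \<gamma> \<xi>)\<^sup>2)) at_top"
        unfolding f_def by (rule tendsto_mult)
      then show "((\<lambda>\<tau>. f (1 / \<tau>) \<xi>) \<longlongrightarrow> 0) at_top" by simp
    qed
  qed (use wi in auto)
  then have "\<forall>\<^sub>F \<tau> in at_top. (LINT \<xi>|lborel. f (1 / \<tau>) \<xi>) < \<epsilon>"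
    using e by (intro order_tendstoD) auto
  then obtain \<tau>0 where \<tau>0: "\<And>\<tau>. \<tau> \<ge> \<tau>0 \<Longrightarrow> (LINT \<xi>|lborel. f (1 / \<tau>) \<xi>) < \<epsilon>"
    unfolding eventually_at_top_linorder by blast
  define T where "T = 1 / max \<tau>0 1"
  show ?thesis
  proof (rule that)
    show "T > 0" by (simp add: T_def)
    fix t assume t: "0 < t" "t < T"
    have "1 / T < 1 / t" using t by (intro divide_strict_left_mono) auto
    then have "1 / t \<ge> \<tau>0" by (simp add: T_def)
    from \<tau>0[OF this] have l: "(LINT \<xi>|lborel. f t \<xi>) < \<epsilon>" by simp
    have fi: "integrable lborel (f t)"
      by (rule Bochner_Integration.integrable_bound[OF wi]) (use fw[OF t(1)] in \<open>auto intro!: AE_I2 intro: order_trans[OF _ abs_ge_self]\<close>)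
    have e1: "ennreal (norm \<xi> powr ?p) * (heat_maj \<gamma> (t, \<xi>))\<^sup>2 = ennreal (t powr (- \<rho>)) * ennreal (f t \<xi>)" for \<xi>
    proof -
      have "t powr (- \<rho>) * f t \<xi> = (t powr (- \<rho>) * t powr \<rho>) * (norm \<xi> powr ?p * (exp (- t * (norm \<xi>)\<^sup>2) * \<gamma> \<xi>)\<^sup>2)"
        unfolding f_def by (simp only: mult.assoc)
      also have "t powr (- \<rho>) * t powr \<rho> = 1" using t by (simp add: powr_add[symmetric])
      finally have "norm \<xi> powr ?p * (exp (- t * (norm \<xi>)\<^sup>2) * \<gamma> \<xi>)\<^sup>2 = t powr (- \<rho>) * f t \<xi>" by simp
      then have "ennreal (norm \<xi> powr ?p * (exp (- t * (norm \<xi>)\<^sup>2) * \<gamma> \<xi>)\<^sup>2) = ennreal (t powr (- \<rho>) * f t \<xi>)" by simp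
      then show ?thesis
        unfolding heat_maj_square[of \<gamma>, OF \<gamma>] by (simp only: ennreal_mult'[OF powr_ge_zero])
    qed
    have "wint ?p (\<lambda>\<xi>. heat_maj \<gamma> (t, \<xi>)) = (\<integral>\<^sup>+\<xi>. ennreal (t powr (- \<rho>)) * ennreal (f t \<xi>) \<partial>lborel)"
      unfolding wint_def e1 ..
    also have "\<dots> = ennreal (t powr (- \<rho>)) * (\<integral>\<^sup>+\<xi>. ennreal (f t \<xi>) \<partial>lborel)" by (rule nn_integral_cmult) measurable
    also have "(\<integral>\<^sup>+\<xi>. ennreal (f t \<xi>) \<partial>lborel) = ennreal (LINT \<xi>|lborel. f t \<xi>)"
      using fw(1)[OF t(1)] by (intro nn_integral_eq_integral fi) auto
    also have "ennreal (t powr (- \<rho>)) * ennreal (LINT \<xi>|lborel. f t \<xi>) \<le> ennreal (t powr (- \<rho>)) * ennreal \<epsilon>"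
      using l by (intro mult_left_mono ennreal_leI) auto
    also have "\<dots> = ennreal (\<epsilon> * t powr (- \<rho>))" using e by (simp add: ennreal_mult mult.commute)
    finally show "wint ?p (\<lambda>\<xi>. heat_maj \<gamma> (t, \<xi>)) \<le> ennreal (\<epsilon> * t powr (- \<rho>))" .
  qed
qed

section \<open>The increasing scalar iteration\<close>

definition self_conv :: "(real \<times> (real^'n::finite) \<Rightarrow> ennreal) \<Rightarrow> real \<times> (real^'n) \<Rightarrow> ennreal" where
  "self_conv V z = nconv (\<lambda>\<eta>. V (fst z, \<eta>)) (\<lambda>\<eta>. V (fst z, \<eta>)) (snd z)"

lemma self_conv_measurable [measurable]:
  fixes V :: "real \<times> (real^'n::finite) \<Rightarrow> ennreal"
  assumes V: "V \<in> borel_measurable borel"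
  shows "self_conv V \<in> borel_measurable borel"
proof -
  have [measurable]: "V \<in> borel_measurable (borel \<Otimes>\<^sub>M borel)" using V by (simp add: borel_prod)
  have "self_conv V \<in> borel_measurable (borel \<Otimes>\<^sub>M borel)"
    unfolding self_conv_def[abs_def] nconv_def by measurable
  then show ?thesis by (simp add: borel_prod)
qed

lemma section_measurable:
  fixes V :: "real \<times> (real^'n::finite) \<Rightarrow> 'a::topological_space"
  assumes "V \<in> borel_measurable borel"
  shows "(\<lambda>\<xi>. V (t, \<xi>)) \<in> borel_measurable borel" "(\<lambda>t. V (t, \<xi>)) \<in> borel_measurable borel"
proof -
  have [measurable]: "V \<in> borel_measurable (borel \<Otimes>\<^sub>M borel)" using assms by (simp add: borel_prod)
  show "(\<lambda>\<xi>. V (t, \<xi>)) \<in> borel_measurable borel" "(\<lambda>t. V (t, \<xi>)) \<in> borel_measurable borel" by measurable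
qed

lemma duhamel_measurable:
  fixes F :: "real \<times> (real^'n::finite) \<Rightarrow> ennreal"
  assumes F: "F \<in> borel_measurable borel"
  shows "(\<lambda>z. duhamel t1 (fst z) F (snd z)) \<in> borel_measurable borel"
    "duhamel t1 t2 F \<in> borel_measurable borel"
proof -
  have [measurable]: "F \<in> borel_measurable (borel \<Otimes>\<^sub>M borel)" using F by (simp add: borel_prod)
  have [measurable]: "(\<lambda>p. indicator {t1<..<fst (fst p)} (snd p) :: ennreal) \<in> borel_measurable ((borel \<Otimes>\<^sub>M borel) \<Otimes>\<^sub>M lborel)"
    unfolding indicator_def greaterThanLessThan_iff by measurable
  have "(\<lambda>z. duhamel t1 (fst z) F (snd z)) \<in> borel_measurable (borel \<Otimes>\<^sub>M borel)"
    unfolding duhamel_def by measurable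
  then show 1: "(\<lambda>z. duhamel t1 (fst z) F (snd z)) \<in> borel_measurable borel" by (simp add: borel_prod)
  from section_measurable(1)[OF 1, of t2] show "duhamel t1 t2 F \<in> borel_measurable borel" by simp
qed

lemma nconv_mono: "(\<And>\<xi>. V \<xi> \<le> V' \<xi>) \<Longrightarrow> nconv V V \<xi> \<le> nconv V' V' \<xi>"
  unfolding nconv_def by (intro nn_integral_mono mult_mono) auto

lemma self_conv_mono: "(\<And>z. V z \<le> V' z) \<Longrightarrow> self_conv V z \<le> self_conv V' z"
  unfolding self_conv_def by (intro nconv_mono) auto

lemma duhamel_mono: "(\<And>z. F z \<le> F' z) \<Longrightarrow> duhamel t1 t2 F \<xi> \<le> duhamel t1 t2 F' \<xi>"
  unfolding duhamel_def by (intro nn_integral_mono mult_left_mono) auto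

text \<open>Started at 0, the sequence increases because the right-hand side is monotone; in
  \<open>ennreal\<close> every step is meaningful before any convergence is known.\<close>

fun maj :: "real \<Rightarrow> (real^'n::finite \<Rightarrow> real) \<Rightarrow> nat \<Rightarrow> real \<times> (real^'n) \<Rightarrow> ennreal" where
  "maj K \<gamma> 0 z = 0"
| "maj K \<gamma> (Suc k) z = heat_maj \<gamma> z + ennreal K * duhamel 0 (fst z) (self_conv (maj K \<gamma> k)) (snd z)"

definition maj_lim :: "real \<Rightarrow> (real^'n::finite \<Rightarrow> real) \<Rightarrow> real \<times> (real^'n) \<Rightarrow> ennreal" where
  "maj_lim K \<gamma> z = (SUP k. maj K \<gamma> k z)"

lemma heat_maj_measurable [measurable]:
  fixes \<gamma> :: "real^'n::finite \<Rightarrow> real"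
  assumes [measurable]: "\<gamma> \<in> borel_measurable borel"
  shows "heat_maj \<gamma> \<in> borel_measurable borel"
proof -
  have "heat_maj \<gamma> \<in> borel_measurable (borel \<Otimes>\<^sub>M borel)" unfolding heat_maj_def[abs_def] by measurable
  then show ?thesis by (simp add: borel_prod)
qed

lemma maj_measurable [measurable]:
  fixes \<gamma> :: "real^'n::finite \<Rightarrow> real"
  assumes [measurable]: "\<gamma> \<in> borel_measurable borel"
  shows "maj K \<gamma> k \<in> borel_measurable borel"
proof (induction k)
  case 0
  have "maj K \<gamma> 0 = (\<lambda>z. 0)" by auto
  then show ?case by simp
next
  case (Suc k)
  have e: "maj K \<gamma> (Suc k) = (\<lambda>z. heat_maj \<gamma> z + ennreal K * duhamel 0 (fst z) (self_conv (maj K \<gamma> k)) (snd z))" by auto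
  note [measurable] = duhamel_measurable(1)[OF self_conv_measurable[OF Suc]]
  show ?case unfolding e by measurable
qed

lemma maj_lim_measurable [measurable]:
  fixes \<gamma> :: "real^'n::finite \<Rightarrow> real"
  assumes [measurable]: "\<gamma> \<in> borel_measurable borel"
  shows "maj_lim K \<gamma> \<in> borel_measurable borel"
  unfolding maj_lim_def[abs_def] by measurable

lemma maj_Suc_mono: "maj K \<gamma> k z \<le> maj K \<gamma> (Suc k) z"
proof (induction k arbitrary: z)
  case (Suc k)
  show ?case
    unfolding maj.simps(2)[of K \<gamma> k z] maj.simps(2)[of K \<gamma> "Suc k" z]
    by (intro add_left_mono mult_left_mono duhamel_mono self_conv_mono Suc) simp
qed simp

lemma maj_le_lim: "maj K \<gamma> k z \<le> maj_lim K \<gamma> z"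
  unfolding maj_lim_def by (rule SUP_upper) simp

text \<open>Each iterate lies below the right-hand side evaluated at the limit, so monotonicity
  suffices and no supremum is exchanged with an integral.\<close>

lemma maj_lim_le: "maj_lim K \<gamma> z \<le> heat_maj \<gamma> z + ennreal K * duhamel 0 (fst z) (self_conv (maj_lim K \<gamma>)) (snd z)"
proof -
  have "maj K \<gamma> k z \<le> heat_maj \<gamma> z + ennreal K * duhamel 0 (fst z) (self_conv (maj_lim K \<gamma>)) (snd z)" for k
  proof (cases k)
    case (Suc j)
    show ?thesis
      unfolding Suc maj.simps(2)[of K \<gamma> j z] by (intro add_left_mono mult_left_mono duhamel_mono self_conv_mono maj_le_lim) simp
  qed simp
  then show ?thesis unfolding maj_lim_def by (intro SUP_least)
qed

lemma SUP_square_ennreal: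
  fixes f :: "nat \<Rightarrow> ennreal"
  assumes "incseq f"
  shows "(SUP k. f k)\<^sup>2 \<le> (SUP k. (f k)\<^sup>2)"
proof -
  have "(SUP i. f i) * (SUP j. f j) = (SUP i. SUP j. f i * f j)"
    by (simp add: SUP_mult_left_ennreal SUP_mult_right_ennreal mult.commute)
  also have "\<dots> \<le> (SUP k. (f k)\<^sup>2)"
  proof (intro SUP_least)
    fix i j
    have "f i * f j \<le> f (max i j) * f (max i j)"
      using assms by (intro mult_mono) (auto simp: incseq_def)
    also have "\<dots> \<le> (SUP k. (f k)\<^sup>2)" unfolding power2_eq_square by (rule SUP_upper) simp
    finally show "f i * f j \<le> (SUP k. (f k)\<^sup>2)" .
  qed
  finally show ?thesis by (simp add: power2_eq_square)
qed

text \<open>Squaring passes through the supremum of an increasing sequence, after which monotone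
  convergence applies to the weighted integrals.\<close>

lemma wint_maj_lim_le:
  fixes \<gamma> :: "real^'n::finite \<Rightarrow> real"
  assumes [measurable]: "\<gamma> \<in> borel_measurable borel"
    and b: "\<And>k. wint p (\<lambda>\<xi>. maj K \<gamma> k (t, \<xi>)) \<le> B"
  shows "wint p (\<lambda>\<xi>. maj_lim K \<gamma> (t, \<xi>)) \<le> B"
proof -
  note [measurable] = section_measurable(1)[OF maj_measurable[OF assms(1)]]
  have inc: "incseq (\<lambda>k. maj K \<gamma> k z)" for z by (intro incseq_SucI maj_Suc_mono)
  have "wint p (\<lambda>\<xi>. maj_lim K \<gamma> (t, \<xi>)) \<le> (\<integral>\<^sup>+\<xi>. (SUP k. ennreal (norm \<xi> powr p) * (maj K \<gamma> k (t, \<xi>))\<^sup>2) \<partial>lborel)"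
    unfolding wint_def maj_lim_def
    by (intro nn_integral_mono, subst SUP_mult_left_ennreal[symmetric]) (intro mult_left_mono SUP_square_ennreal inc, simp)
  also have "\<dots> = (SUP k. wint p (\<lambda>\<xi>. maj K \<gamma> k (t, \<xi>)))"
    unfolding wint_def
  proof (rule nn_integral_monotone_convergence_SUP)
    show "incseq (\<lambda>k \<xi>. ennreal (norm \<xi> powr p) * (maj K \<gamma> k (t, \<xi>))\<^sup>2)"
      by (intro incseq_SucI le_funI mult_left_mono power_mono maj_Suc_mono) auto
  qed measurable
  also have "\<dots> \<le> B" by (rule SUP_least) (rule b)
  finally show ?thesis .
qed

text \<open>With q = n - 1/2 the convolution lands in the weight 2q - n = n - 1, and (s^(-3/4))^2 =
  s^(-3/2): exactly the input of \<open>wint_duhamel_le\<close>.\<close>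

lemma wint_bilinear:
  assumes n: "CARD('n::finite) \<ge> 2"
  obtains C where "C \<ge> 0" "\<And>(V :: real \<times> (real^'n) \<Rightarrow> ennreal) L b t1 t2.
      V \<in> borel_measurable borel \<Longrightarrow> 0 \<le> t1 \<Longrightarrow> 1 / 4 \<le> b \<Longrightarrow> b \<le> 1 \<Longrightarrow> L \<ge> 0 \<Longrightarrow>
      (\<And>s. t1 < s \<Longrightarrow> s < t2 \<Longrightarrow> wint (real CARD('n) - 1 / 2) (\<lambda>\<xi>. V (s, \<xi>)) \<le> ennreal (L * s powr (- 3 / 4))) \<Longrightarrow>
      wint (real CARD('n) - 3 + 4 * b) (duhamel t1 t2 (self_conv V)) \<le> ennreal (C * L\<^sup>2) * (beta_int b t1 t2)\<^sup>2"
proof -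
  define q where "q = real CARD('n) - 1 / 2"
  have "real CARD('n) \<ge> 2" using n by linarith
  then have q: "real CARD('n) < 2 * q" "q < real CARD('n)" by (auto simp: q_def)
  obtain C where C: "C \<ge> 0" "\<And>V :: real^'n \<Rightarrow> ennreal. V \<in> borel_measurable borel \<Longrightarrow>
    wint (2 * q - real CARD('n)) (nconv V V) \<le> ennreal C * (wint q V)\<^sup>2"
    using wint_nconv_le[OF q] by blast
  show ?thesis
  proof (rule that[OF C(1)])
    fix V :: "real \<times> (real^'n) \<Rightarrow> ennreal" and L b t1 t2 :: real
    assume V: "V \<in> borel_measurable borel" and t: "0 \<le> t1" and b: "1 / 4 \<le> b" "b \<le> 1" and L: "L \<ge> 0"
      and W: "\<And>s. t1 < s \<Longrightarrow> s < t2 \<Longrightarrow> wint (real CARD('n) - 1 / 2) (\<lambda>\<xi>. V (s, \<xi>)) \<le> ennreal (L * s powr (- 3 / 4))"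
    show "wint (real CARD('n) - 3 + 4 * b) (duhamel t1 t2 (self_conv V)) \<le> ennreal (C * L\<^sup>2) * (beta_int b t1 t2)\<^sup>2"
    proof (rule wint_duhamel_le[OF self_conv_measurable[OF V] t b])
      fix s assume s: "t1 < s" "s < t2"
      have "wint (real CARD('n) - 1) (\<lambda>\<xi>. self_conv V (s, \<xi>)) \<le> ennreal C * (wint q (\<lambda>\<xi>. V (s, \<xi>)))\<^sup>2"
        using C(2)[OF section_measurable(1)[OF V], of s] by (simp add: self_conv_def q_def)
      also have "\<dots> \<le> ennreal C * (ennreal (L * s powr (- 3 / 4)))\<^sup>2"
        using W[OF s] by (intro mult_left_mono power_mono) (auto simp: q_def)
      also have "\<dots> = ennreal (C * L\<^sup>2 * s powr (- 3 / 2))"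
      proof -
        have "(L * s powr (- 3 / 4))\<^sup>2 = L\<^sup>2 * s powr (- 3 / 2)"
          using powr_half_power2[of s "- 3 / 2"] by (simp add: power_mult_distrib)
        then show ?thesis using L C(1) by (simp add: ennreal_power ennreal_mult[symmetric])
      qed
      finally show "wint (real CARD('n) - 1) (\<lambda>\<xi>. self_conv V (s, \<xi>)) \<le> ennreal (C * L\<^sup>2 * s powr (- 3 / 2))" .
    qed (use C L in simp)
  qed
qed

subsection \<open>Picard iteration\<close>

text \<open>Based on a'b' - ab = a'(b' - b) + (a' - a)b. The additive form, increment plus old
  majorant at most new majorant, telescopes and avoids subtraction in \<open>ennreal\<close>, where
  infinite values do not cancel.\<close>

lemma ennreal_norm_prod_diff_le:
  fixes a a' b b' :: complex and V1 V2 W1 W2 :: ennreal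
  assumes a: "ennreal (cmod (a' - a)) + V1 \<le> W1" and b: "ennreal (cmod (b' - b)) + V2 \<le> W2"
    and a': "ennreal (cmod a') \<le> W1" and bV: "ennreal (cmod b) \<le> V2"
  shows "ennreal (cmod (a' * b' - a * b)) + V1 * V2 \<le> W1 * W2"
proof -
  have "a' * b' - a * b = a' * (b' - b) + (a' - a) * b" by (simp add: algebra_simps)
  then have "cmod (a' * b' - a * b) \<le> cmod a' * cmod (b' - b) + cmod (a' - a) * cmod b"
    by (metis norm_mult norm_triangle_ineq)
  then have "ennreal (cmod (a' * b' - a * b)) \<le> ennreal (cmod a' * cmod (b' - b) + cmod (a' - a) * cmod b)"
    by (rule ennreal_leI)
  also have "\<dots> = ennreal (cmod a') * ennreal (cmod (b' - b)) + ennreal (cmod (a' - a)) * ennreal (cmod b)"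
    by (simp add: ennreal_mult)
  also have "\<dots> \<le> W1 * ennreal (cmod (b' - b)) + ennreal (cmod (a' - a)) * V2"
    by (intro add_mono mult_right_mono mult_left_mono a' bV) auto
  finally have "ennreal (cmod (a' * b' - a * b)) + V1 * V2 \<le> W1 * ennreal (cmod (b' - b)) + (ennreal (cmod (a' - a)) + V1) * V2"
    by (simp add: distrib_right add.assoc[symmetric] add_right_mono)
  also have "\<dots> \<le> W1 * ennreal (cmod (b' - b)) + W1 * V2"
    by (intro add_left_mono mult_right_mono a) auto
  also have "\<dots> = W1 * (ennreal (cmod (b' - b)) + V2)" by (simp add: distrib_left)
  also have "\<dots> \<le> W1 * W2" by (intro mult_left_mono b) auto
  finally show ?thesis .
qed

text \<open>The symmetry of \<open>g\<close> is required at every point, so the Picard iterates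
  inherit it pointwise and their limit has a real inverse transform.\<close>

locale ns_data =
  fixes g :: "'n::finite \<Rightarrow> real^'n \<Rightarrow> complex"
  assumes dim3: "CARD('n) \<ge> 3"
    and g_measurable [measurable]: "\<And>j. g j \<in> borel_measurable borel"
    and g_herm: "\<And>j \<xi>. g j (- \<xi>) = cnj (g j \<xi>)"
    and g_int: "\<And>j. integrable lborel (\<lambda>\<xi>. norm \<xi> powr (real CARD('n) - 2) * (cmod (g j \<xi>))\<^sup>2)"
begin

definition \<gamma> :: "real^'n \<Rightarrow> real" where "\<gamma> \<xi> = (\<Sum>j\<in>UNIV. cmod (g j \<xi>))"

definition cn :: real where "cn = ft_const CARD('n)"

text \<open>The symbol of the projected derivative, including the constant \<open>cn\<close> that
  arises when a product of inverse transforms becomes a convolution.\<close>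

definition symb :: "'n \<Rightarrow> 'n \<Rightarrow> 'n \<Rightarrow> real^'n \<Rightarrow> complex" where
  "symb j k l \<xi> = \<i> * of_real (cn * \<xi> $ l * leray_symbol j k \<xi>)"

text \<open>There are n^2 index pairs, and each \<open>symb\<close> is at most 2 \<open>cn\<close>
  |\<xi>|.\<close>

definition K :: real where "K = real (CARD('n) * CARD('n)) * (2 * cn)"

text \<open>Time and inner frequency form one variable \<open>p\<close>, so the Duhamel term
  converges by a single use of dominated convergence; Fubini recovers the iterated form
  later.\<close>

definition kern :: "('n \<Rightarrow> real \<times> (real^'n) \<Rightarrow> complex) \<Rightarrow> 'n \<Rightarrow> real \<times> (real^'n) \<Rightarrow> real \<times> (real^'n) \<Rightarrow> complex" where
  "kern U j z p = of_real (indicator {0<..<fst z} (fst p) * exp (- (fst z - fst p) * (norm (snd z))\<^sup>2)) *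
     (\<Sum>k\<in>UNIV. \<Sum>l\<in>UNIV. symb j k l (snd z) * (U l (fst p, snd z - snd p) * U k p))"

definition kern_maj :: "(real \<times> (real^'n) \<Rightarrow> ennreal) \<Rightarrow> real \<times> (real^'n) \<Rightarrow> real \<times> (real^'n) \<Rightarrow> ennreal" where
  "kern_maj V z p = ennreal (indicator {0<..<fst z} (fst p) * exp (- (fst z - fst p) * (norm (snd z))\<^sup>2) * (K * norm (snd z))) *
     (V (fst p, snd z - snd p) * V p)"

fun pic :: "nat \<Rightarrow> 'n \<Rightarrow> real \<times> (real^'n) \<Rightarrow> complex" where
  "pic 0 j z = 0"
| "pic (Suc k) j z = of_real (exp (- fst z * (norm (snd z))\<^sup>2)) * g j (snd z) - (LINT p|lborel. kern (pic k) j z p)"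

abbreviation V where "V \<equiv> maj_lim K \<gamma>"

lemma cn_pos: "cn > 0"
  by (simp add: cn_def ft_const_pos)

lemma K_nonneg: "K \<ge> 0"
  using cn_pos by (simp add: K_def)

lemma \<gamma>_measurable [measurable]: "\<gamma> \<in> borel_measurable borel"
  unfolding \<gamma>_def[abs_def] by measurable

lemma \<gamma>_nonneg: "\<gamma> \<xi> \<ge> 0"
  by (simp add: \<gamma>_def sum_nonneg)

lemma g_le_\<gamma>: "cmod (g j \<xi>) \<le> \<gamma> \<xi>"
  unfolding \<gamma>_def by (rule member_le_sum) auto

lemma symb_measurable [measurable]: "symb j k l \<in> borel_measurable borel"
  unfolding symb_def[abs_def] by measurable

lemma symb_bound: "cmod (symb j k l \<xi>) \<le> 2 * cn * norm \<xi>"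
proof -
  have "\<bar>\<xi> $ l\<bar> * \<bar>leray_symbol j k \<xi>\<bar> \<le> norm \<xi> * 2"
    by (intro mult_mono component_le_norm_cart leray_symbol_bound) auto
  then have "cn * (\<bar>\<xi> $ l\<bar> * \<bar>leray_symbol j k \<xi>\<bar>) \<le> cn * (norm \<xi> * 2)"
    using cn_pos by (intro mult_left_mono) auto
  then show ?thesis using cn_pos by (simp add: symb_def norm_mult abs_mult mult_ac)
qed

lemma symb_minus: "symb j k l (- \<xi>) = cnj (symb j k l \<xi>)"
  by (simp add: symb_def)

lemma kern_measurable:
  assumes U: "\<And>l. U l \<in> borel_measurable borel"
  shows "(\<lambda>(z, p). kern U j z p) \<in> borel_measurable (borel \<Otimes>\<^sub>M borel)"
    "kern U j z \<in> borel_measurable borel"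
proof -
  have [measurable]: "U l \<in> borel_measurable (borel \<Otimes>\<^sub>M borel)" for l using U by (simp add: borel_prod)
  have [measurable]: "(\<lambda>x. indicator {0<..<fst (fst x)} (fst (snd x) :: real) :: real) \<in> borel_measurable ((borel \<Otimes>\<^sub>M borel) \<Otimes>\<^sub>M (borel \<Otimes>\<^sub>M borel))"
    unfolding indicator_def greaterThanLessThan_iff by measurable
  have "(\<lambda>x. kern U j (fst x) (snd x)) \<in> borel_measurable ((borel \<Otimes>\<^sub>M borel) \<Otimes>\<^sub>M (borel \<Otimes>\<^sub>M borel))"
    unfolding kern_def by measurable
  then show 1: "(\<lambda>(z, p). kern U j z p) \<in> borel_measurable (borel \<Otimes>\<^sub>M borel)"
    by (simp add: borel_prod split_beta')
  show "kern U j z \<in> borel_measurable borel"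
    using measurable_compose[OF measurable_Pair1'[of z borel borel] 1] by simp
qed

lemma kern_maj_measurable:
  assumes U: "W \<in> borel_measurable borel"
  shows "kern_maj W z \<in> borel_measurable borel"
proof -
  have [measurable]: "W \<in> borel_measurable (borel \<Otimes>\<^sub>M borel)" using U by (simp add: borel_prod)
  have "kern_maj W z \<in> borel_measurable (borel \<Otimes>\<^sub>M borel)"
    unfolding kern_maj_def[abs_def] by measurable
  then show ?thesis by (simp add: borel_prod)
qed

lemma nn_integral_kern_maj:
  assumes W: "W \<in> borel_measurable borel"
  shows "(\<integral>\<^sup>+p. kern_maj W z p \<partial>lborel) = ennreal K * duhamel 0 (fst z) (self_conv W) (snd z)"
proof -
  have [measurable]: "W \<in> borel_measurable (borel \<Otimes>\<^sub>M borel)" using W by (simp add: borel_prod)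
  have [measurable]: "self_conv W \<in> borel_measurable (borel \<Otimes>\<^sub>M borel)"
    using self_conv_measurable[OF W] by (simp add: borel_prod)
  have m: "kern_maj W z \<in> borel_measurable (lborel \<Otimes>\<^sub>M lborel)"
    using kern_maj_measurable[OF W] by (simp add: lborel_prod)
  have "(\<integral>\<^sup>+p. kern_maj W z p \<partial>lborel) = (\<integral>\<^sup>+s. \<integral>\<^sup>+\<eta>. kern_maj W z (s, \<eta>) \<partial>lborel \<partial>lborel)"
    using lborel.nn_integral_fst[OF m] by (simp add: lborel_prod)
  also have "\<dots> = (\<integral>\<^sup>+s. ennreal K * (indicator {0<..<fst z} s * (ennreal (exp (- (fst z - s) * (norm (snd z))\<^sup>2) * norm (snd z)) * self_conv W (s, snd z))) \<partial>lborel)"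
  proof (rule nn_integral_cong)
    fix s
    have "(\<integral>\<^sup>+\<eta>. kern_maj W z (s, \<eta>) \<partial>lborel) = ennreal (indicator {0<..<fst z} s * exp (- (fst z - s) * (norm (snd z))\<^sup>2) * (K * norm (snd z))) * self_conv W (s, snd z)"
      unfolding kern_maj_def self_conv_def nconv_def fst_conv snd_conv by (rule nn_integral_cmult) measurable
    then show "(\<integral>\<^sup>+\<eta>. kern_maj W z (s, \<eta>) \<partial>lborel) = ennreal K * (indicator {0<..<fst z} s * (ennreal (exp (- (fst z - s) * (norm (snd z))\<^sup>2) * norm (snd z)) * self_conv W (s, snd z)))"
      using K_nonneg by (simp add: ennreal_mult ennreal_indicator mult_ac)
  qed
  also have "\<dots> = ennreal K * duhamel 0 (fst z) (self_conv W) (snd z)"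
    unfolding duhamel_def by (rule nn_integral_cmult) measurable
  finally show ?thesis .
qed

text \<open>The increment form is carried from single products to the whole nonlinearity. Taking the
  smaller family and its majorant to be 0 gives plain domination.\<close>

lemma kern_diff_le:
  assumes d: "\<And>l p. ennreal (cmod (U' l p - U l p)) + W p \<le> W' p"
    and b: "\<And>l p. ennreal (cmod (U l p)) \<le> W p" and b': "\<And>l p. ennreal (cmod (U' l p)) \<le> W' p"
  shows "ennreal (cmod (kern U' j z p - kern U j z p)) + kern_maj W z p \<le> kern_maj W' z p"
proof -
  define w where "w = indicator {0<..<fst z} (fst p) * exp (- (fst z - fst p) * (norm (snd z))\<^sup>2)"
  have w: "w \<ge> 0" by (simp add: w_def)
  define y where "y = 2 * cn * norm (snd z)"
  have y: "y \<ge> 0" using cn_pos by (simp add: y_def)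
  let ?D = "\<lambda>k l. U' l (fst p, snd z - snd p) * U' k p - U l (fst p, snd z - snd p) * U k p"
  let ?VV = "W (fst p, snd z - snd p) * W p" and ?WW = "W' (fst p, snd z - snd p) * W' p"
  have D: "ennreal (cmod (?D k l)) + ?VV \<le> ?WW" for k l
    by (rule ennreal_norm_prod_diff_le[OF d d b' b])
  have "kern U' j z p - kern U j z p = of_real w * (\<Sum>k\<in>UNIV. \<Sum>l\<in>UNIV. symb j k l (snd z) * ?D k l)"
    unfolding kern_def w_def[symmetric] by (simp add: right_diff_distrib sum_subtractf)
  then have "cmod (kern U' j z p - kern U j z p) \<le> w * (\<Sum>k\<in>UNIV. \<Sum>l\<in>UNIV. y * cmod (?D k l))"
    using w by (auto simp: norm_mult y_def intro!: mult_left_mono sum_norm_le order_trans[OF norm_sum] sum_mono mult_right_mono symb_bound)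
  then have "ennreal (cmod (kern U' j z p - kern U j z p)) \<le> ennreal (w * y) * (\<Sum>k\<in>UNIV. \<Sum>l\<in>UNIV. ennreal (cmod (?D k l)))"
    using w y by (auto simp: sum_distrib_left[symmetric] ennreal_mult[symmetric] sum_nonneg mult_ac sum_ennreal intro!: ennreal_leI)
  \<comment> \<open>The factor n^2 in \<open>K\<close> is unfolded into a double sum, so that the
    comparison can be made term by term.\<close>
  moreover have kd: "kern_maj X z p = ennreal (w * y) * (\<Sum>k\<in>(UNIV::'n set). \<Sum>l\<in>(UNIV::'n set). X (fst p, snd z - snd p) * X p)" for X
  proof -
    have "w * (K * norm (snd z)) = (w * y) * real (CARD('n) * CARD('n))"
      by (simp add: K_def y_def)
    then have "ennreal (w * (K * norm (snd z))) = ennreal (w * y) * ennreal (real (CARD('n) * CARD('n)))"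
      using w y by (simp only:) (intro ennreal_mult, auto)
    then have "ennreal (w * (K * norm (snd z))) = ennreal (w * y) * of_nat (CARD('n) * CARD('n))"
      by (simp only: ennreal_of_nat_eq_real_of_nat)
    then show ?thesis unfolding kern_maj_def w_def[symmetric] by (simp add: mult_ac)
  qed
  ultimately have "ennreal (cmod (kern U' j z p - kern U j z p)) + kern_maj W z p \<le>
      ennreal (w * y) * (\<Sum>k\<in>(UNIV::'n set). \<Sum>l\<in>(UNIV::'n set). (ennreal (cmod (?D k l)) + ?VV))"
    by (simp only: kd sum.distrib distrib_left add_right_mono)
  also have "\<dots> \<le> kern_maj W' z p"
    unfolding kd by (intro mult_left_mono sum_mono D) auto
  finally show ?thesis .
qed

lemma kern_le:
  assumes b: "\<And>l p. ennreal (cmod (U l p)) \<le> W p"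
  shows "ennreal (cmod (kern U j z p)) \<le> kern_maj W z p"
  using kern_diff_le[where U' = U and U = "\<lambda>l p. 0" and W = "\<lambda>p. 0" and W' = W and j = j and z = z and p = p] b by (simp add: kern_def kern_maj_def)

lemma kern_integrable:
  assumes U: "\<And>l. U l \<in> borel_measurable borel" and b: "\<And>l p. ennreal (cmod (U l p)) \<le> W p"
    and f: "(\<integral>\<^sup>+p. kern_maj W z p \<partial>lborel) < \<infinity>"
  shows "integrable lborel (kern U j z)"
proof (rule integrableI_bounded)
  show "kern U j z \<in> borel_measurable lborel" using kern_measurable(2)[OF U] by simp
  have "(\<integral>\<^sup>+p. ennreal (cmod (kern U j z p)) \<partial>lborel) \<le> (\<integral>\<^sup>+p. kern_maj W z p \<partial>lborel)"
    by (intro nn_integral_mono kern_le b)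
  then show "(\<integral>\<^sup>+p. ennreal (norm (kern U j z p)) \<partial>lborel) < \<infinity>" using f by (rule le_less_trans)
qed

text \<open>If the larger majorant has infinite integral the claim is trivial; otherwise both
  kernels are integrable. Hence the bound holds at every point, in spite of the value 0 given to
  divergent integrals.\<close>

lemma kern_integral_diff_le:
  assumes U: "\<And>l. U l \<in> borel_measurable borel" and U': "\<And>l. U' l \<in> borel_measurable borel"
    and W: "W \<in> borel_measurable borel"
    and d: "\<And>l p. ennreal (cmod (U' l p - U l p)) + W p \<le> W' p"
    and b: "\<And>l p. ennreal (cmod (U l p)) \<le> W p" and b': "\<And>l p. ennreal (cmod (U' l p)) \<le> W' p"
  shows "ennreal (cmod ((LINT p|lborel. kern U' j z p) - (LINT p|lborel. kern U j z p))) + (\<integral>\<^sup>+p. kern_maj W z p \<partial>lborel) \<le> (\<integral>\<^sup>+p. kern_maj W' z p \<partial>lborel)"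
proof (cases "(\<integral>\<^sup>+p. kern_maj W' z p \<partial>lborel) < \<infinity>")
  case True
  have le: "kern_maj W z p \<le> kern_maj W' z p" for p
    by (rule order_trans[OF _ kern_diff_le[OF d b b', where j = j]]) (simp add: add_increasing)
  have "(\<integral>\<^sup>+p. kern_maj W z p \<partial>lborel) < \<infinity>"
    using nn_integral_mono[of lborel "kern_maj W z" "kern_maj W' z"] le True by (auto intro: le_less_trans)
  then have i: "integrable lborel (kern U j z)" by (rule kern_integrable[OF U b])
  have i': "integrable lborel (kern U' j z)" by (rule kern_integrable[OF U' b' True])
  have [measurable]: "kern U j z \<in> borel_measurable borel" "kern U' j z \<in> borel_measurable borel" "kern_maj W z \<in> borel_measurable borel"
    using kern_measurable(2)[OF U] kern_measurable(2)[OF U'] kern_maj_measurable[OF W] by auto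
  have "ennreal (cmod ((LINT p|lborel. kern U' j z p) - (LINT p|lborel. kern U j z p))) = ennreal (cmod (LINT p|lborel. kern U' j z p - kern U j z p))"
    using i i' by simp
  also have "\<dots> \<le> (\<integral>\<^sup>+p. ennreal (cmod (kern U' j z p - kern U j z p)) \<partial>lborel)"
    using i i' by (intro integral_norm_bound_ennreal) simp
  finally have "ennreal (cmod ((LINT p|lborel. kern U' j z p) - (LINT p|lborel. kern U j z p))) + (\<integral>\<^sup>+p. kern_maj W z p \<partial>lborel)
     \<le> (\<integral>\<^sup>+p. ennreal (cmod (kern U' j z p - kern U j z p)) \<partial>lborel) + (\<integral>\<^sup>+p. kern_maj W z p \<partial>lborel)"
    by (rule add_right_mono)
  also have "\<dots> = (\<integral>\<^sup>+p. (ennreal (cmod (kern U' j z p - kern U j z p)) + kern_maj W z p) \<partial>lborel)"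
    by (rule nn_integral_add[symmetric]) measurable
  also have "\<dots> \<le> (\<integral>\<^sup>+p. kern_maj W' z p \<partial>lborel)"
    by (intro nn_integral_mono kern_diff_le d b b')
  finally show ?thesis .
next
  case False
  then show ?thesis by (simp add: not_less top.extremum_unique)
qed

lemma kern_integral_le:
  assumes U: "\<And>l. U l \<in> borel_measurable borel" and b: "\<And>l p. ennreal (cmod (U l p)) \<le> W p"
  shows "ennreal (cmod (LINT p|lborel. kern U j z p)) \<le> (\<integral>\<^sup>+p. kern_maj W z p \<partial>lborel)"
  using kern_integral_diff_le[where U' = U and U = "\<lambda>l p. 0" and W = "\<lambda>p. 0" and W' = W and j = j and z = z] U b by (simp add: kern_def kern_maj_def)

lemma pic_measurable [measurable]: "pic k j \<in> borel_measurable borel"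
proof (induction k arbitrary: j)
  case 0
  have "pic 0 j = (\<lambda>z. 0)" by auto
  then show ?case by simp
next
  case (Suc k)
  have "(\<lambda>(z, p). kern (pic k) j z p) \<in> borel_measurable (borel \<Otimes>\<^sub>M lborel)"
    using kern_measurable(1)[OF Suc] by simp
  then have [measurable]: "(\<lambda>z. LINT p|lborel. kern (pic k) j z p) \<in> borel_measurable borel"
    by (rule lborel.borel_measurable_lebesgue_integral)
  have [measurable]: "(\<lambda>z. of_real (exp (- fst z * (norm (snd z))\<^sup>2)) * g j (snd z)) \<in> borel_measurable (borel :: (real \<times> (real^'n)) measure)"
  proof -
    have "(\<lambda>z. of_real (exp (- fst z * (norm (snd z))\<^sup>2)) * g j (snd z)) \<in> borel_measurable (borel \<Otimes>\<^sub>M borel :: (real \<times> (real^'n)) measure)"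
      by measurable
    then show ?thesis by (simp add: borel_prod)
  qed
  have e: "pic (Suc k) j = (\<lambda>z. of_real (exp (- fst z * (norm (snd z))\<^sup>2)) * g j (snd z) - (LINT p|lborel. kern (pic k) j z p))"
    by auto
  show ?case unfolding e by (rule borel_measurable_diff) measurable
qed

lemma maj_Suc_kern: "maj K \<gamma> (Suc k) z = heat_maj \<gamma> z + (\<integral>\<^sup>+p. kern_maj (maj K \<gamma> k) z p \<partial>lborel)"
  by (subst nn_integral_kern_maj) auto

lemma heat_g_le: "ennreal (cmod (of_real (exp (- fst z * (norm (snd z))\<^sup>2)) * g j (snd z))) \<le> heat_maj \<gamma> z"
  unfolding heat_maj_def by (intro ennreal_leI) (auto simp: norm_mult intro!: mult_left_mono g_le_\<gamma>)

lemma pic_le_maj: "ennreal (cmod (pic k j z)) \<le> maj K \<gamma> k z"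
proof (induction k arbitrary: j z)
  case (Suc k)
  have "cmod (pic (Suc k) j z) \<le> cmod (of_real (exp (- fst z * (norm (snd z))\<^sup>2)) * g j (snd z)) + cmod (LINT p|lborel. kern (pic k) j z p)"
    unfolding pic.simps(2) by (rule norm_triangle_ineq4)
  then have "ennreal (cmod (pic (Suc k) j z)) \<le> ennreal (cmod (of_real (exp (- fst z * (norm (snd z))\<^sup>2)) * g j (snd z)) + cmod (LINT p|lborel. kern (pic k) j z p))"
    by (rule ennreal_leI)
  also have "\<dots> = ennreal (cmod (of_real (exp (- fst z * (norm (snd z))\<^sup>2)) * g j (snd z))) + ennreal (cmod (LINT p|lborel. kern (pic k) j z p))"
    by (rule ennreal_plus) auto
  also have "\<dots> \<le> maj K \<gamma> (Suc k) z"
    unfolding maj_Suc_kern by (intro add_mono heat_g_le kern_integral_le pic_measurable Suc)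
  finally show ?case .
qed simp

text \<open>Telescoping: the increments of the Picard iterates are summable wherever the majorants stay finite.\<close>

lemma pic_diff_le: "ennreal (cmod (pic (Suc k) j z - pic k j z)) + maj K \<gamma> k z \<le> maj K \<gamma> (Suc k) z"
proof (induction k arbitrary: j z)
  case 0
  show ?case using pic_le_maj[of 1 j z] by simp
next
  case (Suc k)
  have "pic (Suc (Suc k)) j z - pic (Suc k) j z = (LINT p|lborel. kern (pic k) j z p) - (LINT p|lborel. kern (pic (Suc k)) j z p)"
    unfolding pic.simps(2)[of "Suc k" j z] pic.simps(2)[of k j z] by simp
  then have e: "cmod (pic (Suc (Suc k)) j z - pic (Suc k) j z) = cmod ((LINT p|lborel. kern (pic (Suc k)) j z p) - (LINT p|lborel. kern (pic k) j z p))"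
    by (simp only: norm_minus_commute)
  have "ennreal (cmod ((LINT p|lborel. kern (pic (Suc k)) j z p) - (LINT p|lborel. kern (pic k) j z p))) + (\<integral>\<^sup>+p. kern_maj (maj K \<gamma> k) z p \<partial>lborel)
      \<le> (\<integral>\<^sup>+p. kern_maj (maj K \<gamma> (Suc k)) z p \<partial>lborel)"
    by (rule kern_integral_diff_le[OF pic_measurable pic_measurable maj_measurable[OF \<gamma>_measurable] Suc pic_le_maj pic_le_maj])
  from add_left_mono[OF this, of "heat_maj \<gamma> z"] show ?case
    unfolding e maj_Suc_kern[of "Suc k"] maj_Suc_kern[of k] by (simp only: add.left_commute)
qed

text \<open>The sums of the increments stay below the majorants and hence below \<open>V\<close>.
  They are the iterates themselves, because the iteration starts at 0.\<close>

lemma pic_convergent: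
  assumes f: "V z < \<infinity>"
  shows "convergent (\<lambda>k. pic k j z)"
proof -
  define d where "d i = pic (Suc i) j z - pic i j z" for i
  have "(\<Sum>i<k. ennreal (cmod (d i))) \<le> maj K \<gamma> k z" for k
  proof (induction k)
    case (Suc k)
    have "(\<Sum>i<Suc k. ennreal (cmod (d i))) \<le> ennreal (cmod (d k)) + maj K \<gamma> k z"
      using Suc by (simp add: add_mono add.commute)
    also have "\<dots> \<le> maj K \<gamma> (Suc k) z" unfolding d_def by (rule pic_diff_le)
    finally show ?case .
  qed simp
  then have "(\<Sum>i<k. ennreal (cmod (d i))) \<le> V z" for k using maj_le_lim order_trans by blast
  then have "(\<Sum>i. ennreal (cmod (d i))) \<le> V z" by (intro suminf_le_const) auto
  then have "summable (\<lambda>i. cmod (d i))"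
    using f by (intro summable_suminf_not_top) auto
  then have "summable d" by (rule summable_norm_cancel)
  then have "convergent (\<lambda>k. \<Sum>i<k. d i)" by (simp add: summable_iff_convergent)
  moreover have "(\<Sum>i<k. d i) = pic k j z" for k
    unfolding d_def by (subst sum_lessThan_telescope) simp
  ultimately show ?thesis by simp
qed

text \<open>The default 0 keeps \<open>sol\<close> measurable and hermitian everywhere. It respects
  the majorant, as the iterates converge wherever \<open>V\<close> is finite.\<close>

definition sol :: "'n \<Rightarrow> real \<times> (real^'n) \<Rightarrow> complex" where
  "sol j z = (if Cauchy (\<lambda>k. pic k j z) then lim (\<lambda>k. pic k j z) else 0)"

lemma sol_measurable [measurable]: "sol j \<in> borel_measurable borel"
proof -
  have 1: "(\<lambda>z. lim (\<lambda>k. pic k j z)) \<in> borel_measurable borel"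
    by (rule borel_measurable_lim_metric) (rule pic_measurable)
  have 2: "{z \<in> space borel. Cauchy (\<lambda>k. pic k j z)} \<in> sets borel"
    by (rule sets_Collect_Cauchy) (rule pic_measurable)
  show ?thesis unfolding sol_def[abs_def] by (rule measurable_If[OF 1 borel_measurable_const 2])
qed

lemma pic_tendsto_sol:
  assumes "V z < \<infinity>"
  shows "(\<lambda>k. pic k j z) \<longlonglongrightarrow> sol j z"
proof -
  note c = pic_convergent[OF assms, of j]
  then have "Cauchy (\<lambda>k. pic k j z)" by (rule convergent_Cauchy)
  then show ?thesis using c by (simp add: sol_def convergent_LIMSEQ_iff)
qed

lemma sol_le: "ennreal (cmod (sol j z)) \<le> V z"
proof (cases "V z < \<infinity>")
  case True
  have "(\<lambda>k. ennreal (cmod (pic k j z))) \<longlonglongrightarrow> ennreal (cmod (sol j z))"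
    by (intro tendsto_intros tendsto_ennrealI pic_tendsto_sol True)
  then show ?thesis
    by (rule LIMSEQ_le_const2) (use pic_le_maj maj_le_lim order_trans in blast)
next
  case False
  then show ?thesis by (simp add: not_less top.extremum_unique)
qed

text \<open>The kernel at frequency -\<xi> is the conjugate of the kernel at \<xi> with the inner
  frequency reflected. Time stays fixed, so it is the partial reflection \<open>R\<close> that has
  to preserve Lebesgue measure.\<close>

lemma kern_herm:
  assumes [measurable]: "\<And>l. U l \<in> borel_measurable borel" and h: "\<And>l s \<xi>. U l (s, - \<xi>) = cnj (U l (s, \<xi>))"
  shows "(LINT p|lborel. kern U j (t, - \<xi>) p) = cnj (LINT p|lborel. kern U j (t, \<xi>) p)"
proof -
  define R where "R p = (fst p, - snd p)" for p :: "real \<times> (real^'n)"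
  have Rm: "R \<in> borel_measurable borel"
    unfolding R_def[abs_def] by (intro borel_measurable_continuous_onI continuous_intros)
  \<comment> \<open>Invariance is checked on boxes: the preimage of a box swaps and negates its
    spatial corners only.\<close>
  have d: "distr lborel borel R = (lborel :: (real \<times> (real^'n)) measure)"
  proof (rule lborel_eqI[symmetric])
    fix l u :: "real \<times> (real^'n)" assume lu: "\<And>b. b \<in> Basis \<Longrightarrow> l \<bullet> b \<le> u \<bullet> b"
    have bx: "x \<in> box l u \<longleftrightarrow> fst x \<in> box (fst l) (fst u) \<and> snd x \<in> box (snd l) (snd u)" for x l u :: "real \<times> (real^'n)"
      by (cases x, cases l, cases u) (simp add: box_prod)
    have neg: "- y \<in> box a b \<longleftrightarrow> y \<in> box (- b) (- a)" for y a b :: "real^'n"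
      by (auto simp: mem_box)
    have "R -` box l u = box (fst l, - snd u) (fst u, - snd l)"
      by (rule set_eqI) (simp only: vimage_eq R_def bx fst_conv snd_conv neg)
    moreover have "(\<Prod>b\<in>Basis. ((fst u, - snd l) - (fst l, - snd u)) \<bullet> b) = (\<Prod>b\<in>Basis. (u - l) \<bullet> b)"
      by (intro prod.cong refl) (cases u, cases l, simp add: algebra_simps)
    moreover have "\<And>b. b \<in> Basis \<Longrightarrow> (fst l, - snd u) \<bullet> b \<le> (fst u, - snd l) \<bullet> b"
    proof -
      fix b :: "real \<times> (real^'n)" assume b: "b \<in> Basis"
      have "(fst u, - snd l) \<bullet> b - (fst l, - snd u) \<bullet> b = (u - l) \<bullet> b"
        by (cases u, cases l, cases b) (simp add: inner_diff_left inner_diff_right algebra_simps)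
      then show "(fst l, - snd u) \<bullet> b \<le> (fst u, - snd l) \<bullet> b" using lu[OF b] by (simp add: inner_diff_left)
    qed
    ultimately show "emeasure (distr lborel borel R) (box l u) = ennreal (\<Prod>b\<in>Basis. (u - l) \<bullet> b)"
      using Rm by (simp add: emeasure_distr emeasure_lborel_box)
  qed simp
  have k: "kern U j (t, - \<xi>) p = cnj (kern U j (t, \<xi>) (R p))" for p
  proof -
    have "- \<xi> - snd p = - (\<xi> - - snd p)" by simp
    then have "U l (fst p, - \<xi> - snd p) = cnj (U l (fst p, \<xi> - - snd p))" for l by (simp only: h)
    moreover have "U k p = cnj (U k (fst p, - snd p))" for k using h[of k "fst p" "snd p"] by simp
    ultimately show ?thesis unfolding kern_def R_def by (simp add: symb_minus)
  qed
  have "(LINT p|lborel. kern U j (t, - \<xi>) p) = cnj (LINT p|lborel. kern U j (t, \<xi>) (R p))"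
    unfolding k by (rule Bochner_Integration.integral_cnj)
  also have "(LINT p|lborel. kern U j (t, \<xi>) (R p)) = (LINT p|distr lborel borel R. kern U j (t, \<xi>) p)"
    by (rule integral_distr[symmetric]) (use Rm kern_measurable(2)[of U j "(t, \<xi>)"] in auto)
  finally show ?thesis unfolding d .
qed

lemma pic_herm: "pic k j (s, - \<xi>) = cnj (pic k j (s, \<xi>))"
proof (induction k arbitrary: j s \<xi>)
  case (Suc k)
  show ?case
    unfolding pic.simps(2)[of k j "(s, - \<xi>)"] pic.simps(2)[of k j "(s, \<xi>)"] kern_herm[of "pic k", OF pic_measurable Suc]
    by (simp add: g_herm)
qed simp

lemma sol_herm: "sol j (s, - \<xi>) = cnj (sol j (s, \<xi>))"
proof -
  have c: "Cauchy (\<lambda>k. cnj (pic k j (s, \<xi>))) \<longleftrightarrow> Cauchy (\<lambda>k. pic k j (s, \<xi>))"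
    unfolding Cauchy_def dist_norm complex_cnj_diff[symmetric] complex_mod_cnj ..
  show ?thesis
  proof (cases "Cauchy (\<lambda>k. pic k j (s, \<xi>))")
    case True
    then have "(\<lambda>k. pic k j (s, \<xi>)) \<longlonglongrightarrow> lim (\<lambda>k. pic k j (s, \<xi>))"
      by (simp add: Cauchy_convergent convergent_LIMSEQ_iff[symmetric])
    then have "(\<lambda>k. cnj (pic k j (s, \<xi>))) \<longlonglongrightarrow> cnj (lim (\<lambda>k. pic k j (s, \<xi>)))" by (rule tendsto_cnj)
    then show ?thesis using True by (simp add: sol_def pic_herm c limI)
  qed (simp add: sol_def pic_herm c)
qed

section \<open>The a priori bound for the majorant\<close>

lemma \<gamma>_wint: "wint (real CARD('n) - 2) (\<lambda>\<xi>. ennreal (\<gamma> \<xi>)) < \<infinity>"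
proof -
  have "(\<gamma> \<xi>)\<^sup>2 \<le> real CARD('n) * (\<Sum>j\<in>UNIV. (cmod (g j \<xi>))\<^sup>2)" for \<xi>
    unfolding \<gamma>_def using sum_squared_le_sum_of_squares[of "\<lambda>j. cmod (g j \<xi>)" UNIV] by (simp add: mult.commute)
  then have "norm \<xi> powr (real CARD('n) - 2) * (\<gamma> \<xi>)\<^sup>2 \<le> norm \<xi> powr (real CARD('n) - 2) * (real CARD('n) * (\<Sum>j\<in>UNIV. (cmod (g j \<xi>))\<^sup>2))" for \<xi> :: "real^'n"
    by (rule mult_left_mono) simp
  then have le: "norm \<xi> powr (real CARD('n) - 2) * (\<gamma> \<xi>)\<^sup>2 \<le> real CARD('n) * (\<Sum>j\<in>UNIV. norm \<xi> powr (real CARD('n) - 2) * (cmod (g j \<xi>))\<^sup>2)" for \<xi> :: "real^'n"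
    by (simp add: sum_distrib_left mult_ac)
  let ?F = "\<lambda>\<xi>::real^'n. real CARD('n) * (\<Sum>j\<in>UNIV. norm \<xi> powr (real CARD('n) - 2) * (cmod (g j \<xi>))\<^sup>2)"
  have i: "integrable lborel ?F"
    by (intro integrable_mult_right Bochner_Integration.integrable_sum g_int)
  have "wint (real CARD('n) - 2) (\<lambda>\<xi>. ennreal (\<gamma> \<xi>)) \<le> (\<integral>\<^sup>+\<xi>. ennreal (norm (?F \<xi>)) \<partial>lborel)"
    unfolding wint_def
  proof (rule nn_integral_mono)
    fix \<xi> :: "real^'n"
    have "ennreal (norm \<xi> powr (real CARD('n) - 2)) * (ennreal (\<gamma> \<xi>))\<^sup>2 = ennreal (norm \<xi> powr (real CARD('n) - 2) * (\<gamma> \<xi>)\<^sup>2)"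
      by (simp add: ennreal_power[OF \<gamma>_nonneg] ennreal_mult')
    also have "\<dots> \<le> ennreal (norm (?F \<xi>))" by (intro ennreal_leI order_trans[OF le]) simp
    finally show "ennreal (norm \<xi> powr (real CARD('n) - 2)) * (ennreal (\<gamma> \<xi>))\<^sup>2 \<le> ennreal (norm (?F \<xi>))" .
  qed
  also have "\<dots> < \<infinity>" using i unfolding integrable_iff_bounded by (rule conjunct2)
  finally show ?thesis .
qed

lemma bilinear_const:
  obtains C where "C \<ge> 0" "\<And>(W :: real \<times> (real^'n) \<Rightarrow> ennreal) L b t1 t2.
      W \<in> borel_measurable borel \<Longrightarrow> 0 \<le> t1 \<Longrightarrow> 1 / 4 \<le> b \<Longrightarrow> b \<le> 1 \<Longrightarrow> L \<ge> 0 \<Longrightarrow>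
      (\<And>s. t1 < s \<Longrightarrow> s < t2 \<Longrightarrow> wint (real CARD('n) - 1 / 2) (\<lambda>\<xi>. W (s, \<xi>)) \<le> ennreal (L * s powr (- 3 / 4))) \<Longrightarrow>
      wint (real CARD('n) - 3 + 4 * b) (\<lambda>\<xi>. ennreal K * duhamel t1 t2 (self_conv W) \<xi>) \<le> ennreal (C * L\<^sup>2) * (beta_int b t1 t2)\<^sup>2"
proof -
  have "CARD('n) \<ge> 2" using dim3 by simp
  from wint_bilinear[OF this] obtain C where C: "C \<ge> 0" "\<And>(V :: real \<times> (real^'n) \<Rightarrow> ennreal) L b t1 t2.
      V \<in> borel_measurable borel \<Longrightarrow> 0 \<le> t1 \<Longrightarrow> 1 / 4 \<le> b \<Longrightarrow> b \<le> 1 \<Longrightarrow> L \<ge> 0 \<Longrightarrow>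
      (\<And>s. t1 < s \<Longrightarrow> s < t2 \<Longrightarrow> wint (real CARD('n) - 1 / 2) (\<lambda>\<xi>. V (s, \<xi>)) \<le> ennreal (L * s powr (- 3 / 4))) \<Longrightarrow>
      wint (real CARD('n) - 3 + 4 * b) (duhamel t1 t2 (self_conv V)) \<le> ennreal (C * L\<^sup>2) * (beta_int b t1 t2)\<^sup>2"
    by blast
  show ?thesis
  proof (rule that)
    show "K\<^sup>2 * C \<ge> 0" using C(1) by simp
    fix W :: "real \<times> (real^'n) \<Rightarrow> ennreal" and L b t1 t2 :: real
    assume W: "W \<in> borel_measurable borel" and a: "0 \<le> t1" "1 / 4 \<le> b" "b \<le> 1" "L \<ge> 0"
      "\<And>s. t1 < s \<Longrightarrow> s < t2 \<Longrightarrow> wint (real CARD('n) - 1 / 2) (\<lambda>\<xi>. W (s, \<xi>)) \<le> ennreal (L * s powr (- 3 / 4))"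
    have "wint (real CARD('n) - 3 + 4 * b) (\<lambda>\<xi>. ennreal K * duhamel t1 t2 (self_conv W) \<xi>) = (ennreal K)\<^sup>2 * wint (real CARD('n) - 3 + 4 * b) (duhamel t1 t2 (self_conv W))"
      by (rule wint_cmult[OF duhamel_measurable(2)[OF self_conv_measurable[OF W]]])
    also have "\<dots> \<le> (ennreal K)\<^sup>2 * (ennreal (C * L\<^sup>2) * (beta_int b t1 t2)\<^sup>2)"
      by (intro mult_left_mono C(2) W a) auto
    also have "\<dots> = ennreal (K\<^sup>2 * C * L\<^sup>2) * (beta_int b t1 t2)\<^sup>2"
      using C(1) K_nonneg by (simp add: ennreal_power ennreal_mult mult_ac)
    finally show "wint (real CARD('n) - 3 + 4 * b) (\<lambda>\<xi>. ennreal K * duhamel t1 t2 (self_conv W) \<xi>) \<le> ennreal (K\<^sup>2 * C * L\<^sup>2) * (beta_int b t1 t2)\<^sup>2" .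
  qed
qed

text \<open>\<open>beta_int\<close> from time 0 enters squared and contributes twice the power 1/4 -
  b, the exponent predicted by scaling.\<close>

lemma bilinear_const_0:
  assumes b: "1 / 4 \<le> b" "b < 1"
  obtains D where "D \<ge> 0" "\<And>(W :: real \<times> (real^'n) \<Rightarrow> ennreal) L t.
      W \<in> borel_measurable borel \<Longrightarrow> t > 0 \<Longrightarrow> L \<ge> 0 \<Longrightarrow>
      (\<And>s. 0 < s \<Longrightarrow> s < t \<Longrightarrow> wint (real CARD('n) - 1 / 2) (\<lambda>\<xi>. W (s, \<xi>)) \<le> ennreal (L * s powr (- 3 / 4))) \<Longrightarrow>
      wint (real CARD('n) - 3 + 4 * b) (\<lambda>\<xi>. ennreal K * duhamel 0 t (self_conv W) \<xi>) \<le> ennreal (D * L\<^sup>2 * t powr (1 / 2 - 2 * b))"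
proof -
  obtain C where C: "C \<ge> 0" "\<And>(W :: real \<times> (real^'n) \<Rightarrow> ennreal) L b t1 t2.
      W \<in> borel_measurable borel \<Longrightarrow> 0 \<le> t1 \<Longrightarrow> 1 / 4 \<le> b \<Longrightarrow> b \<le> 1 \<Longrightarrow> L \<ge> 0 \<Longrightarrow>
      (\<And>s. t1 < s \<Longrightarrow> s < t2 \<Longrightarrow> wint (real CARD('n) - 1 / 2) (\<lambda>\<xi>. W (s, \<xi>)) \<le> ennreal (L * s powr (- 3 / 4))) \<Longrightarrow>
      wint (real CARD('n) - 3 + 4 * b) (\<lambda>\<xi>. ennreal K * duhamel t1 t2 (self_conv W) \<xi>) \<le> ennreal (C * L\<^sup>2) * (beta_int b t1 t2)\<^sup>2"
    using bilinear_const by blast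
  have "0 \<le> b" using b by simp
  from beta_int_0_le[OF this b(2)] obtain B where B: "B \<ge> 0" "\<And>t. t > 0 \<Longrightarrow> beta_int b 0 t \<le> ennreal (B * t powr (1 / 4 - b))" by blast
  show ?thesis
  proof (rule that)
    show "C * B\<^sup>2 \<ge> 0" using C(1) by simp
    fix W :: "real \<times> (real^'n) \<Rightarrow> ennreal" and L t :: real
    assume W: "W \<in> borel_measurable borel" and t: "t > 0" and L: "L \<ge> 0"
      and a: "\<And>s. 0 < s \<Longrightarrow> s < t \<Longrightarrow> wint (real CARD('n) - 1 / 2) (\<lambda>\<xi>. W (s, \<xi>)) \<le> ennreal (L * s powr (- 3 / 4))"
    have "wint (real CARD('n) - 3 + 4 * b) (\<lambda>\<xi>. ennreal K * duhamel 0 t (self_conv W) \<xi>) \<le> ennreal (C * L\<^sup>2) * (beta_int b 0 t)\<^sup>2"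
      using b by (intro C(2) W L a) auto
    also have "\<dots> \<le> ennreal (C * L\<^sup>2) * (ennreal (B * t powr (1 / 4 - b)))\<^sup>2"
      by (intro mult_left_mono power_mono B t) auto
    also have "\<dots> = ennreal (C * B\<^sup>2 * L\<^sup>2 * t powr (1 / 2 - 2 * b))"
    proof -
      have "(B * t powr (1 / 4 - b))\<^sup>2 = B\<^sup>2 * t powr (1 / 2 - 2 * b)"
        using powr_half_power2[of t "1 / 2 - 2 * b"] by (simp add: power_mult_distrib diff_divide_distrib)
      then show ?thesis using B(1) C(1) by (simp add: ennreal_power ennreal_mult[symmetric] mult_ac)
    qed
    finally show "wint (real CARD('n) - 3 + 4 * b) (\<lambda>\<xi>. ennreal K * duhamel 0 t (self_conv W) \<xi>) \<le> ennreal (C * B\<^sup>2 * L\<^sup>2 * t powr (1 / 2 - 2 * b))" .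
  qed
qed

text \<open>If an iterate is bounded by 4A t^(-3/4), the factor 2 in \<open>wint_add_le\<close>
  turns the heat part into 2A and the nonlinear part into 2D (4A)^2, at most 2A once 16 D A \<le> 1.
  The threshold depends only on D; below it A may shrink at the cost of a shorter interval.\<close>

lemma V_bound_small:
  obtains A0 where "A0 > 0"
    "\<And>A. 0 < A \<Longrightarrow> A \<le> A0 \<Longrightarrow> \<exists>T>0. \<forall>t. 0 < t \<longrightarrow> t < T \<longrightarrow> wint (real CARD('n) - 1 / 2) (\<lambda>\<xi>. V (t, \<xi>)) \<le> ennreal (4 * A * t powr (- 3 / 4))"
proof -
  \<comment> \<open>b = 5/8 solves n - 3 + 4b = n - 1/2, so the output weight equals the input
    weight.\<close>
  obtain D where D: "D \<ge> 0" "\<And>(W :: real \<times> (real^'n) \<Rightarrow> ennreal) L t.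
      W \<in> borel_measurable borel \<Longrightarrow> t > 0 \<Longrightarrow> L \<ge> 0 \<Longrightarrow>
      (\<And>s. 0 < s \<Longrightarrow> s < t \<Longrightarrow> wint (real CARD('n) - 1 / 2) (\<lambda>\<xi>. W (s, \<xi>)) \<le> ennreal (L * s powr (- 3 / 4))) \<Longrightarrow>
      wint (real CARD('n) - 3 + 4 * (5 / 8)) (\<lambda>\<xi>. ennreal K * duhamel 0 t (self_conv W) \<xi>) \<le> ennreal (D * L\<^sup>2 * t powr (1 / 2 - 2 * (5 / 8)))"
    using bilinear_const_0[of "5 / 8"] by auto
  show ?thesis
  proof (rule that)
    \<comment> \<open>D + 1 in place of D keeps the threshold positive when D = 0.\<close>
    show "1 / (16 * (D + 1)) > 0" using D(1) by simp
    fix A :: real assume A: "0 < A" "A \<le> 1 / (16 * (D + 1))"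
    \<comment> \<open>\<rho> = 3/4 gives n - 2 + 2 \<rho> = n - 1/2, and the heat flow has amplitude
      \<open>A\<close> on a short interval.\<close>
    obtain T where T: "T > 0" "\<And>t. 0 < t \<Longrightarrow> t < T \<Longrightarrow> wint (real CARD('n) - 2 + 2 * (3 / 4)) (\<lambda>\<xi>. heat_maj \<gamma> (t, \<xi>)) \<le> ennreal (A * t powr (- (3 / 4)))"
      using wint_heat_maj_small[OF \<gamma>_measurable \<gamma>_nonneg \<gamma>_wint, of "3 / 4" A] A(1) by auto
    have A16: "16 * D * A \<le> 1"
    proof -
      have "16 * D * A \<le> 16 * (D + 1) * A" using A D(1) by (intro mult_right_mono) auto
      also have "\<dots> \<le> 1" using A(2) D(1) by (simp add: field_simps)
      finally show ?thesis .
    qed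
    have k: "wint (real CARD('n) - 1 / 2) (\<lambda>\<xi>. maj K \<gamma> k (t, \<xi>)) \<le> ennreal (4 * A * t powr (- 3 / 4))" if "0 < t" "t < T" for k t
      using that
    proof (induction k arbitrary: t)
      case 0
      then show ?case by (simp add: wint_def)
    next
      case (Suc k)
      note [measurable] = section_measurable(1)[OF heat_maj_measurable[OF \<gamma>_measurable]]
        duhamel_measurable(2)[OF self_conv_measurable[OF maj_measurable[OF \<gamma>_measurable]]]
      have "wint (real CARD('n) - 1 / 2) (\<lambda>\<xi>. maj K \<gamma> (Suc k) (t, \<xi>)) \<le>
          2 * wint (real CARD('n) - 1 / 2) (\<lambda>\<xi>. heat_maj \<gamma> (t, \<xi>)) + 2 * wint (real CARD('n) - 1 / 2) (\<lambda>\<xi>. ennreal K * duhamel 0 t (self_conv (maj K \<gamma> k)) \<xi>)"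
        by (simp, rule wint_add_le) measurable
      also have "\<dots> \<le> 2 * ennreal (A * t powr (- 3 / 4)) + 2 * ennreal (D * (4 * A)\<^sup>2 * t powr (- 3 / 4))"
      proof (intro add_mono mult_left_mono)
        show "wint (real CARD('n) - 1 / 2) (\<lambda>\<xi>. heat_maj \<gamma> (t, \<xi>)) \<le> ennreal (A * t powr (- 3 / 4))"
          using T(2)[OF Suc.prems] by simp
        have "wint (real CARD('n) - 3 + 4 * (5 / 8)) (\<lambda>\<xi>. ennreal K * duhamel 0 t (self_conv (maj K \<gamma> k)) \<xi>) \<le> ennreal (D * (4 * A)\<^sup>2 * t powr (1 / 2 - 2 * (5 / 8)))"
          by (rule D(2)[OF maj_measurable[OF \<gamma>_measurable] Suc.prems(1)]) (use A Suc.prems Suc.IH in auto)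
        then show "wint (real CARD('n) - 1 / 2) (\<lambda>\<xi>. ennreal K * duhamel 0 t (self_conv (maj K \<gamma> k)) \<xi>) \<le> ennreal (D * (4 * A)\<^sup>2 * t powr (- 3 / 4))"
          by simp
      qed auto
      also have "\<dots> = ennreal (2 * (A * t powr (- 3 / 4)) + 2 * (D * (4 * A)\<^sup>2 * t powr (- 3 / 4)))"
      proof -
        have h: "2 * ennreal x = ennreal (2 * x)" for x by (simp add: ennreal_mult')
        show ?thesis unfolding h using A D(1) by (intro ennreal_plus[symmetric]) auto
      qed
      also have "\<dots> \<le> ennreal (4 * A * t powr (- 3 / 4))"
      proof (rule ennreal_leI)
        have "2 * A + 2 * (D * (4 * A)\<^sup>2) = 2 * A + (16 * D * A) * (2 * A)" by (simp add: power2_eq_square)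
        also have "\<dots> \<le> 2 * A + 1 * (2 * A)" using A A16 by (intro add_left_mono mult_right_mono) auto
        finally have "(2 * A + 2 * (D * (4 * A)\<^sup>2)) * t powr (- 3 / 4) \<le> (4 * A) * t powr (- 3 / 4)" by (intro mult_right_mono) auto
        then show "2 * (A * t powr (- 3 / 4)) + 2 * (D * (4 * A)\<^sup>2 * t powr (- 3 / 4)) \<le> 4 * A * t powr (- 3 / 4)"
          by (simp add: distrib_right mult.assoc)
      qed
      finally show ?case .
    qed
    show "\<exists>T>0. \<forall>t. 0 < t \<longrightarrow> t < T \<longrightarrow> wint (real CARD('n) - 1 / 2) (\<lambda>\<xi>. V (t, \<xi>)) \<le> ennreal (4 * A * t powr (- 3 / 4))"
      using T(1) k by (intro exI[of _ T]) (auto intro!: wint_maj_lim_le[OF \<gamma>_measurable])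
  qed
qed

end

subsection \<open>Regularity of the solution on the Fourier side\<close>

text \<open>\<open>V_bound\<close> holds on the whole interval with one constant.
  \<open>V_small\<close> serves time 0: at the critical weight b = 1/4 the power of t in the Duhamel
  bound is 0, so only a small constant can give convergence.\<close>

locale ns_sol = ns_data g for g :: "'n::finite \<Rightarrow> real^'n \<Rightarrow> complex" +
  fixes T L :: real
  assumes T_pos: "T > 0" and L_nonneg: "L \<ge> 0"
    and V_bound: "\<And>t. 0 < t \<Longrightarrow> t < T \<Longrightarrow> wint (real CARD('n) - 1 / 2) (\<lambda>\<xi>. V (t, \<xi>)) \<le> ennreal (L * t powr (- 3 / 4))"
    and V_small: "\<And>\<epsilon>. \<epsilon> > 0 \<Longrightarrow> \<exists>T'>0. \<forall>t. 0 < t \<longrightarrow> t < T' \<longrightarrow> wint (real CARD('n) - 1 / 2) (\<lambda>\<xi>. V (t, \<xi>)) \<le> ennreal (\<epsilon> * t powr (- 3 / 4))"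
begin

section \<open>Bounds and the integral equation at positive times\<close>

lemma V_measurable: "V \<in> borel_measurable borel"
  by (rule maj_lim_measurable[OF \<gamma>_measurable])

lemma V_section [measurable]: "(\<lambda>\<xi>. V (t, \<xi>)) \<in> borel_measurable borel"
  by (rule section_measurable(1)[OF V_measurable])

lemma sol_section [measurable]: "(\<lambda>\<xi>. sol j (t, \<xi>)) \<in> borel_measurable borel"
  by (rule section_measurable(1)[OF sol_measurable])

definition DV :: "real \<Rightarrow> real \<Rightarrow> real^'n \<Rightarrow> ennreal" where
  "DV t1 t2 \<xi> = ennreal K * duhamel t1 t2 (self_conv V) \<xi>"

lemma DV_measurable [measurable]: "DV t1 t2 \<in> borel_measurable borel"
proof -
  note [measurable] = duhamel_measurable(2)[OF self_conv_measurable[OF V_measurable]]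
  show ?thesis unfolding DV_def[abs_def] by measurable
qed

lemma DV_kern_maj: "DV 0 t \<xi> = (\<integral>\<^sup>+p. kern_maj V (t, \<xi>) p \<partial>lborel)"
  unfolding nn_integral_kern_maj[OF V_measurable] DV_def by simp

lemma V_le: "V (t, \<xi>) \<le> heat_maj \<gamma> (t, \<xi>) + DV 0 t \<xi>"
  using maj_lim_le[of K \<gamma> "(t, \<xi>)"] by (simp add: DV_def)

lemma heat_finite:
  assumes t: "t > 0" and b: "1 / 4 \<le> b" "b < 1"
  obtains M where "M \<ge> 0" "\<And>t. t > 0 \<Longrightarrow> wint (real CARD('n) - 3 + 4 * b) (\<lambda>\<xi>. heat_maj \<gamma> (t, \<xi>)) \<le> ennreal (M * t powr (1 / 2 - 2 * b))"
proof -
  obtain M where M: "M \<ge> 0" "wint (real CARD('n) - 2) (\<lambda>\<xi>. ennreal (\<gamma> \<xi>)) = ennreal M"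
    using \<gamma>_wint by (cases "wint (real CARD('n) - 2) (\<lambda>\<xi>. ennreal (\<gamma> \<xi>))" rule: ennreal_cases) auto
  show ?thesis
  proof (rule that[OF M(1)])
    fix t :: real assume t: "t > 0"
    have "wint (real CARD('n) - 2 + 2 * (2 * b - 1 / 2)) (\<lambda>\<xi>. heat_maj \<gamma> (t, \<xi>)) \<le> ennreal (t powr (- (2 * b - 1 / 2))) * wint (real CARD('n) - 2) (\<lambda>\<xi>. ennreal (\<gamma> \<xi>))"
      using b by (intro wint_heat_maj_le t \<gamma>_measurable \<gamma>_nonneg) auto
    also have "\<dots> = ennreal (M * t powr (1 / 2 - 2 * b))" unfolding M(2) using M(1) by (simp add: ennreal_mult mult.commute)
    also have "real CARD('n) - 2 + 2 * (2 * b - 1 / 2) = real CARD('n) - 3 + 4 * b" by simp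
    finally show "wint (real CARD('n) - 3 + 4 * b) (\<lambda>\<xi>. heat_maj \<gamma> (t, \<xi>)) \<le> ennreal (M * t powr (1 / 2 - 2 * b))" .
  qed
qed

text \<open>The constant L' is free, so the same bound serves the fixed \<open>L\<close> and the
  small constants near time 0.\<close>

lemma DV_bound_0:
  assumes b: "1 / 4 \<le> b" "b < 1"
  obtains D where "D \<ge> 0" "\<And>t L'. 0 < t \<Longrightarrow> L' \<ge> 0 \<Longrightarrow>
      (\<And>s. 0 < s \<Longrightarrow> s < t \<Longrightarrow> wint (real CARD('n) - 1 / 2) (\<lambda>\<xi>. V (s, \<xi>)) \<le> ennreal (L' * s powr (- 3 / 4))) \<Longrightarrow>
      wint (real CARD('n) - 3 + 4 * b) (DV 0 t) \<le> ennreal (D * L'\<^sup>2 * t powr (1 / 2 - 2 * b))"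
proof -
  obtain D where D: "D \<ge> 0" "\<And>(W :: real \<times> (real^'n) \<Rightarrow> ennreal) L t.
      W \<in> borel_measurable borel \<Longrightarrow> t > 0 \<Longrightarrow> L \<ge> 0 \<Longrightarrow>
      (\<And>s. 0 < s \<Longrightarrow> s < t \<Longrightarrow> wint (real CARD('n) - 1 / 2) (\<lambda>\<xi>. W (s, \<xi>)) \<le> ennreal (L * s powr (- 3 / 4))) \<Longrightarrow>
      wint (real CARD('n) - 3 + 4 * b) (\<lambda>\<xi>. ennreal K * duhamel 0 t (self_conv W) \<xi>) \<le> ennreal (D * L\<^sup>2 * t powr (1 / 2 - 2 * b))"
    using bilinear_const_0[OF b] by blast
  show ?thesis
    by (rule that[OF D(1)]) (unfold DV_def[abs_def], rule D(2)[OF V_measurable])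
qed

lemma V_bounds:
  assumes b: "1 / 4 \<le> b" "b < 1"
  obtains B where "B \<ge> 0" "\<And>t. 0 < t \<Longrightarrow> t < T \<Longrightarrow> wint (real CARD('n) - 3 + 4 * b) (\<lambda>\<xi>. V (t, \<xi>)) \<le> ennreal (B * t powr (1 / 2 - 2 * b))"
proof -
  obtain M where M: "M \<ge> 0" "\<And>t. t > 0 \<Longrightarrow> wint (real CARD('n) - 3 + 4 * b) (\<lambda>\<xi>. heat_maj \<gamma> (t, \<xi>)) \<le> ennreal (M * t powr (1 / 2 - 2 * b))"
    using heat_finite[OF T_pos b] by blast
  obtain D where D: "D \<ge> 0" "\<And>t L'. 0 < t \<Longrightarrow> L' \<ge> 0 \<Longrightarrow>
      (\<And>s. 0 < s \<Longrightarrow> s < t \<Longrightarrow> wint (real CARD('n) - 1 / 2) (\<lambda>\<xi>. V (s, \<xi>)) \<le> ennreal (L' * s powr (- 3 / 4))) \<Longrightarrow>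
      wint (real CARD('n) - 3 + 4 * b) (DV 0 t) \<le> ennreal (D * L'\<^sup>2 * t powr (1 / 2 - 2 * b))"
    using DV_bound_0[OF b] by blast
  show ?thesis
  proof (rule that)
    show "2 * M + 2 * (D * L\<^sup>2) \<ge> 0" using M D by simp
    fix t assume t: "0 < t" "t < T"
    note [measurable] = section_measurable(1)[OF heat_maj_measurable[OF \<gamma>_measurable]]
    have h: "2 * ennreal x = ennreal (2 * x)" for x by (simp add: ennreal_mult')
    have "wint (real CARD('n) - 3 + 4 * b) (\<lambda>\<xi>. V (t, \<xi>)) \<le> wint (real CARD('n) - 3 + 4 * b) (\<lambda>\<xi>. heat_maj \<gamma> (t, \<xi>) + DV 0 t \<xi>)"
      by (rule wint_mono) (rule V_le)
    also have "\<dots> \<le> 2 * wint (real CARD('n) - 3 + 4 * b) (\<lambda>\<xi>. heat_maj \<gamma> (t, \<xi>)) + 2 * wint (real CARD('n) - 3 + 4 * b) (DV 0 t)"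
      by (rule wint_add_le) measurable
    also have "\<dots> \<le> 2 * ennreal (M * t powr (1 / 2 - 2 * b)) + 2 * ennreal (D * L\<^sup>2 * t powr (1 / 2 - 2 * b))"
      using t by (intro add_mono mult_left_mono M(2) D(2) L_nonneg V_bound) auto
    also have "\<dots> = ennreal ((2 * M + 2 * (D * L\<^sup>2)) * t powr (1 / 2 - 2 * b))"
      unfolding h using M(1) D(1) by (simp add: ennreal_plus[symmetric] distrib_right mult.assoc del: ennreal_plus)
    finally show "wint (real CARD('n) - 3 + 4 * b) (\<lambda>\<xi>. V (t, \<xi>)) \<le> ennreal ((2 * M + 2 * (D * L\<^sup>2)) * t powr (1 / 2 - 2 * b))" .
  qed
qed

lemma wint_V_finite:
  assumes "1 / 4 \<le> b" "b < 1" "0 < t" "t < T"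
  shows "wint (real CARD('n) - 3 + 4 * b) (\<lambda>\<xi>. V (t, \<xi>)) < \<infinity>"
  using V_bounds[OF assms(1,2)] assms(3,4) by (metis ennreal_less_top infinity_ennreal_def le_less_trans)

lemma V_integrable:
  assumes t: "0 < t" "t < T"
  shows "(\<integral>\<^sup>+\<xi>. V (t, \<xi>) \<partial>lborel) < \<infinity>"
proof (rule nn_integral_finite_of_wint[OF V_section])
  show "wint (real CARD('n) - 1 / 2) (\<lambda>\<xi>. V (t, \<xi>)) < \<infinity>"
    using V_bound[OF t] by (rule le_less_trans) simp
  \<comment> \<open>b = 7/8 gives n - 3 + 4b = n + 1/2.\<close>
  show "wint (real CARD('n) + 1 / 2) (\<lambda>\<xi>. V (t, \<xi>)) < \<infinity>"
    using wint_V_finite[of "7 / 8", OF _ _ t] by (simp add: add.commute)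
qed

lemma sol_integrable:
  assumes t: "0 < t" "t < T"
  shows "integrable lborel (\<lambda>\<xi>. sol j (t, \<xi>))"
proof (rule integrableI_bounded)
  have "(\<integral>\<^sup>+\<xi>. ennreal (cmod (sol j (t, \<xi>))) \<partial>lborel) \<le> (\<integral>\<^sup>+\<xi>. V (t, \<xi>) \<partial>lborel)"
    by (intro nn_integral_mono sol_le)
  then show "(\<integral>\<^sup>+\<xi>. ennreal (norm (sol j (t, \<xi>))) \<partial>lborel) < \<infinity>"
    using V_integrable[OF t] by (rule le_less_trans)
qed measurable

lemma heat_integrable:
  assumes t: "0 < t"
  shows "integrable lborel (\<lambda>\<xi>. of_real (exp (- t * (norm \<xi>)\<^sup>2)) * g j \<xi>)"
proof (rule integrableI_bounded)
  have f: "wint (real CARD('n) - 3 + 4 * b) (\<lambda>\<xi>. heat_maj \<gamma> (t, \<xi>)) < \<infinity>" if "1 / 4 \<le> b" "b < 1" for b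
    using heat_finite[OF t that] t by (metis ennreal_less_top infinity_ennreal_def le_less_trans)
  have "(\<integral>\<^sup>+\<xi>. ennreal (cmod (of_real (exp (- t * (norm \<xi>)\<^sup>2)) * g j \<xi>)) \<partial>lborel) \<le> (\<integral>\<^sup>+\<xi>. heat_maj \<gamma> (t, \<xi>) \<partial>lborel)"
    using heat_g_le[of "(t, _)" j] by (intro nn_integral_mono) simp
  \<comment> \<open>The values b = 5/8 and b = 7/8 give the weights n - 1/2 and n + 1/2 on the two
    sides of n.\<close>
  also have "\<dots> < \<infinity>"
    using f[of "5 / 8"] f[of "7 / 8"]
    by (intro nn_integral_finite_of_wint section_measurable(1)[OF heat_maj_measurable[OF \<gamma>_measurable]]) (auto simp: add.commute)
  finally show "(\<integral>\<^sup>+\<xi>. ennreal (norm (of_real (exp (- t * (norm \<xi>)\<^sup>2)) * g j \<xi>)) \<partial>lborel) < \<infinity>" .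
qed measurable

lemma V_AE_finite:
  assumes t: "0 < t" "t < T"
  shows "AE \<xi> in lborel. V (t, \<xi>) < \<infinity>"
  by (rule wint_AE_finite[OF V_section]) (rule le_less_trans[OF V_bound[OF t]], simp)

lemma DV_AE_finite:
  assumes t: "0 < t" "t < T"
  shows "AE \<xi> in lborel. DV 0 t \<xi> < \<infinity>"
proof -
  obtain D where D: "D \<ge> 0" "\<And>t L'. 0 < t \<Longrightarrow> L' \<ge> 0 \<Longrightarrow>
      (\<And>s. 0 < s \<Longrightarrow> s < t \<Longrightarrow> wint (real CARD('n) - 1 / 2) (\<lambda>\<xi>. V (s, \<xi>)) \<le> ennreal (L' * s powr (- 3 / 4))) \<Longrightarrow>
      wint (real CARD('n) - 3 + 4 * (1 / 4)) (DV 0 t) \<le> ennreal (D * L'\<^sup>2 * t powr (1 / 2 - 2 * (1 / 4)))"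
    using DV_bound_0[of "1 / 4"] by auto
  have "wint (real CARD('n) - 3 + 4 * (1 / 4)) (DV 0 t) \<le> ennreal (D * L\<^sup>2 * t powr (1 / 2 - 2 * (1 / 4)))"
    using t by (intro D(2) L_nonneg V_bound) auto
  then have "wint (real CARD('n) - 3 + 4 * (1 / 4)) (DV 0 t) < \<infinity>" by (rule le_less_trans) simp
  then show ?thesis by (rule wint_AE_finite[OF DV_measurable])
qed

text \<open>The Picard recursion passes to the limit by dominated convergence under the kernel
  majorant of \<open>V\<close>. The exceptional frequencies are those where \<open>V\<close> or its
  Duhamel term is infinite, a null set for each t.\<close>

lemma sol_equation:
  assumes t: "0 < t" "t < T"
  shows "AE \<xi> in lborel. sol j (t, \<xi>) = of_real (exp (- t * (norm \<xi>)\<^sup>2)) * g j \<xi> - (LINT p|lborel. kern sol j (t, \<xi>) p)"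
  using V_AE_finite[OF t] DV_AE_finite[OF t]
proof eventually_elim
  case (elim \<xi>)
  define z where "z = (t, \<xi>)"
  have Wf: "(\<integral>\<^sup>+p. kern_maj V z p \<partial>lborel) < \<infinity>" using elim(2) by (simp add: DV_kern_maj z_def)
  have Vf: "V z < \<infinity>" using elim(1) by (simp add: z_def)
  have [measurable]: "kern_maj V z \<in> borel_measurable borel" by (rule kern_maj_measurable[OF V_measurable])
  have [measurable]: "V \<in> borel_measurable (borel \<Otimes>\<^sub>M borel)" using V_measurable by (simp add: borel_prod)
  \<comment> \<open>Both factors of the nonlinearity have to converge: for each s in (0, t),
    \<open>V\<close> is finite at almost every \<eta> and, by reflection, at \<xi> - \<eta> for
    almost every \<eta>.\<close>
  have "AE p in lborel \<Otimes>\<^sub>M lborel. 0 < fst p \<and> fst p < t \<longrightarrow> V p < \<infinity> \<and> V (fst p, \<xi> - snd p) < \<infinity>"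
  proof (rule lborel_pair.AE_pair_measure)
    show "{p \<in> space (lborel \<Otimes>\<^sub>M lborel). 0 < fst p \<and> fst p < t \<longrightarrow> V p < \<infinity> \<and> V (fst p, \<xi> - snd p) < \<infinity>} \<in> sets (lborel \<Otimes>\<^sub>M lborel)"
      by measurable
    show "AE s in lborel. AE \<eta> in lborel. 0 < fst (s, \<eta>) \<and> fst (s, \<eta>) < t \<longrightarrow> V (s, \<eta>) < \<infinity> \<and> V (fst (s, \<eta>), \<xi> - snd (s, \<eta>)) < \<infinity>"
    proof (rule AE_I2)
      fix s
      show "AE \<eta> in lborel. 0 < fst (s, \<eta>) \<and> fst (s, \<eta>) < t \<longrightarrow> V (s, \<eta>) < \<infinity> \<and> V (fst (s, \<eta>), \<xi> - snd (s, \<eta>)) < \<infinity>"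
      proof (cases "0 < s \<and> s < t")
        case True
        then have s: "0 < s" "s < T" using t by auto
        have "AE \<eta> in lborel. V (s, \<xi> - \<eta>) < \<infinity>"
          by (rule AE_lborel_reflect[OF _ V_AE_finite[OF s]]) measurable
        then show ?thesis using V_AE_finite[OF s] by eventually_elim auto
      qed auto
    qed
  qed
  then have ae: "AE p in lborel. 0 < fst p \<and> fst p < t \<longrightarrow> V p < \<infinity> \<and> V (fst p, \<xi> - snd p) < \<infinity>"
    unfolding lborel_prod .
  have fin: "AE p in lborel. kern_maj V z p \<noteq> \<infinity>"
    using Wf by (intro nn_integral_PInf_AE) auto
  have lim: "(\<lambda>k. LINT p|lborel. kern (pic k) j z p) \<longlonglongrightarrow> (LINT p|lborel. kern sol j z p)"
  proof (rule integral_dominated_convergence[where w = "\<lambda>p. enn2real (kern_maj V z p)"])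
    show "kern (pic k) j z \<in> borel_measurable lborel" for k using kern_measurable(2)[OF pic_measurable] by simp
    show "kern sol j z \<in> borel_measurable lborel" using kern_measurable(2)[OF sol_measurable] by simp
    show "integrable lborel (\<lambda>p. enn2real (kern_maj V z p))"
    proof (rule integrableI_bounded)
      have "(\<integral>\<^sup>+p. ennreal (norm (enn2real (kern_maj V z p))) \<partial>lborel) \<le> (\<integral>\<^sup>+p. kern_maj V z p \<partial>lborel)"
        by (intro nn_integral_mono) (auto simp: ennreal_enn2real_if)
      then show "(\<integral>\<^sup>+p. ennreal (norm (enn2real (kern_maj V z p))) \<partial>lborel) < \<infinity>" using Wf by (rule le_less_trans)
    qed measurable
    show "AE p in lborel. norm (kern (pic k) j z p) \<le> enn2real (kern_maj V z p)" for k
      using fin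
    proof eventually_elim
      case (elim p)
      have "ennreal (cmod (kern (pic k) j z p)) \<le> kern_maj V z p"
        by (rule kern_le) (rule order_trans[OF pic_le_maj maj_le_lim])
      then have "enn2real (ennreal (cmod (kern (pic k) j z p))) \<le> enn2real (kern_maj V z p)"
        using elim by (intro enn2real_mono) (auto simp: less_top)
      then show ?case by simp
    qed
    show "AE p in lborel. (\<lambda>k. kern (pic k) j z p) \<longlonglongrightarrow> kern sol j z p"
      using ae
    proof eventually_elim
      case (elim p)
      show ?case
      proof (cases "0 < fst p \<and> fst p < t")
        case True
        then have "V p < \<infinity>" "V (fst p, \<xi> - snd p) < \<infinity>" using elim by auto
        then show ?thesis unfolding kern_def z_def snd_conv by (intro tendsto_intros pic_tendsto_sol)
      next
        case False
        then have "kern U j z p = 0" for U by (auto simp: kern_def z_def)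
        then show ?thesis by simp
      qed
    qed
  qed
  have "(\<lambda>k. pic (Suc k) j z) \<longlonglongrightarrow> sol j z" by (rule LIMSEQ_Suc[OF pic_tendsto_sol[OF Vf]])
  moreover have "(\<lambda>k. pic (Suc k) j z) \<longlonglongrightarrow> of_real (exp (- fst z * (norm (snd z))\<^sup>2)) * g j (snd z) - (LINT p|lborel. kern sol j z p)"
    unfolding pic.simps(2) by (intro tendsto_intros lim)
  ultimately have "sol j z = of_real (exp (- fst z * (norm (snd z))\<^sup>2)) * g j (snd z) - (LINT p|lborel. kern sol j z p)"
    by (rule LIMSEQ_unique)
  then show ?case by (simp add: z_def)
qed

lemma vec_nth_measurable [measurable (raw)]:
  fixes f :: "'a \<Rightarrow> real^'n"
  assumes "f \<in> borel_measurable M"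
  shows "(\<lambda>x. f x $ i) \<in> borel_measurable M"
  by (rule borel_measurable_continuous_on[OF _ assms]) (intro continuous_intros)

text \<open>A representative of the transformed nonlinearity that is jointly measurable in time and
  frequency, as \<open>is_duhamel_integral\<close> demands.\<close>

definition Gnl :: "'n \<Rightarrow> real \<times> (real^'n) \<Rightarrow> complex" where
  "Gnl j z = (\<Sum>k\<in>UNIV. of_real (leray_symbol j k (snd z)) *
     (\<Sum>l\<in>UNIV. \<i> * of_real (snd z $ l) * (of_real cn * conv (\<lambda>\<eta>. sol l (fst z, \<eta>)) (\<lambda>\<eta>. sol k (fst z, \<eta>)) (snd z))))"

lemma Gnl_measurable [measurable]: "Gnl j \<in> borel_measurable borel"
proof -
  have [measurable]: "sol l \<in> borel_measurable (borel \<Otimes>\<^sub>M borel)" for l using sol_measurable by (simp add: borel_prod)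
  have "(\<lambda>z. conv (\<lambda>\<eta>. sol l (fst z, \<eta>)) (\<lambda>\<eta>. sol k (fst z, \<eta>)) (snd z)) \<in> borel_measurable (borel \<Otimes>\<^sub>M borel)" for k l
    unfolding conv_def by measurable
  then have "Gnl j \<in> borel_measurable (borel \<Otimes>\<^sub>M borel)"
    unfolding Gnl_def[abs_def] by (intro borel_measurable_sum borel_measurable_times) measurable
  then show ?thesis by (simp add: borel_prod)
qed

text \<open>Fubini turns the integral over (s, \<eta>) into the time integral of the definition. The
  origin is excluded because the factor |\<xi>| would hide an infinite self-convolution
  there.\<close>

lemma kern_nested:
  assumes f: "DV 0 t \<xi> < \<infinity>" and \<xi>: "\<xi> \<noteq> 0"
  shows "set_integrable lborel {0<..<t} (\<lambda>s. of_real (exp (- (t - s) * (norm \<xi>)\<^sup>2)) * Gnl j (s, \<xi>))"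
    "(LINT s:{0<..<t}|lborel. of_real (exp (- (t - s) * (norm \<xi>)\<^sup>2)) * Gnl j (s, \<xi>)) = (LINT p|lborel. kern sol j (t, \<xi>) p)"
proof -
  have Wf: "(\<integral>\<^sup>+p. kern_maj V (t, \<xi>) p \<partial>lborel) < \<infinity>" using f by (simp add: DV_kern_maj)
  have i: "integrable (lborel \<Otimes>\<^sub>M lborel) (kern sol j (t, \<xi>))"
    using kern_integrable[OF sol_measurable sol_le Wf] by (simp add: lborel_prod)
  have [measurable]: "self_conv V \<in> borel_measurable borel" by (rule self_conv_measurable[OF V_measurable])
  note [measurable] = section_measurable(2)[OF this]
  \<comment> \<open>Finiteness of the product passes to this factor because K > 0.\<close>
  have "duhamel 0 t (self_conv V) \<xi> \<noteq> \<infinity>"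
  proof -
    have "K > 0" using cn_pos by (simp add: K_def)
    then show ?thesis using f by (auto simp: DV_def ennreal_mult_eq_top_iff less_top[symmetric])
  qed
  then have "AE s in lborel. indicator {0<..<t} s * (ennreal (exp (- (t - s) * (norm \<xi>)\<^sup>2) * norm \<xi>) * self_conv V (s, \<xi>)) \<noteq> \<infinity>"
    unfolding duhamel_def by (intro nn_integral_PInf_AE) measurable
  then have ae: "AE s in lborel. (LINT \<eta>|lborel. kern sol j (t, \<xi>) (s, \<eta>)) = indicator {0<..<t} s *\<^sub>R (of_real (exp (- (t - s) * (norm \<xi>)\<^sup>2)) * Gnl j (s, \<xi>))"
  proof eventually_elim
    case (elim s)
    show ?case
    proof (cases "0 < s \<and> s < t")
      case True
      have "ennreal (exp (- (t - s) * (norm \<xi>)\<^sup>2) * norm \<xi>) \<noteq> 0" using \<xi> by simp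
      then have nf: "self_conv V (s, \<xi>) < \<infinity>"
        using elim True by (auto simp: ennreal_mult_eq_top_iff less_top[symmetric])
      have pi: "integrable lborel (\<lambda>\<eta>. sol l (s, \<xi> - \<eta>) * sol k (s, \<eta>))" for k l
      proof (rule integrableI_bounded)
        have "(\<integral>\<^sup>+\<eta>. ennreal (norm (sol l (s, \<xi> - \<eta>) * sol k (s, \<eta>))) \<partial>lborel) \<le> (\<integral>\<^sup>+\<eta>. V (s, \<xi> - \<eta>) * V (s, \<eta>) \<partial>lborel)"
          by (intro nn_integral_mono) (auto simp: norm_mult ennreal_mult intro!: mult_mono sol_le)
        then show "(\<integral>\<^sup>+\<eta>. ennreal (norm (sol l (s, \<xi> - \<eta>) * sol k (s, \<eta>))) \<partial>lborel) < \<infinity>"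
          using nf by (simp add: self_conv_def nconv_def le_less_trans)
      qed measurable
      have "(LINT \<eta>|lborel. kern sol j (t, \<xi>) (s, \<eta>)) = (LINT \<eta>|lborel. of_real (exp (- (t - s) * (norm \<xi>)\<^sup>2)) *
          (\<Sum>k\<in>UNIV. (\<Sum>l\<in>UNIV. symb j k l \<xi> * (sol l (s, \<xi> - \<eta>) * sol k (s, \<eta>)))))"
        unfolding kern_def using True by simp
      also have "\<dots> = of_real (exp (- (t - s) * (norm \<xi>)\<^sup>2)) * (LINT \<eta>|lborel. (\<Sum>k\<in>UNIV. (\<Sum>l\<in>UNIV. symb j k l \<xi> * (sol l (s, \<xi> - \<eta>) * sol k (s, \<eta>)))))"
        by (rule integral_mult_right_zero)
      also have "(LINT \<eta>|lborel. (\<Sum>k\<in>UNIV. (\<Sum>l\<in>UNIV. symb j k l \<xi> * (sol l (s, \<xi> - \<eta>) * sol k (s, \<eta>))))) =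
          (\<Sum>k\<in>UNIV. \<Sum>l\<in>UNIV. (LINT \<eta>|lborel. symb j k l \<xi> * (sol l (s, \<xi> - \<eta>) * sol k (s, \<eta>))))"
        by (subst Bochner_Integration.integral_sum, intro Bochner_Integration.integrable_sum integrable_mult_right pi,
            intro sum.cong refl Bochner_Integration.integral_sum integrable_mult_right pi)
      also have "\<dots> = Gnl j (s, \<xi>)"
        unfolding integral_mult_right_zero by (simp add: Gnl_def conv_def symb_def sum_distrib_left mult_ac)
      finally show ?thesis using True by simp
    next
      case False
      then have "kern sol j (t, \<xi>) (s, \<eta>) = 0" for \<eta> by (auto simp: kern_def)
      then show ?thesis using False by auto
    qed
  qed
  note [measurable] = section_measurable(2)[OF Gnl_measurable]
  have m: "(\<lambda>s. indicator {0<..<t} s *\<^sub>R (of_real (exp (- (t - s) * (norm \<xi>)\<^sup>2)) * Gnl j (s, \<xi>))) \<in> borel_measurable lborel"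
    by measurable
  have i1: "integrable lborel (\<lambda>s. LINT \<eta>|lborel. kern sol j (t, \<xi>) (s, \<eta>))"
    by (rule lborel_pair.integrable_fst'[OF i])
  show "set_integrable lborel {0<..<t} (\<lambda>s. of_real (exp (- (t - s) * (norm \<xi>)\<^sup>2)) * Gnl j (s, \<xi>))"
    unfolding set_integrable_def by (rule integrable_cong_AE_imp[OF i1 m]) (use ae in eventually_elim, simp)
  have "(LINT s:{0<..<t}|lborel. of_real (exp (- (t - s) * (norm \<xi>)\<^sup>2)) * Gnl j (s, \<xi>)) = (LINT s|lborel. (LINT \<eta>|lborel. kern sol j (t, \<xi>) (s, \<eta>)))"
    unfolding set_lebesgue_integral_def
    by (rule integral_cong_AE[OF m borel_measurable_integrable[OF i1]]) (use ae in eventually_elim, simp)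
  also have "\<dots> = integral\<^sup>L (lborel \<Otimes>\<^sub>M lborel) (kern sol j (t, \<xi>))" by (rule lborel_pair.integral_fst'[OF i])
  finally show "(LINT s:{0<..<t}|lborel. of_real (exp (- (t - s) * (norm \<xi>)\<^sup>2)) * Gnl j (s, \<xi>)) = (LINT p|lborel. kern sol j (t, \<xi>) p)"
    by (simp add: lborel_prod)
qed

lemma nn_integral_kern_maj_from:
  assumes "0 \<le> t1"
  shows "(\<integral>\<^sup>+p. indicator {t1..} (fst p) * kern_maj V (t2, \<xi>) p \<partial>lborel) = DV t1 t2 \<xi>"
proof -
  have [measurable]: "V \<in> borel_measurable (borel \<Otimes>\<^sub>M borel)" using V_measurable by (simp add: borel_prod)
  have [measurable]: "self_conv V \<in> borel_measurable borel" by (rule self_conv_measurable[OF V_measurable])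
  note [measurable] = section_measurable(2)[OF this]
  have [measurable]: "kern_maj V (t2, \<xi>) \<in> borel_measurable (lborel \<Otimes>\<^sub>M lborel)"
    using kern_maj_measurable[OF V_measurable] by (simp add: lborel_prod)
  have m: "(\<lambda>p. indicator {t1..} (fst p) * kern_maj V (t2, \<xi>) p) \<in> borel_measurable (lborel \<Otimes>\<^sub>M lborel)"
    by measurable
  have "(\<integral>\<^sup>+p. indicator {t1..} (fst p) * kern_maj V (t2, \<xi>) p \<partial>lborel) = (\<integral>\<^sup>+s. \<integral>\<^sup>+\<eta>. indicator {t1..} s * kern_maj V (t2, \<xi>) (s, \<eta>) \<partial>lborel \<partial>lborel)"
    using lborel.nn_integral_fst[OF m] by (simp add: lborel_prod)
  also have "\<dots> = (\<integral>\<^sup>+s. ennreal K * (indicator {t1<..<t2} s * (ennreal (exp (- (t2 - s) * (norm \<xi>)\<^sup>2) * norm \<xi>) * self_conv V (s, \<xi>))) \<partial>lborel)"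
  proof (rule nn_integral_cong_AE)
    \<comment> \<open>The closed half-line and the open interval differ only at the null point s =
      t1.\<close>
    show "AE s in lborel. (\<integral>\<^sup>+\<eta>. indicator {t1..} s * kern_maj V (t2, \<xi>) (s, \<eta>) \<partial>lborel) = ennreal K * (indicator {t1<..<t2} s * (ennreal (exp (- (t2 - s) * (norm \<xi>)\<^sup>2) * norm \<xi>) * self_conv V (s, \<xi>)))"
      using AE_lborel_singleton[of t1]
    proof eventually_elim
      case (elim s)
      have "(\<integral>\<^sup>+\<eta>. indicator {t1..} s * kern_maj V (t2, \<xi>) (s, \<eta>) \<partial>lborel) = indicator {t1..} s * (\<integral>\<^sup>+\<eta>. kern_maj V (t2, \<xi>) (s, \<eta>) \<partial>lborel)"
        by (rule nn_integral_cmult) measurable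
      also have "(\<integral>\<^sup>+\<eta>. kern_maj V (t2, \<xi>) (s, \<eta>) \<partial>lborel) = ennreal (indicator {0<..<t2} s * exp (- (t2 - s) * (norm \<xi>)\<^sup>2) * (K * norm \<xi>)) * self_conv V (s, \<xi>)"
        unfolding kern_maj_def self_conv_def nconv_def fst_conv snd_conv by (rule nn_integral_cmult) measurable
      finally show ?case
        using K_nonneg assms elim by (auto simp: ennreal_mult indicator_def mult_ac)
    qed
  qed
  also have "\<dots> = DV t1 t2 \<xi>"
    unfolding duhamel_def DV_def by (rule nn_integral_cmult) measurable
  finally show ?thesis .
qed

text \<open>The heat flow from t1 to t2 reproduces the datum term and the forcing before t1 exactly,
  so only the forcing between t1 and t2 remains.\<close>

lemma sol_increment:
  assumes t: "0 < t1" "t1 < t2" "t2 < T"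
  shows "AE \<xi> in lborel. ennreal (cmod (sol j (t2, \<xi>) - of_real (exp (- (t2 - t1) * (norm \<xi>)\<^sup>2)) * sol j (t1, \<xi>))) \<le> DV t1 t2 \<xi>"
proof -
  have t': "0 < t2" "t1 < T" using t by auto
  show ?thesis
    using sol_equation[OF t(1) t'(2), of j] sol_equation[OF t'(1) t(3), of j] DV_AE_finite[OF t(1) t'(2)] DV_AE_finite[OF t'(1) t(3)]
  proof eventually_elim
    case (elim \<xi>)
    define e where "e = exp (- (t2 - t1) * (norm \<xi>)\<^sup>2)"
    have i: "integrable lborel (kern sol j (t1, \<xi>))" "integrable lborel (kern sol j (t2, \<xi>))"
      using elim(3,4) by (auto intro!: kern_integrable[OF sol_measurable sol_le] simp: DV_kern_maj)
    have ee: "e * exp (- t1 * (norm \<xi>)\<^sup>2) = exp (- t2 * (norm \<xi>)\<^sup>2)"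
      unfolding e_def by (simp add: exp_add[symmetric] algebra_simps)
    have "sol j (t2, \<xi>) - of_real e * sol j (t1, \<xi>) = of_real e * (LINT p|lborel. kern sol j (t1, \<xi>) p) - (LINT p|lborel. kern sol j (t2, \<xi>) p)"
      unfolding elim(1,2) ee[symmetric] by (simp add: algebra_simps)
    also have "\<dots> = (LINT p|lborel. of_real e * kern sol j (t1, \<xi>) p - kern sol j (t2, \<xi>) p)"
      using i by simp
    finally have eq: "sol j (t2, \<xi>) - of_real e * sol j (t1, \<xi>) = (LINT p|lborel. of_real e * kern sol j (t1, \<xi>) p - kern sol j (t2, \<xi>) p)" .
    have "ennreal (cmod (sol j (t2, \<xi>) - of_real e * sol j (t1, \<xi>))) \<le> (\<integral>\<^sup>+p. ennreal (cmod (of_real e * kern sol j (t1, \<xi>) p - kern sol j (t2, \<xi>) p)) \<partial>lborel)"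
      unfolding eq by (rule integral_norm_bound_ennreal) (use i in simp)
    also have "\<dots> \<le> (\<integral>\<^sup>+p. indicator {t1..} (fst p) * kern_maj V (t2, \<xi>) p \<partial>lborel)"
    proof (rule nn_integral_mono)
      fix p :: "real \<times> (real^'n)"
      show "ennreal (cmod (of_real e * kern sol j (t1, \<xi>) p - kern sol j (t2, \<xi>) p)) \<le> indicator {t1..} (fst p) * kern_maj V (t2, \<xi>) p"
      proof (cases "fst p < t1")
        case True
        have e1: "e * exp (- (t1 - fst p) * (norm \<xi>)\<^sup>2) = exp (- (t2 - fst p) * (norm \<xi>)\<^sup>2)"
          unfolding e_def by (simp add: exp_add[symmetric] algebra_simps)
        have i: "indicat_real {0<..<t1} (fst p) = indicat_real {0<..<t2} (fst p)" using True t by (auto simp: indicator_def)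
        have "complex_of_real e * (of_real (a * x) * S) = of_real (a * (e * x)) * S" for a x S by simp
        then have "of_real e * kern sol j (t1, \<xi>) p = kern sol j (t2, \<xi>) p"
          unfolding kern_def fst_conv snd_conv by (simp only: e1 i)
        then show ?thesis by simp
      next
        case False
        then have "kern sol j (t1, \<xi>) p = 0" by (auto simp: kern_def)
        then show ?thesis using False kern_le[OF sol_le, where j = j and z = "(t2, \<xi>)" and p = p] by simp
      qed
    qed
    also have "\<dots> = DV t1 t2 \<xi>" using t by (intro nn_integral_kern_maj_from) simp
    finally show ?case unfolding e_def .
  qed
qed

section \<open>Continuity in time\<close>

lemma one_minus_exp_le:
  fixes x \<theta> :: real
  assumes "x \<ge> 0" "0 \<le> \<theta>" "\<theta> \<le> 1"
  shows "1 - exp (- x) \<le> x powr \<theta>"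
proof (cases "x \<le> 1")
  case True
  show ?thesis
  proof (cases "x = 0")
    case False
    have "1 - exp (- x) \<le> x" using exp_ge_add_one_self[of "- x"] by linarith
    also have "x = x powr 1" using assms by simp
    also have "\<dots> \<le> x powr \<theta>" using True False assms by (intro powr_mono') auto
    finally show ?thesis .
  qed simp
next
  case False
  have "1 - exp (- x) \<le> 1" by simp
  also have "1 \<le> x powr \<theta>" using False assms by (intro ge_one_powr_ge_zero) auto
  finally show ?thesis .
qed

lemma wint_AE_mono:
  assumes "AE \<xi> in lborel. f \<xi> \<le> h \<xi>"
  shows "wint p f \<le> wint p h"
  unfolding wint_def
proof (rule nn_integral_mono_AE)
  show "AE \<xi> in lborel. ennreal (norm \<xi> powr p) * (f \<xi>)\<^sup>2 \<le> ennreal (norm \<xi> powr p) * (h \<xi>)\<^sup>2"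
    using assms by eventually_elim (intro mult_left_mono power_mono, auto)
qed

text \<open>The increment splits into the forcing between t1 and t2 and the deviation of the heat
  flow from the identity at t1. The latter gains a power of the time step by spending the surplus
  weight available up to b = 7/8.\<close>

lemma sol_hoelder:
  assumes b: "1 / 4 \<le> b" "b < 7 / 8" and d: "\<delta> > 0"
  obtains C1 C2 where "C1 \<ge> 0" "C2 \<ge> 0" "\<And>t1 t2 j. \<delta> \<le> t1 \<Longrightarrow> t1 < t2 \<Longrightarrow> t2 < T \<Longrightarrow>
    wint (real CARD('n) - 3 + 4 * b) (\<lambda>\<xi>. ennreal (cmod (sol j (t2, \<xi>) - sol j (t1, \<xi>)))) \<le>
      ennreal (C1 * (t2 - t1) powr (2 * (7 / 8 - b)) + C2 * (t2 - t1) powr (2 * (1 - b)))"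
proof -
  \<comment> \<open>\<theta> is fixed by b + \<theta> = 7/8, so that the weight n - 3 + 4b + 4
    \<theta> is one in which \<open>V\<close> is bounded.\<close>
  define \<theta> where "\<theta> = 7 / 8 - b"
  have \<theta>: "0 < \<theta>" "\<theta> \<le> 1" using b by (auto simp: \<theta>_def)
  obtain B where B: "B \<ge> 0" "\<And>t. 0 < t \<Longrightarrow> t < T \<Longrightarrow> wint (real CARD('n) - 3 + 4 * (7 / 8)) (\<lambda>\<xi>. V (t, \<xi>)) \<le> ennreal (B * t powr (1 / 2 - 2 * (7 / 8)))"
    using V_bounds[of "7 / 8"] by auto
  obtain C where C: "C \<ge> 0" "\<And>(W :: real \<times> (real^'n) \<Rightarrow> ennreal) L b t1 t2.
      W \<in> borel_measurable borel \<Longrightarrow> 0 \<le> t1 \<Longrightarrow> 1 / 4 \<le> b \<Longrightarrow> b \<le> 1 \<Longrightarrow> L \<ge> 0 \<Longrightarrow>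
      (\<And>s. t1 < s \<Longrightarrow> s < t2 \<Longrightarrow> wint (real CARD('n) - 1 / 2) (\<lambda>\<xi>. W (s, \<xi>)) \<le> ennreal (L * s powr (- 3 / 4))) \<Longrightarrow>
      wint (real CARD('n) - 3 + 4 * b) (\<lambda>\<xi>. ennreal K * duhamel t1 t2 (self_conv W) \<xi>) \<le> ennreal (C * L\<^sup>2) * (beta_int b t1 t2)\<^sup>2"
    using bilinear_const by blast
  \<comment> \<open>The factors 2 come from \<open>wint_add_le\<close>; \<delta> replaces t1 because
    the powers of time involved are negative.\<close>
  define E1 where "E1 = 2 * (B * \<delta> powr (1 / 2 - 2 * (7 / 8)))"
  define E2 where "E2 = 2 * (C * L\<^sup>2 * (\<delta> powr (- 3 / 4) / (1 - b))\<^sup>2)"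
  show ?thesis
  proof (rule that)
    show "E1 \<ge> 0" "E2 \<ge> 0" using B(1) C(1) by (auto simp: E1_def E2_def)
    fix t1 t2 :: real and j
    assume t: "\<delta> \<le> t1" "t1 < t2" "t2 < T"
    have t0: "0 < t1" "t1 < T" "0 < t2" using t d by auto
    define h where "h = t2 - t1"
    have h: "h > 0" using t by (simp add: h_def)
    let ?p = "real CARD('n) - 3 + 4 * b"
    let ?X = "\<lambda>\<xi>. ennreal (1 - exp (- h * (norm \<xi>)\<^sup>2)) * V (t1, \<xi>)"
    have "wint ?p (\<lambda>\<xi>. ennreal (cmod (sol j (t2, \<xi>) - sol j (t1, \<xi>)))) \<le> wint ?p (\<lambda>\<xi>. ?X \<xi> + DV t1 t2 \<xi>)"
    proof (rule wint_AE_mono)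
      show "AE \<xi> in lborel. ennreal (cmod (sol j (t2, \<xi>) - sol j (t1, \<xi>))) \<le> ?X \<xi> + DV t1 t2 \<xi>"
        using sol_increment[OF t0(1) t(2,3), of j]
      proof eventually_elim
        case (elim \<xi>)
        define e where "e = exp (- h * (norm \<xi>)\<^sup>2)"
        have e: "0 < e" "e \<le> 1" using h by (auto simp: e_def)
        have "sol j (t2, \<xi>) - sol j (t1, \<xi>) = (sol j (t2, \<xi>) - of_real e * sol j (t1, \<xi>)) - of_real (1 - e) * sol j (t1, \<xi>)"
          by (simp add: algebra_simps)
        then have "cmod (sol j (t2, \<xi>) - sol j (t1, \<xi>)) \<le> cmod (sol j (t2, \<xi>) - of_real e * sol j (t1, \<xi>)) + cmod (of_real (1 - e) * sol j (t1, \<xi>))"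
          using norm_triangle_ineq4 by metis
        also have "cmod (of_real (1 - e) * sol j (t1, \<xi>)) = (1 - e) * cmod (sol j (t1, \<xi>))"
          unfolding norm_mult norm_of_real using e by simp
        finally have "ennreal (cmod (sol j (t2, \<xi>) - sol j (t1, \<xi>))) \<le> ennreal (cmod (sol j (t2, \<xi>) - of_real e * sol j (t1, \<xi>)) + (1 - e) * cmod (sol j (t1, \<xi>)))"
          by (rule ennreal_leI)
        also have "\<dots> = ennreal (cmod (sol j (t2, \<xi>) - of_real e * sol j (t1, \<xi>))) + ennreal (1 - e) * ennreal (cmod (sol j (t1, \<xi>)))"
          using e by (simp add: ennreal_mult)
        also have "\<dots> \<le> DV t1 t2 \<xi> + ennreal (1 - e) * V (t1, \<xi>)"
          using elim by (intro add_mono mult_left_mono sol_le) (auto simp: e_def h_def)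
        finally show ?case by (simp add: e_def add.commute)
      qed
    qed
    also have "\<dots> \<le> 2 * wint ?p ?X + 2 * wint ?p (DV t1 t2)"
      by (rule wint_add_le) measurable
    also have "\<dots> \<le> 2 * ennreal (h powr (2 * \<theta>) * (B * \<delta> powr (1 / 2 - 2 * (7 / 8)))) + 2 * ennreal (C * L\<^sup>2 * (\<delta> powr (- 3 / 4) * (h powr (1 - b) / (1 - b)))\<^sup>2)"
    proof (intro add_mono mult_left_mono)
      have "wint ?p ?X \<le> (\<integral>\<^sup>+\<xi>. ennreal (h powr (2 * \<theta>)) * (ennreal (norm \<xi> powr (real CARD('n) - 3 + 4 * (7 / 8))) * (V (t1, \<xi>))\<^sup>2) \<partial>lborel)"
        unfolding wint_def
      proof (rule nn_integral_mono)
        fix \<xi> :: "real^'n"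
        show "ennreal (norm \<xi> powr ?p) * (?X \<xi>)\<^sup>2 \<le> ennreal (h powr (2 * \<theta>)) * (ennreal (norm \<xi> powr (real CARD('n) - 3 + 4 * (7 / 8))) * (V (t1, \<xi>))\<^sup>2)"
        proof (cases "\<xi> = 0")
          case False
          define r where "r = norm \<xi>"
          have r: "r > 0" using False by (simp add: r_def)
          have l: "1 - exp (- h * r\<^sup>2) \<le> (h * r\<^sup>2) powr \<theta>"
            using one_minus_exp_le[of "h * r\<^sup>2" \<theta>] h \<theta> by simp
          have "r powr ?p * (1 - exp (- h * r\<^sup>2))\<^sup>2 \<le> r powr ?p * ((h * r\<^sup>2) powr \<theta>)\<^sup>2"
            using h by (intro mult_left_mono power_mono l) auto
          also have "((h * r\<^sup>2) powr \<theta>)\<^sup>2 = h powr (2 * \<theta>) * r powr (4 * \<theta>)"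
          proof -
            have "r\<^sup>2 = r powr 2" using r by (simp add: powr_numeral)
            then have "(h * r\<^sup>2) powr \<theta> = h powr \<theta> * r powr (2 * \<theta>)" by (simp add: powr_mult powr_powr)
            then show ?thesis by (simp add: power2_eq_square powr_add[symmetric] mult_ac)
          qed
          also have "r powr ?p * (h powr (2 * \<theta>) * r powr (4 * \<theta>)) = h powr (2 * \<theta>) * r powr (real CARD('n) - 3 + 4 * (7 / 8))"
          proof -
            have "r powr ?p * (h powr (2 * \<theta>) * r powr (4 * \<theta>)) = h powr (2 * \<theta>) * (r powr ?p * r powr (4 * \<theta>))"
              by (simp only: mult.left_commute)
            also have "r powr ?p * r powr (4 * \<theta>) = r powr (?p + 4 * \<theta>)" by (rule powr_add[symmetric])
            also have "?p + 4 * \<theta> = real CARD('n) - 3 + 4 * (7 / 8)" by (simp add: \<theta>_def)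
            finally show ?thesis .
          qed
          finally have "ennreal (r powr ?p * (1 - exp (- h * r\<^sup>2))\<^sup>2) \<le> ennreal (h powr (2 * \<theta>) * r powr (real CARD('n) - 3 + 4 * (7 / 8)))"
            by (rule ennreal_leI)
          from mult_right_mono[OF this, of "(V (t1, \<xi>))\<^sup>2"]
          show ?thesis using h by (simp add: r_def power_mult_distrib ennreal_power ennreal_mult mult.assoc)
        qed simp
      qed
      also have "\<dots> = ennreal (h powr (2 * \<theta>)) * wint (real CARD('n) - 3 + 4 * (7 / 8)) (\<lambda>\<xi>. V (t1, \<xi>))"
        unfolding wint_def by (rule nn_integral_cmult) measurable
      also have "\<dots> \<le> ennreal (h powr (2 * \<theta>)) * ennreal (B * t1 powr (1 / 2 - 2 * (7 / 8)))"
        by (intro mult_left_mono B t0) auto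
      also have "\<dots> = ennreal (h powr (2 * \<theta>) * (B * t1 powr (1 / 2 - 2 * (7 / 8))))"
        using B(1) by (simp add: ennreal_mult)
      also have "\<dots> \<le> ennreal (h powr (2 * \<theta>) * (B * \<delta> powr (1 / 2 - 2 * (7 / 8))))"
        using B(1) d t by (intro ennreal_leI mult_left_mono powr_mono2') auto
      finally show "wint ?p ?X \<le> ennreal (h powr (2 * \<theta>) * (B * \<delta> powr (1 / 2 - 2 * (7 / 8))))" .
      have "wint ?p (DV t1 t2) \<le> ennreal (C * L\<^sup>2) * (beta_int b t1 t2)\<^sup>2"
        unfolding DV_def[abs_def] using b t0 t by (intro C(2) V_measurable V_bound L_nonneg) auto
      also have "\<dots> \<le> ennreal (C * L\<^sup>2) * (ennreal (\<delta> powr (- 3 / 4) * (h powr (1 - b) / (1 - b))))\<^sup>2"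
      proof (intro mult_left_mono power_mono)
        have "beta_int b t1 t2 \<le> ennreal (t1 powr (- 3 / 4) * (h powr (1 - b) / (1 - b)))"
          using b t0 t unfolding h_def by (intro beta_int_le) auto
        also have "\<dots> \<le> ennreal (\<delta> powr (- 3 / 4) * (h powr (1 - b) / (1 - b)))"
          using b d t h by (intro ennreal_leI mult_right_mono powr_mono2') auto
        finally show "beta_int b t1 t2 \<le> ennreal (\<delta> powr (- 3 / 4) * (h powr (1 - b) / (1 - b)))" .
      qed auto
      also have "\<dots> = ennreal (C * L\<^sup>2 * (\<delta> powr (- 3 / 4) * (h powr (1 - b) / (1 - b)))\<^sup>2)"
        using C(1) b by (simp add: ennreal_power ennreal_mult)
      finally show "wint ?p (DV t1 t2) \<le> ennreal (C * L\<^sup>2 * (\<delta> powr (- 3 / 4) * (h powr (1 - b) / (1 - b)))\<^sup>2)" .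
    qed auto
    also have "\<dots> = ennreal (E1 * h powr (2 * \<theta>) + E2 * h powr (2 * (1 - b)))"
    proof -
      have x: "2 * ennreal x = ennreal (2 * x)" for x by (simp add: ennreal_mult')
      have "(h powr (1 - b))\<^sup>2 = h powr (2 * (1 - b))" by (simp add: power2_eq_square powr_add[symmetric])
      then have "2 * (C * L\<^sup>2 * (\<delta> powr (- 3 / 4) * (h powr (1 - b) / (1 - b)))\<^sup>2) = E2 * h powr (2 * (1 - b))"
        by (simp add: E2_def power_mult_distrib power_divide)
      moreover have "2 * (h powr (2 * \<theta>) * (B * \<delta> powr (1 / 2 - 2 * (7 / 8)))) = E1 * h powr (2 * \<theta>)" by (simp add: E1_def)
      ultimately show ?thesis unfolding x
        using B(1) C(1) by (simp only:) (intro ennreal_plus[symmetric], auto simp: E1_def E2_def)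
    qed
    finally show "wint ?p (\<lambda>\<xi>. ennreal (cmod (sol j (t2, \<xi>) - sol j (t1, \<xi>)))) \<le> ennreal (E1 * (t2 - t1) powr (2 * (7 / 8 - b)) + E2 * (t2 - t1) powr (2 * (1 - b)))"
      by (simp add: h_def \<theta>_def)
  qed
qed

lemma sol_tendsto:
  assumes b: "1 / 4 \<le> b" "b < 7 / 8" and t0: "0 < t0" "t0 < T" and e: "\<epsilon> > 0"
  shows "\<exists>d>0. \<forall>t. 0 < t \<longrightarrow> t < T \<longrightarrow> \<bar>t - t0\<bar> < d \<longrightarrow>
    wint (real CARD('n) - 3 + 4 * b) (\<lambda>\<xi>. ennreal (cmod (sol j (t, \<xi>) - sol j (t0, \<xi>)))) \<le> ennreal \<epsilon>"
proof -
  have "t0 / 2 > 0" using t0 by simp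
  from sol_hoelder[OF b this] obtain C1 C2 where C: "C1 \<ge> 0" "C2 \<ge> 0" "\<And>t1 t2 j. t0 / 2 \<le> t1 \<Longrightarrow> t1 < t2 \<Longrightarrow> t2 < T \<Longrightarrow>
    wint (real CARD('n) - 3 + 4 * b) (\<lambda>\<xi>. ennreal (cmod (sol j (t2, \<xi>) - sol j (t1, \<xi>)))) \<le>
      ennreal (C1 * (t2 - t1) powr (2 * (7 / 8 - b)) + C2 * (t2 - t1) powr (2 * (1 - b)))" by blast
  define f where "f h = C1 * h powr (2 * (7 / 8 - b)) + C2 * h powr (2 * (1 - b))" for h
  have "(f \<longlongrightarrow> C1 * 0 powr (2 * (7 / 8 - b)) + C2 * 0 powr (2 * (1 - b))) (at_right 0)"
    unfolding f_def using b
    by (intro tendsto_intros tendsto_powr' tendsto_ident_at) (auto simp: eventually_at_right_less intro: eventually_at_rightI[of 0 1])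
  then have "(f \<longlongrightarrow> 0) (at_right 0)" by simp
  then have "\<forall>\<^sub>F h in at_right 0. f h < \<epsilon>" using e by (rule order_tendstoD)
  then obtain d where d: "d > 0" "\<And>h. 0 < h \<Longrightarrow> h < d \<Longrightarrow> f h < \<epsilon>"
    unfolding eventually_at_right_field by auto
  show ?thesis
  \<comment> \<open>The bound t0/2 keeps both times above the threshold of the Hoelder
    estimate.\<close>
  proof (intro exI[of _ "min d (t0 / 2)"] conjI allI impI)
    show "min d (t0 / 2) > 0" using d t0 by simp
    fix t assume t: "0 < t" "t < T" "\<bar>t - t0\<bar> < min d (t0 / 2)"
    consider "t = t0" | "t < t0" | "t0 < t" by linarith
    then show "wint (real CARD('n) - 3 + 4 * b) (\<lambda>\<xi>. ennreal (cmod (sol j (t, \<xi>) - sol j (t0, \<xi>)))) \<le> ennreal \<epsilon>"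
    proof cases
      case 1
      then show ?thesis by (simp add: wint_def)
    next
      case 2
      have "wint (real CARD('n) - 3 + 4 * b) (\<lambda>\<xi>. ennreal (cmod (sol j (t, \<xi>) - sol j (t0, \<xi>)))) = wint (real CARD('n) - 3 + 4 * b) (\<lambda>\<xi>. ennreal (cmod (sol j (t0, \<xi>) - sol j (t, \<xi>))))"
        by (simp only: norm_minus_commute)
      also have "\<dots> \<le> ennreal (f (t0 - t))" unfolding f_def using 2 t t0 by (intro C(3)) auto
      also have "\<dots> \<le> ennreal \<epsilon>" using d(2)[of "t0 - t"] 2 t by (intro ennreal_leI) auto
      finally show ?thesis .
    next
      case 3
      have "wint (real CARD('n) - 3 + 4 * b) (\<lambda>\<xi>. ennreal (cmod (sol j (t, \<xi>) - sol j (t0, \<xi>)))) \<le> ennreal (f (t - t0))"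
        unfolding f_def using 3 t t0 by (intro C(3)) auto
      also have "\<dots> \<le> ennreal \<epsilon>" using d(2)[of "t - t0"] 3 t by (intro ennreal_leI) auto
      finally show ?thesis .
    qed
  qed
qed

text \<open>Strong continuity of the heat flow at the critical regularity, by dominated convergence
  along t = 1/\<tau>.\<close>

lemma heat_tendsto_0:
  assumes e: "\<epsilon> > 0"
  shows "\<exists>d>0. \<forall>t. 0 < t \<longrightarrow> t < d \<longrightarrow> wint (real CARD('n) - 2) (\<lambda>\<xi>. ennreal ((1 - exp (- t * (norm \<xi>)\<^sup>2)) * \<gamma> \<xi>)) \<le> ennreal \<epsilon>"
proof -
  let ?p = "real CARD('n) - 2"
  define f where "f t \<xi> = norm \<xi> powr ?p * ((1 - exp (- t * (norm \<xi>)\<^sup>2)) * \<gamma> \<xi>)\<^sup>2" for t and \<xi> :: "real^'n"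
  define w where "w \<xi> = norm \<xi> powr ?p * (\<gamma> \<xi>)\<^sup>2" for \<xi> :: "real^'n"
  have [measurable]: "f t \<in> borel_measurable borel" "w \<in> borel_measurable borel" for t
    unfolding f_def[abs_def] w_def[abs_def] by measurable
  have wi: "integrable lborel w"
  proof (rule integrableI_bounded)
    have "(\<integral>\<^sup>+\<xi>. ennreal (norm (w \<xi>)) \<partial>lborel) = wint ?p (\<lambda>\<xi>. ennreal (\<gamma> \<xi>))"
      unfolding wint_def w_def using \<gamma>_nonneg by (intro nn_integral_cong) (simp add: ennreal_mult' ennreal_power)
    then show "(\<integral>\<^sup>+\<xi>. ennreal (norm (w \<xi>)) \<partial>lborel) < \<infinity>" using \<gamma>_wint by simp
  qed measurable
  have fw: "0 \<le> f t \<xi>" "f t \<xi> \<le> w \<xi>" if t: "t > 0" for t \<xi>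
  proof -
    show "0 \<le> f t \<xi>" by (simp add: f_def)
    have "(1 - exp (- t * (norm \<xi>)\<^sup>2)) * \<gamma> \<xi> \<le> 1 * \<gamma> \<xi>" by (intro mult_right_mono \<gamma>_nonneg) simp
    then show "f t \<xi> \<le> w \<xi>"
      unfolding f_def w_def using t \<gamma>_nonneg[of \<xi>] by (intro mult_left_mono power_mono) auto
  qed
  have "((\<lambda>\<tau>. LINT \<xi>|lborel. f (1 / \<tau>) \<xi>) \<longlongrightarrow> (LINT \<xi>::real^'n|lborel. 0)) at_top"
  proof (rule integral_dominated_convergence_at_top[where w = w])
    show "\<forall>\<^sub>F \<tau> in at_top. AE \<xi> in lborel. norm (f (1 / \<tau>) \<xi>) \<le> w \<xi>"
      using eventually_gt_at_top[of "0::real"]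
    proof eventually_elim
      case (elim \<tau>)
      then show ?case using fw[of "1 / \<tau>"] by simp
    qed
    show "AE \<xi> in lborel. ((\<lambda>\<tau>. f (1 / \<tau>) \<xi>) \<longlongrightarrow> 0) at_top"
    proof (rule AE_I2)
      fix \<xi> :: "real^'n"
      have i: "((\<lambda>\<tau>::real. 1 / \<tau>) \<longlongrightarrow> 0) at_top" by (rule tendsto_divide_0[OF tendsto_const filterlim_at_top_imp_at_infinity[OF filterlim_ident]])
      have "((\<lambda>\<tau>. f (1 / \<tau>) \<xi>) \<longlongrightarrow> norm \<xi> powr ?p * ((1 - exp (- 0 * (norm \<xi>)\<^sup>2)) * \<gamma> \<xi>)\<^sup>2) at_top"
        unfolding f_def by (intro tendsto_intros i)
      then show "((\<lambda>\<tau>. f (1 / \<tau>) \<xi>) \<longlongrightarrow> 0) at_top" by simp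
    qed
  qed (use wi in auto)
  then have "\<forall>\<^sub>F \<tau> in at_top. (LINT \<xi>|lborel. f (1 / \<tau>) \<xi>) < \<epsilon>"
    using e by (intro order_tendstoD) auto
  then obtain \<tau>0 where \<tau>0: "\<And>\<tau>. \<tau> \<ge> \<tau>0 \<Longrightarrow> (LINT \<xi>|lborel. f (1 / \<tau>) \<xi>) < \<epsilon>"
    unfolding eventually_at_top_linorder by blast
  define d where "d = 1 / max \<tau>0 1"
  show ?thesis
  proof (intro exI[of _ d] conjI allI impI)
    show "d > 0" by (simp add: d_def)
    fix t assume t: "0 < t" "t < d"
    have "1 / d < 1 / t" using t by (intro divide_strict_left_mono) auto
    then have "1 / t \<ge> \<tau>0" by (simp add: d_def)
    from \<tau>0[OF this] have l: "(LINT \<xi>|lborel. f t \<xi>) < \<epsilon>" by simp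
    have fi: "integrable lborel (f t)"
      by (rule Bochner_Integration.integrable_bound[OF wi]) (use fw[OF t(1)] in \<open>auto intro!: AE_I2 intro: order_trans[OF _ abs_ge_self]\<close>)
    have "wint ?p (\<lambda>\<xi>. ennreal ((1 - exp (- t * (norm \<xi>)\<^sup>2)) * \<gamma> \<xi>)) = (\<integral>\<^sup>+\<xi>. ennreal (f t \<xi>) \<partial>lborel)"
      unfolding wint_def
    proof (rule nn_integral_cong)
      fix \<xi> :: "real^'n"
      have "(1 - exp (- t * (norm \<xi>)\<^sup>2)) * \<gamma> \<xi> \<ge> 0" using t \<gamma>_nonneg by (intro mult_nonneg_nonneg) auto
      then show "ennreal (norm \<xi> powr ?p) * (ennreal ((1 - exp (- t * (norm \<xi>)\<^sup>2)) * \<gamma> \<xi>))\<^sup>2 = ennreal (f t \<xi>)"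
        unfolding f_def by (simp only: ennreal_power ennreal_mult'[OF powr_ge_zero])
    qed
    also have "\<dots> = ennreal (LINT \<xi>|lborel. f t \<xi>)"
      using fw(1)[OF t(1)] by (intro nn_integral_eq_integral fi) auto
    also have "\<dots> \<le> ennreal \<epsilon>" using l by (intro ennreal_leI) simp
    finally show "wint ?p (\<lambda>\<xi>. ennreal ((1 - exp (- t * (norm \<xi>)\<^sup>2)) * \<gamma> \<xi>)) \<le> ennreal \<epsilon>" .
  qed
qed

text \<open>The linear part converges by strong continuity of the heat flow. In the Duhamel part the
  power of t is 0 at b = 1/4, so its smallness is taken from the constant in
  \<open>V_small\<close>.\<close>

lemma sol_tendsto_0:
  assumes e: "\<epsilon> > 0"
  shows "\<exists>d>0. \<forall>t. 0 < t \<longrightarrow> t < T \<longrightarrow> t < d \<longrightarrow>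
    wint (real CARD('n) - 2) (\<lambda>\<xi>. ennreal (cmod (sol j (t, \<xi>) - g j \<xi>))) \<le> ennreal \<epsilon>"
proof -
  obtain D where D: "D \<ge> 0" "\<And>t L'. 0 < t \<Longrightarrow> L' \<ge> 0 \<Longrightarrow>
      (\<And>s. 0 < s \<Longrightarrow> s < t \<Longrightarrow> wint (real CARD('n) - 1 / 2) (\<lambda>\<xi>. V (s, \<xi>)) \<le> ennreal (L' * s powr (- 3 / 4))) \<Longrightarrow>
      wint (real CARD('n) - 3 + 4 * (1 / 4)) (DV 0 t) \<le> ennreal (D * L'\<^sup>2 * t powr (1 / 2 - 2 * (1 / 4)))"
    using DV_bound_0[of "1 / 4"] by auto
  \<comment> \<open>Chosen so that D l^2 \<le> \<epsilon>/4, with D + 1 to cover D = 0; the factor 2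
    of \<open>wint_add_le\<close> brings the two parts to \<epsilon> in total.\<close>
  define l where "l = sqrt (\<epsilon> / (4 * (D + 1)))"
  have l: "l > 0" using e D(1) by (simp add: l_def)
  have "D * l\<^sup>2 = \<epsilon> / 4 * (D / (D + 1))" using e D(1) by (simp add: l_def)
  also have "\<dots> \<le> \<epsilon> / 4 * 1" using e D(1) by (intro mult_left_mono) auto
  finally have Dl: "D * l\<^sup>2 \<le> \<epsilon> / 4" by simp
  obtain T' where T': "T' > 0" "\<And>t. 0 < t \<Longrightarrow> t < T' \<Longrightarrow> wint (real CARD('n) - 1 / 2) (\<lambda>\<xi>. V (t, \<xi>)) \<le> ennreal (l * t powr (- 3 / 4))"
    using V_small[OF l] by blast
  have "\<epsilon> / 4 > 0" using e by simp
  from heat_tendsto_0[OF this] obtain d where d: "d > 0" "\<And>t. 0 < t \<Longrightarrow> t < d \<Longrightarrow> wint (real CARD('n) - 2) (\<lambda>\<xi>. ennreal ((1 - exp (- t * (norm \<xi>)\<^sup>2)) * \<gamma> \<xi>)) \<le> ennreal (\<epsilon> / 4)" by blast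
  show ?thesis
  proof (intro exI[of _ "min T' d"] conjI allI impI)
    show "min T' d > 0" using T' d by simp
    fix t assume t: "0 < t" "t < T" "t < min T' d"
    let ?X = "\<lambda>\<xi>. ennreal ((1 - exp (- t * (norm \<xi>)\<^sup>2)) * \<gamma> \<xi>)"
    have "wint (real CARD('n) - 2) (\<lambda>\<xi>. ennreal (cmod (sol j (t, \<xi>) - g j \<xi>))) \<le> wint (real CARD('n) - 2) (\<lambda>\<xi>. ?X \<xi> + DV 0 t \<xi>)"
    proof (rule wint_AE_mono)
      show "AE \<xi> in lborel. ennreal (cmod (sol j (t, \<xi>) - g j \<xi>)) \<le> ?X \<xi> + DV 0 t \<xi>"
        using sol_equation[OF t(1,2), of j]
      proof eventually_elim
        case (elim \<xi>)
        define e where "e = exp (- t * (norm \<xi>)\<^sup>2)"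
        have e: "0 < e" "e \<le> 1" using t by (auto simp: e_def)
        have "sol j (t, \<xi>) - g j \<xi> = - (of_real (1 - e) * g j \<xi>) - (LINT p|lborel. kern sol j (t, \<xi>) p)"
          unfolding elim e_def[symmetric] by (simp add: algebra_simps)
        then have "cmod (sol j (t, \<xi>) - g j \<xi>) \<le> cmod (- (of_real (1 - e) * g j \<xi>)) + cmod (LINT p|lborel. kern sol j (t, \<xi>) p)"
          using norm_triangle_ineq4 by metis
        also have "cmod (- (of_real (1 - e) * g j \<xi>)) = (1 - e) * cmod (g j \<xi>)"
          unfolding norm_minus_cancel norm_mult norm_of_real using e by simp
        also have "(1 - e) * cmod (g j \<xi>) \<le> (1 - e) * \<gamma> \<xi>" using e by (intro mult_left_mono g_le_\<gamma>) auto
        finally have "ennreal (cmod (sol j (t, \<xi>) - g j \<xi>)) \<le> ennreal ((1 - e) * \<gamma> \<xi> + cmod (LINT p|lborel. kern sol j (t, \<xi>) p))"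
          by (simp add: ennreal_leI)
        also have "\<dots> = ennreal ((1 - e) * \<gamma> \<xi>) + ennreal (cmod (LINT p|lborel. kern sol j (t, \<xi>) p))"
          using e \<gamma>_nonneg[of \<xi>] by (intro ennreal_plus) auto
        also have "\<dots> \<le> ennreal ((1 - e) * \<gamma> \<xi>) + DV 0 t \<xi>"
          unfolding DV_kern_maj by (intro add_left_mono kern_integral_le sol_measurable sol_le)
        finally show ?case by (simp add: e_def)
      qed
    qed
    also have "\<dots> \<le> 2 * wint (real CARD('n) - 2) ?X + 2 * wint (real CARD('n) - 2) (DV 0 t)"
      by (rule wint_add_le) measurable
    also have "\<dots> \<le> 2 * ennreal (\<epsilon> / 4) + 2 * ennreal (\<epsilon> / 4)"
    proof (intro add_mono mult_left_mono)
      show "wint (real CARD('n) - 2) ?X \<le> ennreal (\<epsilon> / 4)" using t by (intro d) auto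
      have "wint (real CARD('n) - 3 + 4 * (1 / 4)) (DV 0 t) \<le> ennreal (D * l\<^sup>2 * t powr (1 / 2 - 2 * (1 / 4)))"
        using t l by (intro D(2) T') auto
      also have "\<dots> \<le> ennreal (\<epsilon> / 4)" using Dl t by (intro ennreal_leI) simp
      finally show "wint (real CARD('n) - 2) (DV 0 t) \<le> ennreal (\<epsilon> / 4)" by simp
    qed auto
    also have "\<dots> = ennreal \<epsilon>"
    proof -
      have x: "2 * ennreal x = ennreal (2 * x)" for x by (simp add: ennreal_mult')
      show ?thesis unfolding x using e by (subst ennreal_plus[symmetric]) auto
    qed
    finally show "wint (real CARD('n) - 2) (\<lambda>\<xi>. ennreal (cmod (sol j (t, \<xi>) - g j \<xi>))) \<le> ennreal \<epsilon>" .
  qed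
qed

end

subsection \<open>The velocity field\<close>

lemma hom_sobolev_weight_integral:
  fixes w :: "real^'n::finite \<Rightarrow> complex"
  assumes [measurable]: "w \<in> borel_measurable borel" and b: "wint (2 * s) (\<lambda>\<xi>. ennreal (cmod (w \<xi>))) \<le> ennreal B" "B \<ge> 0"
  shows "integrable lborel (\<lambda>\<xi>. (norm \<xi> powr s * cmod (w \<xi>))\<^sup>2)"
    "sqrt (LINT \<xi>|lborel. (norm \<xi> powr s * cmod (w \<xi>))\<^sup>2) \<le> sqrt B"
proof -
  have e: "(\<integral>\<^sup>+\<xi>. ennreal ((norm \<xi> powr s * cmod (w \<xi>))\<^sup>2) \<partial>lborel) = wint (2 * s) (\<lambda>\<xi>. ennreal (cmod (w \<xi>)))"
    unfolding wint_def
  proof (rule nn_integral_cong)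
    fix \<xi> :: "real^'n"
    have "(norm \<xi> powr s)\<^sup>2 = norm \<xi> powr (2 * s)" using powr_half_power2[of "norm \<xi>" "2 * s"] by simp
    then show "ennreal ((norm \<xi> powr s * cmod (w \<xi>))\<^sup>2) = ennreal (norm \<xi> powr (2 * s)) * (ennreal (cmod (w \<xi>)))\<^sup>2"
      by (simp add: power_mult_distrib ennreal_mult ennreal_power)
  qed
  show i: "integrable lborel (\<lambda>\<xi>. (norm \<xi> powr s * cmod (w \<xi>))\<^sup>2)"
  proof (rule integrableI_bounded)
    have "(\<integral>\<^sup>+\<xi>. ennreal ((norm \<xi> powr s * cmod (w \<xi>))\<^sup>2) \<partial>lborel) < \<infinity>"
      unfolding e by (rule le_less_trans[OF b(1)]) simp
    then show "(\<integral>\<^sup>+\<xi>. ennreal (norm ((norm \<xi> powr s * cmod (w \<xi>))\<^sup>2)) \<partial>lborel) < \<infinity>" by simp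
  qed measurable
  have "ennreal (LINT \<xi>|lborel. (norm \<xi> powr s * cmod (w \<xi>))\<^sup>2) \<le> ennreal B"
    using b(1) unfolding e[symmetric] by (subst (asm) nn_integral_eq_integral[OF i]) auto
  then show "sqrt (LINT \<xi>|lborel. (norm \<xi> powr s * cmod (w \<xi>))\<^sup>2) \<le> sqrt B"
    using b(2) by (simp add: ennreal_le_iff)
qed

lemma hom_sobolev_field_norm_le:
  fixes f :: "'n::finite \<Rightarrow> 'n distribution"
  assumes "\<And>j. is_L1loc_fun (fourier_dist (f j)) (w j)"
    and "\<And>j. wint (2 * s) (\<lambda>\<xi>. ennreal (cmod (w j \<xi>))) \<le> ennreal B" "B \<ge> 0"
  shows "hom_sobolev_field_norm s f \<le> real CARD('n) * sqrt B"
proof -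
  have n: "hom_sobolev_norm s (f j) \<le> sqrt B" for j
    unfolding hom_sobolev_norm_eq[OF assms(1)]
    by (rule hom_sobolev_weight_integral(2)[OF is_L1loc_fun_measurable[OF assms(1)] assms(2,3)])
  have n0: "0 \<le> hom_sobolev_norm s (f j)" for j
    unfolding hom_sobolev_norm_def by (simp add: integral_nonneg_AE)
  have "hom_sobolev_field_norm s f \<le> (\<Sum>j\<in>UNIV. hom_sobolev_norm s (f j))"
    unfolding hom_sobolev_field_norm_def by (rule L2_set_le_sum) (rule n0)
  also have "\<dots> \<le> (\<Sum>j\<in>(UNIV::'n set). sqrt B)" by (rule sum_mono) (rule n)
  finally show ?thesis by simp
qed

lemma hom_sobolev_field_norm_nonneg: "0 \<le> hom_sobolev_field_norm s f"
  unfolding hom_sobolev_field_norm_def by (rule L2_set_nonneg)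

lemma hom_sobolev_field_tendsto:
  fixes U :: "real \<Rightarrow> 'n::finite \<Rightarrow> 'n distribution"
  assumes t0: "t0 \<in> I" and U: "\<And>t j. t \<in> I \<Longrightarrow> is_L1loc_fun (fourier_dist (U t j)) (w t j)"
    and e: "\<And>\<epsilon> j. \<epsilon> > 0 \<Longrightarrow> \<exists>d>0. \<forall>t\<in>I. t \<noteq> t0 \<longrightarrow> \<bar>t - t0\<bar> < d \<longrightarrow> wint (2 * s) (\<lambda>\<xi>. ennreal (cmod (w t j \<xi> - w t0 j \<xi>))) \<le> ennreal \<epsilon>"
  shows "((\<lambda>t. hom_sobolev_field_norm s (\<lambda>j \<phi>. U t j \<phi> - U t0 j \<phi>)) \<longlongrightarrow> 0) (at t0 within I)"
proof (rule tendstoI)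
  fix r :: real assume r: "r > 0"
  define n where "n = real CARD('n)"
  have n: "n > 0" by (simp add: n_def)
  \<comment> \<open>This makes n sqrt \<epsilon> = r/2 in \<open>hom_sobolev_field_norm_le\<close>,
    where the components are simply added up.\<close>
  define \<epsilon> where "\<epsilon> = (r / (2 * n))\<^sup>2"
  have \<epsilon>: "\<epsilon> > 0" using r n by (simp add: \<epsilon>_def)
  have "\<forall>\<^sub>F t in at t0 within I. \<forall>j. wint (2 * s) (\<lambda>\<xi>. ennreal (cmod (w t j \<xi> - w t0 j \<xi>))) \<le> ennreal \<epsilon>"
  proof (rule eventually_all_finite)
    fix j
    obtain d where "d > 0" "\<forall>t\<in>I. t \<noteq> t0 \<longrightarrow> \<bar>t - t0\<bar> < d \<longrightarrow> wint (2 * s) (\<lambda>\<xi>. ennreal (cmod (w t j \<xi> - w t0 j \<xi>))) \<le> ennreal \<epsilon>"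
      using e[OF \<epsilon>, of j] by blast
    then show "\<forall>\<^sub>F t in at t0 within I. wint (2 * s) (\<lambda>\<xi>. ennreal (cmod (w t j \<xi> - w t0 j \<xi>))) \<le> ennreal \<epsilon>"
      unfolding eventually_at dist_real_def by blast
  qed
  moreover have "\<forall>\<^sub>F t in at t0 within I. t \<in> I" by (simp add: eventually_at_filter)
  ultimately show "\<forall>\<^sub>F t in at t0 within I. dist (hom_sobolev_field_norm s (\<lambda>j \<phi>. U t j \<phi> - U t0 j \<phi>)) 0 < r"
  proof eventually_elim
    case (elim t)
    have "hom_sobolev_field_norm s (\<lambda>j \<phi>. U t j \<phi> - U t0 j \<phi>) \<le> n * sqrt \<epsilon>"
      unfolding n_def
      by (rule hom_sobolev_field_norm_le[where w = "\<lambda>j \<xi>. w t j \<xi> - w t0 j \<xi>"])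
        (use elim t0 \<epsilon> in \<open>auto intro!: is_L1loc_fun_diff U\<close>)
    also have "\<dots> = r / 2" using r n by (simp add: \<epsilon>_def)
    finally show ?case using r hom_sobolev_field_norm_nonneg[of s "\<lambda>j \<phi>. U t j \<phi> - U t0 j \<phi>"] by simp
  qed
qed

lemma real_valued_field_dist: "real_valued_dist (field_dist v j)"
  unfolding real_valued_dist_def field_dist_def fun_dist_def
proof (intro allI impI)
  fix \<phi> :: "real^'a \<Rightarrow> complex" assume r: "\<forall>x. \<phi> x \<in> \<real>"
  have "(LINT x|lborel. of_real (v x $ j) * \<phi> x) = (LINT x|lborel. complex_of_real (v x $ j * Re (\<phi> x)))"
    using r by (intro Bochner_Integration.integral_cong) auto
  also have "\<dots> = of_real (LINT x|lborel. v x $ j * Re (\<phi> x))" by (rule integral_complex_of_real)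
  finally show "(LINT x|lborel. of_real (v x $ j) * \<phi> x) \<in> \<real>" by simp
qed

lemma inv_fourier_pairing:
  fixes W :: "real^'n::finite \<Rightarrow> complex"
  assumes "integrable lborel W" "schwartz \<phi>"
  shows "(LINT x|lborel. inv_fourier W x * \<phi> x) = (LINT \<xi>|lborel. W \<xi> * inv_fourier \<phi> \<xi>)"
    "integrable lborel (\<lambda>\<xi>. W \<xi> * inv_fourier \<phi> \<xi>)"
proof -
  have i: "integrable lborel \<phi>" by (rule schwartz_integrable[OF assms(2)])
  have [measurable]: "\<phi> \<in> borel_measurable borel" "W \<in> borel_measurable borel"
    using borel_measurable_integrable[OF i] borel_measurable_integrable[OF assms(1)] by auto
  show "(LINT x|lborel. inv_fourier W x * \<phi> x) = (LINT \<xi>|lborel. W \<xi> * inv_fourier \<phi> \<xi>)"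
    by (rule inv_fourier_duality[OF assms(1) i])
  obtain P where P: "\<And>\<xi>. cmod (inv_fourier \<phi> \<xi>) \<le> P" using inv_fourier_bound[OF i] by blast
  have P0: "P \<ge> 0" using order_trans[OF norm_ge_zero P] .
  show "integrable lborel (\<lambda>\<xi>. W \<xi> * inv_fourier \<phi> \<xi>)"
  proof (rule Bochner_Integration.integrable_bound[OF integrable_mult_right[OF assms(1), of "of_real P"]])
    have "norm (W \<xi> * inv_fourier \<phi> \<xi>) \<le> norm (of_real P * W \<xi>)" for \<xi>
      using mult_right_mono[OF P norm_ge_zero, of \<xi> "W \<xi>"] P0 by (simp add: norm_mult mult.commute)
    then show "AE \<xi> in lborel. norm (W \<xi> * inv_fourier \<phi> \<xi>) \<le> norm (of_real P * W \<xi>)" by simp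
  qed measurable
qed

context ns_sol
begin

text \<open>\<open>h\<close> represents the initial datum. The inverse transform does not apply at time 0, where the Fourier
  transform of the solution need not be integrable.\<close>

definition vel :: "('n \<Rightarrow> real^'n \<Rightarrow> real) \<Rightarrow> real \<Rightarrow> real^'n \<Rightarrow> real^'n" where
  "vel h t x = (\<chi> j. if t = 0 then h j x else Re (inv_fourier (\<lambda>\<xi>. sol j (t, \<xi>)) x))"

section \<open>Products of the velocity and the mild equation\<close>

lemma vel_complex:
  assumes t: "t \<noteq> 0"
  shows "complex_of_real (vel h t x $ j) = inv_fourier (\<lambda>\<xi>. sol j (t, \<xi>)) x"
  unfolding vel_def using t by (simp add: inv_fourier_hermitian_real[OF sol_section sol_herm])

lemma field_dist_vel: "t \<noteq> 0 \<Longrightarrow> field_dist (vel h t) j = fun_dist (inv_fourier (\<lambda>\<xi>. sol j (t, \<xi>)))"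
  by (simp add: field_dist_def vel_complex)

lemma field_dist_vel_0: "field_dist (vel h 0) j = fun_dist (\<lambda>x. of_real (h j x))"
  by (simp add: field_dist_def vel_def)

lemma vel_is_L1loc:
  assumes t: "0 < t" "t < T"
  shows "is_L1loc_fun (fourier_dist (field_dist (vel h t) j)) (\<lambda>\<xi>. sol j (t, \<xi>))"
  using t field_dist_vel[of t h j] inv_fourier_is_L1loc[OF sol_integrable[OF t, of j]] by simp

lemma vel_slow_growth:
  assumes t: "0 < t" "t < T"
  shows "slow_growth (\<lambda>x. complex_of_real (vel h t x $ j))"
  using t inv_fourier_slow_growth[OF sol_integrable[OF t, of j]] by (simp add: vel_complex)

lemma vel_prod:
  assumes t: "0 < t" "t < T"
  shows "complex_of_real (vel h t x $ j * vel h t x $ k) =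
    inv_fourier (\<lambda>\<xi>. of_real cn * conv (\<lambda>\<eta>. sol j (t, \<eta>)) (\<lambda>\<eta>. sol k (t, \<eta>)) \<xi>) x"
  using inv_fourier_conv[OF sol_integrable[OF t, of j] sol_integrable[OF t, of k], of x] t
  by (simp add: vel_complex cn_def)

lemma conv_sol_integrable:
  assumes t: "0 < t" "t < T"
  shows "integrable lborel (\<lambda>\<xi>. of_real cn * conv (\<lambda>\<eta>. sol j (t, \<eta>)) (\<lambda>\<eta>. sol k (t, \<eta>)) \<xi>)"
  by (intro integrable_mult_right conv_integrable sol_integrable t)

lemma div_tensor_vel:
  assumes t: "0 < t" "t < T"
  shows "div_tensor (vel h t) (vel h t) k = (\<lambda>\<phi>. \<Sum>j\<in>UNIV. partial_dist j (fun_dist (inv_fourier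
     (\<lambda>\<xi>. of_real cn * conv (\<lambda>\<eta>. sol j (t, \<eta>)) (\<lambda>\<eta>. sol k (t, \<eta>)) \<xi>))) \<phi>)"
  unfolding div_tensor_def vel_prod[OF t] ..

lemma div_tensor_vel_is_L1loc:
  assumes t: "0 < t" "t < T"
  shows "is_L1loc_fun (fourier_dist (div_tensor (vel h t) (vel h t) k))
    (\<lambda>\<xi>. \<Sum>l\<in>UNIV. \<i> * of_real (\<xi> $ l) * (of_real cn * conv (\<lambda>\<eta>. sol l (t, \<eta>)) (\<lambda>\<eta>. sol k (t, \<eta>)) \<xi>))"
  unfolding div_tensor_vel[OF t] by (intro is_L1loc_fun_sum inv_fourier_partial_is_L1loc conv_sol_integrable t) simp

lemma div_tensor_vel_defined:
  assumes t: "0 < t" "t < T"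
  shows "div_tensor_defined (vel h t) (vel h t)"
  unfolding div_tensor_defined_def
proof (intro conjI allI)
  fix j k
  show "tempered_fun (\<lambda>x. complex_of_real (vel h t x $ j * vel h t x $ k))"
    unfolding vel_prod[OF t] by (intro tempered_fun_slow_growth inv_fourier_slow_growth conv_sol_integrable t)
next
  fix k
  have "tempered (div_tensor (vel h t) (vel h t) k)"
    unfolding div_tensor_vel[OF t]
    by (intro tempered_sum tempered_partial_dist inv_fourier_slow_growth conv_sol_integrable t) simp
  then show "has_fourier_fun (div_tensor (vel h t) (vel h t) k)"
    unfolding has_fourier_fun_def using div_tensor_vel_is_L1loc[OF t] by blast
qed

lemma leray_vel_is_L1loc:
  assumes t: "0 < t" "t < T"
  shows "is_L1loc_fun (fourier_dist (leray (div_tensor (vel h t) (vel h t)) j)) (\<lambda>\<xi>. Gnl j (t, \<xi>))"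
  using leray_is_L1loc[of "div_tensor (vel h t) (vel h t)", OF div_tensor_vel_is_L1loc[OF t], of j]
  by (simp add: Gnl_def)

definition dfun :: "real \<Rightarrow> 'n \<Rightarrow> real^'n \<Rightarrow> complex" where
  "dfun t j \<xi> = (LINT s:{0<..<t}|lborel. of_real (exp (- (t - s) * (norm \<xi>)\<^sup>2)) * Gnl j (s, \<xi>))"

lemma dfun_measurable [measurable]: "dfun t j \<in> borel_measurable borel"
proof -
  have [measurable]: "Gnl j \<in> borel_measurable (borel \<Otimes>\<^sub>M borel)" using Gnl_measurable by (simp add: borel_prod)
  show ?thesis unfolding dfun_def[abs_def] set_lebesgue_integral_def by measurable
qed

lemma dfun_AE:
  assumes t: "0 < t" "t < T"
  shows "AE \<xi> in lborel. set_integrable lborel {0<..<t} (\<lambda>s. of_real (exp (- (t - s) * (norm \<xi>)\<^sup>2)) * Gnl j (s, \<xi>))"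
    "AE \<xi> in lborel. of_real (exp (- t * (norm \<xi>)\<^sup>2)) * g j \<xi> - sol j (t, \<xi>) = dfun t j \<xi>"
proof -
  show "AE \<xi> in lborel. set_integrable lborel {0<..<t} (\<lambda>s. of_real (exp (- (t - s) * (norm \<xi>)\<^sup>2)) * Gnl j (s, \<xi>))"
    using DV_AE_finite[OF t] AE_lborel_singleton[of 0] by eventually_elim (rule kern_nested(1))
  show "AE \<xi> in lborel. of_real (exp (- t * (norm \<xi>)\<^sup>2)) * g j \<xi> - sol j (t, \<xi>) = dfun t j \<xi>"
    using DV_AE_finite[OF t] AE_lborel_singleton[of 0] sol_equation[OF t, of j]
  proof eventually_elim
    case (elim \<xi>)
    show ?case unfolding dfun_def kern_nested(2)[OF elim(1,2)] elim(3) by simp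
  qed
qed

text \<open>Integrability is read off from the equation, as a difference of the heat flow of the
  datum and the solution, so the time integral is not estimated again.\<close>

lemma dfun_integrable:
  assumes t: "0 < t" "t < T"
  shows "integrable lborel (dfun t j)"
  by (rule integrable_cong_AE_imp[OF Bochner_Integration.integrable_diff[OF heat_integrable[OF t(1), of j] sol_integrable[OF t, of j]]])
    (use dfun_AE(2)[OF t, of j] in auto)

lemma duhamel_vel:
  assumes t: "0 < t" "t < T"
  shows "is_duhamel_integral (vel h) t (\<lambda>j. fun_dist (inv_fourier (dfun t j)))"
  unfolding is_duhamel_integral_def
proof (intro conjI allI exI[of _ Gnl] ballI)
  show "tempered (fun_dist (inv_fourier (dfun t j)))" for j
    by (intro tempered_fun_dist inv_fourier_slow_growth dfun_integrable t)
  show "Gnl j \<in> borel_measurable borel" for j by (rule Gnl_measurable)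
  show "is_L1loc_fun (fourier_dist (leray (div_tensor (vel h s) (vel h s)) j)) (\<lambda>\<xi>. Gnl j (s, \<xi>))" if "s \<in> {0<..<t}" for j s
    using that t by (intro leray_vel_is_L1loc) auto
  show "AE \<xi> in lborel. set_integrable lborel {0<..<t} (\<lambda>s. of_real (exp (- (t - s) * (norm \<xi>)\<^sup>2)) * Gnl j (s, \<xi>))" for j
    by (rule dfun_AE(1)[OF t])
  show "is_L1loc_fun (fourier_dist (fun_dist (inv_fourier (dfun t j))))
      (\<lambda>\<xi>. LINT s:{0<..<t}|lborel. of_real (exp (- (t - s) * (norm \<xi>)\<^sup>2)) * Gnl j (s, \<xi>))" for j
    unfolding dfun_def[symmetric] by (rule inv_fourier_is_L1loc[OF dfun_integrable[OF t]])
qed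

text \<open>All three transforms are integrable at positive times, so the pairing with any Schwartz
  function moves to the frequency side, where the equation holds almost everywhere.\<close>

lemma vel_mild:
  assumes t: "0 < t" "t < T" and u0: "AE \<xi> in lborel. fourier_fun u0 \<xi> = g j \<xi>"
    and [measurable]: "fourier_fun u0 \<in> borel_measurable borel" and s: "schwartz \<phi>"
  shows "field_dist (vel h t) j \<phi> = heat t u0 \<phi> - fun_dist (inv_fourier (dfun t j)) \<phi>"
proof -
  have [measurable]: "\<phi> \<in> borel_measurable borel" by (rule schwartz_measurable[OF s])
  let ?p = "inv_fourier \<phi>" and ?H = "\<lambda>\<xi>. of_real (exp (- t * (norm \<xi>)\<^sup>2)) * g j \<xi>"
  have "field_dist (vel h t) j \<phi> = (LINT \<xi>|lborel. sol j (t, \<xi>) * ?p \<xi>)"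
    using t field_dist_vel[of t h j] inv_fourier_pairing(1)[OF sol_integrable[OF t, of j] s] by (simp add: fun_dist_def)
  also have "\<dots> = (LINT \<xi>|lborel. ?H \<xi> * ?p \<xi> - dfun t j \<xi> * ?p \<xi>)"
  proof (rule integral_cong_AE)
    show "AE \<xi> in lborel. sol j (t, \<xi>) * ?p \<xi> = ?H \<xi> * ?p \<xi> - dfun t j \<xi> * ?p \<xi>"
      using dfun_AE(2)[OF t, of j]
    proof eventually_elim
      case (elim \<xi>)
      show ?case unfolding elim[symmetric] by (simp add: algebra_simps)
    qed
  qed measurable
  also have "\<dots> = (LINT \<xi>|lborel. ?H \<xi> * ?p \<xi>) - (LINT \<xi>|lborel. dfun t j \<xi> * ?p \<xi>)"
    by (rule Bochner_Integration.integral_diff[OF inv_fourier_pairing(2)[OF heat_integrable[OF t(1)] s] inv_fourier_pairing(2)[OF dfun_integrable[OF t] s]])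
  also have "(LINT \<xi>|lborel. dfun t j \<xi> * ?p \<xi>) = fun_dist (inv_fourier (dfun t j)) \<phi>"
    unfolding fun_dist_def by (rule inv_fourier_pairing(1)[OF dfun_integrable[OF t] s, symmetric])
  also have "(LINT \<xi>|lborel. ?H \<xi> * ?p \<xi>) = heat t u0 \<phi>"
    unfolding heat_def fourier_multiplier_def inv_fourier_dist_def fun_dist_def
    by (rule integral_cong_AE) (use u0 in auto)
  finally show ?thesis .
qed

lemma wint_sol_finite:
  assumes b: "1 / 4 \<le> b" "b < 1" and t: "0 < t" "t < T"
  obtains B where "B \<ge> 0" "wint (real CARD('n) - 3 + 4 * b) (\<lambda>\<xi>. ennreal (cmod (sol j (t, \<xi>)))) \<le> ennreal B"
proof -
  have "wint (real CARD('n) - 3 + 4 * b) (\<lambda>\<xi>. ennreal (cmod (sol j (t, \<xi>)))) \<le> wint (real CARD('n) - 3 + 4 * b) (\<lambda>\<xi>. V (t, \<xi>))"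
    by (rule wint_mono) (rule sol_le)
  also have "\<dots> < \<infinity>" by (rule wint_V_finite[OF b t])
  finally show ?thesis
    using that[of "enn2real (wint (real CARD('n) - 3 + 4 * b) (\<lambda>\<xi>. ennreal (cmod (sol j (t, \<xi>)))))"] by simp
qed

lemma vel_hom_sobolev_field:
  assumes b: "1 / 4 \<le> b" "b < 1" and t: "0 < t" "t < T" and s: "2 * s = real CARD('n) - 3 + 4 * b"
  shows "field_dist (vel h t) \<in> hom_sobolev_field s"
  unfolding hom_sobolev_field_def
proof (intro CollectI allI conjI real_valued_field_dist)
  fix j
  obtain B where B: "B \<ge> 0" "wint (real CARD('n) - 3 + 4 * b) (\<lambda>\<xi>. ennreal (cmod (sol j (t, \<xi>)))) \<le> ennreal B"
    using wint_sol_finite[OF b t, of j] by blast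
  show "field_dist (vel h t) j \<in> hom_sobolev s"
  proof (rule hom_sobolevI[OF _ vel_is_L1loc[OF t]])
    show "tempered (field_dist (vel h t) j)"
      unfolding field_dist_def by (rule tempered_fun_dist[OF vel_slow_growth[OF t]])
    show "integrable lborel (\<lambda>\<xi>. (norm \<xi> powr s * cmod (sol j (t, \<xi>)))\<^sup>2)"
      by (rule hom_sobolev_weight_integral(1)[OF sol_section _ B(1)]) (use B(2) s in simp)
  qed
qed

lemma vel_E_space: "(\<lambda>t. field_dist (vel h t)) \<in> E_space (ereal T)"
  unfolding E_space_def
proof (intro CollectI conjI)
  let ?s = "(real CARD('n) - 1) / 2" and ?I = "{t. 0 < t \<and> ereal t < ereal T}"
  \<comment> \<open>At b = 1/2 the squared norm is at most a multiple of t^(-1/2); its square root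
    is balanced by the factor t^(1/4).\<close>
  have s: "2 * ?s = real CARD('n) - 3 + 4 * (1 / 2)" by simp
  show "continuous_into_hom_sobolev ?I ?s (\<lambda>t. field_dist (vel h t))"
    unfolding continuous_into_hom_sobolev_def
  proof (intro conjI ballI)
    fix t assume "t \<in> ?I"
    then show "field_dist (vel h t) \<in> hom_sobolev_field ?s"
      using vel_hom_sobolev_field[OF _ _ _ _ s] by simp
  next
    fix t0 assume t0: "t0 \<in> ?I"
    show "((\<lambda>t. hom_sobolev_field_norm ?s (\<lambda>j \<phi>. field_dist (vel h t) j \<phi> - field_dist (vel h t0) j \<phi>)) \<longlongrightarrow> 0) (at t0 within ?I)"
    proof (rule hom_sobolev_field_tendsto[where w = "\<lambda>t j \<xi>. sol j (t, \<xi>)", OF t0])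
      show "is_L1loc_fun (fourier_dist (field_dist (vel h t) j)) (\<lambda>\<xi>. sol j (t, \<xi>))" if "t \<in> ?I" for t j
        using that by (intro vel_is_L1loc) auto
      fix \<epsilon> :: real and j assume "\<epsilon> > 0"
      then show "\<exists>d>0. \<forall>t\<in>?I. t \<noteq> t0 \<longrightarrow> \<bar>t - t0\<bar> < d \<longrightarrow> wint (2 * ?s) (\<lambda>\<xi>. ennreal (cmod (sol j (t, \<xi>) - sol j (t0, \<xi>)))) \<le> ennreal \<epsilon>"
        using sol_tendsto[of "1 / 2" t0 \<epsilon> j] t0 unfolding s by auto
    qed
  qed
  obtain B where B: "B \<ge> 0" "\<And>t. 0 < t \<Longrightarrow> t < T \<Longrightarrow> wint (real CARD('n) - 3 + 4 * (1 / 2)) (\<lambda>\<xi>. V (t, \<xi>)) \<le> ennreal (B * t powr (1 / 2 - 2 * (1 / 2)))"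
    using V_bounds[of "1 / 2"] by auto
  show "bdd_above ((\<lambda>t. t powr (1 / 4) * hom_sobolev_field_norm ?s (field_dist (vel h t))) ` ?I)"
  proof (rule bdd_aboveI2)
    fix t assume "t \<in> ?I"
    then have t: "0 < t" "t < T" by auto
    have "hom_sobolev_field_norm ?s (field_dist (vel h t)) \<le> real CARD('n) * sqrt (B * t powr (- 1 / 2))"
    proof (rule hom_sobolev_field_norm_le[OF vel_is_L1loc[OF t]])
      fix j
      have "wint (2 * ?s) (\<lambda>\<xi>. ennreal (cmod (sol j (t, \<xi>)))) \<le> wint (2 * ?s) (\<lambda>\<xi>. V (t, \<xi>))"
        by (rule wint_mono) (rule sol_le)
      also have "\<dots> \<le> ennreal (B * t powr (- 1 / 2))"
        using B(2)[OF t, folded s] by simp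
      finally show "wint (2 * ?s) (\<lambda>\<xi>. ennreal (cmod (sol j (t, \<xi>)))) \<le> ennreal (B * t powr (- 1 / 2))" .
    qed (use B in simp)
    also have "sqrt (B * t powr (- 1 / 2)) = sqrt B * t powr (- 1 / 4)"
    proof -
      have "t powr (- 1 / 2) = (t powr (- 1 / 4))\<^sup>2" using powr_half_power2[of t "- 1 / 2"] by simp
      then show ?thesis by (simp add: real_sqrt_mult)
    qed
    finally have "t powr (1 / 4) * hom_sobolev_field_norm ?s (field_dist (vel h t)) \<le> t powr (1 / 4) * (real CARD('n) * (sqrt B * t powr (- 1 / 4)))"
      by (intro mult_left_mono) auto
    also have "\<dots> = real CARD('n) * sqrt B * (t powr (1 / 4) * t powr (- 1 / 4))" by simp
    also have "t powr (1 / 4) * t powr (- 1 / 4) = 1" using t by (simp add: powr_add[symmetric])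
    finally show "t powr (1 / 4) * hom_sobolev_field_norm ?s (field_dist (vel h t)) \<le> real CARD('n) * sqrt B" by simp
  qed
qed

lemma vel_continuous:
  assumes h: "\<And>j. is_L1loc_fun (fourier_dist (field_dist (vel h 0) j)) (g j)"
    and h': "\<And>j. slow_growth (\<lambda>x. complex_of_real (h j x))"
  shows "continuous_into_hom_sobolev {t. 0 \<le> t \<and> ereal t < ereal T} (real CARD('n) / 2 - 1) (\<lambda>t. field_dist (vel h t))"
  unfolding continuous_into_hom_sobolev_def
proof (intro conjI ballI)
  let ?s = "real CARD('n) / 2 - 1" and ?I = "{t. 0 \<le> t \<and> ereal t < ereal T}"
  have s: "2 * ?s = real CARD('n) - 3 + 4 * (1 / 4)" by simp
  have s2: "2 * ?s = real CARD('n) - 2" by simp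
  {
    fix t assume "t \<in> ?I"
    then have t: "0 \<le> t" "t < T" by auto
    show "field_dist (vel h t) \<in> hom_sobolev_field ?s"
    proof (cases "t = 0")
      case False
      then show ?thesis using t by (intro vel_hom_sobolev_field[OF _ _ _ _ s]) auto
    next
      case True
      show ?thesis
        unfolding hom_sobolev_field_def True
      proof (intro CollectI allI conjI real_valued_field_dist)
        fix j
        show "field_dist (vel h 0) j \<in> hom_sobolev ?s"
        proof (rule hom_sobolevI[OF _ h])
          show "tempered (field_dist (vel h 0) j)" unfolding field_dist_vel_0 by (rule tempered_fun_dist[OF h'])
          have "(norm \<xi> powr ?s * cmod (g j \<xi>))\<^sup>2 = norm \<xi> powr (real CARD('n) - 2) * (cmod (g j \<xi>))\<^sup>2" for \<xi>
            using powr_half_power2[of "norm \<xi>" "real CARD('n) - 2"] by (simp add: power_mult_distrib diff_divide_distrib)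
          then show "integrable lborel (\<lambda>\<xi>. (norm \<xi> powr ?s * cmod (g j \<xi>))\<^sup>2)" using g_int[of j] by simp
        qed
      qed
    qed
  }
  fix t0 assume t0: "t0 \<in> ?I"
  \<comment> \<open>At time 0 the transform is that of the datum rather than the value of
    \<open>sol\<close>, so continuity at 0 is a separate case.\<close>
  define w where "w t j \<xi> = (if t = 0 then g j \<xi> else sol j (t, \<xi>))" for t j \<xi>
  show "((\<lambda>t. hom_sobolev_field_norm ?s (\<lambda>j \<phi>. field_dist (vel h t) j \<phi> - field_dist (vel h t0) j \<phi>)) \<longlongrightarrow> 0) (at t0 within ?I)"
  proof (rule hom_sobolev_field_tendsto[where w = w, OF t0])
    fix t j assume "t \<in> ?I"
    then show "is_L1loc_fun (fourier_dist (field_dist (vel h t) j)) (w t j)"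
      using h[of j] vel_is_L1loc[of t h j] by (cases "t = 0") (auto simp: w_def[abs_def])
  next
    fix \<epsilon> :: real and j assume e: "\<epsilon> > 0"
    show "\<exists>d>0. \<forall>t\<in>?I. t \<noteq> t0 \<longrightarrow> \<bar>t - t0\<bar> < d \<longrightarrow> wint (2 * ?s) (\<lambda>\<xi>. ennreal (cmod (w t j \<xi> - w t0 j \<xi>))) \<le> ennreal \<epsilon>"
    proof (cases "t0 = 0")
      case True
      obtain d where d: "d > 0" "\<And>t. 0 < t \<Longrightarrow> t < T \<Longrightarrow> t < d \<Longrightarrow> wint (real CARD('n) - 2) (\<lambda>\<xi>. ennreal (cmod (sol j (t, \<xi>) - g j \<xi>))) \<le> ennreal \<epsilon>"
        using sol_tendsto_0[OF e, of j] by blast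
      show ?thesis
        unfolding s2 by (rule exI[of _ d]) (use d True in \<open>auto simp: w_def\<close>)
    next
      case False
      then have t0': "0 < t0" "t0 < T" using t0 by auto
      obtain d where d: "d > 0" "\<And>t. 0 < t \<Longrightarrow> t < T \<Longrightarrow> \<bar>t - t0\<bar> < d \<Longrightarrow> wint (real CARD('n) - 3 + 4 * (1 / 4)) (\<lambda>\<xi>. ennreal (cmod (sol j (t, \<xi>) - sol j (t0, \<xi>)))) \<le> ennreal \<epsilon>"
        using sol_tendsto[of "1 / 4" t0 \<epsilon> j] t0' e by auto
      show ?thesis
        unfolding s
      \<comment> \<open>The minimum with t0 excludes t = 0, where \<open>w\<close> changes its
        form.\<close>
      proof (intro exI[of _ "min d t0"] conjI ballI impI)
        show "min d t0 > 0" using d t0' by simp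
        fix t assume t: "t \<in> ?I" "t \<noteq> t0" "\<bar>t - t0\<bar> < min d t0"
        then have "0 < t" by auto
        then show "wint (real CARD('n) - 3 + 4 * (1 / 4)) (\<lambda>\<xi>. ennreal (cmod (w t j \<xi> - w t0 j \<xi>))) \<le> ennreal \<epsilon>"
          using t t0' d(2)[of t] by (simp add: w_def)
      qed
    qed
  qed
qed

end

theorem theorem3p7:
  fixes u\<^sub>0 :: "'n::finite \<Rightarrow> 'n distribution"
  assumes "CARD('n) \<ge> 3"
    and "u\<^sub>0 \<in> hom_sobolev_field (real CARD('n) / 2 - 1)"
    and "divergence_free u\<^sub>0"
  shows "\<exists>T::ereal. 0 < T \<and>
    (\<exists>u :: real \<Rightarrow> real^'n \<Rightarrow> real^'n.
       (\<lambda>t. field_dist (u t)) \<in> E_space T \<and>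
       mild_solution T u\<^sub>0 u \<and>
       continuous_into_hom_sobolev {t. 0 \<le> t \<and> ereal t < T} (real CARD('n) / 2 - 1)
         (\<lambda>t. field_dist (u t)))"
proof -
  define f where "f j = fourier_fun (u\<^sub>0 j)" for j
  have u0: "u\<^sub>0 j \<in> hom_sobolev (real CARD('n) / 2 - 1)" "real_valued_dist (u\<^sub>0 j)" for j
    using assms(2) by (auto simp: hom_sobolev_field_def)
  have fL: "is_L1loc_fun (fourier_dist (u\<^sub>0 j)) (f j)" for j
    using u0(1)[of j] fourier_fun_is_L1loc unfolding f_def hom_sobolev_def has_fourier_fun_def by blast
  have [measurable]: "f j \<in> borel_measurable borel" for j by (rule is_L1loc_fun_measurable[OF fL])
  \<comment> \<open>The symmetry of the Fourier transform of a real distribution holds only almost everywhere;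
    averaging gives a representative that is symmetric everywhere.\<close>
  define g where "g j \<xi> = (f j \<xi> + cnj (f j (- \<xi>))) / 2" for j \<xi>
  have gm [measurable]: "g j \<in> borel_measurable borel" for j
    unfolding g_def[abs_def] by measurable
  have fg: "AE \<xi> in lborel. f j \<xi> = g j \<xi>" for j
    using real_valued_dist_hermitian[OF u0(2) fL[of j]] by eventually_elim (simp add: g_def)
  have gL: "is_L1loc_fun (fourier_dist (u\<^sub>0 j)) (g j)" for j
    by (rule is_L1loc_fun_cong_AE[OF fL fg gm])
  have g_herm: "g j (- \<xi>) = cnj (g j \<xi>)" for j \<xi> by (simp add: g_def add.commute)
  have g_int: "integrable lborel (\<lambda>\<xi>. norm \<xi> powr (real CARD('n) - 2) * (cmod (g j \<xi>))\<^sup>2)" for j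
  proof (rule integrable_cong_AE_imp)
    show "integrable lborel (\<lambda>\<xi>. (norm \<xi> powr (real CARD('n) / 2 - 1) * cmod (f j \<xi>))\<^sup>2)"
      using u0(1)[of j] by (simp add: hom_sobolev_def f_def)
    have e: "(norm \<xi> powr (real CARD('n) / 2 - 1) * c)\<^sup>2 = norm \<xi> powr (real CARD('n) - 2) * c\<^sup>2" for \<xi> :: "real^'n" and c
      using powr_half_power2[of "norm \<xi>" "real CARD('n) - 2"] by (simp add: power_mult_distrib diff_divide_distrib)
    show "AE \<xi> in lborel. (norm \<xi> powr (real CARD('n) / 2 - 1) * cmod (f j \<xi>))\<^sup>2 = norm \<xi> powr (real CARD('n) - 2) * (cmod (g j \<xi>))\<^sup>2"
      using fg[of j] unfolding e by eventually_elim simp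
  qed measurable
  interpret ns_data g
    by unfold_locales (use assms(1) g_herm g_int in auto)
  obtain A0 where A0: "A0 > 0"
    "\<And>A. 0 < A \<Longrightarrow> A \<le> A0 \<Longrightarrow> \<exists>T>0. \<forall>t. 0 < t \<longrightarrow> t < T \<longrightarrow> wint (real CARD('n) - 1 / 2) (\<lambda>\<xi>. V (t, \<xi>)) \<le> ennreal (4 * A * t powr (- 3 / 4))"
    using V_bound_small by blast
  obtain T where T: "T > 0" "\<And>t. 0 < t \<Longrightarrow> t < T \<Longrightarrow> wint (real CARD('n) - 1 / 2) (\<lambda>\<xi>. V (t, \<xi>)) \<le> ennreal (4 * A0 * t powr (- 3 / 4))"
    using A0(2)[OF A0(1)] by blast
  interpret ns_sol g T "4 * A0"
  proof unfold_locales
    show "\<exists>T'>0. \<forall>t. 0 < t \<longrightarrow> t < T' \<longrightarrow> wint (real CARD('n) - 1 / 2) (\<lambda>\<xi>. V (t, \<xi>)) \<le> ennreal (\<epsilon> * t powr (- 3 / 4))" if e: "\<epsilon> > 0" for \<epsilon>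
    proof -
      \<comment> \<open>The a priori bound with a smaller amplitude, on a shorter interval, provides
        the vanishing constant.\<close>
      define A where "A = min A0 (\<epsilon> / 4)"
      have A: "0 < A" "A \<le> A0" "4 * A \<le> \<epsilon>" using A0(1) e by (auto simp: A_def)
      obtain T' where T': "T' > 0" "\<And>t. 0 < t \<Longrightarrow> t < T' \<Longrightarrow> wint (real CARD('n) - 1 / 2) (\<lambda>\<xi>. V (t, \<xi>)) \<le> ennreal (4 * A * t powr (- 3 / 4))"
        using A0(2)[OF A(1,2)] by blast
      have "ennreal (4 * A * t powr (- 3 / 4)) \<le> ennreal (\<epsilon> * t powr (- 3 / 4))" for t
        using A(3) by (intro ennreal_leI mult_right_mono) auto
      then show ?thesis using T' order_trans by blast
    qed
  qed (use T A0(1) in auto)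
  have "\<exists>h. slow_growth (\<lambda>x. complex_of_real (h x)) \<and> (\<forall>\<phi>. schwartz \<phi> \<longrightarrow>
      (LINT x|lborel. of_real (h x) * \<phi> x) = (LINT \<xi>|lborel. g j \<xi> * inv_fourier \<phi> \<xi>))" for j
  proof -
    have gl: "locally_integrable (g j)" using gL[of j] by (simp add: is_L1loc_fun_def)
    have low: "integrable lborel (\<lambda>\<xi>. indicator (ball 0 1) \<xi> *\<^sub>R g j \<xi>)"
      by (rule Bochner_Integration.integrable_bound[OF locally_integrable_cball[OF gl, of 1]]) (auto simp: indicator_def)
    have high: "integrable lborel (\<lambda>\<xi>. indicator (- ball 0 1) \<xi> * (norm \<xi> * (cmod (g j \<xi>))\<^sup>2))"
    proof (rule Bochner_Integration.integrable_bound[OF g_int[of j]])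
      show "AE \<xi> in lborel. norm (indicator (- ball 0 1) \<xi> * (norm \<xi> * (cmod (g j \<xi>))\<^sup>2)) \<le> norm (norm \<xi> powr (real CARD('n) - 2) * (cmod (g j \<xi>))\<^sup>2)"
      proof (rule AE_I2)
        fix \<xi> :: "real^'n"
        show "norm (indicator (- ball 0 1) \<xi> * (norm \<xi> * (cmod (g j \<xi>))\<^sup>2)) \<le> norm (norm \<xi> powr (real CARD('n) - 2) * (cmod (g j \<xi>))\<^sup>2)"
        proof (cases "norm \<xi> < 1")
          case False
          \<comment> \<open>Here n \<ge> 3 enters: outside the unit ball |\<xi>| is at most
            |\<xi>|^(n - 2).\<close>
          have "real CARD('n) \<ge> 3" using assms(1) by linarith
          then have "norm \<xi> powr 1 \<le> norm \<xi> powr (real CARD('n) - 2)" using False by (intro powr_mono) auto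
          then show ?thesis using False by (simp add: mult_right_mono)
        qed simp
      qed
    qed measurable
    show ?thesis
      using low_regularity_representation[OF gm g_herm low high] by metis
  qed
  then obtain h where h: "\<And>j. slow_growth (\<lambda>x. complex_of_real (h j x))"
    "\<And>j \<phi>. schwartz \<phi> \<Longrightarrow> (LINT x|lborel. of_real (h j x) * \<phi> x) = (LINT \<xi>|lborel. g j \<xi> * inv_fourier \<phi> \<xi>)"
    by metis
  have h0: "is_L1loc_fun (fourier_dist (field_dist (vel h 0) j)) (g j)" for j
    unfolding is_L1loc_fun_def
  proof (intro conjI allI impI)
    show "locally_integrable (g j)" using gL[of j] by (simp add: is_L1loc_fun_def)
    fix \<phi> :: "real^'n \<Rightarrow> complex" assume t: "test_fun \<phi>"
    show "fourier_dist (field_dist (vel h 0) j) \<phi> = fun_dist (g j) \<phi>"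
      using h(2)[OF schwartz_fourier_test_fun[OF t], of j]
      by (simp add: fourier_dist_def field_dist_vel_0 fun_dist_def fourier_inversion_test_fun[OF t])
  qed
  have mild: "mild_solution (ereal T) u\<^sub>0 (vel h)"
    unfolding mild_solution_def
  proof (intro conjI allI impI)
    fix t j assume "0 \<le> t" "ereal t < ereal T"
    then have t: "0 \<le> t" "t < T" by auto
    show "tempered_fun (\<lambda>x. complex_of_real (vel h t x $ j))"
    proof (cases "t = 0")
      case True
      then show ?thesis using tempered_fun_slow_growth[OF h(1)[of j]] by (simp add: vel_def)
    next
      case False
      then show ?thesis using t by (intro tempered_fun_slow_growth vel_slow_growth) auto
    qed
  next
    fix t assume "0 < t" "ereal t < ereal T"
    then show "div_tensor_defined (vel h t) (vel h t)" by (intro div_tensor_vel_defined) auto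
  next
    fix t assume "0 \<le> t" "ereal t < ereal T"
    then have t: "0 \<le> t" "t < T" by auto
    show "\<exists>D. is_duhamel_integral (vel h) t D \<and> (\<forall>j \<phi>. schwartz \<phi> \<longrightarrow> field_dist (vel h t) j \<phi> = heat t (u\<^sub>0 j) \<phi> - D j \<phi>)"
    proof (cases "t = 0")
      case False
      then have t': "0 < t" using t by simp
      have "fourier_fun (u\<^sub>0 j) \<in> borel_measurable borel" for j
        using is_L1loc_fun_measurable[OF fL[of j]] by (simp add: f_def)
      then show ?thesis
        using duhamel_vel[OF t' t(2)] vel_mild[OF t' t(2) fg[unfolded f_def]] by blast
    next
      \<comment> \<open>At time 0 the Duhamel integral runs over an empty interval, so the equation
        reduces to the representation of the datum by \<open>h\<close>.\<close>
      case True
      have z: "is_L1loc_fun (fourier_dist (\<lambda>\<phi>. 0)) (\<lambda>\<xi>::real^'n. 0)"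
        by (simp add: is_L1loc_fun_def integrable_imp_locally_integrable fourier_dist_def fun_dist_def)
      have "is_duhamel_integral (vel h) 0 (\<lambda>j \<phi>. 0)"
        unfolding is_duhamel_integral_def
        by (intro conjI allI exI[of _ "\<lambda>j z. 0"])
          (use z in \<open>auto simp: tempered_def set_integrable_def set_lebesgue_integral_def intro!: exI[of _ 0]\<close>)
      moreover have "field_dist (vel h 0) j \<phi> = heat 0 (u\<^sub>0 j) \<phi>" if s: "schwartz \<phi>" for j \<phi>
      proof -
        have [measurable]: "\<phi> \<in> borel_measurable borel" by (rule schwartz_measurable[OF s])
        have "field_dist (vel h 0) j \<phi> = (LINT \<xi>|lborel. g j \<xi> * inv_fourier \<phi> \<xi>)"
          unfolding field_dist_vel_0 fun_dist_def by (rule h(2)[OF s])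
        also have "\<dots> = (LINT \<xi>|lborel. f j \<xi> * inv_fourier \<phi> \<xi>)"
          by (rule integral_cong_AE) (use fg[of j] in auto)
        finally show ?thesis
          by (simp add: heat_def fourier_multiplier_def inv_fourier_dist_def fun_dist_def f_def)
      qed
      ultimately show ?thesis unfolding True by (intro exI[of _ "\<lambda>j \<phi>. 0"]) simp
    qed
  qed
  show ?thesis
    using T(1) vel_E_space[of h] mild vel_continuous[of h, OF h0 h(1)]
    by (intro exI[of _ "ereal T"] conjI exI[of _ "vel h"]) auto
qed

end
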